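(* Let $\mathtt{\Omega\Omega}'_+\subset\mathtt{SC}_+$ be the suboperad generated by $\mu_c$, $\mu_o$, $f$ and the nullary elements. There is a zigzag of categorical equivalences of operads in groupoids $$\pi\mathtt{SC}_+\xleftarrow{\sim}(\pi\mathtt{SC}_+)_{|\mathtt{\Omega\Omega}'_+}\xrightarrow{\sim}\mathtt{PaPB}_+:=\omega_+^*\mathtt{CoPB}_+\xrightarrow{\sim}\mathtt{CoPB}_+ .$$
   Context: **Relative operads.** A relative operad over a one-colored symmetric operad $P$ is a symmetric operad $Q$ with two colors $c$ ("closed") and $o$ ("open") such that $Q(x_1,\dots,x_n;c)=P(n)$ if $x_1=\dots=x_n=c$ and is empty otherwise. Write $Q(n,m)=Q(o^n,c^m;o)$. In $\circ_i^o:Q(n,m)\times Q(n',m')\to Q(n+n'-1,m+m')$ the closed inputs of the first factor are numbered $1,\dots,m$ and those of the second $m+1,\dots,m+m'$; $\circ_i^c$ is insertion in the $i$-th closed input. **Unitary Swiss-Cheese operad.** Let $D$ be the closed unit disk of $\mathbb C$, $D^+=\{z\in D:\operatorname{Im}z\ge0\}$. $\mathtt D_2^+(m)$ is the space of $m$-tuples of maps $D\to D$, $z\mapsto\lambda z+b$ ($\lambda>0$) whose images have disjoint interiors; $\mathtt{SC}_+(n,m)$ is the space of tuples of $n$ maps $D^+\to D^+$, $z\mapsto\lambda z+b$ ($\lambda>0,b\in\mathbb R$) and $m$ maps $D\to D^+$, $z\mapsto\lambda z+b$ ($\lambda>0$), all images having disjoint interiors. In particular $\mathtt D_2^+(0)$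 and $\mathtt{SC}_+(0,0)$ are points $*_c$, $*_o$ (the nullary elements); composing with them forgets disks or half disks. $\mathtt{SC}_+$ is a relative operad over $\mathtt D_2^+$ by composition of embeddings. $\pi$ is the fundamental groupoid, aritywise. The elements $\mu_c,\mu_o,f$ of $\mathtt{SC}_+$ are: $\mu_c=(z\mapsto\frac{z-1}2,z\mapsto\frac{z+1}2)\in\mathtt D_2^+(2)$; $\mu_o\in\mathtt{SC}_+(2,0)$ given by the same two formulas on half disks; $f=(z\mapsto\frac{z+i}2)\in\mathtt{SC}_+(0,1)$. For a suboperad $S$ of $\operatorname{ob}\pi\mathtt{SC}_+$ (the points of $\mathtt{SC}_+$), $(\pi\mathtt{SC}_+)_{|S}$ is the full suboperad in groupoids with objects $S$. **Colored (permutations and) braids.** $\mathtt{CoB}_+(m)$ is the groupoid whose objects are orderings (words) of $\{1,\dots,m\}$, and whose morphisms $w\to w'$ are homotopy classes of paths of $m$ labeled distinct points in the open unit disk, from a configuration with distinct real parts in left-to-right order $w$ to one with distinct real parts in order $w'$ (endpoints may vary in these contractible sets). $\mathtt{CoPB}_+(n,m)$: let $\operatorname{Conf}(n,m)$ be the space of pairwise distinct points $(z_1,\dots,z_n,u_1,\dots,u_m)$ in $D^+$ with $\operatorname{Im}z_i=0$ (open points), $\operatorname{Im}u_j>0$ (closed points); objects are words containing each open letter $1,\dots,n$ and each closed letter $1,\dots,m$ once, and morphisms are homotopy classes of paths in $\operatorname{Conf}(n,m)$ between configurations with distinct real parts in the prescribed orders. Composition substitutes words; on morphisms it replaces a moving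 point by a very small copy of another moving configuration ($\mathtt{CoB}_+$ at closed points, $\mathtt{CoPB}_+$ at open points; paths are chosen in $|z|<1$). The arity-zero groupoids are points $*_c,*_o$, and composition with them forgets points. $\mathtt{CoPB}_+$ is a relative operad over $\mathtt{CoB}_+$. **Magmas and $\mathtt{PaPB}_+$.** $\mathtt{\Omega\Omega}$ is the free two-colored symmetric operad in sets on generators $\mu_c$ (type $(c,c;c)$), $f$ (type $(c;o)$), $\mu_o$ (type $(o,o;o)$). $\mathtt{\Omega\Omega}_+$ is obtained by adding arity-zero elements $*_c$ (closed output), $*_o$ (open output) with $\mu_c( *_c,\mathrm{id}_c)=\mu_c(\mathrm{id}_c,*_c)=\mathrm{id}_c$, $\mu_o( *_o,\mathrm{id}_o)=\mu_o(\mathrm{id}_o,*_o)=\mathrm{id}_o$, $f( *_c)=*_o$, so that these are the only arity-zero elements and other arities are unchanged. $\omega_+:\mathtt{\Omega\Omega}_+\to\operatorname{ob}\mathtt{CoPB}_+$ is the morphism sending $\mu_c$ to the word $12$ of $\mathtt{CoB}_+(2)$, $f$ to the word with one closed letter and $\mu_o$ to the word $12$ of open letters. $\mathtt{PaPB}_+=\omega_+^*\mathtt{CoPB}_+$ has objects $\mathtt{\Omega\Omega}_+$ and $\operatorname{Hom}(u,v)=\operatorname{Hom}_{\mathtt{CoPB}_+}(\omega_+u,\omega_+v)$. A categorical equivalence is a morphism of operads in groupoids that is an equivalence of categories in each arity. *)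

theory Defs
  imports "HOL-Analysis.Analysis" "HOL-Combinatorics.Permutations"
begin

section \<open>Groupoids\<close>

record ('a, 'm) groupoid =
  Ob  :: "'a set"
  Mor :: "'m set"
  Src :: "'m \<Rightarrow> 'a"
  Trg :: "'m \<Rightarrow> 'a"
  Idm :: "'a \<Rightarrow> 'm"
  Cmp :: "'m \<Rightarrow> 'm \<Rightarrow> 'm"

text \<open>Composition is written in diagrammatic order: \<open>Cmp G f g\<close> is first \<open>f\<close>, then \<open>g\<close>.\<close>

definition is_groupoid :: "('a, 'm) groupoid \<Rightarrow> bool" where
  "is_groupoid G \<longleftrightarrow>
     (\<forall>f\<in>Mor G. Src G f \<in> Ob G \<and> Trg G f \<in> Ob G) \<and>
     (\<forall>x\<in>Ob G. Idm G x \<in> Mor G \<and> Src G (Idm G x) = x \<and> Trg G (Idm G x) = x) \<and>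
     (\<forall>f\<in>Mor G. \<forall>g\<in>Mor G. Trg G f = Src G g \<longrightarrow>
        Cmp G f g \<in> Mor G \<and> Src G (Cmp G f g) = Src G f \<and> Trg G (Cmp G f g) = Trg G g) \<and>
     (\<forall>f\<in>Mor G. Cmp G (Idm G (Src G f)) f = f \<and> Cmp G f (Idm G (Trg G f)) = f) \<and>
     (\<forall>f\<in>Mor G. \<forall>g\<in>Mor G. \<forall>h\<in>Mor G. Trg G f = Src G g \<and> Trg G g = Src G h \<longrightarrow>
        Cmp G (Cmp G f g) h = Cmp G f (Cmp G g h)) \<and>
     (\<forall>f\<in>Mor G. \<exists>g\<in>Mor G. Src G g = Trg G f \<and> Trg G g = Src G f \<and>
        Cmp G f g = Idm G (Src G f) \<and> Cmp G g f = Idm G (Trg G f))"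

definition is_functor ::
  "('a, 'm) groupoid \<Rightarrow> ('b, 'n) groupoid \<Rightarrow> ('a \<Rightarrow> 'b) \<Rightarrow> ('m \<Rightarrow> 'n) \<Rightarrow> bool" where
  "is_functor G H F0 F1 \<longleftrightarrow>
     (\<forall>x\<in>Ob G. F0 x \<in> Ob H \<and> F1 (Idm G x) = Idm H (F0 x)) \<and>
     (\<forall>f\<in>Mor G. F1 f \<in> Mor H \<and> Src H (F1 f) = F0 (Src G f) \<and> Trg H (F1 f) = F0 (Trg G f)) \<and>
     (\<forall>f\<in>Mor G. \<forall>g\<in>Mor G. Trg G f = Src G g \<longrightarrow> F1 (Cmp G f g) = Cmp H (F1 f) (F1 g))"

definition product_groupoid ::
  "('a, 'm) groupoid \<Rightarrow> ('b, 'n) groupoid \<Rightarrow> ('a \<times> 'b, 'm \<times> 'n) groupoid" where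
  "product_groupoid G H =
     \<lparr> Ob = Ob G \<times> Ob H,
       Mor = Mor G \<times> Mor H,
       Src = map_prod (Src G) (Src H),
       Trg = map_prod (Trg G) (Trg H),
       Idm = map_prod (Idm G) (Idm H),
       Cmp = (\<lambda>(f, f') (g, g'). (Cmp G f g, Cmp H f' g')) \<rparr>"

text \<open>
  A natural transformation between functors into a groupoid is automatically invertible, so
  invertibility of its components need not be required separately.
\<close>

definition natural_transformation ::
  "('a, 'm) groupoid \<Rightarrow> ('b, 'n) groupoid \<Rightarrow>
   ('a \<Rightarrow> 'b) \<Rightarrow> ('m \<Rightarrow> 'n) \<Rightarrow> ('a \<Rightarrow> 'b) \<Rightarrow> ('m \<Rightarrow> 'n) \<Rightarrow> ('a \<Rightarrow> 'n) \<Rightarrow> bool" where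
  "natural_transformation G H F0 F1 K0 K1 \<eta> \<longleftrightarrow>
     (\<forall>x\<in>Ob G. \<eta> x \<in> Mor H \<and> Src H (\<eta> x) = F0 x \<and> Trg H (\<eta> x) = K0 x) \<and>
     (\<forall>f\<in>Mor G. Cmp H (\<eta> (Src G f)) (K1 f) = Cmp H (F1 f) (\<eta> (Trg G f)))"

definition equivalence_of_categories ::
  "('a, 'm) groupoid \<Rightarrow> ('b, 'n) groupoid \<Rightarrow> ('a \<Rightarrow> 'b) \<Rightarrow> ('m \<Rightarrow> 'n) \<Rightarrow> bool" where
  "equivalence_of_categories G H F0 F1 \<longleftrightarrow>
     is_functor G H F0 F1 \<and>
     (\<exists>K0 K1. is_functor H G K0 K1 \<and>
        (\<exists>\<eta>. natural_transformation G G id id (K0 \<circ> F0) (K1 \<circ> F1) \<eta>) \<and>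
        (\<exists>\<epsilon>. natural_transformation H H (F0 \<circ> K0) (F1 \<circ> K1) id id \<epsilon>))"


section \<open>Relative operads\<close>

text \<open>
  An arity \<open>a\<close> gives the number \<open>a k\<close> of inputs of each color \<open>k\<close>, and \<open>(k, i)\<close> with
  \<open>1 \<le> i \<le> a k\<close> is the \<open>i\<close>-th input of color \<open>k\<close>. The operations with output \<open>Open\<close> and
  arity \<open>ar n m\<close> form \<open>Q(n, m) = Q(o\<^sup>n, c\<^sup>m; o)\<close>, those with output \<open>Closed\<close> and
  arity \<open>ar 0 m\<close> form \<open>P(m)\<close>.
\<close>

datatype color = Closed | Open

type_synonym input = "color \<times> nat"
type_synonym arity = "color \<Rightarrow> nat"

definition ar :: "nat \<Rightarrow> nat \<Rightarrow> arity" where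
  "ar n m = (\<lambda>k. case k of Open \<Rightarrow> n | Closed \<Rightarrow> m)"

definition unit_arity :: "color \<Rightarrow> arity" where
  "unit_arity d = (\<lambda>k. if k = d then 1 else 0)"

definition inputs :: "arity \<Rightarrow> input set" where
  "inputs a = {p. 1 \<le> snd p \<and> snd p \<le> a (fst p)}"

text \<open>
  Inserting an operation of arity \<open>b\<close> at the input \<open>p\<close> of an operation of arity \<open>a\<close>: arity of
  the result, and new names of the inputs of the outer operation (other than \<open>p\<close>) and of the
  inner one. Inputs of the color of \<open>p\<close> are renumbered by the usual rule for partial composition;
  of the other color, those of the outer operation come first.
\<close>

definition ins_arity :: "arity \<Rightarrow> input \<Rightarrow> arity \<Rightarrow> arity" where
  "ins_arity a p b = (\<lambda>k. if k = fst p then a k + b k - 1 else a k + b k)"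

definition outer_label :: "input \<Rightarrow> arity \<Rightarrow> input \<Rightarrow> input" where
  "outer_label p b r =
     (if fst r = fst p \<and> snd p < snd r then (fst r, snd r + b (fst p) - 1) else r)"

definition inner_label :: "arity \<Rightarrow> input \<Rightarrow> input \<Rightarrow> input" where
  "inner_label a p r =
     (if fst r = fst p then (fst r, snd p + snd r - 1) else (fst r, a (fst r) + snd r))"

text \<open>The group \<open>S\<^sub>n \<times> S\<^sub>m\<close>.\<close>

definition input_perms :: "arity \<Rightarrow> (input \<Rightarrow> input) set" where
  "input_perms a = {\<sigma>. \<sigma> permutes inputs a \<and> (\<forall>p. fst (\<sigma> p) = fst p)}"

text \<open>
  \<open>ins Q d a p b x y\<close> inserts \<open>y\<close>, of arity \<open>b\<close> and output color \<open>fst p\<close>, at the input \<open>p\<close> of \<open>x\<close>,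
  of arity \<open>a\<close> and output color \<open>d\<close>. The symmetric groups act from the left: in \<open>act Q d a \<sigma> x\<close>
  the input of \<open>x\<close> called \<open>p\<close> is renamed \<open>\<sigma> p\<close>.
\<close>

record 'x operad =
  elts :: "color \<Rightarrow> arity \<Rightarrow> 'x set"
  ins  :: "color \<Rightarrow> arity \<Rightarrow> input \<Rightarrow> arity \<Rightarrow> 'x \<Rightarrow> 'x \<Rightarrow> 'x"
  act  :: "color \<Rightarrow> arity \<Rightarrow> (input \<Rightarrow> input) \<Rightarrow> 'x \<Rightarrow> 'x"
  unt  :: "color \<Rightarrow> 'x"

definition operad_closure :: "'x operad \<Rightarrow> bool" where
  "operad_closure Q \<longleftrightarrow>
     (\<forall>d. unt Q d \<in> elts Q d (unit_arity d)) \<and>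
     (\<forall>d a. \<forall>x\<in>elts Q d a. \<forall>p\<in>inputs a. \<forall>b. \<forall>y\<in>elts Q (fst p) b.
        ins Q d a p b x y \<in> elts Q d (ins_arity a p b)) \<and>
     (\<forall>d a. \<forall>x\<in>elts Q d a. \<forall>\<sigma>\<in>input_perms a. act Q d a \<sigma> x \<in> elts Q d a)"

definition operad_action :: "'x operad \<Rightarrow> bool" where
  "operad_action Q \<longleftrightarrow>
     (\<forall>d a. \<forall>x\<in>elts Q d a. act Q d a id x = x \<and>
        (\<forall>\<sigma>\<in>input_perms a. \<forall>\<tau>\<in>input_perms a.
           act Q d a (\<sigma> \<circ> \<tau>) x = act Q d a \<sigma> (act Q d a \<tau> x)))"

definition operad_unit :: "'x operad \<Rightarrow> bool" where
  "operad_unit Q \<longleftrightarrow>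
     (\<forall>d a. \<forall>x\<in>elts Q d a.
        ins Q d (unit_arity d) (d, 1) a (unt Q d) x = x \<and>
        (\<forall>p\<in>inputs a. ins Q d a p (unit_arity (fst p)) x (unt Q (fst p)) = x))"

definition operad_sequential :: "'x operad \<Rightarrow> bool" where
  "operad_sequential Q \<longleftrightarrow>
     (\<forall>d a. \<forall>x\<in>elts Q d a. \<forall>p\<in>inputs a.
        \<forall>b. \<forall>y\<in>elts Q (fst p) b. \<forall>q\<in>inputs b.
        \<forall>c. \<forall>z\<in>elts Q (fst q) c.
          ins Q d (ins_arity a p b) (inner_label a p q) c (ins Q d a p b x y) z =
          ins Q d a p (ins_arity b q c) x (ins Q (fst p) b q c y z))"

text \<open>
  Insertions at two different inputs commute up to the permutation \<open>\<rho>\<close> which matches the names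
  of the inputs on the two sides; \<open>\<rho>\<close> is uniquely determined, and it is the identity unless
  both inputs are open, when it exchanges two blocks of closed inputs. In the same way the
  permutation in the equivariance axiom is the one forced by the renaming of the inputs.
\<close>

definition operad_parallel :: "'x operad \<Rightarrow> bool" where
  "operad_parallel Q \<longleftrightarrow>
     (\<forall>d a. \<forall>x\<in>elts Q d a. \<forall>p\<in>inputs a. \<forall>q\<in>inputs a. p \<noteq> q \<longrightarrow>
        (\<forall>b. \<forall>y\<in>elts Q (fst p) b. \<forall>c. \<forall>z\<in>elts Q (fst q) c.
         \<forall>\<rho>\<in>input_perms (ins_arity (ins_arity a p b) (outer_label p b q) c).
          (\<forall>r\<in>inputs a - {p, q}.
             \<rho> (outer_label (outer_label q c p) b (outer_label q c r)) =
             outer_label (outer_label p b q) c (outer_label p b r)) \<and>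
          (\<forall>r\<in>inputs b.
             \<rho> (inner_label (ins_arity a q c) (outer_label q c p) r) =
             outer_label (outer_label p b q) c (inner_label a p r)) \<and>
          (\<forall>r\<in>inputs c.
             \<rho> (outer_label (outer_label q c p) b (inner_label a q r)) =
             inner_label (ins_arity a p b) (outer_label p b q) r) \<longrightarrow>
          ins Q d (ins_arity a p b) (outer_label p b q) c (ins Q d a p b x y) z =
          act Q d (ins_arity (ins_arity a p b) (outer_label p b q) c) \<rho>
            (ins Q d (ins_arity a q c) (outer_label q c p) b (ins Q d a q c x z) y)))"

definition operad_equivariant :: "'x operad \<Rightarrow> bool" where
  "operad_equivariant Q \<longleftrightarrow>
     (\<forall>d a. \<forall>x\<in>elts Q d a. \<forall>p\<in>inputs a. \<forall>b. \<forall>y\<in>elts Q (fst p) b.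
        \<forall>\<sigma>\<in>input_perms a. \<forall>\<tau>\<in>input_perms b. \<forall>\<rho>\<in>input_perms (ins_arity a p b).
          (\<forall>r\<in>inputs a - {p}. \<rho> (outer_label p b r) = outer_label (\<sigma> p) b (\<sigma> r)) \<and>
          (\<forall>r\<in>inputs b. \<rho> (inner_label a p r) = inner_label a (\<sigma> p) (\<tau> r)) \<longrightarrow>
          ins Q d a (\<sigma> p) b (act Q d a \<sigma> x) (act Q (fst p) b \<tau> y) =
          act Q d (ins_arity a p b) \<rho> (ins Q d a p b x y))"

definition relative_operad :: "'x operad \<Rightarrow> bool" where
  "relative_operad Q \<longleftrightarrow>
     (\<forall>a. 0 < a Open \<longrightarrow> elts Q Closed a = {}) \<and>
     operad_closure Q \<and> operad_action Q \<and> operad_unit Q \<and>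
     operad_sequential Q \<and> operad_parallel Q \<and> operad_equivariant Q"

definition operad_morphism ::
  "'x operad \<Rightarrow> 'y operad \<Rightarrow> (color \<Rightarrow> arity \<Rightarrow> 'x \<Rightarrow> 'y) \<Rightarrow> bool" where
  "operad_morphism Q R \<phi> \<longleftrightarrow>
     (\<forall>d a. \<forall>x\<in>elts Q d a. \<phi> d a x \<in> elts R d a) \<and>
     (\<forall>d. \<phi> d (unit_arity d) (unt Q d) = unt R d) \<and>
     (\<forall>d a. \<forall>x\<in>elts Q d a. \<forall>p\<in>inputs a. \<forall>b. \<forall>y\<in>elts Q (fst p) b.
        \<phi> d (ins_arity a p b) (ins Q d a p b x y) =
        ins R d a p b (\<phi> d a x) (\<phi> (fst p) b y)) \<and>
     (\<forall>d a. \<forall>x\<in>elts Q d a. \<forall>\<sigma>\<in>input_perms a.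
        \<phi> d a (act Q d a \<sigma> x) = act R d a \<sigma> (\<phi> d a x))"

text \<open>The suboperad generated by a set of triples (output color, arity, operation).\<close>

inductive_set generated ::
    "'x operad \<Rightarrow> (color \<times> arity \<times> 'x) set \<Rightarrow> (color \<times> arity \<times> 'x) set"
  for Q :: "'x operad" and X :: "(color \<times> arity \<times> 'x) set" where
  gen: "g \<in> X \<Longrightarrow> g \<in> generated Q X"
| unt: "(d, unit_arity d, unt Q d) \<in> generated Q X"
| ins: "(d, a, x) \<in> generated Q X \<Longrightarrow> p \<in> inputs a \<Longrightarrow> (fst p, b, y) \<in> generated Q X \<Longrightarrow>
        (d, ins_arity a p b, ins Q d a p b x y) \<in> generated Q X"
| act: "(d, a, x) \<in> generated Q X \<Longrightarrow> \<sigma> \<in> input_perms a \<Longrightarrow>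
        (d, a, act Q d a \<sigma> x) \<in> generated Q X"


section \<open>Relative operads in groupoids\<close>

record ('a, 'm) goperad =
  grpd    :: "color \<Rightarrow> arity \<Rightarrow> ('a, 'm) groupoid"
  ob_ins  :: "color \<Rightarrow> arity \<Rightarrow> input \<Rightarrow> arity \<Rightarrow> 'a \<Rightarrow> 'a \<Rightarrow> 'a"
  mor_ins :: "color \<Rightarrow> arity \<Rightarrow> input \<Rightarrow> arity \<Rightarrow> 'm \<Rightarrow> 'm \<Rightarrow> 'm"
  ob_act  :: "color \<Rightarrow> arity \<Rightarrow> (input \<Rightarrow> input) \<Rightarrow> 'a \<Rightarrow> 'a"
  mor_act :: "color \<Rightarrow> arity \<Rightarrow> (input \<Rightarrow> input) \<Rightarrow> 'm \<Rightarrow> 'm"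
  gunt    :: "color \<Rightarrow> 'a"

definition ob_operad :: "('a, 'm) goperad \<Rightarrow> 'a operad" where
  "ob_operad Q =
     \<lparr> elts = (\<lambda>d a. Ob (grpd Q d a)), ins = ob_ins Q, act = ob_act Q, unt = gunt Q \<rparr>"

definition mor_operad :: "('a, 'm) goperad \<Rightarrow> 'm operad" where
  "mor_operad Q =
     \<lparr> elts = (\<lambda>d a. Mor (grpd Q d a)), ins = mor_ins Q, act = mor_act Q,
       unt = (\<lambda>d. Idm (grpd Q d (unit_arity d)) (gunt Q d)) \<rparr>"

definition relative_goperad :: "('a, 'm) goperad \<Rightarrow> bool" where
  "relative_goperad Q \<longleftrightarrow>
     (\<forall>d a. is_groupoid (grpd Q d a)) \<and>
     relative_operad (ob_operad Q) \<and> relative_operad (mor_operad Q) \<and>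
     (\<forall>d a. \<forall>p\<in>inputs a. \<forall>b.
        is_functor (product_groupoid (grpd Q d a) (grpd Q (fst p) b)) (grpd Q d (ins_arity a p b))
          (\<lambda>(x, y). ob_ins Q d a p b x y) (\<lambda>(f, g). mor_ins Q d a p b f g)) \<and>
     (\<forall>d a. \<forall>\<sigma>\<in>input_perms a.
        is_functor (grpd Q d a) (grpd Q d a) (ob_act Q d a \<sigma>) (mor_act Q d a \<sigma>))"

definition goperad_morphism ::
  "('a, 'm) goperad \<Rightarrow> ('b, 'n) goperad \<Rightarrow>
   (color \<Rightarrow> arity \<Rightarrow> 'a \<Rightarrow> 'b) \<Rightarrow> (color \<Rightarrow> arity \<Rightarrow> 'm \<Rightarrow> 'n) \<Rightarrow> bool" where
  "goperad_morphism Q R \<phi> \<psi> \<longleftrightarrow>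
     relative_goperad Q \<and> relative_goperad R \<and>
     (\<forall>d a. is_functor (grpd Q d a) (grpd R d a) (\<phi> d a) (\<psi> d a)) \<and>
     operad_morphism (ob_operad Q) (ob_operad R) \<phi> \<and>
     operad_morphism (mor_operad Q) (mor_operad R) \<psi>"

definition categorical_equivalence ::
  "('a, 'm) goperad \<Rightarrow> ('b, 'n) goperad \<Rightarrow>
   (color \<Rightarrow> arity \<Rightarrow> 'a \<Rightarrow> 'b) \<Rightarrow> (color \<Rightarrow> arity \<Rightarrow> 'm \<Rightarrow> 'n) \<Rightarrow> bool" where
  "categorical_equivalence Q R \<phi> \<psi> \<longleftrightarrow>
     goperad_morphism Q R \<phi> \<psi> \<and>
     (\<forall>d a. equivalence_of_categories (grpd Q d a) (grpd R d a) (\<phi> d a) (\<psi> d a))"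

text \<open>\<open>Q\<^bsub>|S\<^esub>\<close>, where \<open>S\<close> is a set of triples (output color, arity, object).\<close>

definition full_suboperad ::
  "('a, 'm) goperad \<Rightarrow> (color \<times> arity \<times> 'a) set \<Rightarrow> ('a, 'm) goperad" where
  "full_suboperad Q S =
     Q\<lparr> grpd := (\<lambda>d a. (grpd Q d a)
        \<lparr> Ob := {x \<in> Ob (grpd Q d a). (d, a, x) \<in> S},
          Mor := {f \<in> Mor (grpd Q d a).
                    (d, a, Src (grpd Q d a) f) \<in> S \<and> (d, a, Trg (grpd Q d a) f) \<in> S} \<rparr>) \<rparr>"

text \<open>
  \<open>\<omega>\<^sup>*Q\<close> for a morphism \<open>\<omega>\<close> from \<open>A\<close> to the objects of \<open>Q\<close>. A morphism
  is recorded together with its source and target in \<open>A\<close>.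
\<close>

definition pullback_operad ::
  "'b operad \<Rightarrow> (color \<Rightarrow> arity \<Rightarrow> 'b \<Rightarrow> 'a) \<Rightarrow> ('a, 'm) goperad \<Rightarrow> ('b, 'b \<times> 'm \<times> 'b) goperad" where
  "pullback_operad A \<omega> Q =
     \<lparr> grpd = (\<lambda>d a.
         \<lparr> Ob = elts A d a,
           Mor = {(u, f, v). u \<in> elts A d a \<and> v \<in> elts A d a \<and> f \<in> Mor (grpd Q d a) \<and>
                    Src (grpd Q d a) f = \<omega> d a u \<and> Trg (grpd Q d a) f = \<omega> d a v},
           Src = (\<lambda>(u, f, v). u),
           Trg = (\<lambda>(u, f, v). v),
           Idm = (\<lambda>u. (u, Idm (grpd Q d a) (\<omega> d a u), u)),
           Cmp = (\<lambda>(u, f, v) (u', g, v'). (u, Cmp (grpd Q d a) f g, v')) \<rparr>),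
       ob_ins = ins A,
       mor_ins = (\<lambda>d a p b (u, f, v) (u', g, v').
          (ins A d a p b u u', mor_ins Q d a p b f g, ins A d a p b v v')),
       ob_act = act A,
       mor_act = (\<lambda>d a \<sigma> (u, f, v). (act A d a \<sigma> u, mor_act Q d a \<sigma> f, act A d a \<sigma> v)),
       gunt = unt A \<rparr>"


section \<open>The fundamental groupoid\<close>

definition path_class :: "'x::topological_space set \<Rightarrow> (real \<Rightarrow> 'x) \<Rightarrow> (real \<Rightarrow> 'x) set" where
  "path_class X g = {h. homotopic_paths X g h}"

definition fundamental_groupoid ::
  "'x::topological_space set \<Rightarrow> ('x, 'x \<times> (real \<Rightarrow> 'x) set \<times> 'x) groupoid" where
  "fundamental_groupoid X =
     \<lparr> Ob = X,
       Mor = {(pathstart g, path_class X g, pathfinish g) | g. path g \<and> path_image g \<subseteq> X},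
       Src = (\<lambda>(x, C, y). x),
       Trg = (\<lambda>(x, C, y). y),
       Idm = (\<lambda>x. (x, path_class X (\<lambda>_. x), x)),
       Cmp = (\<lambda>(x, C, y) (y', C', z). (x, \<Union>g\<in>C. \<Union>g'\<in>C'. path_class X (g +++ g'), z)) \<rparr>"

definition pi_operad ::
  "('x::topological_space) operad \<Rightarrow> ('x, 'x \<times> (real \<Rightarrow> 'x) set \<times> 'x) goperad" where
  "pi_operad Q =
     \<lparr> grpd = (\<lambda>d a. fundamental_groupoid (elts Q d a)),
       ob_ins = ins Q,
       mor_ins = (\<lambda>d a p b (x, C, x') (y, C', y').
          (ins Q d a p b x y,
           \<Union>g\<in>C. \<Union>g'\<in>C'. path_class (elts Q d (ins_arity a p b)) (\<lambda>t. ins Q d a p b (g t) (g' t)),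
           ins Q d a p b x' y')),
       ob_act = act Q,
       mor_act = (\<lambda>d a \<sigma> (x, C, x').
          (act Q d a \<sigma> x, \<Union>g\<in>C. path_class (elts Q d a) (\<lambda>t. act Q d a \<sigma> (g t)), act Q d a \<sigma> x')),
       gunt = unt Q \<rparr>"


section \<open>The unitary Swiss-Cheese operad\<close>

text \<open>
  Families indexed by the inputs of an operation are functions which vanish outside \<open>inputs a\<close>.
  The following family indexed by \<open>inputs (ins_arity a p b)\<close> consists of \<open>f\<close> without its
  entry at \<open>p\<close> and of \<open>g\<close>.
\<close>

definition graft ::
  "arity \<Rightarrow> input \<Rightarrow> arity \<Rightarrow> (input \<Rightarrow> 'v) \<Rightarrow> (input \<Rightarrow> 'v) \<Rightarrow> input \<Rightarrow> 'v::zero" where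
  "graft a p b f g q =
     (if q \<in> inner_label a p ` inputs b
      then g (inv_into (inputs b) (inner_label a p) q)
      else if q \<in> outer_label p b ` (inputs a - {p})
      then f (inv_into (inputs a - {p}) (outer_label p b) q)
      else 0)"

text \<open>
  The map \<open>z \<mapsto> \<lambda>z + b\<close> is represented by the pair \<open>(\<lambda>, b)\<close>. The product topology on families
  of pairs is the usual topology on the spaces of embeddings.
\<close>

type_synonym emb = "real \<times> complex"

definition emb_map :: "emb \<Rightarrow> complex \<Rightarrow> complex" where
  "emb_map e z = of_real (fst e) * z + snd e"

definition emb_comp :: "emb \<Rightarrow> emb \<Rightarrow> emb" where
  "emb_comp e e' = (fst e * fst e', of_real (fst e) * snd e' + snd e)"

lemma emb_map_emb_comp: "emb_map (emb_comp e e') = emb_map e \<circ> emb_map e'"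
  by (auto simp: emb_map_def emb_comp_def algebra_simps)

text \<open>The disk \<open>D\<close> and the half disk \<open>D\<^sup>+\<close>.\<close>

definition shape :: "color \<Rightarrow> complex set" where
  "shape d = (case d of Closed \<Rightarrow> cball 0 1 | Open \<Rightarrow> {z \<in> cball 0 1. 0 \<le> Im z})"

definition SC_space :: "color \<Rightarrow> arity \<Rightarrow> (input \<Rightarrow> emb) set" where
  "SC_space d a = {x.
     (d = Closed \<longrightarrow> a Open = 0) \<and>
     (\<forall>p\<in>inputs a. 0 < fst (x p) \<and> (fst p = Open \<longrightarrow> snd (x p) \<in> \<real>) \<and>
        emb_map (x p) ` shape (fst p) \<subseteq> shape d) \<and>
     (\<forall>p\<in>inputs a. \<forall>q\<in>inputs a. p \<noteq> q \<longrightarrow>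
        interior (emb_map (x p) ` shape (fst p)) \<inter> interior (emb_map (x q) ` shape (fst q)) = {}) \<and>
     (\<forall>p. p \<notin> inputs a \<longrightarrow> x p = 0)}"

definition SC_plus :: "(input \<Rightarrow> emb) operad" where
  "SC_plus =
     \<lparr> elts = SC_space,
       ins = (\<lambda>d a p b x y. graft a p b x (\<lambda>r. emb_comp (x p) (y r))),
       act = (\<lambda>d a \<sigma> x. x \<circ> inv \<sigma>),
       unt = (\<lambda>d. (\<lambda>_. 0)((d, 1) := (1, 0))) \<rparr>"

definition SC_mu :: "color \<Rightarrow> input \<Rightarrow> emb" where
  "SC_mu d = (\<lambda>_. 0)((d, 1) := (1/2, -1/2), (d, 2) := (1/2, 1/2))"

definition SC_f :: "input \<Rightarrow> emb" where
  "SC_f = (\<lambda>_. 0)((Closed, 1) := (1/2, \<i>/2))"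

definition SC_nullary :: "input \<Rightarrow> emb" where
  "SC_nullary = (\<lambda>_. 0)"

text \<open>
  \<open>\<Omega>\<Omega>'\<^sub>+\<close>. It is not isomorphic to \<open>Omega_plus\<close> below: in \<open>SC_plus\<close>, inserting a nullary element
  into \<open>\<mu>\<^sub>c\<close> gives a disk of radius \<open>1/2\<close> and not the unit.
\<close>

definition Omega'_plus :: "(color \<times> arity \<times> (input \<Rightarrow> emb)) set" where
  "Omega'_plus = generated SC_plus
     {(Closed, ar 0 2, SC_mu Closed), (Open, ar 2 0, SC_mu Open), (Open, ar 0 1, SC_f),
      (Closed, ar 0 0, SC_nullary), (Open, ar 0 0, SC_nullary)}"


section \<open>Colored permutations and braids\<close>

text \<open>
  Objects of \<open>CoB\<^sub>+\<close> (output \<open>Closed\<close>) and of \<open>CoPB\<^sub>+\<close> (output \<open>Open\<close>): each input occurs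
  exactly once as a letter.
\<close>

definition words :: "color \<Rightarrow> arity \<Rightarrow> input list set" where
  "words d a = {w. (d = Closed \<longrightarrow> a Open = 0) \<and> distinct w \<and> set w = inputs a}"

definition word_ins :: "arity \<Rightarrow> input \<Rightarrow> arity \<Rightarrow> input list \<Rightarrow> input list \<Rightarrow> input list" where
  "word_ins a p b w v =
     concat (map (\<lambda>q. if q = p then map (inner_label a p) v else [outer_label p b q]) w)"

definition Conf :: "color \<Rightarrow> arity \<Rightarrow> (input \<Rightarrow> complex) set" where
  "Conf d a = {x.
     (d = Closed \<longrightarrow> a Open = 0) \<and>
     inj_on x (inputs a) \<and>
     (\<forall>p\<in>inputs a. case d of
        Closed \<Rightarrow> x p \<in> ball 0 1
      | Open \<Rightarrow> x p \<in> shape Open \<and> (case fst p of Open \<Rightarrow> Im (x p) = 0 | Closed \<Rightarrow> 0 < Im (x p))) \<and>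
     (\<forall>p. p \<notin> inputs a \<longrightarrow> x p = 0)}"

definition Conf_word :: "color \<Rightarrow> arity \<Rightarrow> input list \<Rightarrow> (input \<Rightarrow> complex) set" where
  "Conf_word d a w = {x \<in> Conf d a. sorted_wrt (\<lambda>p q. Re (x p) < Re (x q)) w}"

text \<open>
  Homotopy class of a path from \<open>Conf_word d a w\<close> to \<open>Conf_word d a w'\<close>; endpoints may move inside
  these sets during a homotopy. The class is empty if \<open>g\<close> is not such a path.
\<close>

definition word_class ::
  "color \<Rightarrow> arity \<Rightarrow> input list \<Rightarrow> input list \<Rightarrow>
   (real \<Rightarrow> input \<Rightarrow> complex) \<Rightarrow> (real \<Rightarrow> input \<Rightarrow> complex) set" where
  "word_class d a w w' g =
     {h. homotopic_with_canon
           (\<lambda>k. pathstart k \<in> Conf_word d a w \<and> pathfinish k \<in> Conf_word d a w')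
           {0..1} (Conf d a) g h}"

definition word_groupoid ::
  "color \<Rightarrow> arity \<Rightarrow> (input list, input list \<times> (real \<Rightarrow> input \<Rightarrow> complex) set \<times> input list) groupoid" where
  "word_groupoid d a =
     \<lparr> Ob = words d a,
       Mor = {(w, word_class d a w w' g, w') | w w' g.
                w \<in> words d a \<and> w' \<in> words d a \<and> path g \<and> path_image g \<subseteq> Conf d a \<and>
                pathstart g \<in> Conf_word d a w \<and> pathfinish g \<in> Conf_word d a w'},
       Src = (\<lambda>(w, C, w'). w),
       Trg = (\<lambda>(w, C, w'). w'),
       Idm = (\<lambda>w. (w, \<Union>x\<in>Conf_word d a w. word_class d a w w (\<lambda>_. x), w)),
       Cmp = (\<lambda>(w, C, w') (v, C', v').
          (w, \<Union>g\<in>C. \<Union>g'\<in>{g' \<in> C'. pathfinish g = pathstart g'}. word_class d a w v' (g +++ g'), v')) \<rparr>"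

text \<open>The point \<open>p\<close> is replaced by a copy of \<open>y\<close> of size \<open>\<epsilon>\<close>.\<close>

definition Conf_ins ::
  "real \<Rightarrow> arity \<Rightarrow> input \<Rightarrow> arity \<Rightarrow> (input \<Rightarrow> complex) \<Rightarrow> (input \<Rightarrow> complex) \<Rightarrow> input \<Rightarrow> complex" where
  "Conf_ins \<epsilon> a p b x y = graft a p b x (\<lambda>r. x p + of_real \<epsilon> * y r)"

text \<open>
  \<open>\<epsilon>\<close> is very small for the insertion of the path \<open>g'\<close> at the point \<open>p\<close> of the path \<open>g\<close> if up to
  this size the result is a path in the configuration space with endpoints in \<open>Conf_word d e w\<close>
  and \<open>Conf_word d e w'\<close>, where \<open>e\<close> is the resulting arity.
\<close>

definition very_small ::
  "color \<Rightarrow> arity \<Rightarrow> input \<Rightarrow> arity \<Rightarrow> input list \<Rightarrow> input list \<Rightarrow>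
   (real \<Rightarrow> input \<Rightarrow> complex) \<Rightarrow> (real \<Rightarrow> input \<Rightarrow> complex) \<Rightarrow> real \<Rightarrow> bool" where
  "very_small d a p b w w' g g' \<epsilon> \<longleftrightarrow> 0 < \<epsilon> \<and>
     (\<forall>\<delta>. 0 < \<delta> \<and> \<delta> \<le> \<epsilon> \<longrightarrow>
        (\<forall>t\<in>{0..1}. Conf_ins \<delta> a p b (g t) (g' t) \<in> Conf d (ins_arity a p b)) \<and>
        Conf_ins \<delta> a p b (g 0) (g' 0) \<in> Conf_word d (ins_arity a p b) w \<and>
        Conf_ins \<delta> a p b (g 1) (g' 1) \<in> Conf_word d (ins_arity a p b) w')"

definition in_open_disk :: "(real \<Rightarrow> input \<Rightarrow> complex) \<Rightarrow> bool" where
  "in_open_disk g \<longleftrightarrow> (\<forall>t\<in>{0..1}. \<forall>p. norm (g t p) < 1)"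

text \<open>\<open>CoPB\<^sub>+\<close>, as a relative operad over \<open>CoB\<^sub>+\<close>.\<close>

definition CoPB_plus ::
  "(input list, input list \<times> (real \<Rightarrow> input \<Rightarrow> complex) set \<times> input list) goperad" where
  "CoPB_plus =
     \<lparr> grpd = word_groupoid,
       ob_ins = (\<lambda>d a p b w v. word_ins a p b w v),
       mor_ins = (\<lambda>d a p b (w, C, w') (v, C', v').
          (word_ins a p b w v,
           \<Union>g\<in>{g \<in> C. in_open_disk g}. \<Union>g'\<in>{g' \<in> C'. in_open_disk g'}.
           \<Union>\<epsilon>\<in>{\<epsilon>. very_small d a p b (word_ins a p b w v) (word_ins a p b w' v') g g' \<epsilon>}.
             word_class d (ins_arity a p b) (word_ins a p b w v) (word_ins a p b w' v')
               (\<lambda>t. Conf_ins \<epsilon> a p b (g t) (g' t)),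
           word_ins a p b w' v')),
       ob_act = (\<lambda>d a \<sigma> w. map \<sigma> w),
       mor_act = (\<lambda>d a \<sigma> (w, C, w').
          (map \<sigma> w, \<Union>g\<in>C. word_class d a (map \<sigma> w) (map \<sigma> w') (\<lambda>t. g t \<circ> inv \<sigma>), map \<sigma> w')),
       gunt = (\<lambda>d. [(d, 1)]) \<rparr>"


section \<open>Magmas and parenthesized permutations and braids\<close>

text \<open>
  The free two-colored symmetric operad \<open>\<Omega>\<Omega>\<close> consists of the planar trees whose vertices are
  the generators \<open>\<mu>\<^sub>c\<close>, \<open>\<mu>\<^sub>o\<close>, \<open>f\<close>, respecting colors, and whose leaves are labeled bijectively
  by the inputs. \<open>Nul d\<close> is the additional arity-zero element with output \<open>d\<close>; it does not occur
  as a subtree of an element of \<open>\<Omega>\<Omega>\<^sub>+\<close>, because the relations remove it.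
\<close>

datatype tree = Leaf input | MuC tree tree | MuO tree tree | F tree | Nul color

fun free_tree :: "color \<Rightarrow> tree \<Rightarrow> bool" where
  "free_tree d (Leaf p) \<longleftrightarrow> fst p = d"
| "free_tree d (MuC s t) \<longleftrightarrow> d = Closed \<and> free_tree Closed s \<and> free_tree Closed t"
| "free_tree d (MuO s t) \<longleftrightarrow> d = Open \<and> free_tree Open s \<and> free_tree Open t"
| "free_tree d (F t) \<longleftrightarrow> d = Open \<and> free_tree Closed t"
| "free_tree d (Nul k) \<longleftrightarrow> False"

fun leaves :: "tree \<Rightarrow> input list" where
  "leaves (Leaf p) = [p]"
| "leaves (MuC s t) = leaves s @ leaves t"
| "leaves (MuO s t) = leaves s @ leaves t"
| "leaves (F t) = leaves t"
| "leaves (Nul k) = []"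

definition trees :: "color \<Rightarrow> arity \<Rightarrow> tree set" where
  "trees d a = {t. (free_tree d t \<or> t = Nul d) \<and> distinct (leaves t) \<and> set (leaves t) = inputs a}"

text \<open>
  Substitution for the leaves, followed by the relations
  \<open>\<mu>\<^sub>c(*\<^sub>c, t) = t = \<mu>\<^sub>c(t, *\<^sub>c)\<close>, \<open>\<mu>\<^sub>o(*\<^sub>o, t) = t = \<mu>\<^sub>o(t, *\<^sub>o)\<close>, \<open>f(*\<^sub>c) = *\<^sub>o\<close>.
\<close>

fun tree_subst :: "(input \<Rightarrow> tree) \<Rightarrow> tree \<Rightarrow> tree" where
  "tree_subst \<theta> (Leaf p) = \<theta> p"
| "tree_subst \<theta> (MuC s t) =
     (let s' = tree_subst \<theta> s; t' = tree_subst \<theta> t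
      in if s' = Nul Closed then t' else if t' = Nul Closed then s' else MuC s' t')"
| "tree_subst \<theta> (MuO s t) =
     (let s' = tree_subst \<theta> s; t' = tree_subst \<theta> t
      in if s' = Nul Open then t' else if t' = Nul Open then s' else MuO s' t')"
| "tree_subst \<theta> (F t) =
     (let t' = tree_subst \<theta> t in if t' = Nul Closed then Nul Open else F t')"
| "tree_subst \<theta> (Nul k) = Nul k"

definition tree_relabel :: "(input \<Rightarrow> input) \<Rightarrow> tree \<Rightarrow> tree" where
  "tree_relabel \<sigma> = tree_subst (\<lambda>p. Leaf (\<sigma> p))"

definition Omega_plus :: "tree operad" where
  "Omega_plus =
     \<lparr> elts = trees,
       ins = (\<lambda>d a p b s t. tree_subst
          (\<lambda>q. if q = p then tree_relabel (inner_label a p) t else Leaf (outer_label p b q)) s),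
       act = (\<lambda>d a \<sigma> t. tree_relabel \<sigma> t),
       unt = (\<lambda>d. Leaf (d, 1)) \<rparr>"

text \<open>
  The unique operad morphism \<open>\<omega>\<^sub>+\<close> with the values on \<open>\<mu>\<^sub>c\<close>, \<open>\<mu>\<^sub>o\<close>, \<open>f\<close> recorded in the
  next lemma.
\<close>

definition omega_plus :: "color \<Rightarrow> arity \<Rightarrow> tree \<Rightarrow> input list" where
  "omega_plus d a t = leaves t"

lemma omega_plus_generators:
  "omega_plus Closed (ar 0 2) (MuC (Leaf (Closed, 1)) (Leaf (Closed, 2))) = [(Closed, 1), (Closed, 2)]"
  "omega_plus Open (ar 0 1) (F (Leaf (Closed, 1))) = [(Closed, 1)]"
  "omega_plus Open (ar 2 0) (MuO (Leaf (Open, 1)) (Leaf (Open, 2))) = [(Open, 1), (Open, 2)]"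
  by (simp_all add: omega_plus_def)

definition PaPB_plus ::
  "(tree, tree \<times> (input list \<times> (real \<Rightarrow> input \<Rightarrow> complex) set \<times> input list) \<times> tree) goperad" where
  "PaPB_plus = pullback_operad Omega_plus omega_plus CoPB_plus"

end

theory Submission
  imports Defs
begin

text \<open>Taking centers is an equivalence from the fundamental groupoids of the Swiss-Cheese spaces to the
  groupoids of colored braids: over a configuration of centers the admissible radii form a convex
  set, and a path of centers lifts after shrinking the disks. A tree is recovered, up to nullary
  leaves, from its realization by disks: the outermost generator and its branches are read off the
  real and imaginary parts of the centers. Hence the objects of \<open>\<Omega>\<Omega>'\<^sub>+\<close> are the trees of
  \<open>\<Omega>\<Omega>\<^sub>+\<close>. The axioms of a relative operad for \<open>PaPB\<^sub>+\<close> and \<open>CoPB\<^sub>+\<close>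
  follow by transport along full functors that are compatible with the operations and onto on objects.\<close>

section \<open>Groupoids and functors\<close>

text \<open>Insertion of morphisms in \<open>CoPB_plus\<close> is a union over all representatives
  in the open disk and over all very small sizes; checking the operad axioms there would mean
  comparing nested choices of sizes. For paths of disks the axioms hold at each time, so they are
  checked in \<open>pi_operad SC_plus\<close>. The analytic comparison is concentrated in
  \<open>CoPB_mor_ins\<close>: the size of an inserted configuration of disks is a radius that
  varies with time and need not be small, but it can be decreased along segments without collisions.

  Classes in \<open>CoPB_plus\<close> let the ends move inside the sets \<open>Conf_word\<close>.
  These are convex, so a homotopy with free ends between paths with equal ends can be replaced by
  one that fixes the ends.

  On objects the middle arrow is onto but not injective: \<open>\<mu>\<^sub>c\<close> with a nullary
  first input is a disk of radius 1/2, and its tree is a leaf. So it has to be shown that a point of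
  \<open>SC_plus\<close> determines a reduced tree, not a formal composition.

  Points of the half disk may lie on the unit circle, where no disk fits around them; therefore
  \<open>sect\<close> inverts \<open>centers\<close> only up to scaling by 1/2.\<close>

lemma groupoidD:
  assumes "is_groupoid G"
  shows groupoid_src: "\<And>f. f \<in> Mor G \<Longrightarrow> Src G f \<in> Ob G"
    and groupoid_trg: "\<And>f. f \<in> Mor G \<Longrightarrow> Trg G f \<in> Ob G"
    and groupoid_idm: "\<And>x. x \<in> Ob G \<Longrightarrow> Idm G x \<in> Mor G"
    and groupoid_src_idm: "\<And>x. x \<in> Ob G \<Longrightarrow> Src G (Idm G x) = x"
    and groupoid_trg_idm: "\<And>x. x \<in> Ob G \<Longrightarrow> Trg G (Idm G x) = x"
    and groupoid_cmp: "\<And>f g. \<lbrakk>f \<in> Mor G; g \<in> Mor G; Trg G f = Src G g\<rbrakk> \<Longrightarrow> Cmp G f g \<in> Mor G"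
    and groupoid_src_cmp: "\<And>f g. \<lbrakk>f \<in> Mor G; g \<in> Mor G; Trg G f = Src G g\<rbrakk> \<Longrightarrow> Src G (Cmp G f g) = Src G f"
    and groupoid_trg_cmp: "\<And>f g. \<lbrakk>f \<in> Mor G; g \<in> Mor G; Trg G f = Src G g\<rbrakk> \<Longrightarrow> Trg G (Cmp G f g) = Trg G g"
    and groupoid_idl: "\<And>f x. \<lbrakk>f \<in> Mor G; Src G f = x\<rbrakk> \<Longrightarrow> Cmp G (Idm G x) f = f"
    and groupoid_idr: "\<And>f x. \<lbrakk>f \<in> Mor G; Trg G f = x\<rbrakk> \<Longrightarrow> Cmp G f (Idm G x) = f"
    and groupoid_assoc: "\<And>f g h. \<lbrakk>f \<in> Mor G; g \<in> Mor G; h \<in> Mor G; Trg G f = Src G g; Trg G g = Src G h\<rbrakk>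
      \<Longrightarrow> Cmp G (Cmp G f g) h = Cmp G f (Cmp G g h)"
    and groupoid_inv: "\<And>f. f \<in> Mor G \<Longrightarrow> \<exists>g\<in>Mor G. Src G g = Trg G f \<and> Trg G g = Src G f \<and>
        Cmp G f g = Idm G (Src G f) \<and> Cmp G g f = Idm G (Trg G f)"
  using assms unfolding is_groupoid_def by blast+

lemma groupoid_cancel_right:
  assumes G: "is_groupoid G" and "f \<in> Mor G" "g \<in> Mor G" "h \<in> Mor G"
    and "Trg G f = Src G h" "Trg G g = Src G h" and "Cmp G f h = Cmp G g h"
  shows "f = g"
proof -
  obtain k where k: "k \<in> Mor G" "Src G k = Trg G h" "Trg G k = Src G h" "Cmp G h k = Idm G (Src G h)"
    using groupoid_inv[OF G \<open>h \<in> Mor G\<close>] by blast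
  have "f = Cmp G f (Cmp G h k)" using assms k groupoid_idr[OF G] by metis
  also have "\<dots> = Cmp G (Cmp G f h) k" using assms k groupoid_assoc[OF G] by metis
  also have "\<dots> = Cmp G (Cmp G g h) k" using assms by simp
  also have "\<dots> = Cmp G g (Cmp G h k)" using assms k groupoid_assoc[OF G] by metis
  also have "\<dots> = g" using assms k groupoid_idr[OF G] by metis
  finally show ?thesis .
qed

lemma functorD:
  assumes "is_functor G H F0 F1"
  shows functor_ob: "\<And>x. x \<in> Ob G \<Longrightarrow> F0 x \<in> Ob H"
    and functor_idm: "\<And>x. x \<in> Ob G \<Longrightarrow> F1 (Idm G x) = Idm H (F0 x)"
    and functor_mor: "\<And>f. f \<in> Mor G \<Longrightarrow> F1 f \<in> Mor H"
    and functor_src: "\<And>f. f \<in> Mor G \<Longrightarrow> Src H (F1 f) = F0 (Src G f)"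
    and functor_trg: "\<And>f. f \<in> Mor G \<Longrightarrow> Trg H (F1 f) = F0 (Trg G f)"
    and functor_cmp: "\<And>f g. \<lbrakk>f \<in> Mor G; g \<in> Mor G; Trg G f = Src G g\<rbrakk> \<Longrightarrow> F1 (Cmp G f g) = Cmp H (F1 f) (F1 g)"
  using assms unfolding is_functor_def by blast+

definition full_functor ::
  "('a, 'm) groupoid \<Rightarrow> ('b, 'n) groupoid \<Rightarrow> ('a \<Rightarrow> 'b) \<Rightarrow> ('m \<Rightarrow> 'n) \<Rightarrow> bool" where
  "full_functor G H F0 F1 \<longleftrightarrow>
     (\<forall>x\<in>Ob G. \<forall>y\<in>Ob G. \<forall>f\<in>Mor H. Src H f = F0 x \<and> Trg H f = F0 y \<longrightarrow>
        (\<exists>g\<in>Mor G. Src G g = x \<and> Trg G g = y \<and> F1 g = f))"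

definition faithful_functor ::
  "('a, 'm) groupoid \<Rightarrow> ('m \<Rightarrow> 'n) \<Rightarrow> bool" where
  "faithful_functor G F1 \<longleftrightarrow>
     (\<forall>f\<in>Mor G. \<forall>g\<in>Mor G. Src G f = Src G g \<and> Trg G f = Trg G g \<and> F1 f = F1 g \<longrightarrow> f = g)"

lemma full_functorD:
  assumes "full_functor G H F0 F1" "x \<in> Ob G" "y \<in> Ob G" "f \<in> Mor H" "Src H f = F0 x" "Trg H f = F0 y"
  obtains g where "g \<in> Mor G" "Src G g = x" "Trg G g = y" "F1 g = f"
  using assms unfolding full_functor_def by blast

text \<open>The definition asks for a quasi-inverse, so one is built: choose \<open>K0 y\<close>
  with an arrow \<open>\<epsilon> y\<close> from \<open>F0 (K0 y)\<close> to \<open>y\<close>.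
  Fullness lifts the conjugate of \<open>f\<close> by \<open>\<epsilon>\<close> to
  \<open>K1 f\<close>, and faithfulness makes this lift unique. Uniqueness gives functoriality of
  \<open>K1\<close>, and faithfulness again gives naturality of the unit.\<close>

lemma equivalence_of_categoriesI:
  assumes G: "is_groupoid G" and H: "is_groupoid H" and F: "is_functor G H F0 F1"
    and full: "full_functor G H F0 F1" and faithful: "faithful_functor G F1"
    and surj: "\<And>y. y \<in> Ob H \<Longrightarrow> \<exists>x\<in>Ob G. \<exists>f\<in>Mor H. Src H f = F0 x \<and> Trg H f = y"
  shows "equivalence_of_categories G H F0 F1"
proof -
  note Gs = groupoidD[OF G] and Hs = groupoidD[OF H] and Fs = functorD[OF F]
  note [simp] = Gs(1-10) Hs(1-10) Fs
  have "\<forall>y. \<exists>x f. y \<in> Ob H \<longrightarrow> x \<in> Ob G \<and> f \<in> Mor H \<and> Src H f = F0 x \<and> Trg H f = y"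
    using surj by blast
  then obtain K0 \<epsilon> where
    K0: "\<And>y. y \<in> Ob H \<Longrightarrow> K0 y \<in> Ob G \<and> \<epsilon> y \<in> Mor H \<and> Src H (\<epsilon> y) = F0 (K0 y) \<and> Trg H (\<epsilon> y) = y"
    by metis
  \<comment> \<open>\<open>?P f g\<close> makes \<open>\<epsilon>\<close> natural at
    \<open>f\<close>. Written as a square it avoids inverses, and cancelling
    \<open>\<epsilon> (Trg H f)\<close> determines \<open>F1 g\<close>.\<close>
  let ?P = "\<lambda>f g. g \<in> Mor G \<and> Src G g = K0 (Src H f) \<and> Trg G g = K0 (Trg H f) \<and>
    Cmp H (F1 g) (\<epsilon> (Trg H f)) = Cmp H (\<epsilon> (Src H f)) f"
  have ex: "\<exists>g. ?P f g" if f: "f \<in> Mor H" for f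
  proof -
    note S = K0[OF Hs(1)[OF f]] and T = K0[OF Hs(2)[OF f]]
    obtain e where e: "e \<in> Mor H" "Src H e = Trg H (\<epsilon> (Trg H f))" "Trg H e = Src H (\<epsilon> (Trg H f))"
      "Cmp H e (\<epsilon> (Trg H f)) = Idm H (Trg H (\<epsilon> (Trg H f)))"
      using Hs(12)[of "\<epsilon> (Trg H f)"] T by blast
    define h where "h = Cmp H (Cmp H (\<epsilon> (Src H f)) f) e"
    have sf: "Cmp H (\<epsilon> (Src H f)) f \<in> Mor H" "Src H (Cmp H (\<epsilon> (Src H f)) f) = F0 (K0 (Src H f))"
      "Trg H (Cmp H (\<epsilon> (Src H f)) f) = Trg H f"
      using f S T by simp_all
    have h: "h \<in> Mor H" "Src H h = F0 (K0 (Src H f))" "Trg H h = F0 (K0 (Trg H f))"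
      using e S T sf unfolding h_def by simp_all
    obtain g where g: "g \<in> Mor G" "Src G g = K0 (Src H f)" "Trg G g = K0 (Trg H f)" "F1 g = h"
      using full_functorD[OF full _ _ h] S T by metis
    have "Cmp H h (\<epsilon> (Trg H f)) = Cmp H (Cmp H (\<epsilon> (Src H f)) f) (Cmp H e (\<epsilon> (Trg H f)))"
      unfolding h_def using e T sf by (intro Hs(11)) simp_all
    also have "\<dots> = Cmp H (\<epsilon> (Src H f)) f" using e T sf by simp
    finally show ?thesis using g by blast
  qed
  have uniq: "g = g'" if f: "f \<in> Mor H" and g: "?P f g" and g': "?P f g'" for f g g'
  proof -
    note T = K0[OF Hs(2)[OF f]]
    have "F1 g = F1 g'"
      by (rule groupoid_cancel_right[OF H, of _ _ "\<epsilon> (Trg H f)"]) (use f g g' T in simp_all)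
    then show ?thesis using faithful g g' unfolding faithful_functor_def by metis
  qed
  define K1 where "K1 f = (SOME g. ?P f g)" for f
  have K1: "?P f (K1 f)" if "f \<in> Mor H" for f
    unfolding K1_def by (rule someI_ex[OF ex[OF that]])
  have KF: "is_functor H G K0 K1"
    unfolding is_functor_def
  proof (intro conjI ballI impI)
    fix x assume x: "x \<in> Ob H"
    show "K0 x \<in> Ob G" using K0 x by blast
    show "K1 (Idm H x) = Idm G (K0 x)"
    proof (rule uniq[OF Hs(3)[OF x] K1[OF Hs(3)[OF x]]], intro conjI)
      show "Cmp H (F1 (Idm G (K0 x))) (\<epsilon> (Trg H (Idm H x))) = Cmp H (\<epsilon> (Src H (Idm H x))) (Idm H x)"
        using K0[OF x] x by simp
    qed (use K0[OF x] x in simp_all)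
  next
    fix f g assume fg: "f \<in> Mor H" "g \<in> Mor H" "Trg H f = Src H g"
    note S = K0[OF Hs(1)[OF fg(1)]] and M = K0[OF Hs(1)[OF fg(2)]] and T = K0[OF Hs(2)[OF fg(2)]]
    note f = K1[OF fg(1)] and g = K1[OF fg(2)] and c = Hs(6,7,8)[OF fg]
    have cG: "Trg G (K1 f) = Src G (K1 g)" using f g fg by simp
    show "K1 (Cmp H f g) = Cmp G (K1 f) (K1 g)"
    proof (rule uniq[OF c(1) K1[OF c(1)]], intro conjI)
      have "Cmp H (F1 (Cmp G (K1 f) (K1 g))) (\<epsilon> (Trg H g)) = Cmp H (F1 (K1 f)) (Cmp H (F1 (K1 g)) (\<epsilon> (Trg H g)))"
        using f g cG T fg by (simp add: Hs(11))
      also have "\<dots> = Cmp H (F1 (K1 f)) (Cmp H (\<epsilon> (Trg H f)) g)" using g fg by simp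
      also have "\<dots> = Cmp H (Cmp H (F1 (K1 f)) (\<epsilon> (Trg H f))) g"
        by (rule Hs(11)[symmetric]) (use f fg M in simp_all)
      also have "\<dots> = Cmp H (Cmp H (\<epsilon> (Src H f)) f) g" using f by simp
      also have "\<dots> = Cmp H (\<epsilon> (Src H f)) (Cmp H f g)"
        using fg S by (simp add: Hs(11))
      finally show "Cmp H (F1 (Cmp G (K1 f) (K1 g))) (\<epsilon> (Trg H (Cmp H f g))) =
        Cmp H (\<epsilon> (Src H (Cmp H f g))) (Cmp H f g)" using c by simp
    qed (use f g cG c in simp_all)
  qed (use K1 in simp_all)
  \<comment> \<open>The unit at \<open>x\<close> is the lift of the inverse of
    \<open>\<epsilon> (F0 x)\<close>.\<close>
  let ?Q = "\<lambda>x h. h \<in> Mor G \<and> Src G h = x \<and> Trg G h = K0 (F0 x) \<and> Cmp H (F1 h) (\<epsilon> (F0 x)) = Idm H (F0 x)"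
  define \<eta> where "\<eta> x = (SOME h. ?Q x h)" for x
  have \<eta>: "?Q x (\<eta> x)" if x: "x \<in> Ob G" for x
  proof -
    note E = K0[OF Fs(1)[OF x]]
    obtain e where e: "e \<in> Mor H" "Src H e = F0 x" "Trg H e = F0 (K0 (F0 x))"
      "Cmp H e (\<epsilon> (F0 x)) = Idm H (F0 x)"
      using Hs(12)[of "\<epsilon> (F0 x)"] E by auto
    have "\<exists>h. ?Q x h" using full_functorD[OF full x _ e(1,2,3)] E e(4) by blast
    then show ?thesis unfolding \<eta>_def by (rule someI_ex)
  qed
  have "natural_transformation G G id id (K0 \<circ> F0) (K1 \<circ> F1) \<eta>"
    unfolding natural_transformation_def
  proof (intro conjI ballI)
    fix f assume f: "f \<in> Mor G"
    note s = \<eta>[OF Gs(1)[OF f]] and t = \<eta>[OF Gs(2)[OF f]] and k = K1[OF Fs(3)[OF f]]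
    note Ff = Fs(3,4,5)[OF f]
    note S = K0[OF Fs(1)[OF Gs(1)[OF f]]] and T = K0[OF Fs(1)[OF Gs(2)[OF f]]]
    let ?l = "Cmp G (\<eta> (Src G f)) (K1 (F1 f))" and ?r = "Cmp G f (\<eta> (Trg G f))"
    have l: "?l \<in> Mor G" "Src G ?l = Src G f" "Trg G ?l = K0 (F0 (Trg G f))"
      using s k Ff by simp_all
    have r: "?r \<in> Mor G" "Src G ?r = Src G f" "Trg G ?r = K0 (F0 (Trg G f))"
      using t f by simp_all
    have "Cmp H (F1 ?l) (\<epsilon> (F0 (Trg G f))) = Cmp H (Cmp H (F1 (\<eta> (Src G f))) (F1 (K1 (F1 f)))) (\<epsilon> (F0 (Trg G f)))"
      using s k Ff by simp
    also have "\<dots> = Cmp H (F1 (\<eta> (Src G f))) (Cmp H (F1 (K1 (F1 f))) (\<epsilon> (F0 (Trg G f))))"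
      by (rule Hs(11)) (use f s k Ff S T in simp_all)
    also have "\<dots> = Cmp H (F1 (\<eta> (Src G f))) (Cmp H (\<epsilon> (F0 (Src G f))) (F1 f))" using f k Ff by simp
    also have "\<dots> = Cmp H (Cmp H (F1 (\<eta> (Src G f))) (\<epsilon> (F0 (Src G f)))) (F1 f)"
      by (rule Hs(11)[symmetric]) (use f s Ff S T in simp_all)
    also have "\<dots> = F1 f" using f s Ff by simp
    also have "\<dots> = Cmp H (F1 f) (Cmp H (F1 (\<eta> (Trg G f))) (\<epsilon> (F0 (Trg G f))))"
      using f t Ff by simp
    also have "\<dots> = Cmp H (Cmp H (F1 f) (F1 (\<eta> (Trg G f)))) (\<epsilon> (F0 (Trg G f)))"
      by (rule Hs(11)[symmetric]) (use f t Ff S T in simp_all)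
    also have "\<dots> = Cmp H (F1 ?r) (\<epsilon> (F0 (Trg G f)))" using f t by simp
    finally have "Cmp H (F1 ?l) (\<epsilon> (F0 (Trg G f))) = Cmp H (F1 ?r) (\<epsilon> (F0 (Trg G f)))" .
    then have "F1 ?l = F1 ?r"
      by (rule groupoid_cancel_right[OF H, rotated -1]) (use f l r T in simp_all)
    then have "?l = ?r" using faithful l r unfolding faithful_functor_def by metis
    then show "Cmp G (\<eta> (Src G f)) ((K1 \<circ> F1) f) = Cmp G (id f) (\<eta> (Trg G f))" by simp
  qed (use \<eta> in auto)
  moreover have "natural_transformation H H (F0 \<circ> K0) (F1 \<circ> K1) id id \<epsilon>"
    unfolding natural_transformation_def using K0 K1 by auto
  ultimately show ?thesis using F KF unfolding equivalence_of_categories_def by blast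
qed

text \<open>\<open>H\<close> is not known to be a groupoid. Since \<open>F0\<close> need not be
  injective, arbitrary lifts of composable morphisms need not be composable. Fullness together with
  surjectivity on objects lets each lift start where the previous one ends, and then the laws of
  \<open>G\<close> are pushed forward.\<close>

lemma is_groupoid_image:
  assumes G: "is_groupoid G" and F: "is_functor G H F0 F1" and full: "full_functor G H F0 F1"
    and onto: "Ob H \<subseteq> F0 ` Ob G"
    and st: "\<And>f. f \<in> Mor H \<Longrightarrow> Src H f \<in> Ob H \<and> Trg H f \<in> Ob H"
  shows "is_groupoid H"
proof -
  note Gs = groupoidD[OF G] and Fs = functorD[OF F]
  note [simp] = Gs(1-10) Fs(1,3-5)
  have lift: "\<exists>g y. g \<in> Mor G \<and> Src G g = x \<and> Trg G g = y \<and> y \<in> Ob G \<and> F1 g = f"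
    if x: "x \<in> Ob G" and f: "f \<in> Mor H" "Src H f = F0 x" for f x
  proof -
    obtain y where "y \<in> Ob G" "Trg H f = F0 y" using st[OF f(1)] onto by blast
    with full_functorD[OF full x _ f] show ?thesis by blast
  qed
  have lift0: "\<exists>x\<in>Ob G. Src H f = F0 x" if f: "f \<in> Mor H" for f
    using st[OF f] onto by blast
  show ?thesis unfolding is_groupoid_def
  proof (intro conjI ballI impI)
    fix x assume "x \<in> Ob H"
    then obtain y where y: "y \<in> Ob G" "x = F0 y" using onto by blast
    have i: "Idm H x = F1 (Idm G y)" using Fs(2) y by simp
    show "Idm H x \<in> Mor H" "Src H (Idm H x) = x" "Trg H (Idm H x) = x"
      unfolding i using y by simp_all
  next
    fix f g assume fg: "f \<in> Mor H" "g \<in> Mor H" "Trg H f = Src H g"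
    obtain x f' y where f': "f' \<in> Mor G" "Src G f' = x" "Trg G f' = y" "y \<in> Ob G" "F1 f' = f"
      using lift0[OF fg(1)] lift[OF _ fg(1)] by metis
    have "Src H g = F0 y" using fg f' Fs(5) by metis
    then obtain g' z where g': "g' \<in> Mor G" "Src G g' = y" "Trg G g' = z" "z \<in> Ob G" "F1 g' = g"
      using lift[OF f'(4) fg(2)] by metis
    have c: "Cmp H f g = F1 (Cmp G f' g')" using f' g' Fs(6)[of f' g'] by simp
    show "Cmp H f g \<in> Mor H" "Src H (Cmp H f g) = Src H f" "Trg H (Cmp H f g) = Trg H g"
      unfolding c using f' g' fg by auto
  next
    fix f assume f: "f \<in> Mor H"
    obtain x f' y where f': "x \<in> Ob G" "f' \<in> Mor G" "Src G f' = x" "Trg G f' = y" "y \<in> Ob G" "F1 f' = f"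
      using lift0[OF f] lift[OF _ f] by metis
    then have st': "Src H f = F0 x" "Trg H f = F0 y" using Fs(4,5) by auto
    have "Cmp H (Idm H (Src H f)) f = F1 (Cmp G (Idm G x) f')"
      using f' st' Fs(2)[OF f'(1)] Fs(6)[of "Idm G x" f'] by simp
    then show "Cmp H (Idm H (Src H f)) f = f" using f' by simp
    have "Cmp H f (Idm H (Trg H f)) = F1 (Cmp G f' (Idm G y))"
      using f' st' Fs(2)[OF f'(5)] Fs(6)[of f' "Idm G y"] by simp
    then show "Cmp H f (Idm H (Trg H f)) = f" using f' by simp
    obtain g where "g \<in> Mor G" "Src G g = y" "Trg G g = x" "Cmp G f' g = Idm G x" "Cmp G g f' = Idm G y"
      using Gs(12)[OF f'(2)] f' by auto
    then show "\<exists>g\<in>Mor H. Src H g = Trg H f \<and> Trg H g = Src H f \<and>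
        Cmp H f g = Idm H (Src H f) \<and> Cmp H g f = Idm H (Trg H f)"
      unfolding st' using f' Fs(6)[of f' g] Fs(6)[of g f'] Fs(2)
      by (intro bexI[of _ "F1 g"]) simp_all
  next
    fix f g h assume fg: "f \<in> Mor H" "g \<in> Mor H" "h \<in> Mor H" "Trg H f = Src H g \<and> Trg H g = Src H h"
    obtain x f' y where f': "f' \<in> Mor G" "Src G f' = x" "Trg G f' = y" "y \<in> Ob G" "F1 f' = f"
      using lift0[OF fg(1)] lift[OF _ fg(1)] by metis
    have "Src H g = F0 y" using fg f' Fs(5) by metis
    then obtain g' z where g': "g' \<in> Mor G" "Src G g' = y" "Trg G g' = z" "z \<in> Ob G" "F1 g' = g"
      using lift[OF f'(4) fg(2)] by metis
    have "Src H h = F0 z" using fg g' Fs(5) by metis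
    then obtain h' w where h': "h' \<in> Mor G" "Src G h' = z" "Trg G h' = w" "w \<in> Ob G" "F1 h' = h"
      using lift[OF g'(4) fg(3)] by metis
    have "F1 (Cmp G (Cmp G f' g') h') = Cmp H (Cmp H f g) h"
      using f' g' h' Fs(6)[of f' g'] Fs(6)[of "Cmp G f' g'" h'] by simp
    moreover have "F1 (Cmp G f' (Cmp G g' h')) = Cmp H f (Cmp H g h)"
      using f' g' h' Fs(6)[of g' h'] Fs(6)[of f' "Cmp G g' h'"] by simp
    moreover have "Cmp G (Cmp G f' g') h' = Cmp G f' (Cmp G g' h')"
      using f' g' h' by (simp add: Gs(11))
    ultimately show "Cmp H (Cmp H f g) h = Cmp H f (Cmp H g h)" by metis
  qed (use st in auto)
qed


section \<open>Relative operads and their images\<close>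

lemma fst_outer_label [simp]: "fst (outer_label p b r) = fst r"
  by (simp add: outer_label_def)

lemma fst_inner_label [simp]: "fst (inner_label a p r) = fst r"
  by (simp add: inner_label_def)

lemma outer_label_inputs:
  "\<lbrakk>p \<in> inputs a; r \<in> inputs a; r \<noteq> p\<rbrakk> \<Longrightarrow> outer_label p b r \<in> inputs (ins_arity a p b)"
  by (cases p; cases r) (auto simp: inputs_def outer_label_def ins_arity_def)

lemma inner_label_inputs:
  "\<lbrakk>p \<in> inputs a; r \<in> inputs b\<rbrakk> \<Longrightarrow> inner_label a p r \<in> inputs (ins_arity a p b)"
  by (cases p; cases r) (auto simp: inputs_def inner_label_def ins_arity_def)

lemma unit_arity_input: "(d, 1) \<in> inputs (unit_arity d)"
  by (simp add: inputs_def unit_arity_def)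

lemma ins_unit_arity [simp]: "ins_arity (unit_arity d) (d, Suc 0) a = a"
  by (auto simp: ins_arity_def unit_arity_def)

lemma ins_arity_unit: "p \<in> inputs a \<Longrightarrow> ins_arity a p (unit_arity (fst p)) = a"
  by (auto simp: ins_arity_def unit_arity_def)

lemma input_permsD:
  assumes "\<sigma> \<in> input_perms a"
  shows input_perms_permutes: "\<sigma> permutes inputs a"
    and input_perms_fst: "fst (\<sigma> p) = fst p"
    and input_perms_inputs: "p \<in> inputs a \<Longrightarrow> \<sigma> p \<in> inputs a"
  using assms permutes_in_image unfolding input_perms_def by fastforce+

lemma input_perms_comp:
  "\<lbrakk>\<sigma> \<in> input_perms a; \<tau> \<in> input_perms a\<rbrakk> \<Longrightarrow> \<sigma> \<circ> \<tau> \<in> input_perms a"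
  unfolding input_perms_def by (auto simp: permutes_compose simp del: split_paired_All)

lemma input_perms_id: "id \<in> input_perms a"
  by (simp add: input_perms_def)

text \<open>The axioms are equations between composites of operations, so each one is lifted along
  \<open>\<phi>\<close>, used in \<open>Q\<close> and mapped back. \<open>R\<close> enters only
  through its compatibility with \<open>\<phi>\<close> and the surjectivity of
  \<open>\<phi>\<close>.\<close>

lemma relative_operad_image:
  assumes Q: "relative_operad Q" and M: "operad_morphism Q R \<phi>"
    and onto: "\<And>d a. elts R d a \<subseteq> \<phi> d a ` elts Q d a"
  shows "relative_operad R"
proof -
  have Mm: "\<And>d a x. x \<in> elts Q d a \<Longrightarrow> \<phi> d a x \<in> elts R d a"
    and Mu: "\<And>d. unt R d = \<phi> d (unit_arity d) (unt Q d)"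
    and Mi: "\<And>d a x p b y k. \<lbrakk>x \<in> elts Q d a; p \<in> inputs a; y \<in> elts Q (fst p) b; k = fst p\<rbrakk> \<Longrightarrow>
        ins R d a p b (\<phi> d a x) (\<phi> k b y) = \<phi> d (ins_arity a p b) (ins Q d a p b x y)"
    and Ma: "\<And>d a x \<sigma>. \<lbrakk>x \<in> elts Q d a; \<sigma> \<in> input_perms a\<rbrakk> \<Longrightarrow>
        act R d a \<sigma> (\<phi> d a x) = \<phi> d a (act Q d a \<sigma> x)"
    using M unfolding operad_morphism_def by (simp_all only: simp_thms)
  have Qu: "\<And>d. unt Q d \<in> elts Q d (unit_arity d)"
    and Qi: "\<And>d a x p b y. \<lbrakk>x \<in> elts Q d a; p \<in> inputs a; y \<in> elts Q (fst p) b\<rbrakk> \<Longrightarrow>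
        ins Q d a p b x y \<in> elts Q d (ins_arity a p b)"
    and Qa: "\<And>d a x \<sigma>. \<lbrakk>x \<in> elts Q d a; \<sigma> \<in> input_perms a\<rbrakk> \<Longrightarrow> act Q d a \<sigma> x \<in> elts Q d a"
    using Q unfolding relative_operad_def operad_closure_def by simp_all
  have lift: "\<exists>x'\<in>elts Q d a. x = \<phi> d a x'" if "x \<in> elts R d a" for d a x
    using onto that by blast
  have "elts R Closed a = {}" if "0 < a Open" for a
    using Q onto that unfolding relative_operad_def by (metis image_is_empty subset_empty)
  moreover have "operad_closure R"
    unfolding operad_closure_def
  proof (intro conjI allI ballI)
    show "unt R d \<in> elts R d (unit_arity d)" for d
      unfolding Mu using Mm Qu by blast
    fix d a x assume "x \<in> elts R d a"
    then obtain x' where x': "x' \<in> elts Q d a" "x = \<phi> d a x'" using lift by blast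
    show "act R d a \<sigma> x \<in> elts R d a" if "\<sigma> \<in> input_perms a" for \<sigma>
      using x' that Ma Mm Qa by simp
    fix p b y assume p: "p \<in> inputs a" and "y \<in> elts R (fst p) b"
    then obtain y' where "y' \<in> elts Q (fst p) b" "y = \<phi> (fst p) b y'" using lift by blast
    then show "ins R d a p b x y \<in> elts R d (ins_arity a p b)"
      using x' p Mi Mm Qi by simp
  qed
  moreover have "operad_action R"
    unfolding operad_action_def
  proof (intro allI ballI conjI)
    fix d a x assume "x \<in> elts R d a"
    then obtain x' where x': "x' \<in> elts Q d a" "x = \<phi> d a x'" using lift by blast
    have q: "act Q d a id x' = x'" "\<And>\<sigma> \<tau>. \<lbrakk>\<sigma> \<in> input_perms a; \<tau> \<in> input_perms a\<rbrakk> \<Longrightarrow>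
        act Q d a (\<sigma> \<circ> \<tau>) x' = act Q d a \<sigma> (act Q d a \<tau> x')"
      using Q x' unfolding relative_operad_def operad_action_def by blast+
    show "act R d a id x = x" using x' q Ma input_perms_id by simp
    show "act R d a (\<sigma> \<circ> \<tau>) x = act R d a \<sigma> (act R d a \<tau> x)"
      if "\<sigma> \<in> input_perms a" "\<tau> \<in> input_perms a" for \<sigma> \<tau>
      using x' q that Ma Qa input_perms_comp[OF that] by simp
  qed
  moreover have "operad_unit R"
    unfolding operad_unit_def
  proof (intro allI ballI conjI)
    fix d a x assume "x \<in> elts R d a"
    then obtain x' where x': "x' \<in> elts Q d a" "x = \<phi> d a x'" using lift by blast
    have q: "ins Q d (unit_arity d) (d, 1) a (unt Q d) x' = x'"
      "\<And>p. p \<in> inputs a \<Longrightarrow> ins Q d a p (unit_arity (fst p)) x' (unt Q (fst p)) = x'"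
      using Q x' unfolding relative_operad_def operad_unit_def by blast+
    have "ins R d (unit_arity d) (d, 1) a (unt R d) x = \<phi> d (ins_arity (unit_arity d) (d, 1) a) x'"
      unfolding Mu x'(2) using Mi[OF Qu unit_arity_input, of x' d a] x'(1) q(1) by simp
    then show "ins R d (unit_arity d) (d, 1) a (unt R d) x = x" using x' by simp
    show "ins R d a p (unit_arity (fst p)) x (unt R (fst p)) = x" if p: "p \<in> inputs a" for p
      unfolding Mu x'(2) using Mi[OF x'(1) p Qu] q(2)[OF p] ins_arity_unit[OF p] by simp
  qed
  moreover have "operad_sequential R"
    unfolding operad_sequential_def
  proof (intro allI ballI)
    fix d a x p b y q c z
    assume "x \<in> elts R d a" and p: "p \<in> inputs a" and "y \<in> elts R (fst p) b" and q: "q \<in> inputs b"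
      and "z \<in> elts R (fst q) c"
    then obtain x' y' z' where x': "x' \<in> elts Q d a" "x = \<phi> d a x'"
      and y': "y' \<in> elts Q (fst p) b" "y = \<phi> (fst p) b y'"
      and z': "z' \<in> elts Q (fst q) c" "z = \<phi> (fst q) c z'" using lift by metis
    have e: "ins Q d (ins_arity a p b) (inner_label a p q) c (ins Q d a p b x' y') z' =
          ins Q d a p (ins_arity b q c) x' (ins Q (fst p) b q c y' z')"
      using Q x' y' z' p q unfolding relative_operad_def operad_sequential_def by blast
    \<comment> \<open>\<open>\<phi>\<close> carries the arity as an argument, so the two ways of
      composing must be shown to have the same arity before the equation \<open>e\<close> can be
      mapped to \<open>R\<close>.\<close>
    have ar: "ins_arity (ins_arity a p b) (inner_label a p q) c = ins_arity a p (ins_arity b q c)"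
      using p q by (cases p; cases q) (auto simp: ins_arity_def inputs_def fun_eq_iff)
    show "ins R d (ins_arity a p b) (inner_label a p q) c (ins R d a p b x y) z =
          ins R d a p (ins_arity b q c) x (ins R (fst p) b q c y z)"
      using x' y' z' p q by (simp add: Mi Qi inner_label_inputs e ar)
  qed
  moreover have "operad_parallel R"
    unfolding operad_parallel_def
  proof (intro allI ballI impI)
    fix d a x p q b y c z \<rho>
    let ?e = "ins_arity (ins_arity a p b) (outer_label p b q) c"
    assume "x \<in> elts R d a" and p: "p \<in> inputs a" and q: "q \<in> inputs a" and pq: "p \<noteq> q"
      and "y \<in> elts R (fst p) b" "z \<in> elts R (fst q) c" and \<rho>: "\<rho> \<in> input_perms ?e"
      and *: "(\<forall>r\<in>inputs a - {p, q}.
             \<rho> (outer_label (outer_label q c p) b (outer_label q c r)) =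
             outer_label (outer_label p b q) c (outer_label p b r)) \<and>
          (\<forall>r\<in>inputs b.
             \<rho> (inner_label (ins_arity a q c) (outer_label q c p) r) =
             outer_label (outer_label p b q) c (inner_label a p r)) \<and>
          (\<forall>r\<in>inputs c.
             \<rho> (outer_label (outer_label q c p) b (inner_label a q r)) =
             inner_label (ins_arity a p b) (outer_label p b q) r)"
    then obtain x' y' z' where x': "x' \<in> elts Q d a" "x = \<phi> d a x'"
      and y': "y' \<in> elts Q (fst p) b" "y = \<phi> (fst p) b y'"
      and z': "z' \<in> elts Q (fst q) c" "z = \<phi> (fst q) c z'" using lift by metis
    have e: "ins Q d (ins_arity a p b) (outer_label p b q) c (ins Q d a p b x' y') z' =
          act Q d ?e \<rho> (ins Q d (ins_arity a q c) (outer_label q c p) b (ins Q d a q c x' z') y')"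
      using Q x'(1) y'(1) z'(1) p q pq \<rho> * unfolding relative_operad_def operad_parallel_def
      by (metis (no_types, lifting))
    have ar: "ins_arity (ins_arity a q c) (outer_label q c p) b = ?e"
      using p q pq by (cases p; cases q) (auto simp: ins_arity_def inputs_def fun_eq_iff)
    have 1: "ins Q d a p b x' y' \<in> elts Q d (ins_arity a p b)" "ins Q d a q c x' z' \<in> elts Q d (ins_arity a q c)"
      "outer_label p b q \<in> inputs (ins_arity a p b)" "outer_label q c p \<in> inputs (ins_arity a q c)"
      using Qi x' y' z' p q pq outer_label_inputs by auto
    have 2: "ins Q d (ins_arity a q c) (outer_label q c p) b (ins Q d a q c x' z') y' \<in> elts Q d ?e"
      using Qi[OF 1(2,4), of y' b] y' ar by simp
    show "ins R d (ins_arity a p b) (outer_label p b q) c (ins R d a p b x y) z =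
          act R d ?e \<rho> (ins R d (ins_arity a q c) (outer_label q c p) b (ins R d a q c x z) y)"
      using x' y' z' p q 1 2 \<rho> by (simp add: Mi Ma e ar)
  qed
  moreover have "operad_equivariant R"
    unfolding operad_equivariant_def
  proof (intro allI ballI impI)
    fix d a x p b y \<sigma> \<tau> \<rho>
    assume "x \<in> elts R d a" and p: "p \<in> inputs a" and "y \<in> elts R (fst p) b"
      and \<sigma>: "\<sigma> \<in> input_perms a" and \<tau>: "\<tau> \<in> input_perms b" and \<rho>: "\<rho> \<in> input_perms (ins_arity a p b)"
      and *: "(\<forall>r\<in>inputs a - {p}. \<rho> (outer_label p b r) = outer_label (\<sigma> p) b (\<sigma> r)) \<and>
          (\<forall>r\<in>inputs b. \<rho> (inner_label a p r) = inner_label a (\<sigma> p) (\<tau> r))"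
    then obtain x' y' where x': "x' \<in> elts Q d a" "x = \<phi> d a x'"
      and y': "y' \<in> elts Q (fst p) b" "y = \<phi> (fst p) b y'" using lift by metis
    have e: "ins Q d a (\<sigma> p) b (act Q d a \<sigma> x') (act Q (fst p) b \<tau> y') =
          act Q d (ins_arity a p b) \<rho> (ins Q d a p b x' y')"
      using Q x'(1) y'(1) p \<sigma> \<tau> \<rho> * unfolding relative_operad_def operad_equivariant_def
      by (metis (no_types, lifting))
    have ar: "ins_arity a (\<sigma> p) b = ins_arity a p b"
      by (simp add: ins_arity_def input_perms_fst[OF \<sigma>])
    show "ins R d a (\<sigma> p) b (act R d a \<sigma> x) (act R (fst p) b \<tau> y) =
          act R d (ins_arity a p b) \<rho> (ins R d a p b x y)"
      using x' y' p \<sigma> \<tau> \<rho> input_perms_inputs[OF \<sigma> p]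
      by (simp add: Mi Ma Qi Qa e ar input_perms_fst[OF \<sigma>])
  qed
  ultimately show ?thesis unfolding relative_operad_def by blast
qed

lemma functor_insD:
  assumes Q: "relative_goperad Q" and p: "p \<in> inputs a"
  shows "\<And>x y. \<lbrakk>x \<in> Ob (grpd Q d a); y \<in> Ob (grpd Q (fst p) b)\<rbrakk> \<Longrightarrow>
        ob_ins Q d a p b x y \<in> Ob (grpd Q d (ins_arity a p b)) \<and>
        mor_ins Q d a p b (Idm (grpd Q d a) x) (Idm (grpd Q (fst p) b) y) =
          Idm (grpd Q d (ins_arity a p b)) (ob_ins Q d a p b x y)"
    and "\<And>f g. \<lbrakk>f \<in> Mor (grpd Q d a); g \<in> Mor (grpd Q (fst p) b)\<rbrakk> \<Longrightarrow>
        mor_ins Q d a p b f g \<in> Mor (grpd Q d (ins_arity a p b)) \<and>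
        Src (grpd Q d (ins_arity a p b)) (mor_ins Q d a p b f g) =
          ob_ins Q d a p b (Src (grpd Q d a) f) (Src (grpd Q (fst p) b) g) \<and>
        Trg (grpd Q d (ins_arity a p b)) (mor_ins Q d a p b f g) =
          ob_ins Q d a p b (Trg (grpd Q d a) f) (Trg (grpd Q (fst p) b) g)"
    and "\<And>f g f' g'. \<lbrakk>f \<in> Mor (grpd Q d a); g \<in> Mor (grpd Q (fst p) b); f' \<in> Mor (grpd Q d a);
          g' \<in> Mor (grpd Q (fst p) b); Trg (grpd Q d a) f = Src (grpd Q d a) f';
          Trg (grpd Q (fst p) b) g = Src (grpd Q (fst p) b) g'\<rbrakk> \<Longrightarrow>
        mor_ins Q d a p b (Cmp (grpd Q d a) f f') (Cmp (grpd Q (fst p) b) g g') =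
        Cmp (grpd Q d (ins_arity a p b)) (mor_ins Q d a p b f g) (mor_ins Q d a p b f' g')"
proof -
  have "is_functor (product_groupoid (grpd Q d a) (grpd Q (fst p) b)) (grpd Q d (ins_arity a p b))
          (\<lambda>(x, y). ob_ins Q d a p b x y) (\<lambda>(f, g). mor_ins Q d a p b f g)"
    using Q p unfolding relative_goperad_def by blast
  note q = functorD[OF this, unfolded product_groupoid_def, simplified]
  show "\<And>x y. \<lbrakk>x \<in> Ob (grpd Q d a); y \<in> Ob (grpd Q (fst p) b)\<rbrakk> \<Longrightarrow>
        ob_ins Q d a p b x y \<in> Ob (grpd Q d (ins_arity a p b)) \<and>
        mor_ins Q d a p b (Idm (grpd Q d a) x) (Idm (grpd Q (fst p) b) y) =
          Idm (grpd Q d (ins_arity a p b)) (ob_ins Q d a p b x y)"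
    using q(1,2) by fastforce
  show "\<And>f g. \<lbrakk>f \<in> Mor (grpd Q d a); g \<in> Mor (grpd Q (fst p) b)\<rbrakk> \<Longrightarrow>
        mor_ins Q d a p b f g \<in> Mor (grpd Q d (ins_arity a p b)) \<and>
        Src (grpd Q d (ins_arity a p b)) (mor_ins Q d a p b f g) =
          ob_ins Q d a p b (Src (grpd Q d a) f) (Src (grpd Q (fst p) b) g) \<and>
        Trg (grpd Q d (ins_arity a p b)) (mor_ins Q d a p b f g) =
          ob_ins Q d a p b (Trg (grpd Q d a) f) (Trg (grpd Q (fst p) b) g)"
    using q(3,4,5) by fastforce
  show "\<And>f g f' g'. \<lbrakk>f \<in> Mor (grpd Q d a); g \<in> Mor (grpd Q (fst p) b); f' \<in> Mor (grpd Q d a);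
          g' \<in> Mor (grpd Q (fst p) b); Trg (grpd Q d a) f = Src (grpd Q d a) f';
          Trg (grpd Q (fst p) b) g = Src (grpd Q (fst p) b) g'\<rbrakk> \<Longrightarrow>
        mor_ins Q d a p b (Cmp (grpd Q d a) f f') (Cmp (grpd Q (fst p) b) g g') =
        Cmp (grpd Q d (ins_arity a p b)) (mor_ins Q d a p b f g) (mor_ins Q d a p b f' g')"
    using q(6)[of "(_, _)" "(_, _)"] by simp
qed

text \<open>Fullness and surjectivity on objects make \<open>\<psi>\<close> onto on morphisms, so
  \<open>relative_operad_image\<close> applies to the operad of objects and to that of morphisms.
  Functoriality of the operations needs composable pairs to lift to composable pairs, which is
  \<open>lift2\<close>; surjectivity of \<open>\<psi>\<close> alone would not give this.\<close>

lemma relative_goperad_image: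
  assumes Q: "relative_goperad Q"
    and F: "\<And>d a. is_functor (grpd Q d a) (grpd R d a) (\<phi> d a) (\<psi> d a)"
    and full: "\<And>d a. full_functor (grpd Q d a) (grpd R d a) (\<phi> d a) (\<psi> d a)"
    and onto: "\<And>d a. Ob (grpd R d a) \<subseteq> \<phi> d a ` Ob (grpd Q d a)"
    and st: "\<And>d a f. f \<in> Mor (grpd R d a) \<Longrightarrow>
      Src (grpd R d a) f \<in> Ob (grpd R d a) \<and> Trg (grpd R d a) f \<in> Ob (grpd R d a)"
    and ob: "operad_morphism (ob_operad Q) (ob_operad R) \<phi>"
    and mor: "operad_morphism (mor_operad Q) (mor_operad R) \<psi>"
  shows "goperad_morphism Q R \<phi> \<psi>"
proof -
  have Qg: "is_groupoid (grpd Q d a)" for d a using Q unfolding relative_goperad_def by blast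
  have Rg: "is_groupoid (grpd R d a)" for d a
    by (rule is_groupoid_image[OF Qg F full onto st])
  note Qs = groupoidD[OF Qg] and Fs = functorD[OF F]
  note [simp] = Qs(1-8) Fs(1,3-5)
  have ontom: "\<exists>f'\<in>Mor (grpd Q d a). f = \<psi> d a f'" if f: "f \<in> Mor (grpd R d a)" for d a f
  proof -
    obtain x y where "x \<in> Ob (grpd Q d a)" "y \<in> Ob (grpd Q d a)"
      "Src (grpd R d a) f = \<phi> d a x" "Trg (grpd R d a) f = \<phi> d a y" using st[OF f] onto by blast
    with full_functorD[OF full _ _ f] show ?thesis by metis
  qed
  have lift2: "\<exists>f'\<in>Mor (grpd Q d a). \<exists>g'\<in>Mor (grpd Q d a). f = \<psi> d a f' \<and> g = \<psi> d a g' \<and>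
      Trg (grpd Q d a) f' = Src (grpd Q d a) g'"
    if f: "f \<in> Mor (grpd R d a)" and g: "g \<in> Mor (grpd R d a)" and fg: "Trg (grpd R d a) f = Src (grpd R d a) g"
    for d a f g
  proof -
    obtain f' where f': "f' \<in> Mor (grpd Q d a)" "f = \<psi> d a f'" using ontom[OF f] by blast
    obtain y where "y \<in> Ob (grpd Q d a)" "Trg (grpd R d a) g = \<phi> d a y" using st[OF g] onto by blast
    moreover have "Src (grpd R d a) g = \<phi> d a (Trg (grpd Q d a) f')" using f' fg by simp
    ultimately obtain g' where "g' \<in> Mor (grpd Q d a)" "Src (grpd Q d a) g' = Trg (grpd Q d a) f'" "g = \<psi> d a g'"
      using full_functorD[OF full _ _ g] f' by (metis Qs(2))
    then show ?thesis using f' by metis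
  qed
  have rob: "relative_operad (ob_operad R)"
    by (rule relative_operad_image[OF _ ob]) (use Q onto in \<open>auto simp: relative_goperad_def ob_operad_def\<close>)
  have rmor: "relative_operad (mor_operad R)"
    by (rule relative_operad_image[OF _ mor]) (use Q in \<open>simp add: relative_goperad_def\<close>, use ontom in \<open>auto simp: mor_operad_def image_iff\<close>)
  have oi: "\<And>d a p b x y. \<lbrakk>p \<in> inputs a; x \<in> Ob (grpd Q d a); y \<in> Ob (grpd Q (fst p) b)\<rbrakk> \<Longrightarrow>
      ob_ins R d a p b (\<phi> d a x) (\<phi> (fst p) b y) = \<phi> d (ins_arity a p b) (ob_ins Q d a p b x y)"
    and oa: "\<And>d a \<sigma> x. \<lbrakk>\<sigma> \<in> input_perms a; x \<in> Ob (grpd Q d a)\<rbrakk> \<Longrightarrow>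
      ob_act R d a \<sigma> (\<phi> d a x) = \<phi> d a (ob_act Q d a \<sigma> x)"
    using ob unfolding operad_morphism_def by (simp_all add: ob_operad_def)
  have mi: "\<And>d a p b x y. \<lbrakk>p \<in> inputs a; x \<in> Mor (grpd Q d a); y \<in> Mor (grpd Q (fst p) b)\<rbrakk> \<Longrightarrow>
      mor_ins R d a p b (\<psi> d a x) (\<psi> (fst p) b y) = \<psi> d (ins_arity a p b) (mor_ins Q d a p b x y)"
    and ma: "\<And>d a \<sigma> x. \<lbrakk>\<sigma> \<in> input_perms a; x \<in> Mor (grpd Q d a)\<rbrakk> \<Longrightarrow>
      mor_act R d a \<sigma> (\<psi> d a x) = \<psi> d a (mor_act Q d a \<sigma> x)"
    using mor unfolding operad_morphism_def by (simp_all add: mor_operad_def)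
  have ins: "is_functor (product_groupoid (grpd R d a) (grpd R (fst p) b)) (grpd R d (ins_arity a p b))
          (\<lambda>(x, y). ob_ins R d a p b x y) (\<lambda>(f, g). mor_ins R d a p b f g)"
    if p: "p \<in> inputs a" for d a p b
  proof -
    note q = functor_insD[OF Q p]
    show ?thesis unfolding is_functor_def
    proof (intro conjI ballI impI)
      fix xy assume "xy \<in> Ob (product_groupoid (grpd R d a) (grpd R (fst p) b))"
      then have "fst xy \<in> Ob (grpd R d a)" "snd xy \<in> Ob (grpd R (fst p) b)"
        by (auto simp: product_groupoid_def)
      then obtain x y where xy': "fst xy = \<phi> d a x" "snd xy = \<phi> (fst p) b y"
        "x \<in> Ob (grpd Q d a)" "y \<in> Ob (grpd Q (fst p) b)"
        using onto by blast
      then have xy: "xy = (\<phi> d a x, \<phi> (fst p) b y)" "x \<in> Ob (grpd Q d a)" "y \<in> Ob (grpd Q (fst p) b)"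
        by (simp_all add: prod_eq_iff)
      show "(case xy of (x, y) \<Rightarrow> ob_ins R d a p b x y) \<in> Ob (grpd R d (ins_arity a p b))"
        using xy p q(1) by (simp add: oi)
      show "(case Idm (product_groupoid (grpd R d a) (grpd R (fst p) b)) xy of (f, g) \<Rightarrow> mor_ins R d a p b f g) =
         Idm (grpd R d (ins_arity a p b)) (case xy of (x, y) \<Rightarrow> ob_ins R d a p b x y)"
        using xy p q(1)[OF xy(2,3)] by (simp add: product_groupoid_def oi mi Fs(2)[symmetric])
    next
      fix fg assume "fg \<in> Mor (product_groupoid (grpd R d a) (grpd R (fst p) b))"
      then have "fst fg \<in> Mor (grpd R d a)" "snd fg \<in> Mor (grpd R (fst p) b)"
        by (auto simp: product_groupoid_def)
      then obtain f g where fg': "fst fg = \<psi> d a f" "snd fg = \<psi> (fst p) b g"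
        "f \<in> Mor (grpd Q d a)" "g \<in> Mor (grpd Q (fst p) b)"
        using ontom by blast
      then have fg: "fg = (\<psi> d a f, \<psi> (fst p) b g)" "f \<in> Mor (grpd Q d a)" "g \<in> Mor (grpd Q (fst p) b)"
        by (simp_all add: prod_eq_iff)
      show "(case fg of (f, g) \<Rightarrow> mor_ins R d a p b f g) \<in> Mor (grpd R d (ins_arity a p b))"
        "Src (grpd R d (ins_arity a p b)) (case fg of (f, g) \<Rightarrow> mor_ins R d a p b f g) =
         (case Src (product_groupoid (grpd R d a) (grpd R (fst p) b)) fg of (x, y) \<Rightarrow> ob_ins R d a p b x y)"
        "Trg (grpd R d (ins_arity a p b)) (case fg of (f, g) \<Rightarrow> mor_ins R d a p b f g) =
         (case Trg (product_groupoid (grpd R d a) (grpd R (fst p) b)) fg of (x, y) \<Rightarrow> ob_ins R d a p b x y)"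
        using fg p q(2)[OF fg(2,3)] by (simp_all add: product_groupoid_def oi mi)
    next
      fix fg fg' assume a: "fg \<in> Mor (product_groupoid (grpd R d a) (grpd R (fst p) b))"
        "fg' \<in> Mor (product_groupoid (grpd R d a) (grpd R (fst p) b))"
        "Trg (product_groupoid (grpd R d a) (grpd R (fst p) b)) fg =
         Src (product_groupoid (grpd R d a) (grpd R (fst p) b)) fg'"
      obtain f f' where f: "f \<in> Mor (grpd Q d a)" "f' \<in> Mor (grpd Q d a)"
        "fst fg = \<psi> d a f" "fst fg' = \<psi> d a f'" "Trg (grpd Q d a) f = Src (grpd Q d a) f'"
        using a lift2[of "fst fg" d a "fst fg'"] by (auto simp: product_groupoid_def)
      obtain g g' where g: "g \<in> Mor (grpd Q (fst p) b)" "g' \<in> Mor (grpd Q (fst p) b)"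
        "snd fg = \<psi> (fst p) b g" "snd fg' = \<psi> (fst p) b g'" "Trg (grpd Q (fst p) b) g = Src (grpd Q (fst p) b) g'"
        using a lift2[of "snd fg" "fst p" b "snd fg'"] by (auto simp: product_groupoid_def)
      have e: "fg = (\<psi> d a f, \<psi> (fst p) b g)" "fg' = (\<psi> d a f', \<psi> (fst p) b g')"
        using f g by (simp_all add: prod_eq_iff)
      show "(case Cmp (product_groupoid (grpd R d a) (grpd R (fst p) b)) fg fg' of (f, g) \<Rightarrow> mor_ins R d a p b f g) =
         Cmp (grpd R d (ins_arity a p b)) (case fg of (f, g) \<Rightarrow> mor_ins R d a p b f g)
           (case fg' of (f, g) \<Rightarrow> mor_ins R d a p b f g)"
        using f g p q(2)[OF f(1) g(1)] q(2)[OF f(2) g(2)] q(3)[OF f(1) g(1) f(2) g(2) f(5) g(5)]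
        unfolding e by (simp add: product_groupoid_def mi Fs(6)[symmetric])
    qed
  qed
  have act: "is_functor (grpd R d a) (grpd R d a) (ob_act R d a \<sigma>) (mor_act R d a \<sigma>)"
    if s: "\<sigma> \<in> input_perms a" for d a \<sigma>
  proof -
    have "is_functor (grpd Q d a) (grpd Q d a) (ob_act Q d a \<sigma>) (mor_act Q d a \<sigma>)"
      using Q s unfolding relative_goperad_def by blast
    note q = functorD[OF this]
    show ?thesis unfolding is_functor_def
    proof (intro conjI ballI impI)
      fix x assume "x \<in> Ob (grpd R d a)"
      then obtain x' where x: "x' \<in> Ob (grpd Q d a)" "x = \<phi> d a x'" using onto by blast
      show "ob_act R d a \<sigma> x \<in> Ob (grpd R d a)" "mor_act R d a \<sigma> (Idm (grpd R d a) x) = Idm (grpd R d a) (ob_act R d a \<sigma> x)"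
        using x s q by (simp_all add: oa ma Fs(2)[symmetric])
    next
      fix f assume "f \<in> Mor (grpd R d a)"
      then obtain f' where f: "f' \<in> Mor (grpd Q d a)" "f = \<psi> d a f'" using ontom by blast
      show "mor_act R d a \<sigma> f \<in> Mor (grpd R d a)"
        "Src (grpd R d a) (mor_act R d a \<sigma> f) = ob_act R d a \<sigma> (Src (grpd R d a) f)"
        "Trg (grpd R d a) (mor_act R d a \<sigma> f) = ob_act R d a \<sigma> (Trg (grpd R d a) f)"
        using f s q by (simp_all add: oa ma)
    next
      fix f g assume "f \<in> Mor (grpd R d a)" "g \<in> Mor (grpd R d a)" "Trg (grpd R d a) f = Src (grpd R d a) g"
      then obtain f' g' where f: "f' \<in> Mor (grpd Q d a)" "g' \<in> Mor (grpd Q d a)" "f = \<psi> d a f'" "g = \<psi> d a g'"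
        "Trg (grpd Q d a) f' = Src (grpd Q d a) g'" using lift2 by metis
      show "mor_act R d a \<sigma> (Cmp (grpd R d a) f g) = Cmp (grpd R d a) (mor_act R d a \<sigma> f) (mor_act R d a \<sigma> g)"
        using f s q(3-5) by (simp add: ma q(6) Fs(6)[symmetric])
    qed
  qed
  have "relative_goperad R"
    unfolding relative_goperad_def using Rg rob rmor ins act by blast
  then show ?thesis unfolding goperad_morphism_def using Q F ob mor by blast
qed

lemma categorical_equivalence_image:
  assumes Q: "relative_goperad Q"
    and F: "\<And>d a. is_functor (grpd Q d a) (grpd R d a) (\<phi> d a) (\<psi> d a)"
    and full: "\<And>d a. full_functor (grpd Q d a) (grpd R d a) (\<phi> d a) (\<psi> d a)"
    and faithful: "\<And>d a. faithful_functor (grpd Q d a) (\<psi> d a)"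
    and onto: "\<And>d a. Ob (grpd R d a) \<subseteq> \<phi> d a ` Ob (grpd Q d a)"
    and st: "\<And>d a f. f \<in> Mor (grpd R d a) \<Longrightarrow>
      Src (grpd R d a) f \<in> Ob (grpd R d a) \<and> Trg (grpd R d a) f \<in> Ob (grpd R d a)"
    and ob: "operad_morphism (ob_operad Q) (ob_operad R) \<phi>"
    and mor: "operad_morphism (mor_operad Q) (mor_operad R) \<psi>"
  shows "categorical_equivalence Q R \<phi> \<psi>"
proof -
  have M: "goperad_morphism Q R \<phi> \<psi>"
    by (rule relative_goperad_image[OF Q F full onto st ob mor])
  have G: "is_groupoid (grpd Q d a)" "is_groupoid (grpd R d a)" for d a
    using M unfolding goperad_morphism_def relative_goperad_def by blast+
  have "equivalence_of_categories (grpd Q d a) (grpd R d a) (\<phi> d a) (\<psi> d a)" for d a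
  proof (rule equivalence_of_categoriesI[OF G F full faithful])
    fix y assume y: "y \<in> Ob (grpd R d a)"
    then obtain x where "x \<in> Ob (grpd Q d a)" "y = \<phi> d a x" using onto by blast
    then show "\<exists>x\<in>Ob (grpd Q d a). \<exists>f\<in>Mor (grpd R d a). Src (grpd R d a) f = \<phi> d a x \<and> Trg (grpd R d a) f = y"
      using groupoidD(3-5)[OF G(2)] y by metis
  qed
  then show ?thesis using M unfolding categorical_equivalence_def by blast
qed

text \<open>All axioms other than closure are universal statements about elements and hence restrict
  to subsets.\<close>

lemma relative_operad_suboperad:
  assumes Q: "relative_operad Q" and S: "\<And>d a. elts R d a \<subseteq> elts Q d a"
    and R: "ins R = ins Q" "act R = act Q" "unt R = unt Q" and C: "operad_closure R"
  shows "relative_operad R"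
proof -
  have s: "\<And>x d a. x \<in> elts R d a \<Longrightarrow> x \<in> elts Q d a" using S by blast
  have "\<And>a. 0 < a Open \<Longrightarrow> elts R Closed a = {}"
    using Q S unfolding relative_operad_def by (metis subset_empty)
  moreover have "operad_action R" "operad_unit R"
    using Q s unfolding relative_operad_def operad_action_def operad_unit_def R by blast+
  moreover have "operad_sequential R"
    using Q s unfolding relative_operad_def operad_sequential_def R by blast
  moreover have "operad_parallel R"
  proof -
    have P: "operad_parallel Q" using Q unfolding relative_operad_def by blast
    show ?thesis unfolding operad_parallel_def R
      by (intro allI ballI impI, rule P[unfolded operad_parallel_def, rule_format]) (assumption | rule s)+
  qed
  moreover have "operad_equivariant R"
  proof -
    have P: "operad_equivariant Q" using Q unfolding relative_operad_def by blast
    show ?thesis unfolding operad_equivariant_def R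
      by (intro allI ballI impI, rule P[unfolded operad_equivariant_def, rule_format]) (assumption | rule s)+
  qed
  ultimately show ?thesis using C unfolding relative_operad_def by blast
qed

lemma relative_goperad_full_suboperad:
  assumes Q: "relative_goperad Q"
    and unt: "\<And>d. (d, unit_arity d, gunt Q d) \<in> S"
    and ins: "\<And>d a x p b y. \<lbrakk>(d, a, x) \<in> S; p \<in> inputs a; (fst p, b, y) \<in> S\<rbrakk> \<Longrightarrow>
      (d, ins_arity a p b, ob_ins Q d a p b x y) \<in> S"
    and act: "\<And>d a x \<sigma>. \<lbrakk>(d, a, x) \<in> S; \<sigma> \<in> input_perms a\<rbrakk> \<Longrightarrow> (d, a, ob_act Q d a \<sigma> x) \<in> S"
  shows "relative_goperad (full_suboperad Q S)"
proof -
  have G: "is_groupoid (grpd Q d a)" for d a using Q unfolding relative_goperad_def by blast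
  note Gs = groupoidD[OF G]
  have I: "is_functor (product_groupoid (grpd Q d a) (grpd Q (fst p) b)) (grpd Q d (ins_arity a p b))
          (\<lambda>(x, y). ob_ins Q d a p b x y) (\<lambda>(f, g). mor_ins Q d a p b f g)"
    if "p \<in> inputs a" for d a p b using Q that unfolding relative_goperad_def by blast
  have A: "is_functor (grpd Q d a) (grpd Q d a) (ob_act Q d a \<sigma>) (mor_act Q d a \<sigma>)"
    if "\<sigma> \<in> input_perms a" for d a \<sigma> using Q that unfolding relative_goperad_def by blast
  have O: "relative_operad (ob_operad Q)" and M: "relative_operad (mor_operad Q)"
    using Q unfolding relative_goperad_def by blast+
  have "is_groupoid (grpd (full_suboperad Q S) d a)" for d a
    unfolding is_groupoid_def
  proof (intro conjI ballI impI)
    fix f assume "f \<in> Mor (grpd (full_suboperad Q S) d a)"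
    then show "\<exists>g\<in>Mor (grpd (full_suboperad Q S) d a).
        Src (grpd (full_suboperad Q S) d a) g = Trg (grpd (full_suboperad Q S) d a) f \<and>
        Trg (grpd (full_suboperad Q S) d a) g = Src (grpd (full_suboperad Q S) d a) f \<and>
        Cmp (grpd (full_suboperad Q S) d a) f g = Idm (grpd (full_suboperad Q S) d a) (Src (grpd (full_suboperad Q S) d a) f) \<and>
        Cmp (grpd (full_suboperad Q S) d a) g f = Idm (grpd (full_suboperad Q S) d a) (Trg (grpd (full_suboperad Q S) d a) f)"
      using Gs(12)[of f d a] by (auto simp: full_suboperad_def)
  qed (simp_all add: full_suboperad_def Gs(1-11))
  moreover have "relative_operad (ob_operad (full_suboperad Q S))"
  proof (rule relative_operad_suboperad[OF O])
    show "operad_closure (ob_operad (full_suboperad Q S))"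
      using O ins act unt unfolding relative_operad_def operad_closure_def ob_operad_def full_suboperad_def
      by simp
  qed (auto simp: ob_operad_def full_suboperad_def)
  moreover have "relative_operad (mor_operad (full_suboperad Q S))"
  proof (rule relative_operad_suboperad[OF M])
    show "operad_closure (mor_operad (full_suboperad Q S))"
      unfolding operad_closure_def
    proof (intro conjI allI ballI)
      show "unt (mor_operad (full_suboperad Q S)) d \<in> elts (mor_operad (full_suboperad Q S)) d (unit_arity d)" for d
        using O Gs(3-5) unt by (auto simp: mor_operad_def ob_operad_def full_suboperad_def relative_operad_def operad_closure_def)
    next
      fix d a f p b g assume *: "f \<in> elts (mor_operad (full_suboperad Q S)) d a" "p \<in> inputs a"
        "g \<in> elts (mor_operad (full_suboperad Q S)) (fst p) b"
      then have "(f, g) \<in> Mor (product_groupoid (grpd Q d a) (grpd Q (fst p) b))"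
        by (simp add: mor_operad_def full_suboperad_def product_groupoid_def)
      from functorD(3-5)[OF I[OF *(2)] this] *
      show "ins (mor_operad (full_suboperad Q S)) d a p b f g \<in> elts (mor_operad (full_suboperad Q S)) d (ins_arity a p b)"
        by (simp add: mor_operad_def full_suboperad_def product_groupoid_def ins)
    next
      fix d a f \<sigma> assume *: "f \<in> elts (mor_operad (full_suboperad Q S)) d a" "\<sigma> \<in> input_perms a"
      then show "act (mor_operad (full_suboperad Q S)) d a \<sigma> f \<in> elts (mor_operad (full_suboperad Q S)) d a"
        using functorD(3-5)[OF A[OF *(2)], of f d] by (simp add: mor_operad_def full_suboperad_def act)
    qed
  qed (auto simp: mor_operad_def full_suboperad_def)
  moreover have "is_functor (product_groupoid (grpd (full_suboperad Q S) d a) (grpd (full_suboperad Q S) (fst p) b))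
      (grpd (full_suboperad Q S) d (ins_arity a p b))
      (\<lambda>(x, y). ob_ins (full_suboperad Q S) d a p b x y) (\<lambda>(f, g). mor_ins (full_suboperad Q S) d a p b f g)"
    if p: "p \<in> inputs a" for d a p b
    using p unfolding is_functor_def
    by (simp add: full_suboperad_def product_groupoid_def ins functor_insD[OF Q p])
  moreover have "is_functor (grpd (full_suboperad Q S) d a) (grpd (full_suboperad Q S) d a)
      (ob_act (full_suboperad Q S) d a \<sigma>) (mor_act (full_suboperad Q S) d a \<sigma>)"
    if s: "\<sigma> \<in> input_perms a" for d a \<sigma>
    using functorD[OF A[OF s, of d]] s unfolding is_functor_def by (simp add: full_suboperad_def act)
  ultimately show ?thesis unfolding relative_goperad_def by blast
qed

section \<open>Homotopies of paths and the fundamental groupoid\<close>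

text \<open>The unit interval is convex, so \<open>f\<close> and \<open>g\<close> are homotopic in
  it with fixed ends, and \<open>k\<close> carries this homotopy along. The unit laws and the
  inverse laws for paths all come from here.\<close>

lemma homotopic_paths_compose_reparametrizations:
  assumes k: "path k" "path_image k \<subseteq> S"
    and f: "continuous_on {0..1} f" "f \<in> {0..1} \<rightarrow> {0..1::real}"
    and g: "continuous_on {0..1} g" "g \<in> {0..1} \<rightarrow> {0..1}"
    and ends: "f 0 = g 0" "f 1 = g 1"
  shows "homotopic_paths S (k \<circ> f) (k \<circ> g)"
proof (rule homotopic_paths_continuous_image[where S = "{0..1::real}"])
  show "homotopic_paths {0..1} f g"
  proof (rule homotopic_paths_linear)
    show "closed_segment (f t) (g t) \<subseteq> {0..1}" if "t \<in> {0..1}" for t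
      by (rule closed_segment_subset) (use that f g in auto)
  qed (use f g ends in \<open>auto simp: path_def pathstart_def pathfinish_def\<close>)
qed (use k in \<open>auto simp: path_def path_image_def\<close>)

lemma homotopic_paths_const_right:
  assumes "path p" "path_image p \<subseteq> S" "x = pathfinish p"
  shows "homotopic_paths S (p +++ (\<lambda>_. x)) p"
proof -
  have "homotopic_paths S (p \<circ> (\<lambda>t. min 1 (2 * t))) (p \<circ> id)"
    using assms by (intro homotopic_paths_compose_reparametrizations continuous_intros) auto
  moreover have "p \<circ> (\<lambda>t. min 1 (2 * t)) = p +++ (\<lambda>_. x)"
  proof
    show "(p \<circ> (\<lambda>t. min 1 (2 * t))) t = (p +++ (\<lambda>_. x)) t" for t
      using assms by (cases "2 * t = 1") (auto simp: joinpaths_def pathfinish_def min_def)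
  qed
  ultimately show ?thesis by simp
qed

lemma homotopic_paths_const_left:
  assumes "path p" "path_image p \<subseteq> S" "x = pathstart p"
  shows "homotopic_paths S ((\<lambda>_. x) +++ p) p"
proof -
  have "homotopic_paths S (p \<circ> (\<lambda>t. max 0 (2 * t - 1))) (p \<circ> id)"
    using assms by (intro homotopic_paths_compose_reparametrizations continuous_intros) auto
  moreover have "p \<circ> (\<lambda>t. max 0 (2 * t - 1)) = (\<lambda>_. x) +++ p"
  proof
    show "(p \<circ> (\<lambda>t. max 0 (2 * t - 1))) t = ((\<lambda>_. x) +++ p) t" for t
      using assms by (cases "2 * t = 1") (auto simp: joinpaths_def pathstart_def max_def)
  qed
  ultimately show ?thesis by simp
qed

lemma homotopic_paths_reversepath_right:
  assumes "path p" "path_image p \<subseteq> S"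
  shows "homotopic_paths S (p +++ reversepath p) (\<lambda>_. pathstart p)"
proof -
  \<comment> \<open>A tent function runs to the end and back; it takes the value 0 at both ends, so
    it can be compared with the constant 0.\<close>
  have "homotopic_paths S (p \<circ> (\<lambda>t. 1 - \<bar>1 - 2 * t\<bar>)) (p \<circ> (\<lambda>_. 0))"
    using assms by (intro homotopic_paths_compose_reparametrizations continuous_intros) auto
  moreover have "p \<circ> (\<lambda>t. 1 - \<bar>1 - 2 * t\<bar>) = p +++ reversepath p"
    using assms by (auto simp: joinpaths_def reversepath_def abs_if)
  moreover have "p \<circ> (\<lambda>_. 0) = (\<lambda>_. pathstart p)" by (auto simp: pathstart_def)
  ultimately show ?thesis by (simp add: pathstart_def)
qed

lemma homotopic_paths_reversepath_left:
  assumes "path p" "path_image p \<subseteq> S"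
  shows "homotopic_paths S (reversepath p +++ p) (\<lambda>_. pathfinish p)"
  using homotopic_paths_reversepath_right[of "reversepath p" S] assms by simp

lemma homotopic_paths_compose2:
  assumes g: "homotopic_paths X g g'" and h: "homotopic_paths Y h h'"
    and m: "continuous_on (X \<times> Y) (\<lambda>(x, y). m x y)" "\<And>x y. \<lbrakk>x \<in> X; y \<in> Y\<rbrakk> \<Longrightarrow> m x y \<in> Z"
  shows "homotopic_paths Z (\<lambda>t. m (g t) (h t)) (\<lambda>t. m (g' t) (h' t))"
proof -
  obtain H where H: "continuous_on ({0..1::real} \<times> {0..1::real}) H" "H \<in> {0..1} \<times> {0..1} \<rightarrow> X"
    "\<forall>x\<in>{0..1}. H (0, x) = g x" "\<forall>x\<in>{0..1}. H (1, x) = g' x"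
    "\<forall>t\<in>{0..1}. pathstart (H \<circ> Pair t) = pathstart g \<and> pathfinish (H \<circ> Pair t) = pathfinish g"
    using g unfolding homotopic_paths by blast
  obtain K where K: "continuous_on ({0..1::real} \<times> {0..1::real}) K" "K \<in> {0..1} \<times> {0..1} \<rightarrow> Y"
    "\<forall>x\<in>{0..1}. K (0, x) = h x" "\<forall>x\<in>{0..1}. K (1, x) = h' x"
    "\<forall>t\<in>{0..1}. pathstart (K \<circ> Pair t) = pathstart h \<and> pathfinish (K \<circ> Pair t) = pathfinish h"
    using h unfolding homotopic_paths by blast
  have "continuous_on ({0..1::real} \<times> {0..1::real}) (\<lambda>u. (\<lambda>(x, y). m x y) (H u, K u))"
  proof (rule continuous_on_compose2[OF m(1)])
    show "continuous_on ({0..1} \<times> {0..1}) (\<lambda>u. (H u, K u))" using H(1) K(1) by (intro continuous_on_Pair)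
    show "(\<lambda>u. (H u, K u)) ` ({0..1} \<times> {0..1}) \<subseteq> X \<times> Y" using H(2) K(2) by blast
  qed
  then have c: "continuous_on ({0..1::real} \<times> {0..1::real}) (\<lambda>u. m (H u) (K u))" by simp
  have "(\<lambda>u. m (H u) (K u)) \<in> {0..1::real} \<times> {0..1::real} \<rightarrow> Z" using H(2) K(2) m(2) by blast
  then show ?thesis unfolding homotopic_paths
    using c H(3-) K(3-) by (intro exI[of _ "\<lambda>u. m (H u) (K u)"]) (simp add: pathstart_def pathfinish_def)
qed

lemma homotopic_paths_compose1:
  assumes g: "homotopic_paths X g g'"
    and m: "continuous_on X m" "\<And>x. x \<in> X \<Longrightarrow> m x \<in> Z"
  shows "homotopic_paths Z (\<lambda>t. m (g t)) (\<lambda>t. m (g' t))"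
  using homotopic_paths_continuous_image[OF g m(1)] m(2) by (auto simp: o_def)

definition path_mor :: "'x::topological_space set \<Rightarrow> (real \<Rightarrow> 'x) \<Rightarrow> 'x \<times> (real \<Rightarrow> 'x) set \<times> 'x" where
  "path_mor X g = (pathstart g, path_class X g, pathfinish g)"

lemma path_class_eqI: "homotopic_paths X g h \<Longrightarrow> path_class X g = path_class X h"
  unfolding path_class_def using homotopic_paths_trans homotopic_paths_sym by blast

lemma path_class_self: "\<lbrakk>path g; path_image g \<subseteq> X\<rbrakk> \<Longrightarrow> g \<in> path_class X g"
  unfolding path_class_def by simp

lemma path_mor_eqI: "homotopic_paths X g h \<Longrightarrow> path_mor X g = path_mor X h"
  unfolding path_mor_def
  using path_class_eqI homotopic_paths_imp_pathstart homotopic_paths_imp_pathfinish by metis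

lemma path_mor_eqD: "\<lbrakk>path_mor X g = path_mor X h; path h; path_image h \<subseteq> X\<rbrakk> \<Longrightarrow> homotopic_paths X g h"
  unfolding path_mor_def path_class_def by auto

lemma path_mor_cong:
  "\<lbrakk>path g; path_image g \<subseteq> X; \<And>t. t \<in> {0..1} \<Longrightarrow> g t = h t\<rbrakk> \<Longrightarrow> path_mor X g = path_mor X h"
  by (intro path_mor_eqI homotopic_paths_eq)

text \<open>Operations on classes are defined as unions over all representatives. Well-definedness
  says that all members of such a union coincide, and then the union is evaluated on one
  representative.\<close>

lemma UN_eq_const: "\<lbrakk>x \<in> A; \<And>x. x \<in> A \<Longrightarrow> f x = c\<rbrakk> \<Longrightarrow> (\<Union>x\<in>A. f x) = c"
  by auto

lemma fundamental_groupoid_simps [simp]: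
  "Ob (fundamental_groupoid X) = X"
  "Src (fundamental_groupoid X) (path_mor X g) = pathstart g"
  "Trg (fundamental_groupoid X) (path_mor X g) = pathfinish g"
  "Idm (fundamental_groupoid X) x = path_mor X (\<lambda>_. x)"
  by (simp_all add: fundamental_groupoid_def path_mor_def) (simp_all add: pathstart_def pathfinish_def)

lemma Mor_fundamental_groupoid:
  "Mor (fundamental_groupoid X) = path_mor X ` {g. path g \<and> path_image g \<subseteq> X}"
  by (auto simp: fundamental_groupoid_def path_mor_def)

lemma path_mor_in_Mor: "\<lbrakk>path g; path_image g \<subseteq> X\<rbrakk> \<Longrightarrow> path_mor X g \<in> Mor (fundamental_groupoid X)"
  by (auto simp: Mor_fundamental_groupoid)

lemma Mor_fundamental_groupoidE:
  assumes "f \<in> Mor (fundamental_groupoid X)"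
  obtains g where "path g" "path_image g \<subseteq> X" "f = path_mor X g"
  using assms by (auto simp: Mor_fundamental_groupoid)

lemma Cmp_fundamental_groupoid:
  assumes "path g" "path_image g \<subseteq> X" "path h" "path_image h \<subseteq> X" "pathfinish g = pathstart h"
  shows "Cmp (fundamental_groupoid X) (path_mor X g) (path_mor X h) = path_mor X (g +++ h)"
proof -
  have "(\<Union>g'\<in>path_class X g. \<Union>h'\<in>path_class X h. path_class X (g' +++ h')) = path_class X (g +++ h)"
  proof (rule UN_eq_const[OF path_class_self[OF assms(1,2)]], rule UN_eq_const[OF path_class_self[OF assms(3,4)]])
    fix g' h' assume "g' \<in> path_class X g" "h' \<in> path_class X h"
    then show "path_class X (g' +++ h') = path_class X (g +++ h)"
      using assms(5) unfolding path_class_def[of X g] path_class_def[of X h]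
      by (metis homotopic_paths_join mem_Collect_eq path_class_eqI)
  qed
  then show ?thesis by (simp add: fundamental_groupoid_def path_mor_def)
qed

lemma path_const: "path (\<lambda>_. x)" "path_image (\<lambda>_. x) = {x}"
  "pathstart (\<lambda>_. x) = x" "pathfinish (\<lambda>_. x) = x"
  by (auto simp: path_def path_image_def pathstart_def pathfinish_def)

lemma is_groupoid_fundamental_groupoid: "is_groupoid (fundamental_groupoid X)"
  unfolding is_groupoid_def
proof (intro conjI ballI impI)
  fix f assume "f \<in> Mor (fundamental_groupoid X)"
  then obtain g where g: "path g" "path_image g \<subseteq> X" "f = path_mor X g" by (rule Mor_fundamental_groupoidE)
  then have s: "pathstart g \<in> X" "pathfinish g \<in> X" by auto
  then show "Src (fundamental_groupoid X) f \<in> Ob (fundamental_groupoid X)"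
    "Trg (fundamental_groupoid X) f \<in> Ob (fundamental_groupoid X)" using g by simp_all
  have "Cmp (fundamental_groupoid X) (path_mor X (\<lambda>_. pathstart g)) (path_mor X g) = path_mor X ((\<lambda>_. pathstart g) +++ g)"
    "Cmp (fundamental_groupoid X) (path_mor X g) (path_mor X (\<lambda>_. pathfinish g)) = path_mor X (g +++ (\<lambda>_. pathfinish g))"
    by (rule Cmp_fundamental_groupoid; use g s in \<open>simp add: path_const\<close>)+
  then show "Cmp (fundamental_groupoid X) (Idm (fundamental_groupoid X) (Src (fundamental_groupoid X) f)) f = f"
    "Cmp (fundamental_groupoid X) f (Idm (fundamental_groupoid X) (Trg (fundamental_groupoid X) f)) = f"
    using g path_mor_eqI[OF homotopic_paths_const_left[OF g(1,2) refl]]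
      path_mor_eqI[OF homotopic_paths_const_right[OF g(1,2) refl]] by auto
  have "Cmp (fundamental_groupoid X) (path_mor X g) (path_mor X (reversepath g)) = path_mor X (g +++ reversepath g)"
    "Cmp (fundamental_groupoid X) (path_mor X (reversepath g)) (path_mor X g) = path_mor X (reversepath g +++ g)"
    by (rule Cmp_fundamental_groupoid; use g in simp)+
  then show "\<exists>k\<in>Mor (fundamental_groupoid X). Src (fundamental_groupoid X) k = Trg (fundamental_groupoid X) f \<and>
      Trg (fundamental_groupoid X) k = Src (fundamental_groupoid X) f \<and>
      Cmp (fundamental_groupoid X) f k = Idm (fundamental_groupoid X) (Src (fundamental_groupoid X) f) \<and>
      Cmp (fundamental_groupoid X) k f = Idm (fundamental_groupoid X) (Trg (fundamental_groupoid X) f)"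
    using g path_mor_eqI[OF homotopic_paths_reversepath_right[OF g(1,2)]]
      path_mor_eqI[OF homotopic_paths_reversepath_left[OF g(1,2)]]
    by (intro bexI[of _ "path_mor X (reversepath g)"]) (auto intro!: path_mor_in_Mor)
next
  fix f g assume fg: "f \<in> Mor (fundamental_groupoid X)" "g \<in> Mor (fundamental_groupoid X)"
    "Trg (fundamental_groupoid X) f = Src (fundamental_groupoid X) g"
  obtain f' where f': "path f'" "path_image f' \<subseteq> X" "f = path_mor X f'"
    using fg(1) by (rule Mor_fundamental_groupoidE)
  obtain g' where g': "path g'" "path_image g' \<subseteq> X" "g = path_mor X g'"
    using fg(2) by (rule Mor_fundamental_groupoidE)
  have c: "pathfinish f' = pathstart g'" using f' g' fg by simp
  have e: "Cmp (fundamental_groupoid X) f g = path_mor X (f' +++ g')"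
    using f' g' c Cmp_fundamental_groupoid by blast
  show "Cmp (fundamental_groupoid X) f g \<in> Mor (fundamental_groupoid X)"
    unfolding e using f' g' c by (intro path_mor_in_Mor) (auto simp: path_image_join)
  show "Src (fundamental_groupoid X) (Cmp (fundamental_groupoid X) f g) = Src (fundamental_groupoid X) f"
    "Trg (fundamental_groupoid X) (Cmp (fundamental_groupoid X) f g) = Trg (fundamental_groupoid X) g"
    unfolding e using f' g' by simp_all
next
  fix f g h assume fg: "f \<in> Mor (fundamental_groupoid X)" "g \<in> Mor (fundamental_groupoid X)"
    "h \<in> Mor (fundamental_groupoid X)"
    "Trg (fundamental_groupoid X) f = Src (fundamental_groupoid X) g \<and>
     Trg (fundamental_groupoid X) g = Src (fundamental_groupoid X) h"
  obtain f' where f': "path f'" "path_image f' \<subseteq> X" "f = path_mor X f'"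
    using fg(1) by (rule Mor_fundamental_groupoidE)
  obtain g' where g': "path g'" "path_image g' \<subseteq> X" "g = path_mor X g'"
    using fg(2) by (rule Mor_fundamental_groupoidE)
  obtain h' where h': "path h'" "path_image h' \<subseteq> X" "h = path_mor X h'"
    using fg(3) by (rule Mor_fundamental_groupoidE)
  have c: "pathfinish f' = pathstart g'" "pathfinish g' = pathstart h'" using f' g' h' fg by simp_all
  show "Cmp (fundamental_groupoid X) (Cmp (fundamental_groupoid X) f g) h =
      Cmp (fundamental_groupoid X) f (Cmp (fundamental_groupoid X) g h)"
    using path_mor_eqI[OF homotopic_paths_assoc[OF f'(1,2) g'(1,2) h'(1,2) c]] f' g' h' c
    by (simp add: Cmp_fundamental_groupoid path_image_join)
qed (auto intro!: path_mor_in_Mor simp: path_const)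

section \<open>Fundamental groupoids of a topological operad\<close>

lemma pi_operad_simps [simp]:
  "grpd (pi_operad Q) d a = fundamental_groupoid (elts Q d a)"
  "ob_ins (pi_operad Q) = ins Q" "ob_act (pi_operad Q) = act Q" "gunt (pi_operad Q) = unt Q"
  by (simp_all add: pi_operad_def)

lemma ob_operad_pi: "ob_operad (pi_operad Q) = Q"
  by (cases Q) (simp add: ob_operad_def)

definition continuous_operad :: "('x::topological_space) operad \<Rightarrow> bool" where
  "continuous_operad Q \<longleftrightarrow>
    (\<forall>d a. \<forall>p\<in>inputs a. \<forall>b. continuous_on (elts Q d a \<times> elts Q (fst p) b) (\<lambda>(x, y). ins Q d a p b x y)) \<and>
    (\<forall>d a. \<forall>\<sigma>\<in>input_perms a. continuous_on (elts Q d a) (act Q d a \<sigma>))"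

lemma operad_closureD:
  assumes "relative_operad Q"
  shows operad_unt: "unt Q d \<in> elts Q d (unit_arity d)"
    and operad_ins: "\<lbrakk>x \<in> elts Q d a; p \<in> inputs a; y \<in> elts Q (fst p) b\<rbrakk> \<Longrightarrow>
        ins Q d a p b x y \<in> elts Q d (ins_arity a p b)"
    and operad_act: "\<lbrakk>x \<in> elts Q d a; \<sigma> \<in> input_perms a\<rbrakk> \<Longrightarrow> act Q d a \<sigma> x \<in> elts Q d a"
  using assms unfolding relative_operad_def operad_closure_def by simp_all

lemma homotopic_paths_ins:
  assumes Q: "relative_operad Q" "continuous_operad Q" and p: "p \<in> inputs a"
    and "homotopic_paths (elts Q d a) g g'" "homotopic_paths (elts Q (fst p) b) h h'"
  shows "homotopic_paths (elts Q d (ins_arity a p b)) (\<lambda>t. ins Q d a p b (g t) (h t)) (\<lambda>t. ins Q d a p b (g' t) (h' t))"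
  by (rule homotopic_paths_compose2[OF assms(4,5)])
    (use Q(2) p operad_ins[OF Q(1)] in \<open>auto simp: continuous_operad_def\<close>)

lemma homotopic_paths_act:
  assumes Q: "relative_operad Q" "continuous_operad Q" and s: "\<sigma> \<in> input_perms a"
    and "homotopic_paths (elts Q d a) g g'"
  shows "homotopic_paths (elts Q d a) (\<lambda>t. act Q d a \<sigma> (g t)) (\<lambda>t. act Q d a \<sigma> (g' t))"
  by (rule homotopic_paths_compose1[OF assms(4)])
    (use Q(2) s operad_act[OF Q(1)] in \<open>auto simp: continuous_operad_def\<close>)

lemma path_ins:
  assumes Q: "relative_operad Q" "continuous_operad Q" and p: "p \<in> inputs a"
    and g: "path g" "path_image g \<subseteq> elts Q d a" and h: "path h" "path_image h \<subseteq> elts Q (fst p) b"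
  shows "path (\<lambda>t. ins Q d a p b (g t) (h t))" "path_image (\<lambda>t. ins Q d a p b (g t) (h t)) \<subseteq> elts Q d (ins_arity a p b)"
  using homotopic_paths_ins[OF Q p, of d g g b h h] g h by simp_all

lemma path_act:
  assumes Q: "relative_operad Q" "continuous_operad Q" and s: "\<sigma> \<in> input_perms a"
    and g: "path g" "path_image g \<subseteq> elts Q d a"
  shows "path (\<lambda>t. act Q d a \<sigma> (g t))" "path_image (\<lambda>t. act Q d a \<sigma> (g t)) \<subseteq> elts Q d a"
  using homotopic_paths_act[OF Q s, of d g g] g by simp_all

lemma pi_mor_ins:
  assumes Q: "relative_operad Q" "continuous_operad Q" and p: "p \<in> inputs a"
    and g: "path g" "path_image g \<subseteq> elts Q d a" and h: "path h" "path_image h \<subseteq> elts Q (fst p) b"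
  shows "mor_ins (pi_operad Q) d a p b (path_mor (elts Q d a) g) (path_mor (elts Q (fst p) b) h) =
    path_mor (elts Q d (ins_arity a p b)) (\<lambda>t. ins Q d a p b (g t) (h t))"
proof -
  have "(\<Union>g'\<in>path_class (elts Q d a) g. \<Union>h'\<in>path_class (elts Q (fst p) b) h.
      path_class (elts Q d (ins_arity a p b)) (\<lambda>t. ins Q d a p b (g' t) (h' t))) =
    path_class (elts Q d (ins_arity a p b)) (\<lambda>t. ins Q d a p b (g t) (h t))"
  proof (rule UN_eq_const[OF path_class_self[OF g]], rule UN_eq_const[OF path_class_self[OF h]])
    fix g' h' assume "g' \<in> path_class (elts Q d a) g" "h' \<in> path_class (elts Q (fst p) b) h"
    then show "path_class (elts Q d (ins_arity a p b)) (\<lambda>t. ins Q d a p b (g' t) (h' t)) =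
      path_class (elts Q d (ins_arity a p b)) (\<lambda>t. ins Q d a p b (g t) (h t))"
      using path_class_eqI[OF homotopic_paths_ins[OF Q p]] by (auto simp: path_class_def[of _ g] path_class_def[of _ h])
  qed
  then show ?thesis by (simp add: pi_operad_def path_mor_def pathstart_def pathfinish_def)
qed

lemma pi_mor_act:
  assumes Q: "relative_operad Q" "continuous_operad Q" and s: "\<sigma> \<in> input_perms a"
    and g: "path g" "path_image g \<subseteq> elts Q d a"
  shows "mor_act (pi_operad Q) d a \<sigma> (path_mor (elts Q d a) g) = path_mor (elts Q d a) (\<lambda>t. act Q d a \<sigma> (g t))"
proof -
  have "(\<Union>g'\<in>path_class (elts Q d a) g. path_class (elts Q d a) (\<lambda>t. act Q d a \<sigma> (g' t))) =
    path_class (elts Q d a) (\<lambda>t. act Q d a \<sigma> (g t))"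
  proof (rule UN_eq_const[OF path_class_self[OF g]])
    fix g' assume "g' \<in> path_class (elts Q d a) g"
    then show "path_class (elts Q d a) (\<lambda>t. act Q d a \<sigma> (g' t)) = path_class (elts Q d a) (\<lambda>t. act Q d a \<sigma> (g t))"
      using path_class_eqI[OF homotopic_paths_act[OF Q s]] by (auto simp: path_class_def[of _ g])
  qed
  then show ?thesis by (simp add: pi_operad_def path_mor_def pathstart_def pathfinish_def)
qed

text \<open>The axioms hold in \<open>Q\<close> at each time, so the representing paths of the two
  sides agree on \<open>{0..1}\<close>, and paths that agree there have the same class. Outside the
  interval paths are unconstrained, hence \<open>path_mor_cong\<close> instead of an equality of
  functions.\<close>

lemma relative_operad_mor_pi:
  assumes Q: "relative_operad Q" "continuous_operad Q"
  shows "relative_operad (mor_operad (pi_operad Q))" (is "relative_operad ?M")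
proof -
  have elts: "elts ?M d a = Mor (fundamental_groupoid (elts Q d a))" for d a by (simp add: mor_operad_def)
  have unt: "unt ?M d = path_mor (elts Q d (unit_arity d)) (\<lambda>_. unt Q d)" for d by (simp add: mor_operad_def)
  have ins: "ins ?M d a p b (path_mor (elts Q d a) g) (path_mor (elts Q k b) h) =
      path_mor (elts Q d (ins_arity a p b)) (\<lambda>t. ins Q d a p b (g t) (h t))"
    if "p \<in> inputs a" "path g" "path_image g \<subseteq> elts Q d a" "path h" "path_image h \<subseteq> elts Q k b" "k = fst p" for d a p b g h k
    using pi_mor_ins[OF Q] that by (simp add: mor_operad_def)
  have act: "act ?M d a \<sigma> (path_mor (elts Q d a) g) = path_mor (elts Q d a) (\<lambda>t. act Q d a \<sigma> (g t))"
    if "\<sigma> \<in> input_perms a" "path g" "path_image g \<subseteq> elts Q d a" for d a \<sigma> g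
    using pi_mor_act[OF Q] that by (simp add: mor_operad_def)
  note pins = path_ins[OF Q] and pact = path_act[OF Q]
  have mem: "g t \<in> X" if "path_image g \<subseteq> X" "t \<in> {0..1}" for g :: "real \<Rightarrow> 'a" and t X
    using that by (auto simp: path_image_def)
  have closure: "operad_closure ?M"
    unfolding operad_closure_def elts unt
  proof (intro conjI allI ballI; (elim Mor_fundamental_groupoidE; hypsubst)?)
    show "path_mor (elts Q d (unit_arity d)) (\<lambda>_. unt Q d) \<in> Mor (fundamental_groupoid (elts Q d (unit_arity d)))" for d
      using operad_unt[OF Q(1)] by (intro path_mor_in_Mor) (simp_all add: path_const)
    fix d a g assume g: "path g" "path_image g \<subseteq> elts Q d a"
    show "act ?M d a \<sigma> (path_mor (elts Q d a) g) \<in> Mor (fundamental_groupoid (elts Q d a))"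
      if "\<sigma> \<in> input_perms a" for \<sigma>
      unfolding act[OF that g] by (rule path_mor_in_Mor[OF pact[OF that g]])
    fix p b h assume p: "p \<in> inputs a" and h: "path h" "path_image h \<subseteq> elts Q (fst p) b"
    show "ins ?M d a p b (path_mor (elts Q d a) g) (path_mor (elts Q (fst p) b) h)
      \<in> Mor (fundamental_groupoid (elts Q d (ins_arity a p b)))"
      unfolding ins[OF p g h refl] by (rule path_mor_in_Mor[OF pins[OF p g h]])
  qed
  moreover have "operad_action ?M"
    unfolding operad_action_def elts
  proof (intro allI ballI conjI; elim Mor_fundamental_groupoidE; hypsubst)
    fix d a g assume g: "path g" "path_image g \<subseteq> elts Q d a"
    have q: "\<And>x. x \<in> elts Q d a \<Longrightarrow> act Q d a id x = x"
      "\<And>x \<sigma> \<tau>. \<lbrakk>x \<in> elts Q d a; \<sigma> \<in> input_perms a; \<tau> \<in> input_perms a\<rbrakk> \<Longrightarrow>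
        act Q d a (\<sigma> \<circ> \<tau>) x = act Q d a \<sigma> (act Q d a \<tau> x)"
      using Q unfolding relative_operad_def operad_action_def by blast+
    show "act ?M d a id (path_mor (elts Q d a) g) = path_mor (elts Q d a) g"
      unfolding act[OF input_perms_id g]
      by (rule path_mor_cong[OF pact[OF input_perms_id g]]) (use q(1) mem[OF g(2)] in auto)
    fix \<sigma> \<tau> assume s: "\<sigma> \<in> input_perms a" "\<tau> \<in> input_perms a"
    show "act ?M d a (\<sigma> \<circ> \<tau>) (path_mor (elts Q d a) g) = act ?M d a \<sigma> (act ?M d a \<tau> (path_mor (elts Q d a) g))"
      unfolding act[OF input_perms_comp[OF s] g] act[OF s(2) g] act[OF s(1) pact[OF s(2) g]]
      by (rule path_mor_cong[OF pact[OF input_perms_comp[OF s] g]]) (use q(2)[OF _ s] mem[OF g(2)] in auto)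
  qed
  moreover have "operad_unit ?M"
    unfolding operad_unit_def elts unt
  proof (intro allI ballI conjI; elim Mor_fundamental_groupoidE; hypsubst)
    fix d a g assume g: "path g" "path_image g \<subseteq> elts Q d a"
    have q: "\<And>x. x \<in> elts Q d a \<Longrightarrow> ins Q d (unit_arity d) (d, 1) a (unt Q d) x = x"
      "\<And>x p. \<lbrakk>x \<in> elts Q d a; p \<in> inputs a\<rbrakk> \<Longrightarrow> ins Q d a p (unit_arity (fst p)) x (unt Q (fst p)) = x"
      using Q unfolding relative_operad_def operad_unit_def by blast+
    have u: "path (\<lambda>_. unt Q d)" "path_image (\<lambda>_. unt Q d) \<subseteq> elts Q d (unit_arity d)" for d
      using operad_unt[OF Q(1)] by (simp_all add: path_const)
    have "ins ?M d (unit_arity d) (d, 1) a (path_mor (elts Q d (unit_arity d)) (\<lambda>_. unt Q d)) (path_mor (elts Q d a) g) =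
      path_mor (elts Q d (ins_arity (unit_arity d) (d, 1) a)) (\<lambda>t. ins Q d (unit_arity d) (d, 1) a (unt Q d) (g t))"
      by (rule ins) (use u g unit_arity_input in auto)
    also have "\<dots> = path_mor (elts Q d a) g"
      using q(1) mem[OF g(2)] g ins_unit_arity[of d a] by (auto intro!: path_mor_cong[symmetric])
    finally show "ins ?M d (unit_arity d) (d, 1) a (path_mor (elts Q d (unit_arity d)) (\<lambda>_. unt Q d)) (path_mor (elts Q d a) g) =
      path_mor (elts Q d a) g" .
    fix p assume p: "p \<in> inputs a"
    have "ins ?M d a p (unit_arity (fst p)) (path_mor (elts Q d a) g)
        (path_mor (elts Q (fst p) (unit_arity (fst p))) (\<lambda>_. unt Q (fst p))) =
      path_mor (elts Q d (ins_arity a p (unit_arity (fst p)))) (\<lambda>t. ins Q d a p (unit_arity (fst p)) (g t) (unt Q (fst p)))"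
      by (rule ins) (use u g p in auto)
    also have "\<dots> = path_mor (elts Q d a) g"
      using q(2)[OF _ p] mem[OF g(2)] g by (auto simp: ins_arity_unit[OF p] intro!: path_mor_cong[symmetric])
    finally show "ins ?M d a p (unit_arity (fst p)) (path_mor (elts Q d a) g)
        (path_mor (elts Q (fst p) (unit_arity (fst p))) (\<lambda>_. unt Q (fst p))) = path_mor (elts Q d a) g" .
  qed
  moreover have "operad_sequential ?M"
    unfolding operad_sequential_def elts
  proof (intro allI ballI; elim Mor_fundamental_groupoidE; hypsubst)
    fix d a p b q c g h k
    assume p: "p \<in> inputs a" and q: "q \<in> inputs b" and g: "path g" "path_image g \<subseteq> elts Q d a"
      and h: "path h" "path_image h \<subseteq> elts Q (fst p) b" and k: "path k" "path_image k \<subseteq> elts Q (fst q) c"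
    have k': "path_image k \<subseteq> elts Q (fst (inner_label a p q)) c" using k by simp
    have e: "ins Q d (ins_arity a p b) (inner_label a p q) c (ins Q d a p b x y) z =
          ins Q d a p (ins_arity b q c) x (ins Q (fst p) b q c y z)"
      if "x \<in> elts Q d a" "y \<in> elts Q (fst p) b" "z \<in> elts Q (fst q) c" for x y z
      using Q(1) that p q unfolding relative_operad_def operad_sequential_def by blast
    have ar: "ins_arity (ins_arity a p b) (inner_label a p q) c = ins_arity a p (ins_arity b q c)"
      using p q by (cases p; cases q) (auto simp: ins_arity_def inputs_def fun_eq_iff)
    show "ins ?M d (ins_arity a p b) (inner_label a p q) c
        (ins ?M d a p b (path_mor (elts Q d a) g) (path_mor (elts Q (fst p) b) h)) (path_mor (elts Q (fst q) c) k) =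
      ins ?M d a p (ins_arity b q c) (path_mor (elts Q d a) g)
        (ins ?M (fst p) b q c (path_mor (elts Q (fst p) b) h) (path_mor (elts Q (fst q) c) k))"
      using p q g h k pins[OF p g h] pins[OF q h k] pins[OF inner_label_inputs[OF p q] pins[OF p g h] k(1) k']
      apply (simp add: ins inner_label_inputs ar)
      apply (rule path_mor_cong)
      using e mem[OF g(2)] mem[OF h(2)] mem[OF k(2)] by auto
  qed
  moreover have "operad_parallel ?M"
    unfolding operad_parallel_def elts
  proof (intro allI ballI impI; elim Mor_fundamental_groupoidE; hypsubst)
    fix d a p q b c \<rho> g h k
    let ?e = "ins_arity (ins_arity a p b) (outer_label p b q) c"
    assume p: "p \<in> inputs a" and q: "q \<in> inputs a" and pq: "p \<noteq> q" and g: "path g" "path_image g \<subseteq> elts Q d a"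
      and h: "path h" "path_image h \<subseteq> elts Q (fst p) b" and k: "path k" "path_image k \<subseteq> elts Q (fst q) c"
      and \<rho>: "\<rho> \<in> input_perms ?e"
      and *: "(\<forall>r\<in>inputs a - {p, q}.
             \<rho> (outer_label (outer_label q c p) b (outer_label q c r)) =
             outer_label (outer_label p b q) c (outer_label p b r)) \<and>
          (\<forall>r\<in>inputs b.
             \<rho> (inner_label (ins_arity a q c) (outer_label q c p) r) =
             outer_label (outer_label p b q) c (inner_label a p r)) \<and>
          (\<forall>r\<in>inputs c.
             \<rho> (outer_label (outer_label q c p) b (inner_label a q r)) =
             inner_label (ins_arity a p b) (outer_label p b q) r)"
    have h': "path_image h \<subseteq> elts Q (fst (outer_label q c p)) b"
      and k': "path_image k \<subseteq> elts Q (fst (outer_label p b q)) c" using h k by simp_all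
    have P: "operad_parallel Q" using Q unfolding relative_operad_def by blast
    have e: "ins Q d (ins_arity a p b) (outer_label p b q) c (ins Q d a p b x y) z =
          act Q d ?e \<rho> (ins Q d (ins_arity a q c) (outer_label q c p) b (ins Q d a q c x z) y)"
      if "x \<in> elts Q d a" "y \<in> elts Q (fst p) b" "z \<in> elts Q (fst q) c" for x y z
      by (rule P[unfolded operad_parallel_def, rule_format]) (use that p q pq \<rho> * in auto)
    have ar: "ins_arity (ins_arity a q c) (outer_label q c p) b = ?e"
      using p q pq by (cases p; cases q) (auto simp: ins_arity_def inputs_def fun_eq_iff)
    have pq': "outer_label p b q \<in> inputs (ins_arity a p b)" "outer_label q c p \<in> inputs (ins_arity a q c)"
      using p q pq outer_label_inputs by auto
    note 1 = pins[OF pq'(1) pins[OF p g h] k(1) k'] and 2 = pins[OF pq'(2) pins[OF q g k] h(1) h', unfolded ar]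
    show "ins ?M d (ins_arity a p b) (outer_label p b q) c
        (ins ?M d a p b (path_mor (elts Q d a) g) (path_mor (elts Q (fst p) b) h)) (path_mor (elts Q (fst q) c) k) =
      act ?M d ?e \<rho> (ins ?M d (ins_arity a q c) (outer_label q c p) b
        (ins ?M d a q c (path_mor (elts Q d a) g) (path_mor (elts Q (fst q) c) k)) (path_mor (elts Q (fst p) b) h))"
      using p q pq' g h k pins[OF p g h] pins[OF q g k] 1 2 \<rho>
      apply (simp add: ins act ar)
      apply (rule path_mor_cong)
      using e mem[OF g(2)] mem[OF h(2)] mem[OF k(2)] by auto
  qed
  moreover have "operad_equivariant ?M"
    unfolding operad_equivariant_def elts
  proof (intro allI ballI impI; elim Mor_fundamental_groupoidE; hypsubst)
    fix d a p b \<sigma> \<tau> \<rho> g h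
    assume p: "p \<in> inputs a" and g: "path g" "path_image g \<subseteq> elts Q d a"
      and h: "path h" "path_image h \<subseteq> elts Q (fst p) b"
      and \<sigma>: "\<sigma> \<in> input_perms a" and \<tau>: "\<tau> \<in> input_perms b" and \<rho>: "\<rho> \<in> input_perms (ins_arity a p b)"
      and *: "(\<forall>r\<in>inputs a - {p}. \<rho> (outer_label p b r) = outer_label (\<sigma> p) b (\<sigma> r)) \<and>
          (\<forall>r\<in>inputs b. \<rho> (inner_label a p r) = inner_label a (\<sigma> p) (\<tau> r))"
    have P: "operad_equivariant Q" using Q unfolding relative_operad_def by blast
    have e: "ins Q d a (\<sigma> p) b (act Q d a \<sigma> x) (act Q (fst p) b \<tau> y) =
          act Q d (ins_arity a p b) \<rho> (ins Q d a p b x y)"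
      if "x \<in> elts Q d a" "y \<in> elts Q (fst p) b" for x y
      by (rule P[unfolded operad_equivariant_def, rule_format]) (use that p \<sigma> \<tau> \<rho> * in auto)
    have ar: "ins_arity a (\<sigma> p) b = ins_arity a p b"
      by (simp add: ins_arity_def input_perms_fst[OF \<sigma>])
    have \<sigma>p: "\<sigma> p \<in> inputs a" "fst (\<sigma> p) = fst p" using input_perms_inputs[OF \<sigma> p] input_perms_fst[OF \<sigma>] by auto
    have h': "path_image (\<lambda>t. act Q (fst p) b \<tau> (h t)) \<subseteq> elts Q (fst (\<sigma> p)) b" using pact[OF \<tau> h] \<sigma>p by simp
    note 1 = pins[OF \<sigma>p(1) pact[OF \<sigma> g] pact(1)[OF \<tau> h] h', unfolded ar]
    show "ins ?M d a (\<sigma> p) b (act ?M d a \<sigma> (path_mor (elts Q d a) g)) (act ?M (fst p) b \<tau> (path_mor (elts Q (fst p) b) h)) =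
          act ?M d (ins_arity a p b) \<rho> (ins ?M d a p b (path_mor (elts Q d a) g) (path_mor (elts Q (fst p) b) h))"
      using p \<sigma> \<tau> \<rho> \<sigma>p g h pins[OF p g h] pact[OF \<sigma> g] pact[OF \<tau> h] 1
      apply (simp add: ins act ar)
      apply (rule path_mor_cong)
      using e mem[OF g(2)] mem[OF h(2)] by auto
  qed
  moreover have "elts ?M Closed a = {}" if "0 < a Open" for a
    using Q that unfolding relative_operad_def by (auto simp: elts Mor_fundamental_groupoid path_image_def)
  ultimately show ?thesis unfolding relative_operad_def by blast
qed

lemma relative_goperad_pi:
  assumes Q: "relative_operad Q" "continuous_operad Q"
  shows "relative_goperad (pi_operad Q)"
proof -
  have "is_functor (product_groupoid (fundamental_groupoid (elts Q d a)) (fundamental_groupoid (elts Q (fst p) b)))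
      (fundamental_groupoid (elts Q d (ins_arity a p b)))
      (\<lambda>(x, y). ins Q d a p b x y) (\<lambda>(f, g). mor_ins (pi_operad Q) d a p b f g)" if p: "p \<in> inputs a" for d a p b
  proof -
    note pins = path_ins[OF Q p] and mins = pi_mor_ins[OF Q p]
    \<comment> \<open>Concatenation commutes with insertion at each time, so the interchange law
      holds for representatives and needs no homotopy.\<close>
    have j: "(\<lambda>t. ins Q d a p b ((g +++ g') t) ((h +++ h') t)) =
        (\<lambda>t. ins Q d a p b (g t) (h t)) +++ (\<lambda>t. ins Q d a p b (g' t) (h' t))" for g g' h h'
      by (auto simp: joinpaths_def)
    have 1: "mor_ins (pi_operad Q) d a p b (Cmp (fundamental_groupoid (elts Q d a)) f f')
          (Cmp (fundamental_groupoid (elts Q (fst p) b)) k k') =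
        Cmp (fundamental_groupoid (elts Q d (ins_arity a p b))) (mor_ins (pi_operad Q) d a p b f k) (mor_ins (pi_operad Q) d a p b f' k')"
      if fk: "f \<in> Mor (fundamental_groupoid (elts Q d a))" "f' \<in> Mor (fundamental_groupoid (elts Q d a))"
        "k \<in> Mor (fundamental_groupoid (elts Q (fst p) b))" "k' \<in> Mor (fundamental_groupoid (elts Q (fst p) b))"
        "Trg (fundamental_groupoid (elts Q d a)) f = Src (fundamental_groupoid (elts Q d a)) f'"
        "Trg (fundamental_groupoid (elts Q (fst p) b)) k = Src (fundamental_groupoid (elts Q (fst p) b)) k'" for f f' k k'
    proof -
      obtain g where g: "path g" "path_image g \<subseteq> elts Q d a" "f = path_mor (elts Q d a) g"
        using fk(1) by (rule Mor_fundamental_groupoidE)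
      obtain g' where g': "path g'" "path_image g' \<subseteq> elts Q d a" "f' = path_mor (elts Q d a) g'"
        using fk(2) by (rule Mor_fundamental_groupoidE)
      obtain h where h: "path h" "path_image h \<subseteq> elts Q (fst p) b" "k = path_mor (elts Q (fst p) b) h"
        using fk(3) by (rule Mor_fundamental_groupoidE)
      obtain h' where h': "path h'" "path_image h' \<subseteq> elts Q (fst p) b" "k' = path_mor (elts Q (fst p) b) h'"
        using fk(4) by (rule Mor_fundamental_groupoidE)
      have c: "pathfinish g = pathstart g'" "pathfinish h = pathstart h'" using fk g g' h h' by simp_all
      then have c': "pathfinish (\<lambda>t. ins Q d a p b (g t) (h t)) = pathstart (\<lambda>t. ins Q d a p b (g' t) (h' t))"
        by (simp add: pathfinish_def pathstart_def)
      have jj: "path (g +++ g')" "path_image (g +++ g') \<subseteq> elts Q d a" "path (h +++ h')" "path_image (h +++ h') \<subseteq> elts Q (fst p) b"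
        using g g' h h' c by (simp_all add: path_image_join)
      show ?thesis
        using g g' h h' c c' jj pins[OF g(1,2) h(1,2)] pins[OF g'(1,2) h'(1,2)] j
        by (simp add: Cmp_fundamental_groupoid mins)
    qed
    show ?thesis unfolding is_functor_def
    proof (intro conjI ballI impI)
      fix xy assume "xy \<in> Ob (product_groupoid (fundamental_groupoid (elts Q d a)) (fundamental_groupoid (elts Q (fst p) b)))"
      then obtain x y where xy: "xy = (x, y)" "x \<in> elts Q d a" "y \<in> elts Q (fst p) b"
        by (auto simp: product_groupoid_def)
      show "(case xy of (x, y) \<Rightarrow> ins Q d a p b x y) \<in> Ob (fundamental_groupoid (elts Q d (ins_arity a p b)))"
        using xy p operad_ins[OF Q(1)] by simp
      show "(case Idm (product_groupoid (fundamental_groupoid (elts Q d a)) (fundamental_groupoid (elts Q (fst p) b))) xy of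
          (f, g) \<Rightarrow> mor_ins (pi_operad Q) d a p b f g) =
        Idm (fundamental_groupoid (elts Q d (ins_arity a p b))) (case xy of (x, y) \<Rightarrow> ins Q d a p b x y)"
        using xy by (simp add: product_groupoid_def mins path_const)
    next
      fix fk assume "fk \<in> Mor (product_groupoid (fundamental_groupoid (elts Q d a)) (fundamental_groupoid (elts Q (fst p) b)))"
      then obtain g h where gh: "fk = (path_mor (elts Q d a) g, path_mor (elts Q (fst p) b) h)"
        "path g" "path_image g \<subseteq> elts Q d a" "path h" "path_image h \<subseteq> elts Q (fst p) b"
        by (auto simp: product_groupoid_def Mor_fundamental_groupoid)
      show "(case fk of (f, g) \<Rightarrow> mor_ins (pi_operad Q) d a p b f g) \<in> Mor (fundamental_groupoid (elts Q d (ins_arity a p b)))"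
        using gh pins[OF gh(2-5)] by (simp add: mins path_mor_in_Mor)
      show "Src (fundamental_groupoid (elts Q d (ins_arity a p b))) (case fk of (f, g) \<Rightarrow> mor_ins (pi_operad Q) d a p b f g) =
        (case Src (product_groupoid (fundamental_groupoid (elts Q d a)) (fundamental_groupoid (elts Q (fst p) b))) fk of
          (x, y) \<Rightarrow> ins Q d a p b x y)"
        "Trg (fundamental_groupoid (elts Q d (ins_arity a p b))) (case fk of (f, g) \<Rightarrow> mor_ins (pi_operad Q) d a p b f g) =
        (case Trg (product_groupoid (fundamental_groupoid (elts Q d a)) (fundamental_groupoid (elts Q (fst p) b))) fk of
          (x, y) \<Rightarrow> ins Q d a p b x y)"
        using gh by (simp_all add: mins product_groupoid_def) (simp_all add: pathstart_def pathfinish_def)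
    qed (auto simp: product_groupoid_def 1)
  qed
  moreover have "is_functor (fundamental_groupoid (elts Q d a)) (fundamental_groupoid (elts Q d a))
      (act Q d a \<sigma>) (mor_act (pi_operad Q) d a \<sigma>)" if s: "\<sigma> \<in> input_perms a" for d a \<sigma>
  proof -
    note pact = path_act[OF Q s] and mact = pi_mor_act[OF Q s]
    have j: "(\<lambda>t. act Q d a \<sigma> ((g +++ g') t)) = (\<lambda>t. act Q d a \<sigma> (g t)) +++ (\<lambda>t. act Q d a \<sigma> (g' t))" for g g'
      by (auto simp: joinpaths_def)
    show ?thesis unfolding is_functor_def
    proof (intro conjI ballI impI)
      fix f f' assume fk: "f \<in> Mor (fundamental_groupoid (elts Q d a))" "f' \<in> Mor (fundamental_groupoid (elts Q d a))"
        "Trg (fundamental_groupoid (elts Q d a)) f = Src (fundamental_groupoid (elts Q d a)) f'"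
      obtain g where g: "path g" "path_image g \<subseteq> elts Q d a" "f = path_mor (elts Q d a) g"
        using fk(1) by (rule Mor_fundamental_groupoidE)
      obtain g' where g': "path g'" "path_image g' \<subseteq> elts Q d a" "f' = path_mor (elts Q d a) g'"
        using fk(2) by (rule Mor_fundamental_groupoidE)
      have c: "pathfinish g = pathstart g'" using fk g g' by simp
      then have c': "pathfinish (\<lambda>t. act Q d a \<sigma> (g t)) = pathstart (\<lambda>t. act Q d a \<sigma> (g' t))"
        by (simp add: pathfinish_def pathstart_def)
      have jj: "path (g +++ g')" "path_image (g +++ g') \<subseteq> elts Q d a"
        using g g' c by (simp_all add: path_image_join)
      show "mor_act (pi_operad Q) d a \<sigma> (Cmp (fundamental_groupoid (elts Q d a)) f f') =
        Cmp (fundamental_groupoid (elts Q d a)) (mor_act (pi_operad Q) d a \<sigma> f) (mor_act (pi_operad Q) d a \<sigma> f')"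
        using g g' c c' jj pact[OF g(1,2)] pact[OF g'(1,2)] j by (simp add: Cmp_fundamental_groupoid mact)
    next
      fix f assume "f \<in> Mor (fundamental_groupoid (elts Q d a))"
      then obtain g where g: "path g" "path_image g \<subseteq> elts Q d a" "f = path_mor (elts Q d a) g"
        by (rule Mor_fundamental_groupoidE)
      show "mor_act (pi_operad Q) d a \<sigma> f \<in> Mor (fundamental_groupoid (elts Q d a))"
        using g pact[OF g(1,2)] by (simp add: mact path_mor_in_Mor)
      show "Src (fundamental_groupoid (elts Q d a)) (mor_act (pi_operad Q) d a \<sigma> f) = act Q d a \<sigma> (Src (fundamental_groupoid (elts Q d a)) f)"
        "Trg (fundamental_groupoid (elts Q d a)) (mor_act (pi_operad Q) d a \<sigma> f) = act Q d a \<sigma> (Trg (fundamental_groupoid (elts Q d a)) f)"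
        using g by (simp_all add: mact) (simp_all add: pathstart_def pathfinish_def)
    qed (use s operad_act[OF Q(1)] in \<open>auto simp: mact path_const\<close>)
  qed
  ultimately show ?thesis
    using Q relative_operad_mor_pi[OF Q]
    unfolding relative_goperad_def by (simp add: ob_operad_pi is_groupoid_fundamental_groupoid)
qed

section \<open>The Swiss-Cheese operad\<close>

lemma inputs_ins_arity:
  assumes p: "p \<in> inputs a"
  shows "inputs (ins_arity a p b) = outer_label p b ` (inputs a - {p}) \<union> inner_label a p ` inputs b"
proof
  show "inputs (ins_arity a p b) \<subseteq> outer_label p b ` (inputs a - {p}) \<union> inner_label a p ` inputs b"
  proof
    fix q assume q: "q \<in> inputs (ins_arity a p b)"
    obtain k i l j where [simp]: "p = (k, i)" "q = (l, j)" by (cases p, cases q)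
    \<comment> \<open>In the color of \<open>p\<close>: before the slot, inside the inserted block,
      behind it. In the other color: the outer inputs, then the inner ones.\<close>
    consider "l = k" "j < i" | "l = k" "i \<le> j" "j < i + b k" | "l = k" "i + b k \<le> j" | "l \<noteq> k" "j \<le> a l"
      | "l \<noteq> k" "a l < j" by linarith
    then show "q \<in> outer_label p b ` (inputs a - {p}) \<union> inner_label a p ` inputs b"
    proof cases
      case 1 then show ?thesis using q p by (intro UnI1 image_eqI[of _ _ q]) (auto simp: inputs_def outer_label_def)
    next
      case 2 then show ?thesis using q p
        by (intro UnI2 image_eqI[of _ _ "(l, j - i + 1)"]) (auto simp: inputs_def inner_label_def)
    next
      case 3 then show ?thesis using q p
        by (intro UnI1 image_eqI[of _ _ "(l, j - b k + 1)"]) (auto simp: inputs_def outer_label_def ins_arity_def)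
    next
      case 4 then show ?thesis using q p by (intro UnI1 image_eqI[of _ _ q]) (auto simp: inputs_def outer_label_def)
    next
      case 5 then show ?thesis using q p
        by (intro UnI2 image_eqI[of _ _ "(l, j - a l)"]) (auto simp: inputs_def inner_label_def ins_arity_def)
    qed
  qed
next
  show "outer_label p b ` (inputs a - {p}) \<union> inner_label a p ` inputs b \<subseteq> inputs (ins_arity a p b)"
    using p outer_label_inputs inner_label_inputs by blast
qed

lemma input_ins_arityE:
  assumes "q \<in> inputs (ins_arity a p b)" "p \<in> inputs a"
  obtains (outer) r where "r \<in> inputs a" "r \<noteq> p" "q = outer_label p b r"
    | (inner) r where "r \<in> inputs b" "q = inner_label a p r"
  using assms by (auto simp: inputs_ins_arity)

lemma outer_neq_inner:
  "\<lbrakk>p \<in> inputs a; r \<in> inputs a; r \<noteq> p; s \<in> inputs b\<rbrakk> \<Longrightarrow> outer_label p b r \<noteq> inner_label a p s"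
  by (cases p; cases r; cases s) (auto simp: inputs_def outer_label_def inner_label_def)

lemma inner_label_eq_iff:
  "\<lbrakk>r \<in> inputs b; s \<in> inputs b\<rbrakk> \<Longrightarrow> inner_label a p r = inner_label a p s \<longleftrightarrow> r = s"
  by (cases p; cases r; cases s) (auto simp: inputs_def inner_label_def split: if_splits)

lemma outer_label_eq_iff:
  "\<lbrakk>p \<in> inputs a; r \<in> inputs a; s \<in> inputs a; r \<noteq> p; s \<noteq> p\<rbrakk> \<Longrightarrow> outer_label p b r = outer_label p b s \<longleftrightarrow> r = s"
  by (cases p; cases r; cases s) (auto simp: inputs_def outer_label_def split: if_splits)

lemma graft_inner [simp]: "r \<in> inputs b \<Longrightarrow> graft a p b f g (inner_label a p r) = g r"
  using inv_into_f_f[of "inner_label a p" "inputs b" r] inner_label_eq_iff[of _ b _ a p]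
  by (auto simp: graft_def inj_on_def)

lemma graft_outer [simp]:
  "\<lbrakk>p \<in> inputs a; r \<in> inputs a; r \<noteq> p\<rbrakk> \<Longrightarrow> graft a p b f g (outer_label p b r) = f r"
proof -
  assume *: "p \<in> inputs a" "r \<in> inputs a" "r \<noteq> p"
  then have "outer_label p b r \<notin> inner_label a p ` inputs b" using outer_neq_inner by blast
  moreover have "inj_on (outer_label p b) (inputs a - {p})"
    using outer_label_eq_iff[OF *(1)] unfolding inj_on_def by blast
  ultimately show ?thesis using * by (simp add: graft_def inv_into_f_f)
qed

lemma graft_outside: "\<lbrakk>p \<in> inputs a; q \<notin> inputs (ins_arity a p b)\<rbrakk> \<Longrightarrow> graft a p b f g q = 0"
  by (auto simp: graft_def inputs_ins_arity)

text \<open>Families on the inputs of a composite are compared block by block on the labels, which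
  keeps the inverse functions in the definition of \<open>graft\<close> out of the identities
  below.\<close>

lemma graft_eqI:
  assumes "p \<in> inputs a" and "\<And>r. \<lbrakk>r \<in> inputs a; r \<noteq> p\<rbrakk> \<Longrightarrow> h (outer_label p b r) = f r"
    and "\<And>r. r \<in> inputs b \<Longrightarrow> h (inner_label a p r) = g r"
    and "\<And>q. q \<notin> inputs (ins_arity a p b) \<Longrightarrow> h q = 0"
  shows "h = graft a p b f g"
proof
  fix q show "h q = graft a p b f g q"
  proof (cases "q \<in> inputs (ins_arity a p b)")
    case True then show ?thesis using assms(1) by (rule input_ins_arityE) (use assms in auto)
  qed (use assms graft_outside in metis)
qed

text \<open>The color hypotheses say that an operation inserted at a closed input has no open
  inputs. The only mixed case left is \<open>p\<close> open and \<open>q\<close> closed; if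
  \<open>c\<close> had open inputs there, the two numberings of the open inputs behind
  \<open>p\<close> would differ by \<open>c Open\<close>.\<close>

lemma outer_label_comp:
  "\<lbrakk>p \<in> inputs a; q \<in> inputs b; r \<in> inputs a; r \<noteq> p; fst q = Closed \<longrightarrow> c Open = 0; fst p = Closed \<longrightarrow> b Open = 0\<rbrakk> \<Longrightarrow>
    outer_label p (ins_arity b q c) r = outer_label (inner_label a p q) c (outer_label p b r)"
  by (cases p; cases q; cases r; cases "fst p"; cases "fst q")
    (auto simp: inputs_def outer_label_def inner_label_def ins_arity_def)

lemma inner_outer_label:
  "\<lbrakk>p \<in> inputs a; q \<in> inputs b; r \<in> inputs b; r \<noteq> q; fst q = Closed \<longrightarrow> c Open = 0; fst p = Closed \<longrightarrow> b Open = 0\<rbrakk> \<Longrightarrow>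
    inner_label a p (outer_label q c r) = outer_label (inner_label a p q) c (inner_label a p r)"
  by (cases p; cases q; cases r; cases "fst p"; cases "fst q")
    (auto simp: inputs_def outer_label_def inner_label_def ins_arity_def)

lemma inner_inner_label:
  "\<lbrakk>p \<in> inputs a; q \<in> inputs b; r \<in> inputs c; fst q = Closed \<longrightarrow> c Open = 0; fst p = Closed \<longrightarrow> b Open = 0\<rbrakk> \<Longrightarrow>
    inner_label a p (inner_label b q r) = inner_label (ins_arity a p b) (inner_label a p q) r"
  by (cases p; cases q; cases r; cases "fst p"; cases "fst q"; cases "fst r")
    (auto simp: inputs_def inner_label_def ins_arity_def)

lemma graft_sequential:
  assumes p: "p \<in> inputs a" and q: "q \<in> inputs b"
    and c: "fst q = Closed \<longrightarrow> c Open = 0" "fst p = Closed \<longrightarrow> b Open = 0"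
  shows "graft (ins_arity a p b) (inner_label a p q) c (graft a p b f g) h =
    graft a p (ins_arity b q c) f (graft b q c g h)"
proof (rule graft_eqI[OF p])
  have iq: "inner_label a p q \<in> inputs (ins_arity a p b)" using p q by (rule inner_label_inputs)
  have ar: "ins_arity (ins_arity a p b) (inner_label a p q) c = ins_arity a p (ins_arity b q c)"
    using p q by (cases p; cases q) (auto simp: ins_arity_def inputs_def fun_eq_iff)
  fix r
  show "graft (ins_arity a p b) (inner_label a p q) c (graft a p b f g) h (outer_label p (ins_arity b q c) r) = f r"
    if r: "r \<in> inputs a" "r \<noteq> p"
    unfolding outer_label_comp[of p a q b r c, OF p q r c] using p q r outer_label_inputs[OF p r] outer_neq_inner[OF p r q] iq by simp
  show "graft (ins_arity a p b) (inner_label a p q) c (graft a p b f g) h r = 0"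
    if "r \<notin> inputs (ins_arity a p (ins_arity b q c))"
    using that by (simp add: graft_outside[OF iq] ar)
  assume "r \<in> inputs (ins_arity b q c)"
  then show "graft (ins_arity a p b) (inner_label a p q) c (graft a p b f g) h (inner_label a p r) = graft b q c g h r"
    using q
  proof (cases rule: input_ins_arityE)
    case (outer s)
    show ?thesis unfolding outer(3) inner_outer_label[of p a q b s c, OF p q outer(1,2) c]
      using p q outer inner_label_inputs[OF p outer(1)] inner_label_eq_iff[OF outer(1) q] iq by simp
  next
    case (inner s)
    show ?thesis unfolding inner(2) inner_inner_label[of p a q b s c, OF p q inner(1) c] using inner by simp
  qed
qed

lemma graft_cong:
  assumes "\<And>r. \<lbrakk>r \<in> inputs a; r \<noteq> p\<rbrakk> \<Longrightarrow> f r = f' r" "\<And>r. r \<in> inputs b \<Longrightarrow> g r = g' r" "p \<in> inputs a"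
  shows "graft a p b f g = graft a p b f' g'"
  by (rule graft_eqI) (simp_all add: assms graft_outside)

lemma graft_map:
  assumes "q \<in> inputs (ins_arity a p b)" "p \<in> inputs a"
  shows "m (graft a p b f g q) = graft a p b (\<lambda>r. m (f r)) (\<lambda>r. m (g r)) q"
  using assms by (rule input_ins_arityE) (use assms in auto)

lemma permutes_comp_inv_eqI:
  assumes "\<rho> permutes S" "\<And>s. s \<in> S \<Longrightarrow> h (\<rho> s) = k s" "\<And>q. q \<notin> S \<Longrightarrow> h q = k q"
  shows "h = k \<circ> inv \<rho>"
proof
  fix q show "h q = (k \<circ> inv \<rho>) q"
    using assms(2)[of "inv \<rho> q"] assms(3)[of q] permutes_inverses[OF assms(1)]
      permutes_in_image[OF permutes_inv[OF assms(1)], of q] permutes_not_in[OF permutes_inv[OF assms(1)], of q]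
    by (cases "q \<in> S") auto
qed

text \<open>Both sides consist of the same three blocks: \<open>f\<close> without two entries,
  \<open>g\<close> and \<open>h\<close>. Hypotheses 1 to 3 match the names block by block, so the
  permutation \<open>\<rho>\<close> is never computed.\<close>

lemma graft_parallel:
  assumes p: "p \<in> inputs a" and q: "q \<in> inputs a" and pq: "p \<noteq> q"
    and \<rho>: "\<rho> \<in> input_perms (ins_arity (ins_arity a p b) (outer_label p b q) c)"
    and 1: "\<And>r. \<lbrakk>r \<in> inputs a; r \<noteq> p; r \<noteq> q\<rbrakk> \<Longrightarrow>
      \<rho> (outer_label (outer_label q c p) b (outer_label q c r)) = outer_label (outer_label p b q) c (outer_label p b r)"
    and 2: "\<And>r. r \<in> inputs b \<Longrightarrow>
      \<rho> (inner_label (ins_arity a q c) (outer_label q c p) r) = outer_label (outer_label p b q) c (inner_label a p r)"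
    and 3: "\<And>r. r \<in> inputs c \<Longrightarrow>
      \<rho> (outer_label (outer_label q c p) b (inner_label a q r)) = inner_label (ins_arity a p b) (outer_label p b q) r"
  shows "graft (ins_arity a p b) (outer_label p b q) c (graft a p b f g) h =
    graft (ins_arity a q c) (outer_label q c p) b (graft a q c f h) g \<circ> inv \<rho>"
proof (rule permutes_comp_inv_eqI[OF input_perms_permutes[OF \<rho>]])
  have ar: "ins_arity (ins_arity a q c) (outer_label q c p) b = ins_arity (ins_arity a p b) (outer_label p b q) c"
    using p q pq by (cases p; cases q) (auto simp: ins_arity_def inputs_def fun_eq_iff)
  have pq': "outer_label p b q \<in> inputs (ins_arity a p b)" "outer_label q c p \<in> inputs (ins_arity a q c)"
    using p q pq outer_label_inputs by auto
  fix s
  show "graft (ins_arity a p b) (outer_label p b q) c (graft a p b f g) h s =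
      graft (ins_arity a q c) (outer_label q c p) b (graft a q c f h) g s"
    if "s \<notin> inputs (ins_arity (ins_arity a p b) (outer_label p b q) c)"
    using that by (simp add: graft_outside[OF pq'(1)] graft_outside[OF pq'(2)] ar)
  assume "s \<in> inputs (ins_arity (ins_arity a p b) (outer_label p b q) c)"
  then have "s \<in> inputs (ins_arity (ins_arity a q c) (outer_label q c p) b)" by (simp add: ar)
  then show "graft (ins_arity a p b) (outer_label p b q) c (graft a p b f g) h (\<rho> s) =
      graft (ins_arity a q c) (outer_label q c p) b (graft a q c f h) g s"
    using pq'(2)
  proof (cases rule: input_ins_arityE)
    case (inner r)
    show ?thesis unfolding inner(2) 2[OF inner(1)]
      using inner pq' p q pq inner_label_inputs[OF p inner(1)] outer_neq_inner[OF p q _ inner(1)] by (simp add: not_sym)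
  next
    case s: (outer r)
    from s(1) q show ?thesis
    proof (cases rule: input_ins_arityE)
      case (outer t)
      then have "t \<noteq> p" using s by auto
      then show ?thesis unfolding s(3) outer(3) 1[OF outer(1) \<open>t \<noteq> p\<close> outer(2)]
        using s outer pq' p q pq outer_label_inputs[OF p outer(1) \<open>t \<noteq> p\<close>] outer_label_eq_iff[OF p outer(1) q, of b]
        by simp
    next
      case (inner t)
      then show ?thesis unfolding s(3) inner(2) 3[OF inner(1)] using s inner pq' by simp
    qed
  qed
qed

lemma graft_equivariant:
  assumes p: "p \<in> inputs a" and \<sigma>: "\<sigma> \<in> input_perms a" and \<tau>: "\<tau> \<in> input_perms b"
    and \<rho>: "\<rho> \<in> input_perms (ins_arity a p b)"
    and 1: "\<And>r. \<lbrakk>r \<in> inputs a; r \<noteq> p\<rbrakk> \<Longrightarrow> \<rho> (outer_label p b r) = outer_label (\<sigma> p) b (\<sigma> r)"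
    and 2: "\<And>r. r \<in> inputs b \<Longrightarrow> \<rho> (inner_label a p r) = inner_label a (\<sigma> p) (\<tau> r)"
  shows "graft a (\<sigma> p) b (f \<circ> inv \<sigma>) (g \<circ> inv \<tau>) = graft a p b f g \<circ> inv \<rho>"
proof (rule permutes_comp_inv_eqI[OF input_perms_permutes[OF \<rho>]])
  have ar: "ins_arity a (\<sigma> p) b = ins_arity a p b"
    by (simp add: ins_arity_def input_perms_fst[OF \<sigma>])
  have \<sigma>p: "\<sigma> p \<in> inputs a" by (rule input_perms_inputs[OF \<sigma> p])
  note inv = permutes_inverses[OF input_perms_permutes[OF \<sigma>]] permutes_inverses[OF input_perms_permutes[OF \<tau>]]
  fix s
  show "graft a (\<sigma> p) b (f \<circ> inv \<sigma>) (g \<circ> inv \<tau>) s = graft a p b f g s" if "s \<notin> inputs (ins_arity a p b)"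
    using that by (simp add: graft_outside[OF \<sigma>p] graft_outside[OF p] ar)
  assume "s \<in> inputs (ins_arity a p b)"
  then show "graft a (\<sigma> p) b (f \<circ> inv \<sigma>) (g \<circ> inv \<tau>) (\<rho> s) = graft a p b f g s"
    using p
  proof (cases rule: input_ins_arityE)
    case (outer r)
    have "\<sigma> r \<noteq> \<sigma> p" using outer(2) inv by metis
    then show ?thesis unfolding outer(3) 1[OF outer(1,2)]
      using outer p \<sigma>p input_perms_inputs[OF \<sigma> outer(1)] inv by simp
  next
    case (inner r)
    then show ?thesis unfolding inner(2) 2[OF inner(1)]
      using inner input_perms_inputs[OF \<tau> inner(1)] inv by simp
  qed
qed


section \<open>Embedded disks and half disks described by inequalities\<close>

lemma emb_image_cball: "0 < fst e \<Longrightarrow> emb_map e ` cball 0 1 = cball (snd e) (fst e)"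
proof (intro equalityI subsetI)
  fix z assume "0 < fst e" "z \<in> emb_map e ` cball 0 1"
  then show "z \<in> cball (snd e) (fst e)" by (auto simp: emb_map_def dist_norm norm_mult)
next
  fix z assume e: "0 < fst e" and z: "z \<in> cball (snd e) (fst e)"
  then have "(z - snd e) / of_real (fst e) \<in> cball 0 1"
    by (simp add: norm_divide divide_le_eq dist_norm norm_minus_commute)
  moreover have "z = emb_map e ((z - snd e) / of_real (fst e))" using e by (simp add: emb_map_def)
  ultimately show "z \<in> emb_map e ` cball 0 1" by blast
qed

lemma emb_image_half:
  assumes e: "0 < fst e" "Im (snd e) = 0"
  shows "emb_map e ` {z \<in> cball 0 1. 0 \<le> Im z} = {z \<in> cball (snd e) (fst e). 0 \<le> Im z}"
proof -
  have "Im (emb_map e z) = fst e * Im z" for z using e by (simp add: emb_map_def)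
  then have "0 \<le> Im (emb_map e z) \<longleftrightarrow> 0 \<le> Im z" for z using e by (simp add: zero_le_mult_iff)
  then have "emb_map e ` {z \<in> cball 0 1. 0 \<le> Im z} = {z \<in> emb_map e ` cball 0 1. 0 \<le> Im z}" by blast
  then show ?thesis using emb_image_cball[OF e(1)] by simp
qed

lemma emb_image_shape:
  "0 < fst e \<Longrightarrow> (k = Open \<Longrightarrow> Im (snd e) = 0) \<Longrightarrow>
    emb_map e ` shape k = {z \<in> cball (snd e) (fst e). k = Open \<longrightarrow> 0 \<le> Im z}"
  using emb_image_cball[of e] emb_image_half[of e] by (cases k) (auto simp: shape_def)

text \<open>Necessity is tested on extreme points: the lowest point of a disk in the half disk, and
  the two ends of the diameter of a half disk. Sufficiency follows from the triangle inequality and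
  from bounding the imaginary part by the norm.\<close>

lemma emb_image_shape_subset:
  assumes e: "0 < fst e" "k = Open \<Longrightarrow> Im (snd e) = 0" and dk: "d = Closed \<Longrightarrow> k = Closed"
  shows "emb_map e ` shape k \<subseteq> shape d \<longleftrightarrow>
    norm (snd e) + fst e \<le> 1 \<and> (d = Open \<and> k = Closed \<longrightarrow> fst e \<le> Im (snd e))"
proof -
  let ?b = "snd e" and ?l = "fst e"
  have I: "\<bar>Im z - Im ?b\<bar> \<le> ?l" if "z \<in> cball ?b ?l" for z
    using that abs_Im_le_cmod[of "z - ?b"] by (simp add: dist_norm norm_minus_commute)
  have N: "norm z \<le> 1" if "z \<in> cball ?b ?l" "norm ?b + ?l \<le> 1" for z
    using that norm_triangle_sub[of z ?b] by (simp add: dist_norm norm_minus_commute)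
  show ?thesis
  proof (cases d)
    case Closed
    then show ?thesis using e dk emb_image_cball[of e] by (simp add: shape_def cball_subset_cball_iff)
  next
    case d: Open
    show ?thesis
    proof (cases k)
      case Closed
      have "cball ?b ?l \<subseteq> {z \<in> cball 0 1. 0 \<le> Im z} \<longleftrightarrow> norm ?b + ?l \<le> 1 \<and> ?l \<le> Im ?b"
      proof
        assume *: "cball ?b ?l \<subseteq> {z \<in> cball 0 1. 0 \<le> Im z}"
        then have "cball ?b ?l \<subseteq> cball 0 1" by blast
        then have "norm ?b + ?l \<le> 1" using e by (simp add: cball_subset_cball_iff)
        moreover have "?b - \<i> * of_real ?l \<in> cball ?b ?l" using e by (simp add: dist_norm norm_mult)
        then have "0 \<le> Im (?b - \<i> * of_real ?l)" using * by blast
        ultimately show "norm ?b + ?l \<le> 1 \<and> ?l \<le> Im ?b" by simp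
      next
        assume *: "norm ?b + ?l \<le> 1 \<and> ?l \<le> Im ?b"
        show "cball ?b ?l \<subseteq> {z \<in> cball 0 1. 0 \<le> Im z}"
        proof
          fix z assume z: "z \<in> cball ?b ?l"
          have "0 \<le> Im z" using I[OF z] * by linarith
          then show "z \<in> {z \<in> cball 0 1. 0 \<le> Im z}" using N[OF z] * by simp
        qed
      qed
      then show ?thesis using e d Closed emb_image_cball[of e] by (simp add: shape_def)
    next
      case k: Open
      have "{z \<in> cball ?b ?l. 0 \<le> Im z} \<subseteq> {z \<in> cball 0 1. 0 \<le> Im z} \<longleftrightarrow> norm ?b + ?l \<le> 1"
      proof
        assume *: "{z \<in> cball ?b ?l. 0 \<le> Im z} \<subseteq> {z \<in> cball 0 1. 0 \<le> Im z}"
        have b: "?b = of_real (Re ?b)" using e k by (simp add: complex_eq_iff)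
        have "?b + of_real ?l \<in> {z \<in> cball ?b ?l. 0 \<le> Im z}" "?b - of_real ?l \<in> {z \<in> cball ?b ?l. 0 \<le> Im z}"
          using e k by (simp_all add: dist_norm)
        then have "?b + of_real ?l \<in> cball 0 1" "?b - of_real ?l \<in> cball 0 1" using * by blast+
        moreover have "of_real (Re ?b + ?l) = ?b + of_real ?l" "of_real (Re ?b - ?l) = ?b - of_real ?l"
          using b by simp_all
        ultimately have "norm (of_real (Re ?b + ?l) :: complex) \<le> 1" "norm (of_real (Re ?b - ?l) :: complex) \<le> 1"
          by (simp_all only: mem_cball_0)
        then have "\<bar>Re ?b\<bar> + ?l \<le> 1" unfolding norm_of_real by linarith
        then show "norm ?b + ?l \<le> 1" using b norm_of_real[of "Re ?b", where 'a = complex] by simp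
      qed (use N in auto)
      then show ?thesis using e d k emb_image_shape[of e k] by (simp add: shape_def)
    qed
  qed
qed

text \<open>The interiors lie in open balls, which are disjoint if the radii add up to at most the
  distance of the centers. Otherwise the two balls share a point of the segment between the centers.
  For half disks this point may lie on the real axis, where it is not interior, so it is pushed
  upwards by a small amount.\<close>

lemma disjoint_interiors_iff:
  assumes e: "0 < fst e" "k = Open \<Longrightarrow> Im (snd e) = 0" and e': "0 < fst e'" "k' = Open \<Longrightarrow> Im (snd e') = 0"
    and h: "(k = Closed \<and> k' = Closed) \<or> (0 \<le> Im (snd e) \<and> 0 \<le> Im (snd e'))"
  shows "interior (emb_map e ` shape k) \<inter> interior (emb_map e' ` shape k') = {} \<longleftrightarrow>
    fst e + fst e' \<le> dist (snd e) (snd e')"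
proof
  assume *: "fst e + fst e' \<le> dist (snd e) (snd e')"
  have "interior (emb_map e ` shape k) \<subseteq> ball (snd e) (fst e)" if "0 < fst e" "k = Open \<Longrightarrow> Im (snd e) = 0" for e k
  proof -
    have "emb_map e ` shape k \<subseteq> cball (snd e) (fst e)" using emb_image_shape[OF that] by blast
    from interior_mono[OF this] show ?thesis by simp
  qed
  from this[OF e] this[OF e'] show "interior (emb_map e ` shape k) \<inter> interior (emb_map e' ` shape k') = {}"
    using disjoint_ballI[OF *] by blast
next
  assume *: "interior (emb_map e ` shape k) \<inter> interior (emb_map e' ` shape k') = {}"
  show "fst e + fst e' \<le> dist (snd e) (snd e')"
  proof (rule ccontr)
    assume D: "\<not> ?thesis"
    \<comment> \<open>The point \<open>z\<close> below divides the segment between the centers in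
      the ratio of the radii.\<close>
    define u where "u = fst e / (fst e + fst e')"
    have u: "0 < u" "u < 1" "u * (fst e + fst e') = fst e" "(1 - u) * (fst e + fst e') = fst e'"
      using e e' by (simp_all add: u_def field_simps)
    define z where "z = snd e + of_real u * (snd e' - snd e)"
    have "dist (snd e) z = u * dist (snd e) (snd e')"
      using u by (simp add: z_def dist_norm norm_mult norm_minus_commute)
    also have "\<dots> < u * (fst e + fst e')" using D u by (intro mult_strict_left_mono) auto
    finally have z1: "z \<in> ball (snd e) (fst e)" using u by simp
    have "snd e' - z = of_real (1 - u) * (snd e' - snd e)" by (simp add: z_def algebra_simps)
    then have "dist (snd e') z = (1 - u) * dist (snd e) (snd e')"
      using u by (simp add: dist_norm norm_mult norm_minus_commute del: of_real_diff)
    also have "\<dots> < (1 - u) * (fst e + fst e')" using D u by (intro mult_strict_left_mono) auto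
    finally have z2: "z \<in> ball (snd e') (fst e')" using u by simp
    have "open (ball (snd e) (fst e) \<inter> ball (snd e') (fst e'))" by (intro open_Int open_ball)
    then obtain \<epsilon> where \<epsilon>: "0 < \<epsilon>" "cball z \<epsilon> \<subseteq> ball (snd e) (fst e) \<inter> ball (snd e') (fst e')"
      using z1 z2 open_contains_cball by blast
    define w where "w = z + \<i> * of_real \<epsilon>"
    have w: "w \<in> ball (snd e) (fst e)" "w \<in> ball (snd e') (fst e')"
    proof -
      have "w \<in> cball z \<epsilon>" using \<epsilon>(1) by (simp add: w_def dist_norm norm_mult)
      then show "w \<in> ball (snd e) (fst e)" "w \<in> ball (snd e') (fst e')" using \<epsilon>(2) by blast+
    qed
    have "Im z = (1 - u) * Im (snd e) + u * Im (snd e')"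
      unfolding z_def by (simp add: algebra_simps)
    then have iw: "(k = Closed \<and> k' = Closed) \<or> 0 < Im w" using h u \<epsilon>(1) by (auto simp: w_def intro!: add_nonneg_pos)
    have "w \<in> interior (emb_map f ` shape l)" if f: "0 < fst f" "l = Open \<Longrightarrow> Im (snd f) = 0"
      "w \<in> ball (snd f) (fst f)" "l = Closed \<or> 0 < Im w" for f l
    proof -
      have "open {z \<in> ball (snd f) (fst f). l = Open \<longrightarrow> 0 < Im z}"
      proof (cases l)
        case Open
        have "open {z. 0 < Im z}" by (rule open_halfspace_Im_gt)
        moreover have "{z \<in> ball (snd f) (fst f). l = Open \<longrightarrow> 0 < Im z} = ball (snd f) (fst f) \<inter> {z. 0 < Im z}"
          using Open by auto
        ultimately show ?thesis by auto
      next
        case Closed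
        have "{z \<in> ball (snd f) (fst f). l = Open \<longrightarrow> 0 < Im z} = ball (snd f) (fst f)" using Closed by auto
        then show ?thesis using open_ball by metis
      qed
      moreover have "{z \<in> ball (snd f) (fst f). l = Open \<longrightarrow> 0 < Im z} \<subseteq> emb_map f ` shape l"
        using emb_image_shape[OF f(1,2)] by auto
      ultimately show ?thesis using f(3,4) by (intro interiorI) auto
    qed
    from this[OF e w(1)] this[OF e' w(2)] iw * show False by (cases k; cases k') auto
  qed
qed

text \<open>All later geometry uses only these inequalities. The two translations are nested:
  containment needs the color condition, and disjointness also needs the containment inequalities,
  which make the heights of the centers nonnegative in the half disk.\<close>

lemma SC_space_iff:
  "x \<in> SC_space d a \<longleftrightarrow>
     (d = Closed \<longrightarrow> a Open = 0) \<and>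
     (\<forall>p\<in>inputs a. 0 < fst (x p) \<and> (fst p = Open \<longrightarrow> Im (snd (x p)) = 0) \<and>
        norm (snd (x p)) + fst (x p) \<le> 1 \<and> (d = Open \<and> fst p = Closed \<longrightarrow> fst (x p) \<le> Im (snd (x p)))) \<and>
     (\<forall>p\<in>inputs a. \<forall>q\<in>inputs a. p \<noteq> q \<longrightarrow> fst (x p) + fst (x q) \<le> dist (snd (x p)) (snd (x q))) \<and>
     (\<forall>p. p \<notin> inputs a \<longrightarrow> x p = 0)" (is "_ \<longleftrightarrow> ?o \<and> ?P \<and> ?D \<and> ?z")
proof -
  let ?P' = "\<forall>p\<in>inputs a. 0 < fst (x p) \<and> (fst p = Open \<longrightarrow> snd (x p) \<in> \<real>) \<and> emb_map (x p) ` shape (fst p) \<subseteq> shape d"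
  let ?D' = "\<forall>p\<in>inputs a. \<forall>q\<in>inputs a. p \<noteq> q \<longrightarrow>
        interior (emb_map (x p) ` shape (fst p)) \<inter> interior (emb_map (x q) ` shape (fst q)) = {}"
  have R: "z \<in> \<real> \<longleftrightarrow> Im z = 0" for z by (simp add: complex_is_Real_iff)
  have oC: "fst p = Closed" if ?o "d = Closed" "p \<in> inputs a" for p
    using that by (cases p; cases "fst p") (auto simp: inputs_def)
  have P: "?P' \<longleftrightarrow> ?P" if ?o
  proof (intro ball_cong refl)
    fix p assume "p \<in> inputs a"
    then show "(0 < fst (x p) \<and> (fst p = Open \<longrightarrow> snd (x p) \<in> \<real>) \<and> emb_map (x p) ` shape (fst p) \<subseteq> shape d) \<longleftrightarrow>
      (0 < fst (x p) \<and> (fst p = Open \<longrightarrow> Im (snd (x p)) = 0) \<and>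
        norm (snd (x p)) + fst (x p) \<le> 1 \<and> (d = Open \<and> fst p = Closed \<longrightarrow> fst (x p) \<le> Im (snd (x p))))"
      using emb_image_shape_subset[of "x p" "fst p" d] oC[OF that] by (auto simp: R)
  qed
  have D: "?D' \<longleftrightarrow> ?D" if ?o ?P
  proof (intro ball_cong refl imp_cong)
    fix p q assume pq: "p \<in> inputs a" "q \<in> inputs a"
    have "0 \<le> Im (snd (x r))" if "d = Open" "r \<in> inputs a" for r
      using \<open>?P\<close> that by (cases "fst r") force+
    then have "(fst p = Closed \<and> fst q = Closed) \<or> (0 \<le> Im (snd (x p)) \<and> 0 \<le> Im (snd (x q)))"
      using pq oC[OF \<open>?o\<close>] by (cases d) auto
    then show "interior (emb_map (x p) ` shape (fst p)) \<inter> interior (emb_map (x q) ` shape (fst q)) = {} \<longleftrightarrow>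
      fst (x p) + fst (x q) \<le> dist (snd (x p)) (snd (x q))"
      using \<open>?P\<close> pq by (intro disjoint_interiors_iff) auto
  qed
  have "x \<in> SC_space d a \<longleftrightarrow> ?o \<and> ?P' \<and> ?D' \<and> ?z" by (simp only: SC_space_def mem_Collect_eq)
  moreover have "(A \<and> B' \<and> C' \<and> Z) = (A \<and> B \<and> C \<and> Z)" if "A \<Longrightarrow> B' = B" "A \<Longrightarrow> B \<Longrightarrow> C' = C" for A B B' C C' Z
    using that by blast
  from this[OF P D] have "(?o \<and> ?P' \<and> ?D' \<and> ?z) = (?o \<and> ?P \<and> ?D \<and> ?z)" .
  ultimately show ?thesis by (rule trans)
qed

section \<open>The operad of disks: axioms and continuity\<close>

lemma SC_plus_simps [simp]:
  "elts SC_plus = SC_space" "act SC_plus d a \<sigma> x = x \<circ> inv \<sigma>"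
  "unt SC_plus d = (\<lambda>_. 0)((d, 1) := (1, 0))"
  "ins SC_plus d a p b x y = graft a p b x (\<lambda>r. emb_comp (x p) (y r))"
  by (simp_all add: SC_plus_def)

lemma emb_comp_assoc: "emb_comp (emb_comp e f) g = emb_comp e (emb_comp f g)"
  by (simp add: emb_comp_def algebra_simps)

lemma emb_comp_unit [simp]: "emb_comp (1, 0) e = e" "emb_comp e (1, 0) = e"
  by (simp_all add: emb_comp_def)

lemma SC_spaceD:
  assumes "x \<in> SC_space d a"
  shows "d = Closed \<Longrightarrow> a Open = 0"
    and "p \<in> inputs a \<Longrightarrow> 0 < fst (x p)"
    and "\<lbrakk>p \<in> inputs a; fst p = Open\<rbrakk> \<Longrightarrow> Im (snd (x p)) = 0"
    and "p \<in> inputs a \<Longrightarrow> norm (snd (x p)) + fst (x p) \<le> 1"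
    and "\<lbrakk>p \<in> inputs a; d = Open; fst p = Closed\<rbrakk> \<Longrightarrow> fst (x p) \<le> Im (snd (x p))"
    and "\<lbrakk>p \<in> inputs a; q \<in> inputs a; p \<noteq> q\<rbrakk> \<Longrightarrow> fst (x p) + fst (x q) \<le> dist (snd (x p)) (snd (x q))"
    and "p \<notin> inputs a \<Longrightarrow> x p = 0"
proof -
  note A = assms[unfolded SC_space_iff]
  note A1 = conjunct1[OF A] and A2 = conjunct1[OF conjunct2[OF A]]
    and A3 = conjunct1[OF conjunct2[OF conjunct2[OF A]]] and A4 = conjunct2[OF conjunct2[OF conjunct2[OF A]]]
  show "d = Closed \<Longrightarrow> a Open = 0" using A1 by simp
  show "p \<in> inputs a \<Longrightarrow> 0 < fst (x p)" "\<lbrakk>p \<in> inputs a; fst p = Open\<rbrakk> \<Longrightarrow> Im (snd (x p)) = 0"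
    "p \<in> inputs a \<Longrightarrow> norm (snd (x p)) + fst (x p) \<le> 1"
    "\<lbrakk>p \<in> inputs a; d = Open; fst p = Closed\<rbrakk> \<Longrightarrow> fst (x p) \<le> Im (snd (x p))"
    using bspec[OF A2, of p] by simp_all
  show "\<lbrakk>p \<in> inputs a; q \<in> inputs a; p \<noteq> q\<rbrakk> \<Longrightarrow> fst (x p) + fst (x q) \<le> dist (snd (x p)) (snd (x q))"
    using A3 by simp
  show "p \<notin> inputs a \<Longrightarrow> x p = 0" using spec[OF A4, of p] by simp
qed

text \<open>The bounds for an inner entry are those of \<open>y\<close> scaled by the radius at
  \<open>p\<close>. An outer entry keeps its distance from an inner one because the inner one stays
  within the disk at \<open>p\<close>.\<close>

lemma SC_space_graft:
  assumes x: "x \<in> SC_space d a" and p: "p \<in> inputs a" and y: "y \<in> SC_space (fst p) b"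
  shows "graft a p b x (\<lambda>r. emb_comp (x p) (y r)) \<in> SC_space d (ins_arity a p b)"
proof -
  let ?g = "graft a p b x (\<lambda>r. emb_comp (x p) (y r))"
  let ?l = "fst (x p)"
  note X = SC_spaceD[OF x] and Y = SC_spaceD[OF y]
  have l: "0 < ?l" using X(2) p by blast
  have o: "d = Closed \<Longrightarrow> fst p = Closed" using X(1) p by (cases p; cases "fst p") (auto simp: inputs_def)
  have "d = Closed \<longrightarrow> ins_arity a p b Open = 0"
    using X(1) Y(1) o by (auto simp: ins_arity_def)
  moreover have "0 < fst (?g q) \<and> (fst q = Open \<longrightarrow> Im (snd (?g q)) = 0) \<and> norm (snd (?g q)) + fst (?g q) \<le> 1 \<and>
      (d = Open \<and> fst q = Closed \<longrightarrow> fst (?g q) \<le> Im (snd (?g q)))"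
    if "q \<in> inputs (ins_arity a p b)" for q
    using that p
  proof (cases rule: input_ins_arityE)
    case (outer r) then show ?thesis using X p by simp
  next
    case (inner r)
    have n: "norm (of_real ?l * snd (y r) + snd (x p)) \<le> ?l * norm (snd (y r)) + norm (snd (x p))"
      using norm_triangle_ineq[of "of_real ?l * snd (y r)" "snd (x p)"] l by (simp add: norm_mult)
    have m: "?l * (norm (snd (y r)) + fst (y r)) \<le> ?l * 1"
      using Y(4)[OF inner(1)] l by (intro mult_left_mono) auto
    have "norm (snd (?g q)) + fst (?g q) \<le> 1"
      using inner p n m X(4)[OF p] by (simp add: emb_comp_def algebra_simps)
    moreover have "Im (snd (?g q)) = 0" if "fst q = Open"
    proof -
      have "fst r = Open" using that inner by simp
      then have "fst p = Open" using Y(1) inner by (cases r; cases "fst p") (auto simp: inputs_def)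
      then show ?thesis using inner p X(3)[OF p] Y(3)[OF inner(1)] \<open>fst r = Open\<close> by (simp add: emb_comp_def)
    qed
    moreover have "fst (?g q) \<le> Im (snd (?g q))" if "d = Open" "fst q = Closed"
    proof (cases "fst p")
      case Open
      have "fst (y r) \<le> Im (snd (y r))" using Y(5) inner that Open by simp
      then show ?thesis using inner p l X(3)[OF p Open] by (simp add: emb_comp_def)
    next
      case Closed
      have "- (1 - fst (y r)) \<le> Im (snd (y r))"
        using Y(4)[OF inner(1)] abs_Im_le_cmod[of "snd (y r)"] by linarith
      then have "?l * (fst (y r) - 1) \<le> ?l * Im (snd (y r))" using l by (intro mult_left_mono) auto
      then show ?thesis using inner p X(5)[OF p that(1) Closed] by (simp add: emb_comp_def algebra_simps)
    qed
    moreover have "0 < fst (?g q)" using inner l Y(2) by (simp add: emb_comp_def)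
    ultimately show ?thesis by blast
  qed
  moreover have "fst (?g q) + fst (?g s) \<le> dist (snd (?g q)) (snd (?g s))"
    if q: "q \<in> inputs (ins_arity a p b)" and s: "s \<in> inputs (ins_arity a p b)" and qs: "q \<noteq> s" for q s
  proof -
    have mixed: "fst (x r) + ?l * fst (y t) \<le> dist (snd (x r)) (of_real ?l * snd (y t) + snd (x p))"
      if r: "r \<in> inputs a" "r \<noteq> p" and t: "t \<in> inputs b" for r t
    proof -
      have "dist (snd (x r)) (snd (x p)) \<le> dist (snd (x r)) (of_real ?l * snd (y t) + snd (x p)) + ?l * norm (snd (y t))"
        using dist_triangle[of "snd (x r)" "snd (x p)" "of_real ?l * snd (y t) + snd (x p)"] l
        by (simp add: dist_norm norm_mult)
      moreover have "?l * (norm (snd (y t)) + fst (y t)) \<le> ?l * 1"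
        using Y(4)[OF t] l by (intro mult_left_mono) auto
      ultimately show ?thesis using X(6)[OF r(1) p r(2)] by (simp add: algebra_simps)
    qed
    show ?thesis using q p
    proof (cases rule: input_ins_arityE)
      case q: (outer r)
      show ?thesis using s p
      proof (cases rule: input_ins_arityE)
        case (outer t) then show ?thesis using q qs p X(6)[of r t] by auto
      next
        case (inner t) then show ?thesis using q p mixed[of r t] by (simp add: emb_comp_def)
      qed
    next
      case q: (inner r)
      show ?thesis using s p
      proof (cases rule: input_ins_arityE)
        case (outer t)
        then show ?thesis using q p mixed[of t r] by (simp add: emb_comp_def dist_commute add.commute)
      next
        case (inner t)
        then have "?l * (fst (y r) + fst (y t)) \<le> ?l * dist (snd (y r)) (snd (y t))"
          using q qs l Y(6)[of r t] by (intro mult_left_mono) auto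
        moreover have "?l * dist (snd (y r)) (snd (y t)) = norm (of_real ?l * (snd (y r) - snd (y t)))"
          using l by (simp add: dist_norm norm_mult)
        ultimately show ?thesis using q inner p by (simp add: emb_comp_def dist_norm algebra_simps)
      qed
    qed
  qed
  moreover have "?g q = 0" if "q \<notin> inputs (ins_arity a p b)" for q using graft_outside[OF p that] .
  ultimately show ?thesis unfolding SC_space_iff by blast
qed

lemma SC_space_act:
  assumes x: "x \<in> SC_space d a" and \<sigma>: "\<sigma> \<in> input_perms a"
  shows "x \<circ> inv \<sigma> \<in> SC_space d a"
proof -
  have i: "inv \<sigma> p \<in> inputs a \<longleftrightarrow> p \<in> inputs a" for p
    using permutes_in_image[OF permutes_inv[OF input_perms_permutes[OF \<sigma>]]] .
  have f: "fst (inv \<sigma> p) = fst p" for p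
    using input_perms_fst[OF \<sigma>, of "inv \<sigma> p"] permutes_inverses[OF input_perms_permutes[OF \<sigma>]] by simp
  have n: "inv \<sigma> p = inv \<sigma> q \<longleftrightarrow> p = q" for p q
    using permutes_inverses[OF input_perms_permutes[OF \<sigma>]] by metis
  show ?thesis unfolding SC_space_iff o_apply
    by (intro conjI ballI impI allI) (simp_all add: SC_spaceD[OF x] i f n)
qed

lemma relative_operad_SC_plus: "relative_operad SC_plus"
proof -
  have col: "fst p = Closed \<longrightarrow> b Open = 0" if "y \<in> SC_space (fst p) b" for p :: input and b y
    using SC_spaceD(1)[OF that] by blast
  have "operad_closure SC_plus"
    unfolding operad_closure_def SC_plus_simps
  proof (intro conjI allI ballI)
    have "p \<in> inputs (unit_arity d) \<longleftrightarrow> p = (d, 1)" for p d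
      by (cases p) (auto simp: inputs_def unit_arity_def)
    then show "(\<lambda>_. 0)((d, 1) := (1, 0)) \<in> SC_space d (unit_arity d)" for d
      unfolding SC_space_iff by (auto simp: unit_arity_def)
  qed (simp_all add: SC_space_graft SC_space_act)
  moreover have "operad_action SC_plus"
    unfolding operad_action_def SC_plus_simps
  proof (intro allI ballI conjI)
    fix a x \<sigma> \<tau> assume "\<sigma> \<in> input_perms a" "\<tau> \<in> input_perms a"
    then have "inv (\<sigma> \<circ> \<tau>) = inv \<tau> \<circ> inv \<sigma>"
      by (intro o_inv_distrib permutes_bij[OF input_perms_permutes])
    then show "x \<circ> inv (\<sigma> \<circ> \<tau>) = x \<circ> inv \<tau> \<circ> inv \<sigma>" by (simp add: o_assoc)
  qed simp
  moreover have "operad_unit SC_plus"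
    unfolding operad_unit_def SC_plus_simps
  proof (intro allI ballI conjI)
    fix d a x assume x: "x \<in> SC_space d a"
    have i: "inner_label (unit_arity d) (d, 1) r = r" if "r \<in> inputs a" for r
      using that by (cases r) (auto simp: inner_label_def unit_arity_def inputs_def)
    show "graft (unit_arity d) (d, 1) a ((\<lambda>_. 0)((d, 1) := (1, 0))) (\<lambda>r. emb_comp (((\<lambda>_. 0)((d, 1) := (1, 0))) (d, 1)) (x r)) = x"
    proof (rule graft_eqI[symmetric, OF unit_arity_input])
      show "x q = 0" if "q \<notin> inputs (ins_arity (unit_arity d) (d, 1) a)" for q
        using that SC_spaceD(7)[OF x] by simp
      show "x (outer_label (d, 1) a r) = ((\<lambda>_. 0)((d, 1) := (1, 0))) r" if "r \<in> inputs (unit_arity d)" "r \<noteq> (d, 1)" for r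
        using that by (cases r) (auto simp: inputs_def unit_arity_def split: if_splits)
      show "x (inner_label (unit_arity d) (d, 1) r) = emb_comp (((\<lambda>_. 0)((d, 1) := (1, 0))) (d, 1)) (x r)"
        if "r \<in> inputs a" for r using i[OF that] by simp
    qed
    fix p assume p: "p \<in> inputs a"
    have 1: "r = (fst p, 1)" if "r \<in> inputs (unit_arity (fst p))" for r
      using that by (cases r) (auto simp: inputs_def unit_arity_def split: if_splits)
    show "graft a p (unit_arity (fst p)) x (\<lambda>r. emb_comp (x p) (((\<lambda>_. 0)((fst p, 1) := (1, 0))) r)) = x"
    proof (rule graft_eqI[symmetric, OF p])
      show "x (inner_label a p r) = emb_comp (x p) (((\<lambda>_. 0)((fst p, 1) := (1, 0))) r)"
        if "r \<in> inputs (unit_arity (fst p))" for r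
        using 1[OF that] by (simp add: inner_label_def)
      show "x (outer_label p (unit_arity (fst p)) r) = x r" if "r \<in> inputs a" "r \<noteq> p" for r
        by (cases r) (simp add: outer_label_def unit_arity_def)
      show "x q = 0" if "q \<notin> inputs (ins_arity a p (unit_arity (fst p)))" for q
        using that SC_spaceD(7)[OF x] by (simp add: ins_arity_unit[OF p])
    qed
  qed
  moreover have "operad_sequential SC_plus"
    unfolding operad_sequential_def SC_plus_simps
  proof (intro allI ballI)
    fix d a x p b y q c z
    assume x: "x \<in> SC_space d a" and p: "p \<in> inputs a" and y: "y \<in> SC_space (fst p) b" and q: "q \<in> inputs b"
      and z: "z \<in> SC_space (fst q) c"
    \<comment> \<open>\<open>emb_comp (x p)\<close> acts entry by entry and is moved inside the
      inner graft; then \<open>graft_sequential\<close> and associativity of \<open>emb_comp\<close>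
      apply.\<close>
    have "graft a p (ins_arity b q c) x (\<lambda>r. emb_comp (x p) (graft b q c y (\<lambda>r. emb_comp (y q) (z r)) r)) =
      graft a p (ins_arity b q c) x
        (graft b q c (\<lambda>r. emb_comp (x p) (y r)) (\<lambda>r. emb_comp (x p) (emb_comp (y q) (z r))))"
      by (rule graft_cong[OF refl _ p]) (rule graft_map[where m = "emb_comp (x p)", OF _ q])
    then show "graft (ins_arity a p b) (inner_label a p q) c (graft a p b x (\<lambda>r. emb_comp (x p) (y r)))
        (\<lambda>r. emb_comp (graft a p b x (\<lambda>r. emb_comp (x p) (y r)) (inner_label a p q)) (z r)) =
      graft a p (ins_arity b q c) x (\<lambda>r. emb_comp (x p) (graft b q c y (\<lambda>r. emb_comp (y q) (z r)) r))"
      using p q col[OF y] col[OF z] by (simp add: graft_sequential emb_comp_assoc)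
  qed
  moreover have "operad_parallel SC_plus"
    unfolding operad_parallel_def SC_plus_simps
  proof (intro allI ballI impI)
    fix d a p q b c \<rho> and x y z :: "input \<Rightarrow> emb"
    assume p: "p \<in> inputs a" and q: "q \<in> inputs a" and pq: "p \<noteq> q"
      and \<rho>: "\<rho> \<in> input_perms (ins_arity (ins_arity a p b) (outer_label p b q) c)"
      and *: "(\<forall>r\<in>inputs a - {p, q}.
             \<rho> (outer_label (outer_label q c p) b (outer_label q c r)) =
             outer_label (outer_label p b q) c (outer_label p b r)) \<and>
          (\<forall>r\<in>inputs b.
             \<rho> (inner_label (ins_arity a q c) (outer_label q c p) r) =
             outer_label (outer_label p b q) c (inner_label a p r)) \<and>
          (\<forall>r\<in>inputs c.
             \<rho> (outer_label (outer_label q c p) b (inner_label a q r)) =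
             inner_label (ins_arity a p b) (outer_label p b q) r)"
    show "graft (ins_arity a p b) (outer_label p b q) c (graft a p b x (\<lambda>r. emb_comp (x p) (y r)))
        (\<lambda>r. emb_comp (graft a p b x (\<lambda>r. emb_comp (x p) (y r)) (outer_label p b q)) (z r)) =
      graft (ins_arity a q c) (outer_label q c p) b (graft a q c x (\<lambda>r. emb_comp (x q) (z r)))
        (\<lambda>r. emb_comp (graft a q c x (\<lambda>r. emb_comp (x q) (z r)) (outer_label q c p)) (y r)) \<circ> inv \<rho>"
      using p q pq * by (subst graft_parallel[OF p q pq \<rho>]) auto
  qed
  moreover have "operad_equivariant SC_plus"
    unfolding operad_equivariant_def SC_plus_simps
  proof (intro allI ballI impI)
    fix d a x p b y \<sigma> \<tau> \<rho>
    assume p: "p \<in> inputs a"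
      and \<sigma>: "\<sigma> \<in> input_perms a" and \<tau>: "\<tau> \<in> input_perms b" and \<rho>: "\<rho> \<in> input_perms (ins_arity a p b)"
      and *: "(\<forall>r\<in>inputs a - {p}. \<rho> (outer_label p b r) = outer_label (\<sigma> p) b (\<sigma> r)) \<and>
          (\<forall>r\<in>inputs b. \<rho> (inner_label a p r) = inner_label a (\<sigma> p) (\<tau> r))"
    have "(\<lambda>r. emb_comp ((x \<circ> inv \<sigma>) (\<sigma> p)) ((y \<circ> inv \<tau>) r)) = (\<lambda>r. emb_comp (x p) (y r)) \<circ> inv \<tau>"
      using permutes_inverses[OF input_perms_permutes[OF \<sigma>]] by auto
    then show "graft a (\<sigma> p) b (x \<circ> inv \<sigma>) (\<lambda>r. emb_comp ((x \<circ> inv \<sigma>) (\<sigma> p)) ((y \<circ> inv \<tau>) r)) =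
      graft a p b x (\<lambda>r. emb_comp (x p) (y r)) \<circ> inv \<rho>"
      using graft_equivariant[OF p \<sigma> \<tau> \<rho>, of x "\<lambda>r. emb_comp (x p) (y r)"] * by auto
  qed
  moreover have "elts SC_plus Closed a = {}" if "0 < a Open" for a
    using that by (auto simp: SC_space_iff)
  ultimately show ?thesis unfolding relative_operad_def by blast
qed


lemma continuous_on_coordinate:
  "continuous_on S f \<Longrightarrow> continuous_on S (\<lambda>x. f x i :: 'b::topological_space)"
  by (rule continuous_on_product_then_coordinatewise)

lemma continuous_on_graft:
  assumes "\<And>r. continuous_on S (\<lambda>x. f x r)" "\<And>r. continuous_on S (\<lambda>x. g x r)"
  shows "continuous_on S (\<lambda>x. graft a p b (f x) (g x) :: input \<Rightarrow> 'v::{zero, topological_space})"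
proof (intro continuous_on_coordinatewise_then_product)
  show "continuous_on S (\<lambda>x. graft a p b (f x) (g x) q)" for q
    unfolding graft_def
    by (cases "q \<in> inner_label a p ` inputs b"; cases "q \<in> outer_label p b ` (inputs a - {p})")
      (simp_all add: assms)
qed

lemma continuous_operad_SC_plus: "continuous_operad SC_plus"
  unfolding continuous_operad_def
proof (intro conjI allI ballI)
  fix d a p b
  have 1: "continuous_on S (\<lambda>xy. fst xy r)" "continuous_on S (\<lambda>xy. snd xy r)"
    for S :: "((input \<Rightarrow> emb) \<times> (input \<Rightarrow> emb)) set" and r
    by (rule continuous_on_coordinate[OF continuous_on_fst[OF continuous_on_id]],
        rule continuous_on_coordinate[OF continuous_on_snd[OF continuous_on_id]])
  show "continuous_on (elts SC_plus d a \<times> elts SC_plus (fst p) b) (\<lambda>(x, y). ins SC_plus d a p b x y)"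
    unfolding case_prod_unfold SC_plus_simps emb_comp_def by (intro continuous_on_graft continuous_intros 1)
next
  fix d a and \<sigma> :: "input \<Rightarrow> input"
  have "continuous_on (SC_space d a) (\<lambda>x. x \<circ> inv \<sigma>)"
    by (intro continuous_on_coordinatewise_then_product) (simp add: continuous_on_coordinate[OF continuous_on_id])
  then show "continuous_on (elts SC_plus d a) (act SC_plus d a \<sigma>)" by (simp add: SC_plus_def)
qed

lemma relative_goperad_pi_SC_plus: "relative_goperad (pi_operad SC_plus)"
  by (rule relative_goperad_pi[OF relative_operad_SC_plus continuous_operad_SC_plus])

section \<open>Configurations and centers\<close>

lemma finite_inputs [simp]: "finite (inputs a)"
proof -
  have "inputs a \<subseteq> {Closed, Open} \<times> {..a Closed + a Open}"
    by (auto simp: inputs_def) (metis color.exhaust trans_le_add1 trans_le_add2)+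
  then show ?thesis by (rule finite_subset) auto
qed

lemma Conf_iff:
  "x \<in> Conf d a \<longleftrightarrow> (d = Closed \<longrightarrow> a Open = 0) \<and> inj_on x (inputs a) \<and>
    (\<forall>p\<in>inputs a. norm (x p) \<le> 1 \<and> (d = Closed \<longrightarrow> norm (x p) < 1) \<and>
      (d = Open \<and> fst p = Open \<longrightarrow> Im (x p) = 0) \<and> (d = Open \<and> fst p = Closed \<longrightarrow> 0 < Im (x p))) \<and>
    (\<forall>p. p \<notin> inputs a \<longrightarrow> x p = 0)"
proof -
  have "(case d of Closed \<Rightarrow> x p \<in> ball 0 1
      | Open \<Rightarrow> x p \<in> shape Open \<and> (case fst p of Open \<Rightarrow> Im (x p) = 0 | Closed \<Rightarrow> 0 < Im (x p))) \<longleftrightarrow>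
    (norm (x p) \<le> 1 \<and> (d = Closed \<longrightarrow> norm (x p) < 1) \<and>
      (d = Open \<and> fst p = Open \<longrightarrow> Im (x p) = 0) \<and> (d = Open \<and> fst p = Closed \<longrightarrow> 0 < Im (x p)))" for p
    by (cases d; cases "fst p") (auto simp: shape_def)
  then show ?thesis unfolding Conf_def by simp
qed

lemma ConfD:
  assumes "x \<in> Conf d a"
  shows "d = Closed \<Longrightarrow> a Open = 0"
    and "\<lbrakk>p \<in> inputs a; q \<in> inputs a; p \<noteq> q\<rbrakk> \<Longrightarrow> x p \<noteq> x q"
    and "p \<in> inputs a \<Longrightarrow> norm (x p) \<le> 1"
    and "\<lbrakk>p \<in> inputs a; d = Closed\<rbrakk> \<Longrightarrow> norm (x p) < 1"
    and "\<lbrakk>p \<in> inputs a; d = Open; fst p = Open\<rbrakk> \<Longrightarrow> Im (x p) = 0"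
    and "\<lbrakk>p \<in> inputs a; d = Open; fst p = Closed\<rbrakk> \<Longrightarrow> 0 < Im (x p)"
    and "p \<notin> inputs a \<Longrightarrow> x p = 0"
proof -
  note A = assms[unfolded Conf_iff]
  note A1 = conjunct1[OF A] and A2 = conjunct1[OF conjunct2[OF A]]
    and A3 = conjunct1[OF conjunct2[OF conjunct2[OF A]]] and A4 = conjunct2[OF conjunct2[OF conjunct2[OF A]]]
  show "d = Closed \<Longrightarrow> a Open = 0" using A1 by simp
  show "\<lbrakk>p \<in> inputs a; q \<in> inputs a; p \<noteq> q\<rbrakk> \<Longrightarrow> x p \<noteq> x q" using A2 unfolding inj_on_def by blast
  show "p \<in> inputs a \<Longrightarrow> norm (x p) \<le> 1" "\<lbrakk>p \<in> inputs a; d = Closed\<rbrakk> \<Longrightarrow> norm (x p) < 1"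
    "\<lbrakk>p \<in> inputs a; d = Open; fst p = Open\<rbrakk> \<Longrightarrow> Im (x p) = 0"
    "\<lbrakk>p \<in> inputs a; d = Open; fst p = Closed\<rbrakk> \<Longrightarrow> 0 < Im (x p)"
    using bspec[OF A3, of p] by simp_all
  show "p \<notin> inputs a \<Longrightarrow> x p = 0" using spec[OF A4, of p] by simp
qed

lemma Closed_no_open_input: "\<lbrakk>a Open = 0; p \<in> inputs a\<rbrakk> \<Longrightarrow> fst p = Closed"
  by (cases p; cases "fst p") (auto simp: inputs_def)

section \<open>Centers, and disks around given centers\<close>

definition centers :: "(input \<Rightarrow> emb) \<Rightarrow> input \<Rightarrow> complex" where
  "centers x = (\<lambda>p. snd (x p))"

text \<open>Positive radii keep the centers off the unit circle. So paths of centers satisfy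
  \<open>in_open_disk\<close> and are admissible representatives for insertion in
  \<open>CoPB_plus\<close>, although \<open>Conf\<close> allows points of the half disk on the
  circle.\<close>

lemma norm_centers_less:
  assumes "x \<in> SC_space d a"
  shows "norm (centers x p) < 1"
proof (cases "p \<in> inputs a")
  case True then show ?thesis using SC_spaceD(2,4)[OF assms True] by (simp add: centers_def)
next
  case False then show ?thesis using SC_spaceD(7)[OF assms] by (simp add: centers_def)
qed

lemma centers_Conf:
  assumes x: "x \<in> SC_space d a"
  shows "centers x \<in> Conf d a"
  unfolding Conf_iff
proof (intro conjI ballI impI allI)
  show "inj_on (centers x) (inputs a)"
  proof (rule inj_onI, rule ccontr)
    fix p q assume "p \<in> inputs a" "q \<in> inputs a" "centers x p = centers x q" "p \<noteq> q"
    then show False using SC_spaceD(6)[OF x, of p q] SC_spaceD(2)[OF x, of p] SC_spaceD(2)[OF x, of q]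
      by (simp add: centers_def)
  qed
  fix p assume p: "p \<in> inputs a"
  show "norm (centers x p) < 1" "norm (centers x p) \<le> 1" using norm_centers_less[OF x, of p] by simp_all
  show "Im (centers x p) = 0" if "d = Open \<and> fst p = Open"
    using SC_spaceD(3)[OF x p] that by (simp add: centers_def)
  show "0 < Im (centers x p)" if "d = Open \<and> fst p = Closed"
    using SC_spaceD(2)[OF x p] SC_spaceD(5)[OF x p] that by (simp add: centers_def)
qed (use SC_spaceD[OF x] in \<open>simp_all add: centers_def\<close>)

definition scale :: "real \<Rightarrow> (input \<Rightarrow> complex) \<Rightarrow> input \<Rightarrow> complex" where
  "scale c x = (\<lambda>p. of_real c * x p)"

lemma scale_Conf:
  assumes x: "x \<in> Conf d a" and c: "0 < c" "c \<le> 1"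
  shows "scale c x \<in> Conf d a"
  unfolding Conf_iff
proof (intro conjI ballI impI allI)
  show "inj_on (scale c x) (inputs a)"
    using ConfD(2)[OF x] c unfolding inj_on_def scale_def by auto
  fix p assume p: "p \<in> inputs a"
  have "c * norm (x p) \<le> norm (x p)" using c by (simp add: mult_left_le_one_le)
  then show "norm (scale c x p) \<le> 1" "d = Closed \<Longrightarrow> norm (scale c x p) < 1"
    using ConfD(3,4)[OF x p] c by (auto simp: scale_def norm_mult)
qed (use ConfD[OF x] c in \<open>auto simp: scale_def\<close>)

lemma norm_scale_less:
  assumes x: "x \<in> Conf d a" and c: "0 \<le> c" "c < 1"
  shows "norm (scale c x p) < 1"
proof (cases "p \<in> inputs a")
  case True
  have "c * norm (x p) \<le> c" using ConfD(3)[OF x True] c by (simp add: mult_left_le)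
  then show ?thesis using c by (simp add: scale_def norm_mult)
qed (use ConfD(7)[OF x] in \<open>simp add: scale_def\<close>)

text \<open>Positive scaling keeps the order of the real parts, so the radial motion of the centers
  under \<open>shrink\<close> never leaves the set belonging to a word.\<close>

lemma scale_Conf_word: "\<lbrakk>x \<in> Conf_word d a w; 0 < c; c \<le> 1\<rbrakk> \<Longrightarrow> scale c x \<in> Conf_word d a w"
  unfolding Conf_word_def using scale_Conf[of x d a c] by (auto simp: scale_def elim: sorted_wrt_mono_rel[rotated])

lemma prod_le_factor:
  fixes f :: "'i \<Rightarrow> real"
  assumes "finite A" "i \<in> A" and f: "\<And>j. j \<in> A \<Longrightarrow> 0 \<le> f j \<and> f j \<le> 1"
  shows "prod f A \<le> f i"
proof -
  have "prod f A = f i * prod f (A - {i})" using assms by (simp add: prod.remove)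
  also have "\<dots> \<le> f i" using f assms(2) by (intro mult_left_le prod_le_1) auto
  finally show ?thesis .
qed

text \<open>A continuous positive lower bound of the distances between the points and, in the half disk,
  of the heights of the closed points: disks of this order of magnitude fit around the points.\<close>

definition gap :: "color \<Rightarrow> arity \<Rightarrow> (input \<Rightarrow> complex) \<Rightarrow> real" where
  "gap d a z = (\<Prod>pq\<in>inputs a \<times> inputs a.
     if fst pq \<noteq> snd pq then min 1 (dist (z (fst pq)) (z (snd pq)))
     else if d = Open \<and> fst (fst pq) = Closed then min 1 (Im (z (fst pq))) else 1)"

text \<open>All factors lie between 0 and 1, so the product is positive and below each factor:
  factors off the diagonal bound distances, diagonal ones bound heights. Unlike a minimum, the
  product also makes sense for arity zero.\<close>

lemma gap_bounds:
  assumes z: "z \<in> Conf d a"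
  shows "0 < gap d a z" "gap d a z \<le> 1"
    and "\<lbrakk>p \<in> inputs a; q \<in> inputs a; p \<noteq> q\<rbrakk> \<Longrightarrow> gap d a z \<le> dist (z p) (z q)"
    and "\<lbrakk>p \<in> inputs a; d = Open; fst p = Closed\<rbrakk> \<Longrightarrow> gap d a z \<le> Im (z p)"
proof -
  let ?f = "\<lambda>pq. if fst pq \<noteq> snd pq then min 1 (dist (z (fst pq)) (z (snd pq)))
     else if d = Open \<and> fst (fst pq) = Closed then min 1 (Im (z (fst pq))) else 1"
  have pos: "0 < ?f pq" and le: "?f pq \<le> 1" if "pq \<in> inputs a \<times> inputs a" for pq
    using that ConfD(2)[OF z, of "fst pq" "snd pq"] ConfD(6)[OF z, of "fst pq"] by (auto simp: mem_Times_iff)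
  show "0 < gap d a z" unfolding gap_def using pos by (intro prod_pos) blast
  have pl: "0 \<le> ?f pq \<and> ?f pq \<le> 1" if "pq \<in> inputs a \<times> inputs a" for pq
    by (rule conjI[OF less_imp_le[OF pos[OF that]] le[OF that]])
  show "gap d a z \<le> 1" unfolding gap_def by (rule prod_le_1[OF pl])
  have fac: "gap d a z \<le> ?f pq" if "pq \<in> inputs a \<times> inputs a" for pq
    unfolding gap_def by (rule prod_le_factor[OF _ that pl]) simp
  show "gap d a z \<le> dist (z p) (z q)" if "p \<in> inputs a" "q \<in> inputs a" "p \<noteq> q"
    using fac[of "(p, q)"] that by simp
  show "gap d a z \<le> Im (z p)" if "p \<in> inputs a" "d = Open" "fst p = Closed"
    using fac[of "(p, p)"] that by simp
qed

lemma continuous_on_gap: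
  assumes "continuous_on S f"
  shows "continuous_on S (\<lambda>x. gap d a (f x))"
  unfolding gap_def
proof (intro continuous_on_prod)
  fix pq
  show "continuous_on S (\<lambda>x. if fst pq \<noteq> snd pq then min 1 (dist (f x (fst pq)) (f x (snd pq)))
     else if d = Open \<and> fst (fst pq) = Closed then min 1 (Im (f x (fst pq))) else 1)"
    by (cases "fst pq = snd pq"; cases "d = Open \<and> fst (fst pq) = Closed")
      (auto intro!: continuous_intros continuous_on_coordinate[OF assms])
qed

text \<open>\<open>shrink d a 0\<close> is the identity, and \<open>shrink d a 1\<close> factors through the centers. In between,
  the centers move radially towards 0.\<close>

definition shrink :: "color \<Rightarrow> arity \<Rightarrow> real \<Rightarrow> (input \<Rightarrow> emb) \<Rightarrow> input \<Rightarrow> emb" where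
  "shrink d a s x = (\<lambda>p. if p \<in> inputs a
     then ((1 - s) * fst (x p) + s * (gap d a (centers x) / 4), of_real (1 - s / 2) * snd (x p)) else 0)"

text \<open>Halving the centers moves them off the unit circle and leaves room for a radius of at
  most 1/4. At half scale distances are at least \<open>gap d a z / 2\<close>, and so are the
  heights of closed points in the half disk; hence the radius \<open>gap d a z / 4\<close> satisfies
  all inequalities.\<close>

definition sect :: "color \<Rightarrow> arity \<Rightarrow> (input \<Rightarrow> complex) \<Rightarrow> input \<Rightarrow> emb" where
  "sect d a z = (\<lambda>p. if p \<in> inputs a then (gap d a z / 4, of_real (1 / 2) * z p) else 0)"

lemma shrink_0: "x \<in> SC_space d a \<Longrightarrow> shrink d a 0 x = x"
  using SC_spaceD(7) by (fastforce simp: shrink_def)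

lemma shrink_1: "shrink d a 1 x = sect d a (centers x)"
  by (auto simp: shrink_def sect_def centers_def)

lemma centers_shrink: "x \<in> SC_space d a \<Longrightarrow> centers (shrink d a s x) = scale (1 - s / 2) (centers x)"
  using SC_spaceD(7) by (fastforce simp: shrink_def centers_def scale_def)

lemma centers_sect: "z \<in> Conf d a \<Longrightarrow> centers (sect d a z) = scale (1 / 2) z"
  using ConfD(7) by (fastforce simp: sect_def centers_def scale_def)

text \<open>A common criterion for \<open>sect\<close>, with \<open>c = 1/2\<close>, and for
  \<open>shrink\<close>, with \<open>c = 1 - s / 2\<close>.\<close>

lemma SC_space_scaleI:
  assumes z: "z \<in> Conf d a" and c: "1/2 \<le> c" "c \<le> 1"
    and l: "\<And>p. p \<in> inputs a \<Longrightarrow> 0 < l p \<and> c * norm (z p) + l p \<le> 1 \<and>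
      (d = Open \<and> fst p = Closed \<longrightarrow> l p \<le> c * Im (z p))"
    and D: "\<And>p q. \<lbrakk>p \<in> inputs a; q \<in> inputs a; p \<noteq> q\<rbrakk> \<Longrightarrow> l p + l q \<le> c * dist (z p) (z q)"
  shows "(\<lambda>p. if p \<in> inputs a then (l p, of_real c * z p) else 0) \<in> SC_space d a"
  unfolding SC_space_iff
proof (intro conjI ballI impI allI)
  fix p assume p: "p \<in> inputs a"
  show "Im (snd (if p \<in> inputs a then (l p, of_real c * z p) else 0)) = 0" if "fst p = Open"
    using ConfD(1,5)[OF z] Closed_no_open_input[OF _ p] that p by (cases d) auto
  fix q assume q: "q \<in> inputs a" "p \<noteq> q"
  have "dist (of_real c * z p) (of_real c * z q) = c * dist (z p) (z q)"
    using c by (simp add: dist_norm norm_mult flip: right_diff_distrib)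
  then show "fst (if p \<in> inputs a then (l p, of_real c * z p) else 0) +
      fst (if q \<in> inputs a then (l q, of_real c * z q) else 0) \<le>
    dist (snd (if p \<in> inputs a then (l p, of_real c * z p) else 0)) (snd (if q \<in> inputs a then (l q, of_real c * z q) else 0))"
    using D[OF p q] p q by simp
qed (use l ConfD(1)[OF z] c in \<open>auto simp: norm_mult\<close>)

lemma sect_SC_space:
  assumes z: "z \<in> Conf d a"
  shows "sect d a z \<in> SC_space d a"
  unfolding sect_def
proof (rule SC_space_scaleI[OF z])
  note G = gap_bounds[OF z]
  show "0 < gap d a z / 4 \<and> 1 / 2 * norm (z p) + gap d a z / 4 \<le> 1 \<and>
      (d = Open \<and> fst p = Closed \<longrightarrow> gap d a z / 4 \<le> 1 / 2 * Im (z p))" if "p \<in> inputs a" for p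
    using G(1,2) G(4)[OF that] ConfD(3)[OF z that] by auto
  show "gap d a z / 4 + gap d a z / 4 \<le> 1 / 2 * dist (z p) (z q)" if "p \<in> inputs a" "q \<in> inputs a" "p \<noteq> q" for p q
    using G(3)[OF that] by simp
qed simp_all

text \<open>Since \<open>1 - s / 2 = (1 - s) + s / 2\<close>, every inequality is
  \<open>1 - s\<close> times the one for \<open>x\<close> plus \<open>s\<close> times the one for
  the halved centers with a quarter of the gap as radius.\<close>

lemma shrink_SC_space:
  assumes x: "x \<in> SC_space d a" and s: "s \<in> {0..1}"
  shows "shrink d a s x \<in> SC_space d a"
proof -
  have z: "centers x \<in> Conf d a" by (rule centers_Conf[OF x])
  note G = gap_bounds[OF z] and X = SC_spaceD[OF x]
  let ?g = "gap d a (centers x)"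
  have s01: "0 \<le> s" "s \<le> 1" using s by auto
  have "(\<lambda>p. if p \<in> inputs a then ((1 - s) * fst (x p) + s * (?g / 4), of_real (1 - s / 2) * centers x p) else 0)
    \<in> SC_space d a"
  proof (rule SC_space_scaleI[OF z])
    fix p assume p: "p \<in> inputs a"
    have l: "0 < fst (x p)" using X(2)[OF p] .
    have "0 < (1 - s) * fst (x p) + s * (?g / 4)"
    proof (cases "s = 1")
      case False
      then show ?thesis using l G(1) s01 by (intro add_pos_nonneg mult_pos_pos mult_nonneg_nonneg) auto
    qed (use G(1) in simp)
    moreover have "(1 - s / 2) * norm (centers x p) + ((1 - s) * fst (x p) + s * (?g / 4)) \<le> 1"
    proof -
      have "(1 - s) * (norm (centers x p) + fst (x p)) \<le> (1 - s) * 1"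
        using X(4)[OF p] s01 by (intro mult_left_mono) (auto simp: centers_def)
      moreover have "s * (norm (centers x p) / 2 + ?g / 4) \<le> s * 1"
        using ConfD(3)[OF z p] G(2) s01 by (intro mult_left_mono) auto
      ultimately show ?thesis by (simp add: algebra_simps)
    qed
    moreover have "(1 - s) * fst (x p) + s * (?g / 4) \<le> (1 - s / 2) * Im (centers x p)" if "d = Open \<and> fst p = Closed"
    proof -
      have "(1 - s) * fst (x p) \<le> (1 - s) * Im (centers x p)"
        using X(5)[OF p] that s01 by (intro mult_left_mono) (auto simp: centers_def)
      moreover have "s * (?g / 4) \<le> s * (Im (centers x p) / 2)"
        using G(1) G(4)[OF p] that s01 by (intro mult_left_mono) auto
      ultimately show ?thesis by (simp add: algebra_simps)
    qed
    ultimately show "0 < (1 - s) * fst (x p) + s * (?g / 4) \<and>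
      (1 - s / 2) * norm (centers x p) + ((1 - s) * fst (x p) + s * (?g / 4)) \<le> 1 \<and>
      (d = Open \<and> fst p = Closed \<longrightarrow> (1 - s) * fst (x p) + s * (?g / 4) \<le> (1 - s / 2) * Im (centers x p))" by blast
    fix q assume q: "q \<in> inputs a" "p \<noteq> q"
    have "(1 - s) * (fst (x p) + fst (x q)) \<le> (1 - s) * dist (centers x p) (centers x q)"
      using X(6)[OF p q] s01 by (intro mult_left_mono) (auto simp: centers_def)
    moreover have "s * (?g / 2) \<le> s * (dist (centers x p) (centers x q) / 2)"
      using G(3)[OF p q] s01 by (intro mult_left_mono) auto
    ultimately show "(1 - s) * fst (x p) + s * (?g / 4) + ((1 - s) * fst (x q) + s * (?g / 4)) \<le>
      (1 - s / 2) * dist (centers x p) (centers x q)" by (simp add: algebra_simps)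
  qed (use s01 in auto)
  then show ?thesis unfolding shrink_def centers_def .
qed

lemma continuous_on_centers: "continuous_on S f \<Longrightarrow> continuous_on S (\<lambda>x. centers (f x))"
  unfolding centers_def
  by (rule continuous_on_coordinatewise_then_product, rule continuous_on_snd, erule continuous_on_coordinate)

lemma continuous_on_scale:
  "\<lbrakk>continuous_on S c; continuous_on S f\<rbrakk> \<Longrightarrow> continuous_on S (\<lambda>x. scale (c x) (f x))"
  unfolding scale_def
  by (rule continuous_on_coordinatewise_then_product, rule continuous_on_mult, erule continuous_on_of_real,
    erule continuous_on_coordinate)

lemma continuous_on_sect:
  assumes "continuous_on S f"
  shows "continuous_on S (\<lambda>x. sect d a (f x))"
proof (intro continuous_on_coordinatewise_then_product)
  fix p show "continuous_on S (\<lambda>x. sect d a (f x) p)"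
    by (cases "p \<in> inputs a")
      (auto simp: sect_def intro!: continuous_intros continuous_on_gap[OF assms] continuous_on_coordinate[OF assms])
qed

lemma continuous_on_shrink:
  assumes s: "continuous_on S s" and f: "continuous_on S f"
  shows "continuous_on S (\<lambda>x. shrink d a (s x) (f x))"
proof (intro continuous_on_coordinatewise_then_product)
  fix p show "continuous_on S (\<lambda>x. shrink d a (s x) (f x) p)"
    by (cases "p \<in> inputs a")
      (auto simp: shrink_def intro!: continuous_intros continuous_on_gap[OF continuous_on_centers[OF f]]
        continuous_on_coordinate[OF f] s)
qed

section \<open>Homotopies of paths with free endpoints\<close>

text \<open>The two routes along the boundary of the square are joined by a linear homotopy in the
  square, which is convex, and \<open>H\<close> carries it to \<open>S\<close>.\<close>

lemma homotopic_paths_square: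
  fixes H :: "real \<times> real \<Rightarrow> 'a::topological_space"
  assumes H: "continuous_on ({0..1} \<times> {0..1}) H" "H \<in> {0..1} \<times> {0..1} \<rightarrow> S"
  shows "homotopic_paths S ((\<lambda>t. H (0, t)) +++ (\<lambda>s. H (s, 1))) ((\<lambda>s. H (s, 0)) +++ (\<lambda>t. H (1, t)))"
proof -
  let ?I = "{0..1} \<times> {0..1} :: (real \<times> real) set"
  let ?p = "linepath (0, 0) (0, 1) +++ linepath (0, 1) (1, 1) :: real \<Rightarrow> real \<times> real"
  let ?q = "linepath (0, 0) (1, 0) +++ linepath (1, 0) (1, 1) :: real \<Rightarrow> real \<times> real"
  have c: "convex ?I" by (intro convex_Times convex_real_interval)
  have seg: "closed_segment x y \<subseteq> ?I" if "x \<in> ?I" "y \<in> ?I" for x y using that c convex_contains_segment by blast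
  have p: "path_image ?p \<subseteq> ?I" and q: "path_image ?q \<subseteq> ?I"
    by (rule subset_path_image_join; simp only: path_image_linepath; rule seg; simp)+
  have "homotopic_paths ?I ?p ?q"
  proof (rule homotopic_paths_linear)
    fix t :: real assume "t \<in> {0..1}"
    then show "closed_segment (?p t) (?q t) \<subseteq> ?I" using p q by (intro seg) (auto simp: path_image_def)
  qed simp_all
  then have "homotopic_paths S (H \<circ> ?p) (H \<circ> ?q)" by (rule homotopic_paths_continuous_image[OF _ H])
  moreover have "H \<circ> ?p = (\<lambda>t. H (0, t)) +++ (\<lambda>s. H (s, 1))" "H \<circ> ?q = (\<lambda>s. H (s, 0)) +++ (\<lambda>t. H (1, t))"
    by (auto simp: joinpaths_def linepath_def)
  ultimately show ?thesis by simp
qed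

definition free_homotopic :: "'a::topological_space set \<Rightarrow> 'a set \<Rightarrow> 'a set \<Rightarrow> (real \<Rightarrow> 'a) \<Rightarrow> (real \<Rightarrow> 'a) \<Rightarrow> bool" where
  "free_homotopic B W W' = homotopic_with_canon (\<lambda>k. pathstart k \<in> W \<and> pathfinish k \<in> W') {0..1} B"

lemma word_class_free: "word_class d a w w' g = {h. free_homotopic (Conf d a) (Conf_word d a w) (Conf_word d a w') g h}"
  by (simp add: word_class_def free_homotopic_def)

lemma free_homotopic_iff:
  "free_homotopic B W W' g h \<longleftrightarrow>
    (\<exists>H. continuous_on ({0..1::real} \<times> {0..1}) H \<and> H \<in> {0..1} \<times> {0..1} \<rightarrow> B \<and>
      (\<forall>t\<in>{0..1}. H (0, t) = g t) \<and> (\<forall>t\<in>{0..1}. H (1, t) = h t) \<and>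
      (\<forall>s\<in>{0..1}. H (s, 0) \<in> W \<and> H (s, 1) \<in> W'))"
proof -
  have "free_homotopic B W W' g h \<longleftrightarrow>
    (\<exists>H. continuous_map (prod_topology (top_of_set {0..1::real}) (top_of_set {0..1})) (top_of_set B) H \<and>
      (\<forall>t\<in>topspace (top_of_set {0..1}). H (0, t) = g t) \<and> (\<forall>t\<in>topspace (top_of_set {0..1}). H (1, t) = h t) \<and>
      (\<forall>s\<in>{0..1}. pathstart (\<lambda>t. H (s, t)) \<in> W \<and> pathfinish (\<lambda>t. H (s, t)) \<in> W'))"
    unfolding free_homotopic_def by (rule homotopic_with) (auto simp: pathstart_def pathfinish_def)
  then show ?thesis
    by (simp add: prod_topology_subtopology_eu image_subset_iff_funcset pathstart_def pathfinish_def conj_assoc)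
qed

lemma free_homotopicI:
  fixes H :: "real \<Rightarrow> real \<Rightarrow> 'a::topological_space"
  assumes "continuous_on ({0..1} \<times> {0..1}) (\<lambda>z. H (fst z) (snd z))"
    and "\<And>s t. \<lbrakk>s \<in> {0..1}; t \<in> {0..1}\<rbrakk> \<Longrightarrow> H s t \<in> B"
    and "\<And>t. t \<in> {0..1} \<Longrightarrow> H 0 t = g t" "\<And>t. t \<in> {0..1} \<Longrightarrow> H 1 t = h t"
    and "\<And>s. s \<in> {0..1} \<Longrightarrow> H s 0 \<in> W" "\<And>s. s \<in> {0..1} \<Longrightarrow> H s 1 \<in> W'"
  shows "free_homotopic B W W' g h"
  unfolding free_homotopic_iff by (rule exI[of _ "\<lambda>z. H (fst z) (snd z)"]) (use assms in auto)

lemma free_homotopicE: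
  assumes "free_homotopic B W W' g h"
  obtains H where "continuous_on ({0..1::real} \<times> {0..1::real}) H" "\<forall>s\<in>{0..1}. \<forall>t\<in>{0..1}. H (s, t) \<in> B"
    and "\<forall>t\<in>{0..1}. H (0, t) = g t" "\<forall>t\<in>{0..1}. H (1, t) = h t"
    and "\<forall>s\<in>{0..1}. H (s, 0) \<in> W" "\<forall>s\<in>{0..1}. H (s, 1) \<in> W'"
proof -
  obtain H where H: "continuous_on ({0..1::real} \<times> {0..1::real}) H" "H \<in> {0..1} \<times> {0..1} \<rightarrow> B"
      "\<forall>t\<in>{0..1}. H (0, t) = g t" "\<forall>t\<in>{0..1}. H (1, t) = h t"
      "\<forall>s\<in>{0..1}. H (s, 0) \<in> W \<and> H (s, 1) \<in> W'" using assms unfolding free_homotopic_iff by blast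
  show ?thesis by (rule that[OF H(1)]) (use H in auto)
qed

lemma free_homotopic_sym: "free_homotopic B W W' g h \<Longrightarrow> free_homotopic B W W' h g"
  unfolding free_homotopic_def by (rule homotopic_with_symD)

lemma free_homotopic_trans [trans]:
  "free_homotopic B W W' g h \<Longrightarrow> free_homotopic B W W' h k \<Longrightarrow> free_homotopic B W W' g k"
  unfolding free_homotopic_def by (rule homotopic_with_trans)

lemma free_homotopic_path:
  assumes "free_homotopic B W W' g h"
  shows "path g" "path_image g \<subseteq> B" "pathstart g \<in> W" "pathfinish g \<in> W'"
proof -
  note A = assms[unfolded free_homotopic_def]
  show "path g" "path_image g \<subseteq> B"
    using homotopic_with_imp_continuous[OF A] homotopic_with_imp_subset1[OF A] by (auto simp: path_def path_image_def)
  show "pathstart g \<in> W" "pathfinish g \<in> W'" using homotopic_with_imp_property[OF A] by auto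
qed

lemma free_homotopic_paths:
  assumes "homotopic_paths B g h" "pathstart g \<in> W" "pathfinish g \<in> W'"
  shows "free_homotopic B W W' g h"
proof -
  obtain H where "continuous_on ({0..1::real} \<times> {0..1::real}) H" "H \<in> {0..1} \<times> {0..1} \<rightarrow> B"
    "\<forall>x\<in>{0..1}. H (0, x) = g x" "\<forall>x\<in>{0..1}. H (1, x) = h x"
    "\<forall>t\<in>{0..1::real}. pathstart (H \<circ> Pair t) = pathstart g \<and> pathfinish (H \<circ> Pair t) = pathfinish g"
    using assms(1) unfolding homotopic_paths by blast
  then show ?thesis unfolding free_homotopic_iff
    using assms(2,3) by (intro exI[of _ H]) (auto simp: pathstart_def pathfinish_def)
qed

lemma free_homotopic_refl:
  "\<lbrakk>path g; path_image g \<subseteq> B; pathstart g \<in> W; pathfinish g \<in> W'\<rbrakk> \<Longrightarrow> free_homotopic B W W' g g"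
  by (rule free_homotopic_paths) auto

text \<open>The homotopy only moves the parameter along one fixed path; both lemmas below, which
  slide an end along a path, are instances.\<close>

lemma free_homotopic_reparametrize:
  fixes u :: "real \<Rightarrow> real \<Rightarrow> real" and k :: "real \<Rightarrow> 'a::topological_space"
  assumes k: "path k" "path_image k \<subseteq> B" and u: "continuous_on ({0..1} \<times> {0..1}) (\<lambda>z. u (fst z) (snd z))"
    and u01: "\<And>s t. \<lbrakk>s \<in> {0..1}; t \<in> {0..1}\<rbrakk> \<Longrightarrow> u s t \<in> {0..1}"
    and ends: "\<And>t. t \<in> {0..1} \<Longrightarrow> k (u 0 t) = g t" "\<And>t. t \<in> {0..1} \<Longrightarrow> k (u 1 t) = h t"
    and W: "\<And>s. s \<in> {0..1} \<Longrightarrow> k (u s 0) \<in> W" "\<And>s. s \<in> {0..1} \<Longrightarrow> k (u s 1) \<in> W'"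
  shows "free_homotopic B W W' g h"
proof (rule free_homotopicI[where H = "\<lambda>s t. k (u s t)"])
  show "continuous_on ({0..1} \<times> {0..1}) (\<lambda>z. k (u (fst z) (snd z)))"
    by (rule continuous_on_compose2[OF k(1)[unfolded path_def] u]) (use u01 in auto)
qed (use ends W u01 k(2) in \<open>auto simp: path_image_def\<close>)

text \<open>Moving the starting point of \<open>\<alpha> +++ h\<close> along \<open>\<alpha>\<close> removes \<open>\<alpha>\<close>.\<close>

lemma free_homotopic_join_left:
  assumes \<alpha>: "path \<alpha>" "path_image \<alpha> \<subseteq> W" "W \<subseteq> B" and h: "path h" "path_image h \<subseteq> B"
    and e: "pathfinish \<alpha> = pathstart h" "pathfinish h \<in> W'"
  shows "free_homotopic B W W' (\<alpha> +++ h) h"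
proof (rule free_homotopic_reparametrize[where k = "\<alpha> +++ h" and u = "\<lambda>s t. (1 - s) * t + s * (1/2 + t/2)"])
  show "path (\<alpha> +++ h)" "path_image (\<alpha> +++ h) \<subseteq> B" using assms by (auto simp: path_image_join)
  show "continuous_on ({0..1} \<times> {0..1}) (\<lambda>z::real \<times> real. (1 - fst z) * snd z + fst z * (1/2 + snd z/2))"
    by (auto intro!: continuous_intros)
  fix s t :: real assume s: "s \<in> {0..1}"
  show "(\<alpha> +++ h) ((1 - s) * 0 + s * (1/2 + 0/2)) \<in> W"
    using s \<alpha>(2) by (auto simp: joinpaths_def path_image_def)
  have "(1 - s) * 1 + s * (1/2 + 1/2) = 1" by simp
  then show "(\<alpha> +++ h) ((1 - s) * 1 + s * (1/2 + 1/2)) \<in> W'"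
    using e(2) by (simp only: ) (simp add: joinpaths_def pathfinish_def)
  assume t: "t \<in> {0..1}"
  have "(1 - s) * t + s * (1/2 + t/2) \<le> (1 - s) * 1 + s * 1"
    using s t by (intro add_mono mult_left_mono) auto
  then show "(1 - s) * t + s * (1/2 + t/2) \<in> {0..1}" using s t by auto
next
  fix t :: real assume "t \<in> {0..1}"
  then show "(\<alpha> +++ h) ((1 - 1) * t + 1 * (1/2 + t/2)) = h t"
    using e(1) by (cases "t = 0") (auto simp: joinpaths_def pathfinish_def pathstart_def)
qed simp_all

text \<open>Dual to the previous lemma: the parameter interval is shrunk to its first half, where
  \<open>g +++ \<beta>\<close> runs through \<open>g\<close>, and meanwhile the end slides back
  along \<open>\<beta>\<close> inside \<open>W'\<close>.\<close>

lemma free_homotopic_join_right: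
  assumes \<beta>: "path \<beta>" "path_image \<beta> \<subseteq> W'" "W' \<subseteq> B" and g: "path g" "path_image g \<subseteq> B"
    and e: "pathfinish g = pathstart \<beta>" "pathstart g \<in> W"
  shows "free_homotopic B W W' (g +++ \<beta>) g"
proof (rule free_homotopic_reparametrize[where k = "g +++ \<beta>" and u = "\<lambda>s t. (1 - s) * t + s * (t/2)"])
  show "path (g +++ \<beta>)" "path_image (g +++ \<beta>) \<subseteq> B" using assms by (auto simp: path_image_join)
  show "continuous_on ({0..1} \<times> {0..1}) (\<lambda>z::real \<times> real. (1 - fst z) * snd z + fst z * (snd z/2))"
    by (auto intro!: continuous_intros)
  fix s t :: real assume s: "s \<in> {0..1}"
  show "(g +++ \<beta>) ((1 - s) * 0 + s * (0/2)) \<in> W"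
    using e(2) by (simp add: joinpaths_def pathstart_def)
  have "(g +++ \<beta>) (1 - s / 2) \<in> W'"
  \<comment> \<open>At \<open>s = 1\<close> the parameter is 1/2, which \<open>+++\<close> assigns
    to \<open>g\<close>; the value is still the point where \<open>\<beta>\<close> starts.\<close>
  proof (cases "s = 1")
    case True then show ?thesis using e(1) \<beta>(2) by (auto simp: joinpaths_def path_image_def pathfinish_def pathstart_def)
  next
    case False then show ?thesis using s \<beta>(2) by (auto simp: joinpaths_def path_image_def)
  qed
  moreover have "(1 - s) * 1 + s * (1/2) = 1 - s / 2" by simp
  ultimately show "(g +++ \<beta>) ((1 - s) * 1 + s * (1/2)) \<in> W'" by (simp only:)
  assume t: "t \<in> {0..1}"
  have "(1 - s) * t + s * (t/2) \<le> (1 - s) * 1 + s * 1"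
    using s t by (intro add_mono mult_left_mono) auto
  then show "(1 - s) * t + s * (t/2) \<in> {0..1}" using s t by auto
next
  fix t :: real assume "t \<in> {0..1}"
  then show "(g +++ \<beta>) ((1 - 1) * t + 1 * (t/2)) = g t"
    by (auto simp: joinpaths_def)
qed simp_all

text \<open>The square of the homotopy has \<open>g\<close>, \<open>h\<close> and the tracks of the
  two ends as its sides. Free homotopies are thereby reduced to homotopies with fixed ends.\<close>

lemma free_homotopic_tracks:
  assumes "free_homotopic B W W' g h"
  obtains \<alpha> \<beta> where "path \<alpha>" "path_image \<alpha> \<subseteq> W" "pathstart \<alpha> = pathstart g" "pathfinish \<alpha> = pathstart h"
    and "path \<beta>" "path_image \<beta> \<subseteq> W'" "pathstart \<beta> = pathfinish g" "pathfinish \<beta> = pathfinish h"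
    and "homotopic_paths B (g +++ \<beta>) (\<alpha> +++ h)"
proof -
  obtain H where H: "continuous_on ({0..1::real} \<times> {0..1::real}) H" "\<forall>s\<in>{0..1}. \<forall>t\<in>{0..1}. H (s, t) \<in> B"
    "\<forall>t\<in>{0..1}. H (0, t) = g t" "\<forall>t\<in>{0..1}. H (1, t) = h t"
    "\<forall>s\<in>{0..1}. H (s, 0) \<in> W" "\<forall>s\<in>{0..1}. H (s, 1) \<in> W'"
    using assms by (rule free_homotopicE)
  note p = free_homotopic_path[OF assms] and q = free_homotopic_path[OF free_homotopic_sym[OF assms]]
  have sq: "homotopic_paths B ((\<lambda>t. H (0, t)) +++ (\<lambda>s. H (s, 1))) ((\<lambda>s. H (s, 0)) +++ (\<lambda>t. H (1, t)))"
    by (rule homotopic_paths_square) (use H in auto)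
  have c: "path (\<lambda>s. H (s, t))" if "t \<in> {0..1}" for t
    unfolding path_def by (rule continuous_on_compose2[OF H(1)]) (use that in \<open>auto intro!: continuous_intros\<close>)
  have e: "pathfinish g = pathstart (\<lambda>s. H (s, 1))" "pathfinish (\<lambda>s. H (s, 0)) = pathstart h"
    using H(3,4) by (simp_all add: pathstart_def pathfinish_def)
  have i: "path_image (\<lambda>s. H (s, t)) \<subseteq> B" if "t \<in> {0..1}" for t
    using H(2) that by (auto simp: path_image_def)
  have "homotopic_paths B (g +++ (\<lambda>s. H (s, 1))) ((\<lambda>t. H (0, t)) +++ (\<lambda>s. H (s, 1)))"
  proof (rule homotopic_paths_eq)
    show "path (g +++ (\<lambda>s. H (s, 1)))" "path_image (g +++ (\<lambda>s. H (s, 1))) \<subseteq> B"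
      using p c[of 1] i[of 1] e by (simp_all add: path_image_join)
  qed (use H(3) in \<open>auto simp: joinpaths_def\<close>)
  moreover have "homotopic_paths B ((\<lambda>s. H (s, 0)) +++ h) ((\<lambda>s. H (s, 0)) +++ (\<lambda>t. H (1, t)))"
  proof (rule homotopic_paths_eq)
    show "path ((\<lambda>s. H (s, 0)) +++ h)" "path_image ((\<lambda>s. H (s, 0)) +++ h) \<subseteq> B"
      using q c[of 0] i[of 0] e by (simp_all add: path_image_join)
  qed (use H(4) in \<open>auto simp: joinpaths_def\<close>)
  ultimately have "homotopic_paths B (g +++ (\<lambda>s. H (s, 1))) ((\<lambda>s. H (s, 0)) +++ h)"
    using sq homotopic_paths_trans homotopic_paths_sym by blast
  then show ?thesis
    by (rule that[of "\<lambda>s. H (s, 0)" "\<lambda>s. H (s, 1)", rotated -1])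
      (use c[of 0] c[of 1] H in \<open>auto simp: path_image_def pathstart_def pathfinish_def\<close>)
qed

text \<open>Every path component of \<open>W\<close> is simply connected; the empty set is
  included.\<close>

definition paths_homotopic_in :: "'a::topological_space set \<Rightarrow> bool" where
  "paths_homotopic_in W \<longleftrightarrow> (\<forall>p q. path p \<and> path_image p \<subseteq> W \<and> path q \<and> path_image q \<subseteq> W \<and>
     pathstart p = pathstart q \<and> pathfinish p = pathfinish q \<longrightarrow> homotopic_paths W p q)"

text \<open>The tracks of the ends are loops in \<open>W\<close> and \<open>W'\<close>, hence null
  homotopic, and can be deleted from \<open>g +++ \<beta>\<close> and \<open>\<alpha> +++ h\<close>.
  So letting the ends move adds no identification between paths with the same ends.\<close>

lemma free_homotopic_same_ends:
  assumes W: "paths_homotopic_in W" "W \<subseteq> B" and W': "paths_homotopic_in W'" "W' \<subseteq> B"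
    and gh: "free_homotopic B W W' g h" and e: "pathstart g = pathstart h" "pathfinish g = pathfinish h"
  shows "homotopic_paths B g h"
proof -
  obtain \<alpha> \<beta> where \<alpha>: "path \<alpha>" "path_image \<alpha> \<subseteq> W" "pathstart \<alpha> = pathstart g" "pathfinish \<alpha> = pathstart h"
    and \<beta>: "path \<beta>" "path_image \<beta> \<subseteq> W'" "pathstart \<beta> = pathfinish g" "pathfinish \<beta> = pathfinish h"
    and sq: "homotopic_paths B (g +++ \<beta>) (\<alpha> +++ h)"
    using gh by (rule free_homotopic_tracks)
  note p = free_homotopic_path[OF gh] and q = free_homotopic_path[OF free_homotopic_sym[OF gh]]
  have "homotopic_paths W \<alpha> (\<lambda>_. pathstart g)"
    using W(1) \<alpha> p e unfolding paths_homotopic_in_def by (simp add: path_const)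
  then have a: "homotopic_paths B \<alpha> (\<lambda>_. pathstart g)" using W(2) homotopic_paths_subset by blast
  have "homotopic_paths W' \<beta> (\<lambda>_. pathfinish g)"
    using W'(1) \<beta> p e unfolding paths_homotopic_in_def by (simp add: path_const)
  then have b: "homotopic_paths B \<beta> (\<lambda>_. pathfinish g)" using W'(2) homotopic_paths_subset by blast
  have "homotopic_paths B g (g +++ (\<lambda>_. pathfinish g))"
    using homotopic_paths_const_right p homotopic_paths_sym by blast
  also have "homotopic_paths B (g +++ (\<lambda>_. pathfinish g)) (g +++ \<beta>)"
    using b p \<beta> by (intro homotopic_paths_join homotopic_paths_sym[OF b]) (auto simp: path_const)
  also note sq
  also have "homotopic_paths B (\<alpha> +++ h) ((\<lambda>_. pathstart g) +++ h)"
    using a q \<alpha> by (intro homotopic_paths_join a) auto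
  also have "homotopic_paths B ((\<lambda>_. pathstart g) +++ h) h"
    using q e by (intro homotopic_paths_const_left) auto
  finally show ?thesis .
qed

text \<open>In the middle there are two tracks in \<open>W'\<close> with common ends, one from each
  homotopy; by the hypothesis on \<open>W'\<close> they may be exchanged. The outer tracks disappear
  by sliding the free ends. This is what makes the composition of classes well defined.\<close>

lemma free_homotopic_join:
  assumes W: "W \<subseteq> B" and W': "paths_homotopic_in W'" "W' \<subseteq> B" and W'': "W'' \<subseteq> B"
    and g: "free_homotopic B W W' g g'" and h: "free_homotopic B W' W'' h h'"
    and e: "pathfinish g = pathstart h" "pathfinish g' = pathstart h'"
  shows "free_homotopic B W W'' (g +++ h) (g' +++ h')"
proof -
  obtain \<alpha> \<beta> where \<alpha>: "path \<alpha>" "path_image \<alpha> \<subseteq> W" "pathstart \<alpha> = pathstart g" "pathfinish \<alpha> = pathstart g'"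
    and \<beta>: "path \<beta>" "path_image \<beta> \<subseteq> W'" "pathstart \<beta> = pathfinish g" "pathfinish \<beta> = pathfinish g'"
    and sqg: "homotopic_paths B (g +++ \<beta>) (\<alpha> +++ g')"
    using g by (rule free_homotopic_tracks)
  obtain \<gamma> \<delta> where \<gamma>: "path \<gamma>" "path_image \<gamma> \<subseteq> W'" "pathstart \<gamma> = pathstart h" "pathfinish \<gamma> = pathstart h'"
    and \<delta>: "path \<delta>" "path_image \<delta> \<subseteq> W''" "pathstart \<delta> = pathfinish h" "pathfinish \<delta> = pathfinish h'"
    and sqh: "homotopic_paths B (h +++ \<delta>) (\<gamma> +++ h')"
    using h by (rule free_homotopic_tracks)
  note pg = free_homotopic_path[OF g] and pg' = free_homotopic_path[OF free_homotopic_sym[OF g]]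
  note ph = free_homotopic_path[OF h] and ph' = free_homotopic_path[OF free_homotopic_sym[OF h]]
  have B: "path_image \<alpha> \<subseteq> B" "path_image \<beta> \<subseteq> B" "path_image \<gamma> \<subseteq> B" "path_image \<delta> \<subseteq> B"
    using \<alpha> \<beta> \<gamma> \<delta> W W' W'' by auto
  have "homotopic_paths W' \<gamma> \<beta>"
    using W'(1) \<beta> \<gamma> e unfolding paths_homotopic_in_def by simp
  then have \<gamma>\<beta>: "homotopic_paths B \<gamma> \<beta>" using W'(2) homotopic_paths_subset by blast
  have 1: "free_homotopic B W W'' (g +++ h) ((g +++ h) +++ \<delta>)"
    by (rule free_homotopic_sym[OF free_homotopic_join_right]) (use pg ph \<delta> W'' e in \<open>auto simp: path_image_join\<close>)
  have "homotopic_paths B ((g +++ h) +++ \<delta>) (g +++ (h +++ \<delta>))"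
    by (rule homotopic_paths_sym[OF homotopic_paths_assoc]) (use pg ph \<delta> B e in auto)
  also have "homotopic_paths B (g +++ (h +++ \<delta>)) (g +++ (\<gamma> +++ h'))"
    by (rule homotopic_paths_join) (use pg sqh e in auto)
  also have "homotopic_paths B (g +++ (\<gamma> +++ h')) (g +++ (\<beta> +++ h'))"
    by (intro homotopic_paths_join) (use pg ph' \<gamma>\<beta> \<gamma> \<beta> e in auto)
  also have "homotopic_paths B (g +++ (\<beta> +++ h')) ((g +++ \<beta>) +++ h')"
    by (rule homotopic_paths_assoc) (use pg ph' \<beta> B e in auto)
  also have "homotopic_paths B ((g +++ \<beta>) +++ h') ((\<alpha> +++ g') +++ h')"
    by (rule homotopic_paths_join) (use ph' sqg \<beta> e in auto)
  also have "homotopic_paths B ((\<alpha> +++ g') +++ h') (\<alpha> +++ (g' +++ h'))"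
    by (rule homotopic_paths_sym[OF homotopic_paths_assoc]) (use pg' ph' \<alpha> B e in auto)
  finally have "free_homotopic B W W'' ((g +++ h) +++ \<delta>) (\<alpha> +++ (g' +++ h'))"
    by (rule free_homotopic_paths) (use pg \<delta> ph' in auto)
  moreover have "free_homotopic B W W'' (\<alpha> +++ (g' +++ h')) (g' +++ h')"
    by (rule free_homotopic_join_left) (use pg' ph' \<alpha> W e in \<open>auto simp: path_image_join\<close>)
  ultimately show ?thesis using 1 free_homotopic_trans by blast
qed

lemma free_homotopic_image:
  assumes g: "free_homotopic B W W' g h" and f: "continuous_on B f" "f \<in> B \<rightarrow> B'" "f \<in> W \<rightarrow> V" "f \<in> W' \<rightarrow> V'"
  shows "free_homotopic B' V V' (\<lambda>t. f (g t)) (\<lambda>t. f (h t))"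
proof -
  obtain H where H: "continuous_on ({0..1::real} \<times> {0..1::real}) H" "\<forall>s\<in>{0..1}. \<forall>t\<in>{0..1}. H (s, t) \<in> B"
    "\<forall>t\<in>{0..1}. H (0, t) = g t" "\<forall>t\<in>{0..1}. H (1, t) = h t"
    "\<forall>s\<in>{0..1}. H (s, 0) \<in> W" "\<forall>s\<in>{0..1}. H (s, 1) \<in> W'"
    using g by (rule free_homotopicE)
  show ?thesis
  proof (rule free_homotopicI[where H = "\<lambda>s t. f (H (s, t))"])
    show "continuous_on ({0..1} \<times> {0..1}) (\<lambda>z. f (H (fst z, snd z)))"
      by (rule continuous_on_compose2[OF f(1)]) (use H in auto)
  qed (use H f in auto)
qed

section \<open>The centers form an equivalence of fundamental groupoids\<close>

definition mix :: "real \<Rightarrow> (input \<Rightarrow> complex) \<Rightarrow> (input \<Rightarrow> complex) \<Rightarrow> input \<Rightarrow> complex" where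
  "mix s x y = (\<lambda>p. of_real (1 - s) * x p + of_real s * y p)"

lemma mix_simps [simp]: "mix 0 x y = x" "mix 1 x y = y" "mix s x x = x"
  by (auto simp: mix_def algebra_simps)

lemma continuous_on_mix:
  assumes "continuous_on S s" "continuous_on S f" "continuous_on S g"
  shows "continuous_on S (\<lambda>x. mix (s x) (f x) (g x))"
  unfolding mix_def
  by (rule continuous_on_coordinatewise_then_product)
    (intro continuous_on_add continuous_on_mult continuous_on_of_real continuous_on_diff continuous_on_const
      assms(1) continuous_on_coordinate[OF assms(2)] continuous_on_coordinate[OF assms(3)])

lemma sorted_wrt_Re_inj_on: "sorted_wrt (\<lambda>p q. Re (f p) < Re (f q)) w \<Longrightarrow> inj_on f (set w)"
proof -
  assume "sorted_wrt (\<lambda>p q. Re (f p) < Re (f q)) w"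
  then have "sorted_wrt (<) (map (\<lambda>p. Re (f p)) w)" by (simp add: sorted_wrt_map)
  then have "distinct (map (\<lambda>p. Re (f p)) w)" by (simp add: strict_sorted_iff)
  then show ?thesis by (auto simp: distinct_map inj_on_def)
qed

lemma Conf_word_subset: "Conf_word d a w \<subseteq> Conf d a"
  by (auto simp: Conf_word_def)

lemma sorted_wrt_Re_mix:
  assumes "sorted_wrt (\<lambda>p q. Re (x p) < Re (x q)) w" "sorted_wrt (\<lambda>p q. Re (y p) < Re (y q)) w" "s \<in> {0..1}"
  shows "sorted_wrt (\<lambda>p q. Re (mix s x y p) < Re (mix s x y q)) w"
proof -
  have "Re (mix s x y p) < Re (mix s x y q)" if "Re (x p) < Re (x q)" "Re (y p) < Re (y q)" for p q
  proof (cases "s = 1")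
    case False
    then have "(1 - s) * Re (x p) + s * Re (y p) < (1 - s) * Re (x q) + s * Re (y q)"
      using that assms(3) by (intro add_less_le_mono mult_strict_left_mono mult_left_mono) auto
    then show ?thesis by (simp add: mix_def)
  qed (use that in simp)
  then show ?thesis using assms(1,2) unfolding sorted_wrt_iff_nth_less by blast
qed

text \<open>Being pairwise distinct is not a convex condition, but it follows from the strict order
  of the real parts. That order and the conditions on norms and heights are convex, hence so is
  \<open>Conf_word\<close>.\<close>

lemma mix_Conf_word:
  assumes w: "w \<in> words d a" and x: "x \<in> Conf_word d a w" and y: "y \<in> Conf_word d a w" and s: "s \<in> {0..1}"
  shows "mix s x y \<in> Conf_word d a w"
proof -
  have xc: "x \<in> Conf d a" and yc: "y \<in> Conf d a" using x y Conf_word_subset by blast+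
  note X = ConfD[OF xc] and Y = ConfD[OF yc]
  have st: "sorted_wrt (\<lambda>p q. Re (mix s x y p) < Re (mix s x y q)) w"
    using x y s by (intro sorted_wrt_Re_mix) (auto simp: Conf_word_def)
  have conv: "mix s x y p \<in> C" if "convex C" "x p \<in> C" "y p \<in> C" for C p
    using convexD[OF that, of "1 - s" s] s by (simp add: mix_def scaleR_conv_of_real)
  have "mix s x y \<in> Conf d a"
    unfolding Conf_iff
  proof (intro conjI ballI impI allI)
    show "inj_on (mix s x y) (inputs a)" using sorted_wrt_Re_inj_on[OF st] w by (simp add: words_def)
    fix p assume p: "p \<in> inputs a"
    show "norm (mix s x y p) \<le> 1" using conv[of "cball 0 1" p] X(3)[OF p] Y(3)[OF p] by simp
    show "norm (mix s x y p) < 1" if "d = Closed" using conv[of "ball 0 1" p] X(4)[OF p that] Y(4)[OF p that] by simp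
    show "0 < Im (mix s x y p)" if "d = Open \<and> fst p = Closed"
      using conv[OF convex_halfspace_Im_gt, of p 0] X(6)[OF p] Y(6)[OF p] that by simp
    show "Im (mix s x y p) = 0" if "d = Open \<and> fst p = Open"
      using X(5)[OF p] Y(5)[OF p] that by (simp add: mix_def)
  qed (use X Y in \<open>auto simp: mix_def\<close>)
  then show ?thesis using st by (simp add: Conf_word_def)
qed

lemma paths_homotopic_in_Conf_word:
  assumes w: "w \<in> words d a"
  shows "paths_homotopic_in (Conf_word d a w)"
  unfolding paths_homotopic_in_def
proof (intro allI impI; elim conjE)
  fix p q :: "real \<Rightarrow> input \<Rightarrow> complex"
  assume p: "path p" "path_image p \<subseteq> Conf_word d a w" and q: "path q" "path_image q \<subseteq> Conf_word d a w"
    and e: "pathstart p = pathstart q" "pathfinish p = pathfinish q"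
  show "homotopic_paths (Conf_word d a w) p q"
    unfolding homotopic_paths
  proof (intro exI[of _ "\<lambda>z. mix (fst z) (p (snd z)) (q (snd z))"] conjI)
    have "continuous_on ({0..1} \<times> {0..1}) (\<lambda>z. p (snd z))" "continuous_on ({0..1} \<times> {0..1}) (\<lambda>z. q (snd z))"
      by (rule continuous_on_compose2[OF p(1)[unfolded path_def] continuous_on_snd[OF continuous_on_id]], force,
          rule continuous_on_compose2[OF q(1)[unfolded path_def] continuous_on_snd[OF continuous_on_id]], force)
    then show "continuous_on ({0..1} \<times> {0..1}) (\<lambda>z. mix (fst z) (p (snd z)) (q (snd z)))"
      by (intro continuous_on_mix continuous_on_fst[OF continuous_on_id])
    show "(\<lambda>z. mix (fst z) (p (snd z)) (q (snd z))) \<in> {0..1} \<times> {0..1} \<rightarrow> Conf_word d a w"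
      using p(2) q(2) by (auto intro!: mix_Conf_word[OF w] simp: path_image_def)
  qed (use e in \<open>auto simp: pathstart_def pathfinish_def\<close>)
qed

lemma path_mix:
  assumes w: "w \<in> words d a" and x: "x \<in> Conf_word d a w" and y: "y \<in> Conf_word d a w"
  shows "path (\<lambda>t. mix t x y)" "path_image (\<lambda>t. mix t x y) \<subseteq> Conf_word d a w"
    "pathstart (\<lambda>t. mix t x y) = x" "pathfinish (\<lambda>t. mix t x y) = y"
proof -
  show "path (\<lambda>t. mix t x y)"
    unfolding path_def by (intro continuous_on_mix continuous_on_id continuous_on_const)
  show "path_image (\<lambda>t. mix t x y) \<subseteq> Conf_word d a w"
    using mix_Conf_word[OF w x y] by (auto simp: path_image_def)
qed (simp_all add: pathstart_def pathfinish_def)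

lemma path_centers:
  assumes "path g" "path_image g \<subseteq> SC_space d a"
  shows "path (\<lambda>t. centers (g t))" "path_image (\<lambda>t. centers (g t)) \<subseteq> Conf d a"
    "pathstart (\<lambda>t. centers (g t)) = centers (pathstart g)" "pathfinish (\<lambda>t. centers (g t)) = centers (pathfinish g)"
  using assms centers_Conf by (auto simp: path_def path_image_def pathstart_def pathfinish_def intro: continuous_on_centers)

lemma path_shrink:
  assumes x: "x \<in> SC_space d a"
  shows "path (\<lambda>s. shrink d a s x)" "path_image (\<lambda>s. shrink d a s x) \<subseteq> SC_space d a"
    "pathstart (\<lambda>s. shrink d a s x) = x" "pathfinish (\<lambda>s. shrink d a s x) = sect d a (centers x)"
proof -
  show "path (\<lambda>s. shrink d a s x)"
    unfolding path_def by (intro continuous_on_shrink continuous_on_id continuous_on_const)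
  show "path_image (\<lambda>s. shrink d a s x) \<subseteq> SC_space d a" using shrink_SC_space[OF x] by (auto simp: path_image_def)
qed (simp_all add: pathstart_def pathfinish_def shrink_0[OF x] shrink_1)

lemma centers_shrink_Conf_word:
  assumes x: "x \<in> SC_space d a" and w: "centers x \<in> Conf_word d a w" and s: "s \<in> {0..1}"
  shows "centers (shrink d a s x) \<in> Conf_word d a w"
  unfolding centers_shrink[OF x] using scale_Conf_word[OF w, of "1 - s / 2"] s by simp

text \<open>Go from \<open>x\<close> along \<open>shrink\<close> to
  \<open>sect d a (centers x)\<close>, follow \<open>sect d a\<close> applied to \<open>k\<close>,
  and return to \<open>y\<close>. Shrinking only scales the centers, so the end pieces stay in
  \<open>Conf_word\<close> and are absorbed by the free ends. The words are quantified in the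
  conclusion because the lift is also used for an \<open>x\<close> whose centers may have coinciding
  real parts.\<close>

lemma lift_path:
  assumes x: "x \<in> SC_space d a" and y: "y \<in> SC_space d a"
    and k: "path k" "path_image k \<subseteq> Conf d a" "pathstart k = centers x" "pathfinish k = centers y"
  shows "\<exists>g. path g \<and> path_image g \<subseteq> SC_space d a \<and> pathstart g = x \<and> pathfinish g = y \<and>
    (\<forall>w w'. centers x \<in> Conf_word d a w \<and> centers y \<in> Conf_word d a w' \<longrightarrow>
      free_homotopic (Conf d a) (Conf_word d a w) (Conf_word d a w') (\<lambda>t. centers (g t)) k)"
proof -
  let ?X = "\<lambda>s. shrink d a s x" and ?Y = "\<lambda>s. shrink d a s y" and ?K = "\<lambda>t. sect d a (k t)"
  let ?g = "(?X +++ ?K) +++ reversepath ?Y"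
  note X = path_shrink[OF x] and Y = path_shrink[OF y]
  have K: "path ?K" "path_image ?K \<subseteq> SC_space d a" "pathstart ?K = sect d a (centers x)" "pathfinish ?K = sect d a (centers y)"
    using k sect_SC_space continuous_on_sect by (auto simp: path_def path_image_def pathstart_def pathfinish_def)
  have g: "path ?g" "path_image ?g \<subseteq> SC_space d a" "pathstart ?g = x" "pathfinish ?g = y"
    using X Y K by (simp_all add: path_image_join)
  moreover have "free_homotopic (Conf d a) (Conf_word d a w) (Conf_word d a w') (\<lambda>t. centers (?g t)) k"
    if w: "centers x \<in> Conf_word d a w" "centers y \<in> Conf_word d a w'" for w w'
  proof -
    let ?W = "Conf_word d a w" and ?W' = "Conf_word d a w'"
    note cX = path_centers[OF X(1,2)] and cY = path_centers[OF Y(1,2)] and cK = path_centers[OF K(1,2)]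
    have iX: "path_image (\<lambda>s. centers (?X s)) \<subseteq> ?W" and iY: "path_image (\<lambda>s. centers (?Y s)) \<subseteq> ?W'"
      using centers_shrink_Conf_word[OF x w(1)] centers_shrink_Conf_word[OF y w(2)] by (auto simp: path_image_def)
    have e: "(\<lambda>t. centers (?g t)) = ((\<lambda>s. centers (?X s)) +++ (\<lambda>t. centers (?K t))) +++ reversepath (\<lambda>s. centers (?Y s))"
      by (auto simp: joinpaths_def reversepath_def)
    have f: "pathfinish (\<lambda>t. centers (?K t)) \<in> ?W'" "pathstart (\<lambda>s. centers (?X s)) \<in> ?W"
      "pathstart (\<lambda>t. centers (?K t)) \<in> ?W"
      using iX iY cX cY cK X Y K path_image_def by (metis (no_types, lifting) pathfinish_in_path_image pathstart_in_path_image subsetD)+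
    have "free_homotopic (Conf d a) ?W ?W' (\<lambda>t. centers (?g t)) ((\<lambda>s. centers (?X s)) +++ (\<lambda>t. centers (?K t)))"
      unfolding e by (rule free_homotopic_join_right[OF _ _ Conf_word_subset])
        (use cX cY cK X Y K iY f in \<open>simp_all add: path_image_join\<close>)
    also have "free_homotopic (Conf d a) ?W ?W' ((\<lambda>s. centers (?X s)) +++ (\<lambda>t. centers (?K t))) (\<lambda>t. centers (?K t))"
      by (rule free_homotopic_join_left[OF _ _ Conf_word_subset]) (use cX cK X K iX f in simp_all)
    \<comment> \<open>The middle piece has the centers \<open>k\<close> at half scale; scaling back
      to 1 keeps the order of the real parts at both ends.\<close>
    also have "free_homotopic (Conf d a) ?W ?W' (\<lambda>t. centers (?K t)) k"
    proof (rule free_homotopicI[where H = "\<lambda>s t. scale (1/2 + s/2) (k t)"])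
      have "continuous_on ({0..1} \<times> {0..1}) (\<lambda>z::real \<times> real. k (snd z))"
        by (rule continuous_on_compose2[OF k(1)[unfolded path_def] continuous_on_snd[OF continuous_on_id]]) force
      moreover have "continuous_on ({0..1} \<times> {0..1}) (\<lambda>z::real \<times> real. 1/2 + fst z/2)"
        by (auto intro!: continuous_intros)
      ultimately show "continuous_on ({0..1} \<times> {0..1}) (\<lambda>z::real \<times> real. scale (1/2 + fst z/2) (k (snd z)))"
        by (intro continuous_on_scale)
      have kc: "k t \<in> Conf d a" if "t \<in> {0..1}" for t using k(2) that by (auto simp: path_image_def)
      show "scale (1/2 + s/2) (k t) \<in> Conf d a" if "s \<in> {0..1}" "t \<in> {0..1}" for s t
        using kc[OF that(2)] that(1) by (intro scale_Conf) auto
      show "scale (1/2 + 0/2) (k t) = centers (sect d a (k t))" if "t \<in> {0..1}" for t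
        using centers_sect[OF kc[OF that]] by simp
      show "scale (1/2 + 1/2) (k t) = k t" for t by (simp add: scale_def)
      show "scale (1/2 + s/2) (k 0) \<in> ?W" "scale (1/2 + s/2) (k 1) \<in> ?W'" if "s \<in> {0..1}" for s
        using that k(3,4) w by (auto intro!: scale_Conf_word simp: pathstart_def pathfinish_def)
    qed
    finally show ?thesis .
  qed
  ultimately show ?thesis by blast
qed

text \<open>Here \<open>k\<close> starts and ends only in the same convex sets as the given centers.
  Segments inside these sets supply the missing pieces and are then absorbed by the free
  ends.\<close>

lemma lift_word_path:
  assumes x: "x \<in> SC_space d a" and y: "y \<in> SC_space d a" and w: "w \<in> words d a" "w' \<in> words d a"
    and c: "centers x \<in> Conf_word d a w" "centers y \<in> Conf_word d a w'"
    and k: "path k" "path_image k \<subseteq> Conf d a" "pathstart k \<in> Conf_word d a w" "pathfinish k \<in> Conf_word d a w'"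
  shows "\<exists>g. path g \<and> path_image g \<subseteq> SC_space d a \<and> pathstart g = x \<and> pathfinish g = y \<and>
    free_homotopic (Conf d a) (Conf_word d a w) (Conf_word d a w') (\<lambda>t. centers (g t)) k"
proof -
  let ?W = "Conf_word d a w" and ?W' = "Conf_word d a w'"
  define \<alpha> where "\<alpha> = (\<lambda>t. mix t (centers x) (pathstart k))"
  define \<beta> where "\<beta> = (\<lambda>t. mix t (pathfinish k) (centers y))"
  note A = path_mix[OF w(1) c(1) k(3), folded \<alpha>_def] and B = path_mix[OF w(2) k(4) c(2), folded \<beta>_def]
  have AB: "path_image \<alpha> \<subseteq> Conf d a" "path_image \<beta> \<subseteq> Conf d a" using A(2) B(2) Conf_word_subset by blast+
  have K: "path ((\<alpha> +++ k) +++ \<beta>)" "path_image ((\<alpha> +++ k) +++ \<beta>) \<subseteq> Conf d a"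
    "pathstart ((\<alpha> +++ k) +++ \<beta>) = centers x" "pathfinish ((\<alpha> +++ k) +++ \<beta>) = centers y"
    using A B AB k by (simp_all add: path_image_join)
  obtain g where g: "path g" "path_image g \<subseteq> SC_space d a" "pathstart g = x" "pathfinish g = y"
    and gk: "free_homotopic (Conf d a) ?W ?W' (\<lambda>t. centers (g t)) ((\<alpha> +++ k) +++ \<beta>)"
    using lift_path[OF x y K] c by blast
  note gk
  also have "free_homotopic (Conf d a) ?W ?W' ((\<alpha> +++ k) +++ \<beta>) (\<alpha> +++ k)"
    by (rule free_homotopic_join_right[OF _ _ Conf_word_subset]) (use A B AB k c in \<open>simp_all add: path_image_join\<close>)
  also have "free_homotopic (Conf d a) ?W ?W' (\<alpha> +++ k) k"
    by (rule free_homotopic_join_left[OF _ _ Conf_word_subset]) (use A k in simp_all)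
  finally show ?thesis using g by blast
qed

lemma homotopic_paths_cancel_right:
  assumes g: "path g" "path_image g \<subseteq> S" and h: "path h" "path_image h \<subseteq> S" and b: "path \<beta>" "path_image \<beta> \<subseteq> S"
    and e: "pathfinish g = pathstart \<beta>" "pathfinish h = pathstart \<beta>"
    and gh: "homotopic_paths S (g +++ \<beta>) (h +++ \<beta>)"
  shows "homotopic_paths S g h"
proof -
  have "path_mor S g = path_mor S h"
  proof (rule groupoid_cancel_right[OF is_groupoid_fundamental_groupoid])
    show "Cmp (fundamental_groupoid S) (path_mor S g) (path_mor S \<beta>) = Cmp (fundamental_groupoid S) (path_mor S h) (path_mor S \<beta>)"
      using path_mor_eqI[OF gh] g h b e by (simp add: Cmp_fundamental_groupoid)
  qed (use g h b e in \<open>simp_all add: path_mor_in_Mor\<close>)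
  then show ?thesis by (rule path_mor_eqD[OF _ h])
qed

text \<open>The free homotopy of centers is replaced by one with fixed ends, and \<open>sect\<close>
  carries it to disks. The squares traced by \<open>shrink\<close> compare \<open>g\<close> and
  \<open>h\<close> with these images, using the same paths at the common ends, which are then
  cancelled.\<close>

lemma homotopic_centers_imp_homotopic:
  assumes w: "w \<in> words d a" "w' \<in> words d a"
    and g: "path g" "path_image g \<subseteq> SC_space d a" and h: "path h" "path_image h \<subseteq> SC_space d a"
    and e: "pathstart g = pathstart h" "pathfinish g = pathfinish h"
    and gh: "free_homotopic (Conf d a) (Conf_word d a w) (Conf_word d a w') (\<lambda>t. centers (g t)) (\<lambda>t. centers (h t))"
  shows "homotopic_paths (SC_space d a) g h"
proof -
  note cg = path_centers[OF g] and ch = path_centers[OF h]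
  have "homotopic_paths (Conf d a) (\<lambda>t. centers (g t)) (\<lambda>t. centers (h t))"
    by (rule free_homotopic_same_ends[OF paths_homotopic_in_Conf_word[OF w(1)] Conf_word_subset
          paths_homotopic_in_Conf_word[OF w(2)] Conf_word_subset gh]) (use cg ch e in simp_all)
  then have s: "homotopic_paths (SC_space d a) (\<lambda>t. sect d a (centers (g t))) (\<lambda>t. sect d a (centers (h t)))"
    by (rule homotopic_paths_compose1) (auto intro: continuous_on_sect continuous_on_id sect_SC_space)
  \<comment> \<open>The square with value \<open>shrink d a s (k t)\<close> at \<open>(s, t)\<close>
    joins \<open>k\<close> to \<open>sect\<close> of its centers.\<close>
  have sq: "homotopic_paths (SC_space d a) (k +++ (\<lambda>s. shrink d a s (pathfinish k)))
      ((\<lambda>s. shrink d a s (pathstart k)) +++ (\<lambda>t. sect d a (centers (k t))))"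
    if k: "path k" "path_image k \<subseteq> SC_space d a" for k
  proof -
    have kt: "k t \<in> SC_space d a" if "t \<in> {0..1}" for t using k(2) that by (auto simp: path_image_def)
    have "homotopic_paths (SC_space d a)
      ((\<lambda>t. shrink d a (fst (0::real, t)) (k (snd (0::real, t)))) +++ (\<lambda>s. shrink d a (fst (s, 1::real)) (k (snd (s, 1::real)))))
      ((\<lambda>s. shrink d a (fst (s, 0::real)) (k (snd (s, 0::real)))) +++ (\<lambda>t. shrink d a (fst (1::real, t)) (k (snd (1::real, t)))))"
    proof (rule homotopic_paths_square[where H = "\<lambda>z. shrink d a (fst z) (k (snd z))"])
      have "continuous_on ({0..1} \<times> {0..1}) (\<lambda>z::real \<times> real. k (snd z))"
        by (rule continuous_on_compose2[OF k(1)[unfolded path_def] continuous_on_snd[OF continuous_on_id]]) force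
      then show "continuous_on ({0..1} \<times> {0..1}) (\<lambda>z::real \<times> real. shrink d a (fst z) (k (snd z)))"
        by (intro continuous_on_shrink continuous_on_fst[OF continuous_on_id])
    qed (use kt shrink_SC_space in auto)
    then have "homotopic_paths (SC_space d a)
      ((\<lambda>t. shrink d a 0 (k t)) +++ (\<lambda>s. shrink d a s (pathfinish k)))
      ((\<lambda>s. shrink d a s (pathstart k)) +++ (\<lambda>t. sect d a (centers (k t))))"
      by (simp add: shrink_1 pathstart_def pathfinish_def)
    moreover have "homotopic_paths (SC_space d a) (k +++ (\<lambda>s. shrink d a s (pathfinish k)))
        ((\<lambda>t. shrink d a 0 (k t)) +++ (\<lambda>s. shrink d a s (pathfinish k)))"
    proof (rule homotopic_paths_eq)
      have y: "pathfinish k \<in> SC_space d a" using k by auto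
      show "path (k +++ (\<lambda>s. shrink d a s (pathfinish k)))" "path_image (k +++ (\<lambda>s. shrink d a s (pathfinish k))) \<subseteq> SC_space d a"
        using k path_shrink[OF y] by (simp_all add: path_image_join)
    qed (use kt shrink_0 in \<open>auto simp: joinpaths_def\<close>)
    ultimately show ?thesis using homotopic_paths_trans by blast
  qed
  have xy: "pathstart h \<in> SC_space d a" "pathfinish h \<in> SC_space d a" using h by auto
  note X = path_shrink[OF xy(1)] and Y = path_shrink[OF xy(2)]
  have "homotopic_paths (SC_space d a) (g +++ (\<lambda>s. shrink d a s (pathfinish h)))
      ((\<lambda>s. shrink d a s (pathstart h)) +++ (\<lambda>t. sect d a (centers (g t))))"
    using sq[OF g] e by simp
  also have "homotopic_paths (SC_space d a) ((\<lambda>s. shrink d a s (pathstart h)) +++ (\<lambda>t. sect d a (centers (g t))))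
      ((\<lambda>s. shrink d a s (pathstart h)) +++ (\<lambda>t. sect d a (centers (h t))))"
    by (rule homotopic_paths_join) (use X s e in \<open>simp_all add: pathstart_def\<close>)
  also have "homotopic_paths (SC_space d a) ((\<lambda>s. shrink d a s (pathstart h)) +++ (\<lambda>t. sect d a (centers (h t))))
      (h +++ (\<lambda>s. shrink d a s (pathfinish h)))"
    by (rule homotopic_paths_sym[OF sq[OF h]])
  finally show ?thesis by (rule homotopic_paths_cancel_right[OF g h Y(1,2), rotated 2]) (use Y e in simp_all)
qed

section \<open>Paths to configurations with distinct real parts\<close>

lemma sorted_list_by_key:
  fixes f :: "'a \<Rightarrow> 'b::linorder"
  assumes "finite A" "inj_on f A"
  shows "\<exists>w. distinct w \<and> set w = A \<and> sorted_wrt (\<lambda>p q. f p < f q) w"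
proof -
  let ?L = "sorted_list_of_set (f ` A)" and ?g = "inv_into A f"
  have g: "f (?g y) = y" if "y \<in> f ` A" for y using that by (rule f_inv_into_f)
  have "sorted_wrt (<) ?L" by simp
  then have "sorted_wrt (\<lambda>y z. f (?g y) < f (?g z)) ?L"
    by (rule sorted_wrt_mono_rel[rotated]) (use assms g in simp)
  then have "sorted_wrt (\<lambda>p q. f p < f q) (map ?g ?L)" by (simp add: sorted_wrt_map)
  moreover have "set (map ?g ?L) = A" using assms by (auto simp: image_image)
  moreover have "distinct (map ?g ?L)" using assms by (simp add: distinct_map inj_on_inv_into)
  ultimately show ?thesis by blast
qed

text \<open>A small shear makes the real parts distinct.\<close>

lemma path_to_Conf_word:
  assumes z: "z \<in> Conf d a"
  shows "\<exists>w\<in>words d a. \<exists>k. path k \<and> path_image k \<subseteq> Conf d a \<and> pathstart k = z \<and> pathfinish k \<in> Conf_word d a w"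
proof -
  note Z = ConfD[OF z]
  \<comment> \<open>The shears that give two points of different heights the same real part. Pairs
    of equal height contribute only 0, by the convention for division by zero, and 0 is outside the
    interval for \<open>\<eta>\<close>.\<close>
  let ?bad = "\<Union>pq\<in>inputs a \<times> inputs a. {(Re (z (fst pq)) - Re (z (snd pq))) / (Im (z (snd pq)) - Im (z (fst pq)))}"
  have "infinite {0<..<1/2::real}" by (simp add: infinite_Ioo)
  moreover have "finite ?bad" by simp
  ultimately obtain \<eta> where \<eta>: "\<eta> \<in> {0<..<1/2}" "\<eta> \<notin> ?bad" by (meson finite_subset subsetI)
  \<comment> \<open>As \<open>\<eta> < 1/2\<close>, the shear stretches norms by a factor of at most
    \<open>1 + s / 2\<close>; together with the factor \<open>1 - s / 2\<close> this gives
    \<open>1 - s * s / 4\<close>, so the points stay in the disk.\<close>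
  define k where "k = (\<lambda>s::real. \<lambda>p. of_real (1 - s / 2) * (z p + of_real (s * \<eta> * Im (z p))))"
  have Rk: "Re (k s p) = (1 - s / 2) * (Re (z p) + s * \<eta> * Im (z p))" and Ik: "Im (k s p) = (1 - s / 2) * Im (z p)" for s p
    by (simp_all add: k_def)
  have kC: "k s \<in> Conf d a" if s: "s \<in> {0..1}" for s
    unfolding Conf_iff
  proof (intro conjI ballI impI allI)
    show "inj_on (k s) (inputs a)"
    proof (rule inj_onI, rule ccontr)
      fix p q assume pq: "p \<in> inputs a" "q \<in> inputs a" "k s p = k s q" "p \<noteq> q"
      have i: "Im (z p) = Im (z q)" using arg_cong[OF pq(3), of Im] s by (simp add: Ik)
      then have "Re (z p) = Re (z q)" using arg_cong[OF pq(3), of Re] s by (simp add: Rk)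
      with i have "z p = z q" by (simp add: complex_eq_iff)
      then show False using Z(2)[OF pq(1,2,4)] by simp
    qed
    fix p assume p: "p \<in> inputs a"
    have "norm (k s p) \<le> (1 - s / 2) * (norm (z p) + s / 2 * norm (z p))"
    proof -
      have "norm (of_real (s * \<eta> * Im (z p)) :: complex) = s * \<eta> * \<bar>Im (z p)\<bar>"
        unfolding norm_of_real using s \<eta> by (simp add: abs_mult)
      also have "\<dots> \<le> s * (1/2) * norm (z p)"
        using s \<eta> abs_Im_le_cmod by (intro mult_mono mult_left_mono) auto
      finally have "norm (z p + of_real (s * \<eta> * Im (z p))) \<le> norm (z p) + s / 2 * norm (z p)"
        using norm_triangle_ineq[of "z p" "of_real (s * \<eta> * Im (z p))"] by simp
      then have "(1 - s / 2) * norm (z p + of_real (s * \<eta> * Im (z p))) \<le> (1 - s / 2) * (norm (z p) + s / 2 * norm (z p))"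
        using s by (intro mult_left_mono) auto
      moreover have "norm (k s p) = (1 - s / 2) * norm (z p + of_real (s * \<eta> * Im (z p)))"
        using s unfolding k_def norm_mult norm_of_real by simp
      ultimately show ?thesis by simp
    qed
    also have "\<dots> = norm (z p) - s * s / 4 * norm (z p)" by (simp add: field_simps)
    also have "\<dots> \<le> norm (z p)" by simp
    finally have "norm (k s p) \<le> norm (z p)" .
    then show "norm (k s p) \<le> 1" "d = Closed \<Longrightarrow> norm (k s p) < 1" using Z(3,4)[OF p] by auto
    show "Im (k s p) = 0" if "d = Open \<and> fst p = Open" using Z(5)[OF p] that by (simp add: Ik)
    show "0 < Im (k s p)" if "d = Open \<and> fst p = Closed" using Z(6)[OF p] that s by (simp add: Ik)
  qed (use Z in \<open>auto simp: k_def\<close>)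
  have inj: "inj_on (\<lambda>p. Re (k 1 p)) (inputs a)"
  proof (rule inj_onI, rule ccontr)
    fix p q assume pq: "p \<in> inputs a" "q \<in> inputs a" "Re (k 1 p) = Re (k 1 q)" "p \<noteq> q"
    then have e: "Re (z p) - Re (z q) = \<eta> * (Im (z q) - Im (z p))" by (simp add: Rk algebra_simps)
    show False
    proof (cases "Im (z p) = Im (z q)")
      case True then show False using e Z(2)[OF pq(1,2,4)] by (simp add: complex_eq_iff)
    next
      case False
      then have "\<eta> = (Re (z p) - Re (z q)) / (Im (z q) - Im (z p))" using e by (simp add: field_simps)
      then show False using \<eta>(2) pq(1,2) by force
    qed
  qed
  obtain w where w: "distinct w" "set w = inputs a" "sorted_wrt (\<lambda>p q. Re (k 1 p) < Re (k 1 q)) w"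
    using sorted_list_by_key[OF finite_inputs inj] by blast
  have "w \<in> words d a" using w Z(1) by (simp add: words_def)
  moreover have "path k"
    unfolding path_def k_def
    by (rule continuous_on_coordinatewise_then_product) (auto intro!: continuous_intros)
  moreover have "path_image k \<subseteq> Conf d a" using kC by (auto simp: path_image_def)
  moreover have "pathstart k = z" by (auto simp: pathstart_def k_def)
  moreover have "pathfinish k \<in> Conf_word d a w" using kC[of 1] w by (simp add: pathfinish_def Conf_word_def)
  ultimately show ?thesis by blast
qed

text \<open>Shear the centers until their real parts are distinct, move inside the convex set
  \<open>Conf_word\<close> to the centers of the selected point \<open>y w\<close>, and lift. It is
  applied to realizations of trees, one for each word.\<close>

lemma SC_path_to_word:
  assumes x: "x \<in> SC_space d a" and sp: "\<And>w. w \<in> words d a \<Longrightarrow> y w \<in> SC_space d a \<and> centers (y w) \<in> Conf_word d a w"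
  shows "\<exists>w\<in>words d a. \<exists>g. path g \<and> path_image g \<subseteq> SC_space d a \<and> pathstart g = x \<and> pathfinish g = y w"
proof -
  obtain w k where w: "w \<in> words d a" and k: "path k" "path_image k \<subseteq> Conf d a" "pathstart k = centers x"
    "pathfinish k \<in> Conf_word d a w" using path_to_Conf_word[OF centers_Conf[OF x]] by blast
  have y: "y w \<in> SC_space d a" "centers (y w) \<in> Conf_word d a w" using sp[OF w] by auto
  note B = path_mix[OF w k(4) y(2)]
  have "path (k +++ (\<lambda>t. mix t (pathfinish k) (centers (y w))))"
    "path_image (k +++ (\<lambda>t. mix t (pathfinish k) (centers (y w)))) \<subseteq> Conf d a"
    "pathstart (k +++ (\<lambda>t. mix t (pathfinish k) (centers (y w)))) = centers x"
    "pathfinish (k +++ (\<lambda>t. mix t (pathfinish k) (centers (y w)))) = centers (y w)"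
    using k B subset_trans[OF B(2) Conf_word_subset] by (simp_all add: path_image_join)
  from lift_path[OF x y(1) this] w show ?thesis by blast
qed

section \<open>Operations on classes of paths of configurations\<close>

definition word_mor ::
  "color \<Rightarrow> arity \<Rightarrow> input list \<Rightarrow> (real \<Rightarrow> input \<Rightarrow> complex) \<Rightarrow> input list \<Rightarrow>
   input list \<times> (real \<Rightarrow> input \<Rightarrow> complex) set \<times> input list" where
  "word_mor d a w g w' = (w, word_class d a w w' g, w')"

abbreviation word_homotopic ::
  "color \<Rightarrow> arity \<Rightarrow> input list \<Rightarrow> input list \<Rightarrow> (real \<Rightarrow> input \<Rightarrow> complex) \<Rightarrow> (real \<Rightarrow> input \<Rightarrow> complex) \<Rightarrow> bool" where
  "word_homotopic d a w w' \<equiv> free_homotopic (Conf d a) (Conf_word d a w) (Conf_word d a w')"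

definition word_path :: "color \<Rightarrow> arity \<Rightarrow> input list \<Rightarrow> input list \<Rightarrow> (real \<Rightarrow> input \<Rightarrow> complex) \<Rightarrow> bool" where
  "word_path d a w w' g \<longleftrightarrow> path g \<and> path_image g \<subseteq> Conf d a \<and>
     pathstart g \<in> Conf_word d a w \<and> pathfinish g \<in> Conf_word d a w'"

lemma word_homotopic_refl: "word_path d a w w' g \<Longrightarrow> word_homotopic d a w w' g g"
  by (rule free_homotopic_refl) (auto simp: word_path_def)

lemma word_class_eqI: "word_homotopic d a w w' g h \<Longrightarrow> word_class d a w w' g = word_class d a w w' h"
  unfolding word_class_free using free_homotopic_trans free_homotopic_sym by blast

lemma word_class_self: "word_path d a w w' g \<Longrightarrow> g \<in> word_class d a w w' g"
  unfolding word_class_free using word_homotopic_refl by blast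

lemma word_classD: "h \<in> word_class d a w w' g \<Longrightarrow> word_homotopic d a w w' g h"
  unfolding word_class_free by simp

lemma word_mor_eqI: "word_homotopic d a w w' g h \<Longrightarrow> word_mor d a w g w' = word_mor d a w h w'"
  unfolding word_mor_def using word_class_eqI by blast

lemma word_mor_eqD:
  "\<lbrakk>word_mor d a w g w' = word_mor d a w h w'; word_path d a w w' h\<rbrakk> \<Longrightarrow> word_homotopic d a w w' g h"
  unfolding word_mor_def using word_class_self word_classD by blast

lemma word_groupoid_simps [simp]:
  "Ob (word_groupoid d a) = words d a"
  "Src (word_groupoid d a) (word_mor d a w g w') = w"
  "Trg (word_groupoid d a) (word_mor d a w g w') = w'"
  by (simp_all add: word_groupoid_def word_mor_def)

lemma Mor_word_groupoid:
  "f \<in> Mor (word_groupoid d a) \<longleftrightarrow>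
    (\<exists>w w' g. w \<in> words d a \<and> w' \<in> words d a \<and> word_path d a w w' g \<and> f = word_mor d a w g w')"
  unfolding word_groupoid_def word_mor_def word_path_def by auto

text \<open>The definition takes a union over representatives that meet exactly. Their meeting
  points vary, but all these composites are freely homotopic because paths with common ends in the
  middle \<open>Conf_word\<close> are homotopic.\<close>

lemma Cmp_word_groupoid:
  assumes w: "w' \<in> words d a"
    and g: "word_path d a w w' g" and h: "word_path d a w' w'' h" and e: "pathfinish g = pathstart h"
  shows "Cmp (word_groupoid d a) (word_mor d a w g w') (word_mor d a w' h w'') = word_mor d a w (g +++ h) w''"
proof -
  have eq: "word_class d a w w'' (g' +++ h') = word_class d a w w'' (g +++ h)"
    if "g' \<in> word_class d a w w' g" "h' \<in> word_class d a w' w'' h" "pathfinish g' = pathstart h'" for g' h'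
    by (rule word_class_eqI[OF free_homotopic_join[OF Conf_word_subset paths_homotopic_in_Conf_word[OF w]
          Conf_word_subset Conf_word_subset]])
      (use free_homotopic_sym[OF word_classD] that e in auto)
  have "(\<Union>g'\<in>word_class d a w w' g. \<Union>h'\<in>{h' \<in> word_class d a w' w'' h. pathfinish g' = pathstart h'}.
      word_class d a w w'' (g' +++ h')) = word_class d a w w'' (g +++ h)"
  proof (intro equalityI)
    show "word_class d a w w'' (g +++ h) \<subseteq> (\<Union>g'\<in>word_class d a w w' g.
        \<Union>h'\<in>{h' \<in> word_class d a w' w'' h. pathfinish g' = pathstart h'}. word_class d a w w'' (g' +++ h'))"
      using word_class_self[OF g] word_class_self[OF h] e by blast
  qed (use eq in blast)
  then show ?thesis by (simp add: word_groupoid_def word_mor_def)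
qed

lemma Idm_word_groupoid:
  assumes w: "w \<in> words d a" and x: "x \<in> Conf_word d a w"
  shows "Idm (word_groupoid d a) w = word_mor d a w (\<lambda>_. x) w"
proof -
  have "(\<Union>y\<in>Conf_word d a w. word_class d a w w (\<lambda>_. y)) = word_class d a w w (\<lambda>_. x)"
  proof (rule UN_eq_const[OF x], rule word_class_eqI)
    fix y assume y: "y \<in> Conf_word d a w"
    show "word_homotopic d a w w (\<lambda>_. y) (\<lambda>_. x)"
    proof (rule free_homotopicI[where H = "\<lambda>s t. mix s y x"])
      show "continuous_on ({0..1} \<times> {0..1}) (\<lambda>z::real \<times> real. mix (fst z) y x)"
        by (intro continuous_on_mix continuous_on_fst[OF continuous_on_id] continuous_on_const)
    qed (use mix_Conf_word[OF w y x] in \<open>auto intro: subsetD[OF Conf_word_subset]\<close>)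
  qed
  then show ?thesis by (simp add: word_groupoid_def word_mor_def)
qed

lemma Conf_act:
  assumes x: "x \<in> Conf d a" and \<sigma>: "\<sigma> \<in> input_perms a"
  shows "x \<circ> inv \<sigma> \<in> Conf d a"
proof -
  have i: "inv \<sigma> p \<in> inputs a \<longleftrightarrow> p \<in> inputs a" for p
    using permutes_in_image[OF permutes_inv[OF input_perms_permutes[OF \<sigma>]]] .
  have f: "fst (inv \<sigma> p) = fst p" for p
    using input_perms_fst[OF \<sigma>, of "inv \<sigma> p"] permutes_inverses[OF input_perms_permutes[OF \<sigma>]] by simp
  have n: "inv \<sigma> p = inv \<sigma> q \<longleftrightarrow> p = q" for p q
    using permutes_inverses[OF input_perms_permutes[OF \<sigma>]] by metis
  have "inj_on (x \<circ> inv \<sigma>) (inputs a)"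
    using ConfD(2)[OF x] i n unfolding inj_on_def o_apply by metis
  then show ?thesis unfolding Conf_iff o_apply
    by (intro conjI ballI impI allI) (simp_all add: ConfD[OF x] i f)
qed

lemma Conf_word_act:
  assumes x: "x \<in> Conf_word d a w" and \<sigma>: "\<sigma> \<in> input_perms a"
  shows "x \<circ> inv \<sigma> \<in> Conf_word d a (map \<sigma> w)"
  using x Conf_act[OF _ \<sigma>, of x d] permutes_inverses[OF input_perms_permutes[OF \<sigma>]]
  by (simp add: Conf_word_def sorted_wrt_map)

lemma CoPB_mor_act:
  assumes \<sigma>: "\<sigma> \<in> input_perms a" and g: "word_path d a w w' g"
  shows "mor_act CoPB_plus d a \<sigma> (word_mor d a w g w') = word_mor d a (map \<sigma> w) (\<lambda>t. g t \<circ> inv \<sigma>) (map \<sigma> w')"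
proof -
  have c: "continuous_on (Conf d a) (\<lambda>x. x \<circ> inv \<sigma>)"
    by (rule continuous_on_coordinatewise_then_product) (simp add: continuous_on_coordinate[OF continuous_on_id])
  have "(\<Union>h\<in>word_class d a w w' g. word_class d a (map \<sigma> w) (map \<sigma> w') (\<lambda>t. h t \<circ> inv \<sigma>)) =
    word_class d a (map \<sigma> w) (map \<sigma> w') (\<lambda>t. g t \<circ> inv \<sigma>)"
  proof (rule UN_eq_const[OF word_class_self[OF g]], rule word_class_eqI)
    fix h assume "h \<in> word_class d a w w' g"
    then have "word_homotopic d a w w' h g" by (rule free_homotopic_sym[OF word_classD])
    then show "word_homotopic d a (map \<sigma> w) (map \<sigma> w') (\<lambda>t. h t \<circ> inv \<sigma>) (\<lambda>t. g t \<circ> inv \<sigma>)"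
      by (rule free_homotopic_image[OF _ c]) (use Conf_act[OF _ \<sigma>] Conf_word_act[OF _ \<sigma>] in auto)
  qed
  then show ?thesis by (simp add: CoPB_plus_def word_mor_def)
qed

section \<open>Insertion of small configurations\<close>

lemma sorted_wrt_concat_map:
  "sorted_wrt R (concat (map f w)) \<longleftrightarrow>
    sorted_wrt (\<lambda>q q'. \<forall>s\<in>set (f q). \<forall>s'\<in>set (f q'). R s s') w \<and> (\<forall>q\<in>set w. sorted_wrt R (f q))"
  by (induction w) (auto simp: sorted_wrt_append)

lemma Conf_ins_inner [simp]: "r \<in> inputs b \<Longrightarrow> Conf_ins \<epsilon> a p b x y (inner_label a p r) = x p + of_real \<epsilon> * y r"
  by (simp add: Conf_ins_def)

lemma Conf_ins_outer [simp]:
  "\<lbrakk>p \<in> inputs a; r \<in> inputs a; r \<noteq> p\<rbrakk> \<Longrightarrow> Conf_ins \<epsilon> a p b x y (outer_label p b r) = x r"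
  by (simp add: Conf_ins_def)

text \<open>The inserted configuration is affine in its size. Changing the size thus moves all
  points along segments, and the convexity of \<open>Conf_word\<close> controls the ends of a
  path.\<close>

lemma Conf_ins_mix:
  assumes "p \<in> inputs a"
  shows "Conf_ins ((1 - s) * \<epsilon> + s * \<delta>) a p b x y = mix s (Conf_ins \<epsilon> a p b x y) (Conf_ins \<delta> a p b x y)"
  unfolding Conf_ins_def[of "(1 - s) * \<epsilon> + s * \<delta>"]
  by (rule graft_eqI[symmetric, OF assms])
    (simp_all add: assms graft_outside mix_def Conf_ins_def algebra_simps)

lemma continuous_on_Conf_ins:
  assumes "continuous_on S \<epsilon>" "continuous_on S f" "continuous_on S g"
  shows "continuous_on S (\<lambda>z. Conf_ins (\<epsilon> z) a p b (f z) (g z))"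
  unfolding Conf_ins_def
  by (intro continuous_on_graft continuous_on_add continuous_on_mult continuous_on_of_real
      assms(1) continuous_on_coordinate[OF assms(2)] continuous_on_coordinate[OF assms(3)])

text \<open>As \<open>y\<close> lies in the open unit disk, all inserted points are closer than
  \<open>\<delta>\<close> to \<open>x p\<close>. The bound by \<open>gap\<close> separates them from
  the other points and, around a closed \<open>p\<close> in the half disk, from the real axis; the
  other bound keeps them inside the unit disk.\<close>

lemma Conf_ins_Conf:
  assumes x: "x \<in> Conf d a" and p: "p \<in> inputs a" and y: "y \<in> Conf (fst p) b" "\<And>r. norm (y r) < 1"
    and g: "\<delta> \<le> gap d a x" "\<delta> \<le> 1 - norm (x p)" and \<delta>: "0 < \<delta>"
  shows "Conf_ins \<delta> a p b x y \<in> Conf d (ins_arity a p b)"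
proof -
  let ?z = "Conf_ins \<delta> a p b x y"
  note X = ConfD[OF x] and Y = ConfD[OF y(1)] and G = gap_bounds[OF x]
  have o: "d = Closed \<Longrightarrow> fst p = Closed" using X(1) p Closed_no_open_input by blast
  have dy: "norm (of_real \<delta> * y r) < \<delta>" for r using y(2)[of r] \<delta> by (simp add: norm_mult)
  have neq: "x r \<noteq> x p + of_real \<delta> * y s" if "r \<in> inputs a" "r \<noteq> p" for r s
  proof
    assume "x r = x p + of_real \<delta> * y s"
    then have "dist (x r) (x p) = norm (of_real \<delta> * y s)" by (simp add: dist_norm)
    then show False using dy[of s] G(3)[OF that(1) p that(2)] g by simp
  qed
  show ?thesis unfolding Conf_iff
  proof (intro conjI ballI impI allI)
    show "ins_arity a p b Open = 0" if "d = Closed" using X(1) Y(1) o that by (auto simp: ins_arity_def)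
    show "inj_on ?z (inputs (ins_arity a p b))"
    proof (rule inj_onI, rule ccontr)
      fix q s assume q: "q \<in> inputs (ins_arity a p b)" and s: "s \<in> inputs (ins_arity a p b)" and e: "?z q = ?z s" "q \<noteq> s"
      show False using q p
      proof (cases rule: input_ins_arityE)
        case q: (outer r)
        show False using s p
        proof (cases rule: input_ins_arityE)
          case (outer t) then show False using q e p X(2)[of r t] by auto
        next
          case (inner t) then show False using q e p neq[of r t] by simp
        qed
      next
        case q: (inner r)
        show False using s p
        proof (cases rule: input_ins_arityE)
          case (outer t) then show False using q e p neq[of t r] by simp
        next
          case (inner t) then show False using q e \<delta> Y(2)[of r t] by auto
        qed
      qed
    qed
    show "?z q = 0" if "q \<notin> inputs (ins_arity a p b)" for q unfolding Conf_ins_def using graft_outside[OF p that] .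
    fix q assume "q \<in> inputs (ins_arity a p b)"
    then have "norm (?z q) \<le> 1 \<and> (d = Closed \<longrightarrow> norm (?z q) < 1) \<and> (d = Open \<and> fst q = Open \<longrightarrow> Im (?z q) = 0) \<and>
      (d = Open \<and> fst q = Closed \<longrightarrow> 0 < Im (?z q))"
      using p
    proof (cases rule: input_ins_arityE)
      case (outer r) then show ?thesis using X p by auto
    next
      case (inner r)
      have n: "norm (?z q) < 1"
        using inner norm_triangle_ineq[of "x p" "of_real \<delta> * y r"] dy[of r] g(2) by simp
      have "Im (?z q) = 0" if "d = Open" "fst q = Open"
      proof -
        have "fst r = Open" using that inner by simp
        moreover have "fst p = Open" using Y(1) inner Closed_no_open_input calculation by (metis color.exhaust color.distinct(1))
        ultimately show ?thesis using inner X(5)[OF p that(1)] Y(5)[OF inner(1)] by simp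
      qed
      moreover have "0 < Im (?z q)" if "d = Open" "fst q = Closed"
      proof (cases "fst p")
        case Open
        then show ?thesis using inner that X(5)[OF p that(1) Open] Y(6)[OF inner(1) Open] \<delta> by simp
      next
        case Closed
        then show ?thesis using inner G(4)[OF p that(1) Closed] g(1) dy[of r] abs_Im_le_cmod[of "of_real \<delta> * y r"] by simp
      qed
      ultimately show ?thesis using n by simp
    qed
    then show "norm (?z q) \<le> 1" "d = Closed \<Longrightarrow> norm (?z q) < 1" "d = Open \<and> fst q = Open \<Longrightarrow> Im (?z q) = 0"
      "d = Open \<and> fst q = Closed \<Longrightarrow> 0 < Im (?z q)" by blast+
  qed
qed

text \<open>\<open>gap\<close> controls distances in the plane but not differences of real parts, so
  the order of the letters needs its own bound on \<open>\<delta>\<close>. Below that bound the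
  inserted block stays strictly between the neighbors of \<open>p\<close>.\<close>

lemma Conf_ins_Conf_word:
  assumes z: "Conf_ins \<delta> a p b x y \<in> Conf d (ins_arity a p b)"
    and w: "w \<in> words d a" and x: "x \<in> Conf_word d a w" and p: "p \<in> inputs a"
    and v: "v \<in> words (fst p) b" and y: "y \<in> Conf_word (fst p) b v" "\<And>r. norm (y r) < 1"
    and g: "\<And>q. \<lbrakk>q \<in> inputs a; q \<noteq> p\<rbrakk> \<Longrightarrow> \<delta> \<le> \<bar>Re (x p) - Re (x q)\<bar>" and \<delta>: "0 < \<delta>"
  shows "Conf_ins \<delta> a p b x y \<in> Conf_word d (ins_arity a p b) (word_ins a p b w v)"
proof -
  let ?z = "Conf_ins \<delta> a p b x y" and ?f = "\<lambda>q. if q = p then map (inner_label a p) v else [outer_label p b q]"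
  have sw: "set w = inputs a" "set v = inputs b" using w v by (auto simp: words_def)
  have sx: "sorted_wrt (\<lambda>p q. Re (x p) < Re (x q)) w" and sy: "sorted_wrt (\<lambda>p q. Re (y p) < Re (y q)) v"
    using x y by (auto simp: Conf_word_def)
  have dy: "\<bar>\<delta> * Re (y r)\<bar> < \<delta>" for r
    using abs_Re_le_cmod[of "y r"] y(2)[of r] \<delta> by (simp add: abs_mult)
  have "sorted_wrt (\<lambda>q q'. \<forall>s\<in>set (?f q). \<forall>s'\<in>set (?f q'). Re (?z s) < Re (?z s')) w"
  proof (rule sorted_wrt_mono_rel[OF _ sx])
    fix q q' assume q: "q \<in> set w" "q' \<in> set w" "Re (x q) < Re (x q')"
    show "\<forall>s\<in>set (?f q). \<forall>s'\<in>set (?f q'). Re (?z s) < Re (?z s')"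
    proof (cases "q = p")
      case True
      then have "q' \<noteq> p" using q by auto
      then have "Re (x p) + \<delta> * Re (y r) < Re (x q')" for r using g[of q'] dy[of r] q True sw by auto
      then show ?thesis using True \<open>q' \<noteq> p\<close> q sw p by auto
    next
      case False
      show ?thesis
      proof (cases "q' = p")
        case True
        then have "Re (x q) < Re (x p) + \<delta> * Re (y r)" for r using g[of q] dy[of r] q False sw by auto
        then show ?thesis using True False q sw p by auto
      qed (use False q sw p in auto)
    qed
  qed
  moreover have "sorted_wrt (\<lambda>s s'. Re (?z s) < Re (?z s')) (?f q)" for q
    using sy \<delta> sw by (auto simp: sorted_wrt_map elim!: sorted_wrt_mono_rel[rotated])
  ultimately have "sorted_wrt (\<lambda>s s'. Re (?z s) < Re (?z s')) (word_ins a p b w v)"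
    unfolding word_ins_def sorted_wrt_concat_map by blast
  then show ?thesis using z by (simp add: Conf_word_def)
qed

lemma uniform_positive_bound:
  fixes f :: "'i \<Rightarrow> 'z::topological_space \<Rightarrow> real"
  assumes "finite I" "compact Z" "\<And>i. i \<in> I \<Longrightarrow> continuous_on Z (f i)" "\<And>i z. \<lbrakk>i \<in> I; z \<in> Z\<rbrakk> \<Longrightarrow> 0 < f i z"
  shows "\<exists>\<eta>>0. \<forall>i\<in>I. \<forall>z\<in>Z. \<eta> \<le> f i z"
  using assms(1,3,4)
proof (induction I rule: finite_induct)
  case (insert i I)
  then obtain \<eta> where \<eta>: "\<eta> > 0" "\<forall>i\<in>I. \<forall>z\<in>Z. \<eta> \<le> f i z" by auto
  show ?case
  proof (cases "Z = {}")
    case False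
    obtain z0 where "z0 \<in> Z" "\<forall>z\<in>Z. f i z0 \<le> f i z"
      using continuous_attains_inf[OF assms(2) False] insert.prems(1) by blast
    then show ?thesis using \<eta> insert.prems(2)[of i z0] by (intro exI[of _ "min \<eta> (f i z0)"]) (auto simp: min_le_iff_disj)
  qed (auto intro: exI[of _ 1])
qed (auto intro: exI[of _ 1])

lemma continuous_on_01_bound:
  fixes f :: "real \<Rightarrow> real"
  assumes "continuous_on {0..1} f" "\<And>t. t \<in> {0..1} \<Longrightarrow> 0 < f t"
  shows "\<exists>\<eta>>0. \<forall>t\<in>{0..1}. \<eta> \<le> f t"
  using uniform_positive_bound[of "{()}" "{0..1}" "\<lambda>_. f"] assms by auto

text \<open>The condition of \<open>very_small\<close> for one fixed size, but along whole
  homotopies: \<open>s\<close> is the homotopy parameter and \<open>t\<close> the time on the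
  paths.\<close>

definition small_insertion ::
  "color \<Rightarrow> arity \<Rightarrow> input \<Rightarrow> arity \<Rightarrow> input list \<Rightarrow> input list \<Rightarrow>
   (real \<times> real \<Rightarrow> input \<Rightarrow> complex) \<Rightarrow> (real \<times> real \<Rightarrow> input \<Rightarrow> complex) \<Rightarrow> real \<Rightarrow> bool" where
  "small_insertion d a p b w w' H K \<delta> \<longleftrightarrow>
    (\<forall>s\<in>{0..1}. \<forall>t\<in>{0..1}. Conf_ins \<delta> a p b (H (s, t)) (K (s, t)) \<in> Conf d (ins_arity a p b)) \<and>
    (\<forall>s\<in>{0..1}. Conf_ins \<delta> a p b (H (s, 0)) (K (s, 0)) \<in> Conf_word d (ins_arity a p b) w \<and>
       Conf_ins \<delta> a p b (H (s, 1)) (K (s, 1)) \<in> Conf_word d (ins_arity a p b) w')"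

text \<open>Compactness of the square gives one size for a whole homotopy. The order of the real
  parts is required only at \<open>t = 0\<close> and \<open>t = 1\<close>, so the horizontal
  distances, which may vanish in between, are bounded below on these two edges.\<close>

lemma small_insertion_exists:
  assumes p: "p \<in> inputs a" and w: "w \<in> words d a" "w' \<in> words d a" and v: "v \<in> words (fst p) b" "v' \<in> words (fst p) b"
    and H: "continuous_on ({0..1} \<times> {0..1}) H" "\<forall>s\<in>{0..1}. \<forall>t\<in>{0..1}. H (s, t) \<in> Conf d a \<and> (\<forall>q. norm (H (s, t) q) < 1)"
      "\<forall>s\<in>{0..1}. H (s, 0) \<in> Conf_word d a w \<and> H (s, 1) \<in> Conf_word d a w'"
    and K: "\<forall>s\<in>{0..1}. \<forall>t\<in>{0..1}. K (s, t) \<in> Conf (fst p) b \<and> (\<forall>q. norm (K (s, t) q) < 1)"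
      "\<forall>s\<in>{0..1}. K (s, 0) \<in> Conf_word (fst p) b v \<and> K (s, 1) \<in> Conf_word (fst p) b v'"
  shows "\<exists>\<eta>>0. \<forall>\<delta>. 0 < \<delta> \<and> \<delta> \<le> \<eta> \<longrightarrow> small_insertion d a p b (word_ins a p b w v) (word_ins a p b w' v') H K \<delta>"
proof -
  have cI: "compact ({0..1} \<times> {0..1::real} :: (real \<times> real) set)" by (intro compact_Times compact_Icc)
  \<comment> \<open>\<open>True\<close> stands for the gap and \<open>False\<close> for the distance
    of the point \<open>p\<close> from the unit circle, so that one compactness argument covers
    both.\<close>
  have "\<exists>\<eta>>0. \<forall>i\<in>{True, False}. \<forall>z\<in>{0..1} \<times> {0..1::real}.
      \<eta> \<le> (if i then gap d a (H z) else 1 - norm (H z p))"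
  proof (rule uniform_positive_bound[OF _ cI])
    show "continuous_on ({0..1} \<times> {0..1}) (\<lambda>z. if i then gap d a (H z) else 1 - norm (H z p))" for i
      by (cases i) (auto intro!: continuous_on_gap[OF H(1)] continuous_intros continuous_on_coordinate[OF H(1)])
    show "0 < (if i then gap d a (H z) else 1 - norm (H z p))" if zz: "z \<in> {0..1} \<times> {0..1}" for i z
    proof -
      obtain s t where "z = (s, t)" "s \<in> {0..1}" "t \<in> {0..1}" using zz by (cases z) auto
      then have "H z \<in> Conf d a" "norm (H z p) < 1" using H(2) by blast+
      then show ?thesis using gap_bounds(1) by simp
    qed
  qed simp
  then obtain \<eta>1 where "0 < \<eta>1" and *: "\<forall>i\<in>{True, False}. \<forall>z\<in>{0..1} \<times> {0..1::real}.
      \<eta>1 \<le> (if i then gap d a (H z) else 1 - norm (H z p))" by blast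
  have \<eta>1: "0 < \<eta>1" "\<lbrakk>s \<in> {0..1}; t \<in> {0..1}\<rbrakk> \<Longrightarrow> \<eta>1 \<le> gap d a (H (s, t)) \<and> \<eta>1 \<le> 1 - norm (H (s, t) p)" for s t
    using \<open>0 < \<eta>1\<close> bspec[OF bspec[OF *, of True], of "(s, t)"] bspec[OF bspec[OF *, of False], of "(s, t)"] by auto
  have ends: "\<exists>\<eta>>0. \<forall>q\<in>inputs a - {p}. \<forall>z\<in>{0..1::real} \<times> {c}. \<eta> \<le> \<bar>Re (H z p) - Re (H z q)\<bar>"
    if c: "c \<in> {0..1}" and u: "u \<in> words d a" and W: "\<forall>s\<in>{0..1}. H (s, c) \<in> Conf_word d a u" for c :: real and u
  proof (rule uniform_positive_bound)
    have "continuous_on ({0..1::real} \<times> {c}) H" by (rule continuous_on_subset[OF H(1)]) (use c in auto)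
    from continuous_on_coordinate[OF this] show "continuous_on ({0..1::real} \<times> {c}) (\<lambda>z. \<bar>Re (H z p) - Re (H z q)\<bar>)" for q
      by (intro continuous_intros)
    fix q z assume q: "q \<in> inputs a - {p}" and z: "z \<in> {0..1::real} \<times> {c}"
    then have "sorted_wrt (\<lambda>p q. Re (H z p) < Re (H z q)) u" using W by (auto simp: Conf_word_def)
    \<comment> \<open>\<open>sorted_wrt_Re_inj_on\<close> is applied to the real parts viewed as
      complex numbers: the real parts have to be distinct, not just the points.\<close>
    then have J: "inj_on (\<lambda>p. complex_of_real (Re (H z p))) (inputs a)"
      using sorted_wrt_Re_inj_on[of "\<lambda>p. complex_of_real (Re (H z p))" u] u by (simp add: words_def)
    then show "0 < \<bar>Re (H z p) - Re (H z q)\<bar>" using p q inj_onD[OF J, of p q] by auto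
  qed (auto intro: compact_Times)
  obtain \<eta>2 where \<eta>2: "0 < \<eta>2" "\<forall>q\<in>inputs a - {p}. \<forall>z\<in>{0..1} \<times> {0}. \<eta>2 \<le> \<bar>Re (H z p) - Re (H z q)\<bar>"
    using ends[of 0 w] H(3) w by auto
  obtain \<eta>3 where \<eta>3: "0 < \<eta>3" "\<forall>q\<in>inputs a - {p}. \<forall>z\<in>{0..1} \<times> {1}. \<eta>3 \<le> \<bar>Re (H z p) - Re (H z q)\<bar>"
    using ends[of 1 w'] H(3) w by auto
  show ?thesis
  proof (intro exI[of _ "min \<eta>1 (min \<eta>2 \<eta>3)"] conjI allI impI)
    fix \<delta> assume \<delta>: "0 < \<delta> \<and> \<delta> \<le> min \<eta>1 (min \<eta>2 \<eta>3)"
    have c01: "(0::real) \<in> {0..1}" "(1::real) \<in> {0..1}" by auto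
    have C: "Conf_ins \<delta> a p b (H (s, t)) (K (s, t)) \<in> Conf d (ins_arity a p b)" if s: "s \<in> {0..1}" and t: "t \<in> {0..1}" for s t
    proof (rule Conf_ins_Conf)
      show "H (s, t) \<in> Conf d a" "K (s, t) \<in> Conf (fst p) b" "norm (K (s, t) r) < 1" for r using H(2) K(1) s t by blast+
      show "\<delta> \<le> gap d a (H (s, t))" "\<delta> \<le> 1 - norm (H (s, t) p)" using \<eta>1(2)[OF s t] \<delta> by auto
    qed (use p \<delta> in auto)
    have "Conf_ins \<delta> a p b (H (s, 0)) (K (s, 0)) \<in> Conf_word d (ins_arity a p b) (word_ins a p b w v)" if s: "s \<in> {0..1}" for s
    proof (rule Conf_ins_Conf_word[OF C[OF s]])
      show "H (s, 0) \<in> Conf_word d a w" "K (s, 0) \<in> Conf_word (fst p) b v" "norm (K (s, 0) r) < 1" for r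
        using H(3) K s c01 by blast+
      show "\<delta> \<le> \<bar>Re (H (s, 0) p) - Re (H (s, 0) q)\<bar>" if "q \<in> inputs a" "q \<noteq> p" for q
        using bspec[OF bspec[OF \<eta>2(2), of q], of "(s, 0)"] that s \<delta> by simp
    qed (use w v p \<delta> in auto)
    moreover have "Conf_ins \<delta> a p b (H (s, 1)) (K (s, 1)) \<in> Conf_word d (ins_arity a p b) (word_ins a p b w' v')" if s: "s \<in> {0..1}" for s
    proof (rule Conf_ins_Conf_word[OF C[OF s]])
      show "H (s, 1) \<in> Conf_word d a w'" "K (s, 1) \<in> Conf_word (fst p) b v'" "norm (K (s, 1) r) < 1" for r
        using H(3) K s c01 by blast+
      show "\<delta> \<le> \<bar>Re (H (s, 1) p) - Re (H (s, 1) q)\<bar>" if "q \<in> inputs a" "q \<noteq> p" for q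
        using bspec[OF bspec[OF \<eta>3(2), of q], of "(s, 1)"] that s \<delta> by simp
    qed (use w v p \<delta> in auto)
    ultimately show "small_insertion d a p b (word_ins a p b w v) (word_ins a p b w' v') H K \<delta>"
      using C unfolding small_insertion_def by blast
  qed (use \<eta>1 \<eta>2 \<eta>3 in auto)
qed

text \<open>The radius at \<open>p\<close> takes the role of the size in \<open>Conf_ins\<close>.
  Along a path it varies and need not be very small, and this is the difference from insertion in
  \<open>CoPB_plus\<close>.\<close>

lemma centers_ins:
  assumes p: "p \<in> inputs a"
  shows "centers (graft a p b x (\<lambda>r. emb_comp (x p) (y r))) = Conf_ins (fst (x p)) a p b (centers x) (centers y)"
  unfolding Conf_ins_def
  by (rule graft_eqI[OF p]) (simp_all add: p graft_outside centers_def emb_comp_def)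

text \<open>A smaller radius at \<open>p\<close> leaves an element of \<open>SC_space\<close> with
  the same centers. So every size from the actual radius downwards avoids collisions, without any
  smallness assumption.\<close>

lemma SC_Conf_ins:
  assumes x: "x \<in> SC_space d a" and p: "p \<in> inputs a" and y: "y \<in> SC_space (fst p) b" and l: "0 < l" "l \<le> fst (x p)"
  shows "Conf_ins l a p b (centers x) (centers y) \<in> Conf d (ins_arity a p b)"
proof -
  let ?x = "x(p := (l, snd (x p)))"
  note X = SC_spaceD[OF x]
  have x': "?x \<in> SC_space d a"
    unfolding SC_space_iff
  proof (intro conjI ballI impI allI)
    fix q r assume q: "q \<in> inputs a" and r: "r \<in> inputs a" and qr: "q \<noteq> r"
    show "fst (?x q) + fst (?x r) \<le> dist (snd (?x q)) (snd (?x r))"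
      using X(6)[OF q r qr] l qr by auto
  next
    fix q assume q: "q \<in> inputs a"
    show "0 < fst (?x q)" "norm (snd (?x q)) + fst (?x q) \<le> 1" using X(2,4)[OF q] l by auto
    show "Im (snd (?x q)) = 0" if "fst q = Open" using X(3)[OF q that] by auto
    show "fst (?x q) \<le> Im (snd (?x q))" if "d = Open \<and> fst q = Closed" using X(5)[OF q] that l by auto
  qed (use X p in auto)
  have "centers ?x = centers x" by (auto simp: centers_def)
  then show ?thesis using centers_Conf[OF SC_space_graft[OF x' p y]] centers_ins[OF p, of b ?x y] by simp
qed

lemma very_smallI:
  assumes e: "0 < \<epsilon>" and s: "\<And>\<delta>. \<lbrakk>0 < \<delta>; \<delta> \<le> \<epsilon>\<rbrakk> \<Longrightarrow> small_insertion d a p b w w' (\<lambda>z. g (snd z)) (\<lambda>z. g' (snd z)) \<delta>"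
  shows "very_small d a p b w w' g g' \<epsilon>"
  unfolding very_small_def
proof (intro conjI allI impI ballI)
  fix \<delta> assume "0 < \<delta> \<and> \<delta> \<le> \<epsilon>"
  then have S: "small_insertion d a p b w w' (\<lambda>z. g (snd z)) (\<lambda>z. g' (snd z)) \<delta>" using s by blast
  have "(0::real) \<in> {0..1}" by simp
  then show "Conf_ins \<delta> a p b (g 0) (g' 0) \<in> Conf_word d (ins_arity a p b) w"
    "Conf_ins \<delta> a p b (g 1) (g' 1) \<in> Conf_word d (ins_arity a p b) w'"
    "t \<in> {0..1} \<Longrightarrow> Conf_ins \<delta> a p b (g t) (g' t) \<in> Conf d (ins_arity a p b)" for t
    using S unfolding small_insertion_def by fastforce+
qed (rule e)

lemma continuous_on_path_snd:
  "path g \<Longrightarrow> continuous_on ({0..1} \<times> {0..1}) (\<lambda>z::real \<times> real. g (snd z))"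
  unfolding path_def by (rule continuous_on_compose2[OF _ continuous_on_snd[OF continuous_on_id]]) auto

text \<open>A homotopy between paths in the open disk need not stay in the open disk, but
  it does after scaling it by \<open>1 - s (1 - s)\<close>.\<close>

lemma free_homotopic_in_disk:
  assumes gh: "word_homotopic d a w w' g h" and g: "in_open_disk g" and h: "in_open_disk h"
  obtains H where "continuous_on ({0..1::real} \<times> {0..1::real}) H"
    "\<forall>s\<in>{0..1}. \<forall>t\<in>{0..1}. H (s, t) \<in> Conf d a \<and> (\<forall>q. norm (H (s, t) q) < 1)"
    "\<forall>t\<in>{0..1}. H (0, t) = g t" "\<forall>t\<in>{0..1}. H (1, t) = h t"
    "\<forall>s\<in>{0..1}. H (s, 0) \<in> Conf_word d a w \<and> H (s, 1) \<in> Conf_word d a w'"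
proof -
  obtain H where H: "continuous_on ({0..1::real} \<times> {0..1::real}) H" "\<forall>s\<in>{0..1}. \<forall>t\<in>{0..1}. H (s, t) \<in> Conf d a"
    "\<forall>t\<in>{0..1}. H (0, t) = g t" "\<forall>t\<in>{0..1}. H (1, t) = h t"
    "\<forall>s\<in>{0..1}. H (s, 0) \<in> Conf_word d a w" "\<forall>s\<in>{0..1}. H (s, 1) \<in> Conf_word d a w'"
    using gh by (rule free_homotopicE)
  let ?c = "\<lambda>s::real. 1 - s * (1 - s)"
  have c: "0 < ?c s" "?c s \<le> 1" if "s \<in> {0..1}" for s
  proof -
    have "?c s = (s - 1 / 2)\<^sup>2 + 3 / 4" by (simp add: power2_eq_square algebra_simps)
    then show "0 < ?c s" using zero_le_power2[of "s - 1 / 2"] by linarith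
    show "?c s \<le> 1" using that by simp
  qed
  have scale1: "scale 1 x = x" for x by (simp add: scale_def)
  let ?H = "\<lambda>z. scale (?c (fst z)) (H z)"
  have n: "norm (?H (s, t) q) < 1" if s: "s \<in> {0..1}" and t: "t \<in> {0..1}" for s t q
  proof (cases "s = 0 \<or> s = 1")
    case True
    have "norm (g t q) < 1" "norm (h t q) < 1" using g h t unfolding in_open_disk_def by blast+
    with True show ?thesis using H(3,4) t by (auto simp: scale1)
  next
    case False
    then have "?c s < 1" using s by (simp add: mult_pos_pos)
    then show ?thesis using norm_scale_less[of "H (s, t)" d a "?c s" q] H(2) s t c(1)[OF s] by simp
  qed
  show ?thesis
  proof (rule that[of ?H])
    show "continuous_on ({0..1} \<times> {0..1}) ?H"
      by (intro continuous_on_scale H(1)) (auto intro!: continuous_intros)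
    show "\<forall>s\<in>{0..1}. \<forall>t\<in>{0..1}. ?H (s, t) \<in> Conf d a \<and> (\<forall>q. norm (?H (s, t) q) < 1)"
      unfolding fst_conv
    proof (intro ballI conjI allI)
      fix s t :: real assume st: "s \<in> {0..1}" "t \<in> {0..1}"
      show "scale (?c s) (H (s, t)) \<in> Conf d a" by (rule scale_Conf) (use H(2) c st in auto)
      show "norm (scale (?c s) (H (s, t)) q) < 1" for q using n[OF st, of q] by simp
    qed
    show "\<forall>s\<in>{0..1}. ?H (s, 0) \<in> Conf_word d a w \<and> ?H (s, 1) \<in> Conf_word d a w'"
      using H(5,6) c by (auto intro!: scale_Conf_word)
  qed (use H(3,4) in \<open>auto simp: scale1\<close>)
qed

text \<open>Any admissible representatives and size are joined to the composite of disks by three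
  free homotopies: decrease the size to a suitable \<open>\<delta>\<close>, deform the
  representatives to the paths of centers at this size, and let the size grow from
  \<open>\<delta>\<close> to the radius at \<open>p\<close>. So all members of the union are one
  class, and the union is nonempty because the paths of centers admit a very small size.\<close>

lemma CoPB_mor_ins:
  assumes p: "p \<in> inputs a" and w: "w \<in> words d a" "w' \<in> words d a" and v: "v \<in> words (fst p) b" "v' \<in> words (fst p) b"
    and G: "path G" "path_image G \<subseteq> SC_space d a" and G': "path G'" "path_image G' \<subseteq> SC_space (fst p) b"
    and gw: "word_path d a w w' (\<lambda>t. centers (G t))" and gv: "word_path (fst p) b v v' (\<lambda>t. centers (G' t))"
    and wi: "word_ins a p b w v \<in> words d (ins_arity a p b)" "word_ins a p b w' v' \<in> words d (ins_arity a p b)"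
    and gi: "word_path d (ins_arity a p b) (word_ins a p b w v) (word_ins a p b w' v')
      (\<lambda>t. centers (ins SC_plus d a p b (G t) (G' t)))"
  shows "mor_ins CoPB_plus d a p b (word_mor d a w (\<lambda>t. centers (G t)) w') (word_mor (fst p) b v (\<lambda>t. centers (G' t)) v') =
    word_mor d (ins_arity a p b) (word_ins a p b w v) (\<lambda>t. centers (ins SC_plus d a p b (G t) (G' t))) (word_ins a p b w' v')"
proof -
  let ?e = "ins_arity a p b" and ?u = "word_ins a p b w v" and ?u' = "word_ins a p b w' v'"
  let ?g = "\<lambda>t. centers (G t)" and ?g' = "\<lambda>t. centers (G' t)"
  let ?i = "\<lambda>t. centers (ins SC_plus d a p b (G t) (G' t))"
  have Gt: "G t \<in> SC_space d a" and Gt': "G' t \<in> SC_space (fst p) b" if "t \<in> {0..1}" for t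
    using G(2) G'(2) that by (auto simp: path_image_def)
  have disk: "in_open_disk ?g" "in_open_disk ?g'"
    unfolding in_open_disk_def using norm_centers_less[OF Gt] norm_centers_less[OF Gt'] by blast+
  have i_eq: "?i t = Conf_ins (fst (G t p)) a p b (?g t) (?g' t)" for t by (simp add: centers_ins[OF p])
  have pg: "path ?g" "path ?g'" using gw gv by (simp_all add: word_path_def)
  have key: "word_homotopic d ?e ?u ?u' (\<lambda>t. Conf_ins \<epsilon> a p b (h t) (h' t)) ?i"
    if h: "h \<in> word_class d a w w' ?g" "in_open_disk h" and h': "h' \<in> word_class (fst p) b v v' ?g'" "in_open_disk h'"
      and \<epsilon>: "very_small d a p b ?u ?u' h h' \<epsilon>" for h h' \<epsilon>
  proof -
    have hg: "word_homotopic d a w w' h ?g" "word_homotopic (fst p) b v v' h' ?g'"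
      using h h' free_homotopic_sym[OF word_classD] by blast+
    have ph: "path h" "path h'" using hg free_homotopic_path(1) by blast+
    obtain H where H: "continuous_on ({0..1::real} \<times> {0..1::real}) H"
      "\<forall>s\<in>{0..1}. \<forall>t\<in>{0..1}. H (s, t) \<in> Conf d a \<and> (\<forall>q. norm (H (s, t) q) < 1)"
      "\<forall>t\<in>{0..1}. H (0, t) = h t" "\<forall>t\<in>{0..1}. H (1, t) = ?g t"
      "\<forall>s\<in>{0..1}. H (s, 0) \<in> Conf_word d a w \<and> H (s, 1) \<in> Conf_word d a w'"
      using hg(1) h(2) disk(1) by (rule free_homotopic_in_disk)
    obtain K where K: "continuous_on ({0..1::real} \<times> {0..1::real}) K"
      "\<forall>s\<in>{0..1}. \<forall>t\<in>{0..1}. K (s, t) \<in> Conf (fst p) b \<and> (\<forall>q. norm (K (s, t) q) < 1)"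
      "\<forall>t\<in>{0..1}. K (0, t) = h' t" "\<forall>t\<in>{0..1}. K (1, t) = ?g' t"
      "\<forall>s\<in>{0..1}. K (s, 0) \<in> Conf_word (fst p) b v \<and> K (s, 1) \<in> Conf_word (fst p) b v'"
      using hg(2) h'(2) disk(2) by (rule free_homotopic_in_disk)
    obtain \<eta>1 where \<eta>1: "0 < \<eta>1" "\<And>\<delta>. \<lbrakk>0 < \<delta>; \<delta> \<le> \<eta>1\<rbrakk> \<Longrightarrow> small_insertion d a p b ?u ?u' H K \<delta>"
      using small_insertion_exists[OF p w v H(1,2,5) K(2,5)] by blast
    have cl: "continuous_on {0..1} (\<lambda>t. fst (G t p))"
      using G(1) unfolding path_def by (rule continuous_on_fst[OF continuous_on_coordinate])
    obtain \<eta>2 where \<eta>2: "0 < \<eta>2" "\<forall>t\<in>{0..1}. \<eta>2 \<le> fst (G t p)"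
      using continuous_on_01_bound[OF cl] SC_spaceD(2)[OF Gt p] by blast
    \<comment> \<open>Below the given size, small enough for insertion along all of \<open>H\<close>
      and \<open>K\<close>, and below the radius at \<open>p\<close> at every time.\<close>
    define \<delta> where "\<delta> = min \<epsilon> (min \<eta>1 \<eta>2)"
    have e0: "0 < \<epsilon>" using \<epsilon> by (simp add: very_small_def)
    have \<delta>: "0 < \<delta>" "\<delta> \<le> \<epsilon>" "\<delta> \<le> \<eta>1" "\<delta> \<le> \<eta>2" using e0 \<eta>1(1) \<eta>2(1) by (auto simp: \<delta>_def)
    have S: "small_insertion d a p b ?u ?u' H K \<delta>" using \<eta>1(2) \<delta> by blast
    have between: "0 < (1 - s) * l + s * \<delta> \<and> (1 - s) * l + s * \<delta> \<le> l" if "s \<in> {0..1}" "\<delta> \<le> l" for s l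
    proof -
      have "(1 - s) * \<delta> + s * \<delta> \<le> (1 - s) * l + s * \<delta>" "(1 - s) * l + s * \<delta> \<le> (1 - s) * l + s * l"
        using that by (auto intro!: add_mono mult_left_mono)
      then show ?thesis using \<delta>(1) by (simp add: algebra_simps)
    qed
    have "word_homotopic d ?e ?u ?u' (\<lambda>t. Conf_ins \<epsilon> a p b (h t) (h' t)) (\<lambda>t. Conf_ins \<delta> a p b (h t) (h' t))"
    proof (rule free_homotopicI[where H = "\<lambda>s t. Conf_ins ((1 - s) * \<epsilon> + s * \<delta>) a p b (h t) (h' t)"])
      show "continuous_on ({0..1} \<times> {0..1}) (\<lambda>z::real \<times> real. Conf_ins ((1 - fst z) * \<epsilon> + fst z * \<delta>) a p b (h (snd z)) (h' (snd z)))"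
        by (intro continuous_on_Conf_ins continuous_on_path_snd ph) (intro continuous_intros)
    qed (use \<epsilon> between[OF _ \<delta>(2)] in \<open>auto simp: very_small_def\<close>)
    also have "word_homotopic d ?e ?u ?u' (\<lambda>t. Conf_ins \<delta> a p b (h t) (h' t)) (\<lambda>t. Conf_ins \<delta> a p b (?g t) (?g' t))"
    proof (rule free_homotopicI[where H = "\<lambda>s t. Conf_ins \<delta> a p b (H (s, t)) (K (s, t))"])
      show "continuous_on ({0..1} \<times> {0..1}) (\<lambda>z. Conf_ins \<delta> a p b (H (fst z, snd z)) (K (fst z, snd z)))"
        using H(1) K(1) by (intro continuous_on_Conf_ins continuous_on_const) simp_all
    qed (use S H(3,4) K(3,4) in \<open>auto simp: small_insertion_def\<close>)
    \<comment> \<open>Proved from the radius down to \<open>\<delta>\<close>. Collisions are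
      excluded by \<open>SC_Conf_ins\<close>; the order at the two ends holds by convexity, since it
      holds for the actual composite (\<open>I\<close>) and for the small insertion
      (\<open>D\<close>).\<close>
    also have "word_homotopic d ?e ?u ?u' (\<lambda>t. Conf_ins \<delta> a p b (?g t) (?g' t)) ?i"
    proof (rule free_homotopic_sym, rule free_homotopicI[where H = "\<lambda>s t. Conf_ins ((1 - s) * fst (G t p) + s * \<delta>) a p b (?g t) (?g' t)"])
      have cG: "continuous_on ({0..1} \<times> {0..1}) (\<lambda>z::real \<times> real. fst (G (snd z) p))"
        by (rule continuous_on_fst[OF continuous_on_coordinate[OF continuous_on_path_snd[OF G(1)]]])
      show "continuous_on ({0..1} \<times> {0..1})
        (\<lambda>z::real \<times> real. Conf_ins ((1 - fst z) * fst (G (snd z) p) + fst z * \<delta>) a p b (?g (snd z)) (?g' (snd z)))"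
        by (intro continuous_on_Conf_ins continuous_on_path_snd pg continuous_on_add continuous_on_mult continuous_on_diff
            continuous_on_const continuous_on_fst[OF continuous_on_id] cG)
      show "Conf_ins ((1 - s) * fst (G t p) + s * \<delta>) a p b (?g t) (?g' t) \<in> Conf d ?e" if s: "s \<in> {0..1}" and t: "t \<in> {0..1}" for s t
      proof -
        have "\<delta> \<le> fst (G t p)" using \<eta>2(2) t \<delta>(4) by fastforce
        with between[OF s this] show ?thesis by (intro SC_Conf_ins[OF Gt[OF t] p Gt'[OF t]]) auto
      qed
      have 01: "(0::real) \<in> {0..1}" "(1::real) \<in> {0..1}" by auto
      have D: "Conf_ins \<delta> a p b (?g 0) (?g' 0) \<in> Conf_word d ?e ?u" "Conf_ins \<delta> a p b (?g 1) (?g' 1) \<in> Conf_word d ?e ?u'"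
        using S H(4) K(4) 01 unfolding small_insertion_def by metis+
      have I: "?i 0 \<in> Conf_word d ?e ?u" "?i 1 \<in> Conf_word d ?e ?u'"
        using gi by (simp_all add: word_path_def pathstart_def pathfinish_def)
      show "Conf_ins ((1 - s) * fst (G 0 p) + s * \<delta>) a p b (?g 0) (?g' 0) \<in> Conf_word d ?e ?u" if "s \<in> {0..1}" for s
        unfolding Conf_ins_mix[OF p] using mix_Conf_word[OF wi(1) I(1) D(1) that] unfolding i_eq .
      show "Conf_ins ((1 - s) * fst (G 1 p) + s * \<delta>) a p b (?g 1) (?g' 1) \<in> Conf_word d ?e ?u'" if "s \<in> {0..1}" for s
        unfolding Conf_ins_mix[OF p] using mix_Conf_word[OF wi(2) I(2) D(2) that] unfolding i_eq .
    qed (simp_all add: centers_ins[OF p])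
    finally show ?thesis .
  qed
  \<comment> \<open>A single path is treated as a homotopy that is constant in
    \<open>s\<close>.\<close>
  have "\<exists>\<eta>>0. \<forall>\<delta>. 0 < \<delta> \<and> \<delta> \<le> \<eta> \<longrightarrow> small_insertion d a p b ?u ?u' (\<lambda>z. ?g (snd z)) (\<lambda>z. ?g' (snd z)) \<delta>"
  proof (rule small_insertion_exists[OF p w v continuous_on_path_snd[OF pg(1)]])
    have 1: "?g t \<in> Conf d a" "?g' t \<in> Conf (fst p) b" "norm (?g t q) < 1" "norm (?g' t q) < 1" if "t \<in> {0..1}" for t q
      using centers_Conf[OF Gt[OF that]] centers_Conf[OF Gt'[OF that]] norm_centers_less[OF Gt[OF that]]
        norm_centers_less[OF Gt'[OF that]] by blast+
    show "\<forall>s\<in>{0..1::real}. \<forall>t\<in>{0..1}. ?g (snd (s, t)) \<in> Conf d a \<and> (\<forall>q. norm (?g (snd (s, t)) q) < 1)"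
      "\<forall>s\<in>{0..1::real}. \<forall>t\<in>{0..1}. ?g' (snd (s, t)) \<in> Conf (fst p) b \<and> (\<forall>q. norm (?g' (snd (s, t)) q) < 1)"
      unfolding snd_conv using 1 by blast+
  qed (use gw gv in \<open>simp_all add: word_path_def pathstart_def pathfinish_def\<close>)
  then obtain \<epsilon> where "0 < \<epsilon>" "\<And>\<delta>. \<lbrakk>0 < \<delta>; \<delta> \<le> \<epsilon>\<rbrakk> \<Longrightarrow>
    small_insertion d a p b ?u ?u' (\<lambda>z. ?g (snd z)) (\<lambda>z. ?g' (snd z)) \<delta>" by blast
  then have \<epsilon>: "very_small d a p b ?u ?u' ?g ?g' \<epsilon>" by (rule very_smallI)
  let ?U = "\<Union>h\<in>{h \<in> word_class d a w w' ?g. in_open_disk h}. \<Union>h'\<in>{h' \<in> word_class (fst p) b v v' ?g'. in_open_disk h'}.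
      \<Union>\<epsilon>\<in>{\<epsilon>. very_small d a p b ?u ?u' h h' \<epsilon>}. word_class d ?e ?u ?u' (\<lambda>t. Conf_ins \<epsilon> a p b (h t) (h' t))"
  have "?U = word_class d ?e ?u ?u' ?i"
  proof (intro equalityI)
    show "?U \<subseteq> word_class d ?e ?u ?u' ?i"
    proof (intro UN_least)
      fix h h' \<epsilon> assume "h \<in> {h \<in> word_class d a w w' ?g. in_open_disk h}"
        "h' \<in> {h' \<in> word_class (fst p) b v v' ?g'. in_open_disk h'}" "\<epsilon> \<in> {\<epsilon>. very_small d a p b ?u ?u' h h' \<epsilon>}"
      then show "word_class d ?e ?u ?u' (\<lambda>t. Conf_ins \<epsilon> a p b (h t) (h' t)) \<subseteq> word_class d ?e ?u ?u' ?i"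
        by (intro equalityD1 word_class_eqI key) simp_all
    qed
    have g: "?g \<in> {h \<in> word_class d a w w' ?g. in_open_disk h}" "?g' \<in> {h' \<in> word_class (fst p) b v v' ?g'. in_open_disk h'}"
      "\<epsilon> \<in> {\<epsilon>. very_small d a p b ?u ?u' ?g ?g' \<epsilon>}"
      using word_class_self[OF gw] word_class_self[OF gv] disk \<epsilon> by simp_all
    have "word_class d ?e ?u ?u' ?i = word_class d ?e ?u ?u' (\<lambda>t. Conf_ins \<epsilon> a p b (?g t) (?g' t))"
      by (rule word_class_eqI[OF key, symmetric]) (use g in simp_all)
    also have "\<dots> \<subseteq> ?U" by (rule subsetI, rule UN_I[OF g(1)], rule UN_I[OF g(2)], rule UN_I[OF g(3)])
    finally show "word_class d ?e ?u ?u' ?i \<subseteq> ?U" .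
  qed
  then show ?thesis by (simp add: CoPB_plus_def word_mor_def)
qed

section \<open>Trees and the suboperad generated by the binary operations\<close>

text \<open>Here the constructor \<open>Nul\<close> may occur anywhere in a tree: such trees are formal
  compositions of the generators of \<open>\<Omega>\<Omega>'\<^sub>+\<close>.\<close>

fun composable_tree :: "color \<Rightarrow> tree \<Rightarrow> bool" where
  "composable_tree d (Leaf p) \<longleftrightarrow> fst p = d"
| "composable_tree d (MuC s t) \<longleftrightarrow> d = Closed \<and> composable_tree Closed s \<and> composable_tree Closed t"
| "composable_tree d (MuO s t) \<longleftrightarrow> d = Open \<and> composable_tree Open s \<and> composable_tree Open t"
| "composable_tree d (F t) \<longleftrightarrow> d = Open \<and> composable_tree Closed t"
| "composable_tree d (Nul k) \<longleftrightarrow> k = d"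

definition on_leaves :: "emb \<Rightarrow> tree \<Rightarrow> (input \<Rightarrow> emb) \<Rightarrow> input \<Rightarrow> emb" where
  "on_leaves e t x = (\<lambda>q. if q \<in> set (leaves t) then emb_comp e (x q) else 0)"

text \<open>Evaluates a formal composition in \<open>SC_plus\<close> directly on the names of the
  leaves, so that neither arities nor renumbering of inputs occur. The result is meaningful for
  trees with distinct leaves; a name shared by two branches would be read in the left one.\<close>

fun realize :: "tree \<Rightarrow> input \<Rightarrow> emb" where
  "realize (Leaf p) = (\<lambda>_. 0)(p := (1, 0))"
| "realize (MuC s t) = (\<lambda>q. if q \<in> set (leaves s) then on_leaves (1/2, -1/2) s (realize s) q
     else on_leaves (1/2, 1/2) t (realize t) q)"
| "realize (MuO s t) = (\<lambda>q. if q \<in> set (leaves s) then on_leaves (1/2, -1/2) s (realize s) q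
     else on_leaves (1/2, 1/2) t (realize t) q)"
| "realize (F t) = on_leaves (1/2, \<i>/2) t (realize t)"
| "realize (Nul k) = (\<lambda>_. 0)"

text \<open>Formal substitution: in contrast to \<open>tree_subst\<close> it does not apply the
  relations for nullary elements, and so it matches composition of disks.\<close>

fun graft_leaves :: "(input \<Rightarrow> tree) \<Rightarrow> tree \<Rightarrow> tree" where
  "graft_leaves \<theta> (Leaf p) = \<theta> p"
| "graft_leaves \<theta> (MuC s t) = MuC (graft_leaves \<theta> s) (graft_leaves \<theta> t)"
| "graft_leaves \<theta> (MuO s t) = MuO (graft_leaves \<theta> s) (graft_leaves \<theta> t)"
| "graft_leaves \<theta> (F t) = F (graft_leaves \<theta> t)"
| "graft_leaves \<theta> (Nul k) = Nul k"

text \<open>Replacing each leaf by itself changes nothing except that \<open>tree_subst\<close>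
  applies the relations for nullary elements. This is the normal form in
  \<open>Omega_plus\<close>.\<close>

definition reduce :: "tree \<Rightarrow> tree" where
  "reduce = tree_subst Leaf"

text \<open>Nullary subtrees may be collapsed early or late with the same result. Hence operations
  can be carried out formally and reduced at the end.\<close>

lemma tree_subst_tree_subst: "tree_subst \<theta> (tree_subst \<eta> t) = tree_subst (\<lambda>p. tree_subst \<theta> (\<eta> p)) t"
  by (induction t) (auto simp: Let_def)

lemma tree_subst_reduce: "tree_subst \<theta> (reduce t) = tree_subst \<theta> t"
  by (simp add: reduce_def tree_subst_tree_subst)

lemma reduce_graft_leaves: "reduce (graft_leaves \<theta> t) = tree_subst (\<lambda>p. reduce (\<theta> p)) t"
  by (induction t) (auto simp: Let_def reduce_def)

lemma leaves_tree_subst: "leaves (tree_subst \<theta> t) = concat (map (\<lambda>p. leaves (\<theta> p)) (leaves t))"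
proof (induction t)
  case (MuC s t)
  then show ?case
    by (cases "tree_subst \<theta> s = Nul Closed"; cases "tree_subst \<theta> t = Nul Closed") (auto simp: Let_def)
next
  case (MuO s t)
  then show ?case
    by (cases "tree_subst \<theta> s = Nul Open"; cases "tree_subst \<theta> t = Nul Open") (auto simp: Let_def)
next
  case (F t)
  then show ?case by (cases "tree_subst \<theta> t = Nul Closed") (auto simp: Let_def)
qed auto

lemma leaves_graft_leaves: "leaves (graft_leaves \<theta> t) = concat (map (\<lambda>p. leaves (\<theta> p)) (leaves t))"
  by (induction t) auto

lemma leaves_reduce [simp]: "leaves (reduce t) = leaves t"
  by (simp add: reduce_def leaves_tree_subst)

lemma free_tree_leaves: "free_tree d t \<Longrightarrow> leaves t \<noteq> []"
  by (induction d t rule: free_tree.induct) auto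

lemma free_tree_reduce: "composable_tree d t \<Longrightarrow> free_tree d (reduce t) \<or> reduce t = Nul d"
  by (induction d t rule: composable_tree.induct) (auto simp: reduce_def Let_def)

lemma reduce_no_leaves: "\<lbrakk>composable_tree d t; leaves t = []\<rbrakk> \<Longrightarrow> reduce t = Nul d"
  using free_tree_reduce free_tree_leaves leaves_reduce by metis

lemma free_tree_composable: "free_tree d t \<Longrightarrow> composable_tree d t \<and> reduce t = t"
proof (induction d t rule: free_tree.induct)
  case (2 d s t)
  then have "s \<noteq> Nul Closed" "t \<noteq> Nul Closed" by auto
  with 2 show ?case by (auto simp: reduce_def)
next
  case (3 d s t)
  then have "s \<noteq> Nul Open" "t \<noteq> Nul Open" by auto
  with 3 show ?case by (auto simp: reduce_def)
next
  case (4 d t)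
  then have "t \<noteq> Nul Closed" by auto
  with 4 show ?case by (auto simp: reduce_def)
qed (auto simp: reduce_def)

lemma composable_graft_leaves:
  "\<lbrakk>composable_tree d t; \<And>p. p \<in> set (leaves t) \<Longrightarrow> composable_tree (fst p) (\<theta> p)\<rbrakk> \<Longrightarrow> composable_tree d (graft_leaves \<theta> t)"
  by (induction d t rule: composable_tree.induct) auto

lemma composable_Closed_leaves: "\<lbrakk>composable_tree d t; d = Closed; q \<in> set (leaves t)\<rbrakk> \<Longrightarrow> fst q = Closed"
  by (induction d t rule: composable_tree.induct) auto

lemma realize_outside: "q \<notin> set (leaves t) \<Longrightarrow> realize t q = 0"
  by (induction t) (auto simp: on_leaves_def)

lemma norm_half_shift: "norm (z / 2 + c) \<le> norm z / 2 + norm c" for z c :: complex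
  using norm_triangle_ineq[of "z / 2" c] by (simp add: norm_divide)

lemma realize_bounds: "q \<in> set (leaves t) \<Longrightarrow> 0 < fst (realize t q) \<and> norm (snd (realize t q)) + fst (realize t q) \<le> 1"
proof (induction t)
  case (MuC s t)
  then show ?case
    using norm_half_shift[of "snd (realize s q)" "-1/2"] norm_half_shift[of "snd (realize t q)" "1/2"]
    by (auto simp: on_leaves_def emb_comp_def)
next
  case (MuO s t)
  then show ?case
    using norm_half_shift[of "snd (realize s q)" "-1/2"] norm_half_shift[of "snd (realize t q)" "1/2"]
    by (auto simp: on_leaves_def emb_comp_def)
next
  case (F t)
  then show ?case
    using norm_half_shift[of "snd (realize t q)" "\<i>/2"] by (auto simp: on_leaves_def emb_comp_def norm_divide)
qed auto

lemma realize_Re_less: "q \<in> set (leaves t) \<Longrightarrow> \<bar>Re (snd (realize t q))\<bar> < 1"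
  using realize_bounds[of q t] abs_Re_le_cmod[of "snd (realize t q)"] by linarith

lemma realize_neq_0: "q \<in> set (leaves t) \<Longrightarrow> realize t q \<noteq> 0"
  using realize_bounds[of q t] by auto

text \<open>Heights of centers reveal the root of an open tree: \<open>\<mu>\<^sub>c\<close> keeps
  all centers on the real axis, \<open>F\<close> lifts them to height exactly 1/2, and
  \<open>MuO\<close> halves heights that are at most 1/2, giving at most 1/4.\<close>

lemma realize_Im_Closed: "composable_tree Closed t \<Longrightarrow> Im (snd (realize t q)) = 0"
  by (induction t) (auto simp: on_leaves_def emb_comp_def)

lemma realize_Im_Open: "composable_tree Open t \<Longrightarrow> Im (snd (realize t q)) \<le> 1 / 2"
proof (induction t)
  case (F t)
  then show ?case using realize_Im_Closed[of t q] by (auto simp: on_leaves_def emb_comp_def)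
qed (auto simp: on_leaves_def emb_comp_def)

lemma realize_MuO_Im: "composable_tree d (MuO s t) \<Longrightarrow> Im (snd (realize (MuO s t) q)) \<le> 1 / 4"
  using realize_Im_Open[of s q] realize_Im_Open[of t q] by (auto simp: on_leaves_def emb_comp_def)

lemma realize_F_Im:
  "\<lbrakk>composable_tree d (F t); q \<in> set (leaves (F t))\<rbrakk> \<Longrightarrow> Im (snd (realize (F t) q)) = 1 / 2"
  using realize_Im_Closed[of t q] by (auto simp: on_leaves_def emb_comp_def)

lemma realize_MuO_neq_F:
  "\<lbrakk>composable_tree d (MuO s t); composable_tree d' (F u); q \<in> set (leaves (F u))\<rbrakk> \<Longrightarrow> realize (MuO s t) \<noteq> realize (F u)"
  using realize_MuO_Im[of d s t q] realize_F_Im[of d' u q] by (auto simp del: realize.simps)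

lemma emb_comp_inj: "\<lbrakk>emb_comp e x = emb_comp e y; fst e \<noteq> 0\<rbrakk> \<Longrightarrow> x = y"
  by (auto simp: emb_comp_def prod_eq_iff)

lemma set_leaves_realize: "set (leaves t) = {q. realize t q \<noteq> 0}"
  using realize_outside realize_neq_0 by blast

lemma realize_no_leaves: "\<lbrakk>realize t = realize t'; leaves t = []\<rbrakk> \<Longrightarrow> leaves t' = []"
proof -
  assume e: "realize t = realize t'" and "leaves t = []"
  have "set (leaves t') = set (leaves t)" by (simp only: set_leaves_realize e)
  then show "leaves t' = []" using \<open>leaves t = []\<close> by simp
qed

lemma on_leaves_inj:
  assumes "\<And>q. q \<in> set (leaves s) \<Longrightarrow> on_leaves e s (realize s) q = on_leaves e s' (realize s') q"
    and "set (leaves s) = set (leaves s')" "fst e \<noteq> 0"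
  shows "realize s = realize s'"
proof
  fix q show "realize s q = realize s' q"
  proof (cases "q \<in> set (leaves s)")
    case True then show ?thesis using assms(1)[of q] assms(2,3) emb_comp_inj[of e] by (simp add: on_leaves_def)
  qed (use assms(2) realize_outside in metis)
qed

text \<open>The left and right parts of a composite with a binary generator are told apart by the signs
  of the real parts of their centers.\<close>

lemma realize_binary_inj:
  assumes eq: "\<And>q. (if q \<in> set (leaves s) then on_leaves (1/2, -1/2) s (realize s) q else on_leaves (1/2, 1/2) t (realize t) q) =
      (if q \<in> set (leaves s') then on_leaves (1/2, -1/2) s' (realize s') q else on_leaves (1/2, 1/2) t' (realize t') q)"
    and disj: "set (leaves s) \<inter> set (leaves t) = {}" "set (leaves s') \<inter> set (leaves t') = {}"
  shows "realize s = realize s'" "realize t = realize t'"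
proof -
  have L: "Re (snd (on_leaves (1/2, -1/2) s (realize s) q)) < 0" "fst (on_leaves (1/2, -1/2) s (realize s) q) \<noteq> 0"
    if "q \<in> set (leaves s)" for q s
    using realize_Re_less[OF that] realize_bounds[OF that] that by (auto simp: on_leaves_def emb_comp_def)
  have R: "0 < Re (snd (on_leaves (1/2, 1/2) s (realize s) q))" if "q \<in> set (leaves s)" for q s
    using realize_Re_less[OF that] that by (auto simp: on_leaves_def emb_comp_def)
  have Z: "on_leaves e s x q = 0" if "q \<notin> set (leaves s)" for e s x q using that by (simp add: on_leaves_def)
  have sub: "q \<in> set (leaves s')"
    if eq: "\<And>q. (if q \<in> set (leaves s) then on_leaves (1/2, -1/2) s (realize s) q else on_leaves (1/2, 1/2) t (realize t) q) =
      (if q \<in> set (leaves s') then on_leaves (1/2, -1/2) s' (realize s') q else on_leaves (1/2, 1/2) t' (realize t') q)"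
      and q: "q \<in> set (leaves s)" for q s t s' t'
  proof (rule ccontr)
    assume n: "q \<notin> set (leaves s')"
    have "on_leaves (1/2, -1/2) s (realize s) q = on_leaves (1/2, 1/2) t' (realize t') q" using eq[of q] q n by simp
    then show False using L(1)[OF q] R[of q t'] Z[of q t' "(1/2, 1/2)" "realize t'"] by (cases "q \<in> set (leaves t')") auto
  qed
  have s: "set (leaves s) = set (leaves s')"
    using sub[OF eq] sub[OF eq[symmetric]] by blast
  have m: "q \<in> set (leaves t) \<longleftrightarrow> on_leaves (1/2, 1/2) t (realize t) q \<noteq> 0" for q t
    using R[of q t] Z[of q t "(1/2, 1/2)" "realize t"] by (cases "q \<in> set (leaves t)") auto
  have e: "on_leaves (1/2, 1/2) t (realize t) q = on_leaves (1/2, 1/2) t' (realize t') q" if "q \<notin> set (leaves s)" for q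
    using eq[of q] that s by simp
  have t: "set (leaves t) = set (leaves t')"
  proof (rule set_eqI)
    fix q show "q \<in> set (leaves t) \<longleftrightarrow> q \<in> set (leaves t')"
    proof (cases "q \<in> set (leaves s)")
      case True then show ?thesis using disj s by auto
    next
      case False then show ?thesis using e[OF False] m[of q t] m[of q t'] by simp
    qed
  qed
  show "realize s = realize s'"
  proof (rule on_leaves_inj[OF _ s, of "(1/2, -1/2)"])
    fix q assume "q \<in> set (leaves s)"
    then show "on_leaves (1/2, -1/2) s (realize s) q = on_leaves (1/2, -1/2) s' (realize s') q" using eq[of q] s by simp
  qed simp
  show "realize t = realize t'"
  proof (rule on_leaves_inj[OF _ t, of "(1/2, 1/2)"])
    fix q assume "q \<in> set (leaves t)"
    then have "q \<notin> set (leaves s)" "q \<notin> set (leaves s')" using disj s by auto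
    then show "on_leaves (1/2, 1/2) t (realize t) q = on_leaves (1/2, 1/2) t' (realize t') q" using eq[of q] by simp
  qed simp
qed

text \<open>A leaf alone is realized with radius 1 and every generator halves the radii, so a leaf
  is recognized by the size of its disk.\<close>

lemma realize_size_le:
  assumes "q \<in> set (leaves t)" "\<And>p. t \<noteq> Leaf p"
  shows "fst (realize t q) \<le> 1 / 2"
proof -
  have "fst (realize s q) \<le> 1" if "q \<in> set (leaves s)" for s
    using realize_bounds[OF that] norm_ge_zero[of "snd (realize s q)"] by linarith
  then show ?thesis using assms by (cases t) (auto simp: on_leaves_def emb_comp_def)
qed

lemma realize_not_Leaf:
  assumes "realize t = realize t'" "q \<in> set (leaves t)" "\<And>p. t \<noteq> Leaf p"
  shows "t' \<noteq> Leaf p"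
proof
  assume t': "t' = Leaf p"
  have "q \<in> set (leaves t')" using assms(1,2) by (simp only: set_leaves_realize)
  then have "fst (realize t' q) = 1" by (simp add: t')
  then show False using realize_size_le[OF assms(2,3)] assms(1) by simp
qed

text \<open>Induction on \<open>T\<close>. The root of \<open>T'\<close> is forced by sizes (a
  leaf), heights (\<open>F\<close> against \<open>MuO\<close>) and the output color, and then the
  branches have equal realizations. Without leaves the realization is 0 and shows nothing of the
  shape, but then both trees reduce to \<open>Nul d\<close>; hence the case distinction at each
  constructor.\<close>

lemma realize_inj:
  assumes "composable_tree d T" "composable_tree d T'" "distinct (leaves T)" "distinct (leaves T')" "realize T = realize T'"
  shows "reduce T = reduce T'"
  using assms
proof (induction T arbitrary: d T')
  case (Leaf p)
  have "realize T' p = (1, 0)" using Leaf.prems(5)[symmetric] by simp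
  then have "p \<in> set (leaves T')" "fst (realize T' p) = 1" by (simp_all add: set_leaves_realize zero_prod_def)
  then obtain q where "T' = Leaf q" using realize_size_le[of p T'] by force
  with \<open>p \<in> set (leaves T')\<close> show ?case by simp
next
  case (MuC s t)
  show ?case
  proof (cases "leaves (MuC s t) = []")
    case True
    then have "leaves T' = []" by (rule realize_no_leaves[OF MuC.prems(5)])
    then show ?thesis using True MuC.prems reduce_no_leaves by metis
  next
    case False
    then obtain q where q: "q \<in> set (leaves (MuC s t))" using last_in_set by blast
    then have q': "q \<in> set (leaves T')" by (simp only: set_leaves_realize MuC.prems(5))
    have n: "\<And>p. T' \<noteq> Leaf p" by (rule realize_not_Leaf[OF MuC.prems(5) q]) simp
    then obtain s' t' where T': "T' = MuC s' t'"
      using MuC.prems(1,2) q' n by (cases T') auto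
    have "realize s = realize s'" "realize t = realize t'"
      using realize_binary_inj[of s t s' t'] MuC.prems(3-5) T' by (auto simp: fun_eq_iff)
    then have "reduce s = reduce s'" "reduce t = reduce t'"
      using MuC.IH(1)[of Closed s'] MuC.IH(2)[of Closed t'] MuC.prems T' by auto
    then show ?thesis by (simp add: T' reduce_def)
  qed
next
  case (MuO s t)
  show ?case
  proof (cases "leaves (MuO s t) = []")
    case True
    then have "leaves T' = []" by (rule realize_no_leaves[OF MuO.prems(5)])
    then show ?thesis using True MuO.prems reduce_no_leaves by metis
  next
    case False
    then obtain q where q: "q \<in> set (leaves (MuO s t))" using last_in_set by blast
    then have q': "q \<in> set (leaves T')" by (simp only: set_leaves_realize MuO.prems(5))
    have n: "\<And>p. T' \<noteq> Leaf p" by (rule realize_not_Leaf[OF MuO.prems(5) q]) simp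
    have "T' \<noteq> F u" for u
      using realize_MuO_neq_F[OF MuO.prems(1), of d u q] MuO.prems(2,5) q' by metis
    then obtain s' t' where T': "T' = MuO s' t'"
      using MuO.prems(1,2) q' n by (cases T') auto
    have "realize s = realize s'" "realize t = realize t'"
      using realize_binary_inj[of s t s' t'] MuO.prems(3-5) T' by (auto simp: fun_eq_iff)
    then have "reduce s = reduce s'" "reduce t = reduce t'"
      using MuO.IH(1)[of Open s'] MuO.IH(2)[of Open t'] MuO.prems T' by auto
    then show ?thesis by (simp add: T' reduce_def)
  qed
next
  case (F t)
  show ?case
  proof (cases "leaves (F t) = []")
    case True
    then have "leaves T' = []" by (rule realize_no_leaves[OF F.prems(5)])
    then show ?thesis using True F.prems reduce_no_leaves by metis
  next
    case False
    then obtain q where q: "q \<in> set (leaves (F t))" using last_in_set by blast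
    then have q': "q \<in> set (leaves T')" by (simp only: set_leaves_realize F.prems(5))
    have n: "\<And>p. T' \<noteq> Leaf p" by (rule realize_not_Leaf[OF F.prems(5) q]) simp
    have "T' \<noteq> MuO u v" for u v
      using realize_MuO_neq_F[of d u v d t q] F.prems(1,2,5) q by metis
    then obtain t' where T': "T' = F t'"
      using F.prems(1,2) q' n by (cases T') auto
    have l: "set (leaves t) = set (leaves t')"
      using F.prems(5) T' set_leaves_realize[of "F t"] set_leaves_realize[of T'] by simp
    have "realize t = realize t'"
      by (rule on_leaves_inj[OF _ l, of "(1/2, \<i>/2)"]) (use F.prems(5) T' in simp_all)
    then have "reduce t = reduce t'" using F.IH[of Closed t'] F.prems T' by auto
    then show ?thesis by (simp add: T' reduce_def)
  qed
next
  case (Nul k)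
  then have "leaves T' = []" using realize_no_leaves[OF Nul.prems(5)] by simp
  then show ?case using Nul.prems reduce_no_leaves[of d T'] reduce_no_leaves[of d "Nul k"] by simp
qed

text \<open>The embedding at a leaf is the composite along the way down from the root. Distinctness
  guarantees that \<open>q\<close> occurs only in the tree grafted at \<open>p\<close>.\<close>

lemma realize_graft_leaves:
  assumes "distinct (leaves (graft_leaves \<theta> t))" "p \<in> set (leaves t)" "q \<in> set (leaves (\<theta> p))"
  shows "realize (graft_leaves \<theta> t) q = emb_comp (realize t p) (realize (\<theta> p) q)"
  using assms
proof (induction t)
  case (MuC s t)
  have s: "q \<in> set (leaves (graft_leaves \<theta> s))" if "p \<in> set (leaves s)" for s
    using that MuC.prems(3) by (auto simp: leaves_graft_leaves)
  show ?case
  proof (cases "p \<in> set (leaves s)")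
    case True
    then show ?thesis using MuC s[of s] by (simp add: on_leaves_def emb_comp_assoc)
  next
    case False
    then have "p \<in> set (leaves t)" using MuC.prems by simp
    then have "q \<in> set (leaves (graft_leaves \<theta> t))" "q \<notin> set (leaves (graft_leaves \<theta> s))" using s MuC.prems(1) by auto
    then show ?thesis using MuC False \<open>p \<in> set (leaves t)\<close> by (simp add: on_leaves_def emb_comp_assoc)
  qed
next
  case (MuO s t)
  have s: "q \<in> set (leaves (graft_leaves \<theta> s))" if "p \<in> set (leaves s)" for s
    using that MuO.prems(3) by (auto simp: leaves_graft_leaves)
  show ?case
  proof (cases "p \<in> set (leaves s)")
    case True
    then show ?thesis using MuO s[of s] by (simp add: on_leaves_def emb_comp_assoc)
  next
    case False
    then have "p \<in> set (leaves t)" using MuO.prems by simp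
    then have "q \<in> set (leaves (graft_leaves \<theta> t))" "q \<notin> set (leaves (graft_leaves \<theta> s))" using s MuO.prems(1) by auto
    then show ?thesis using MuO False \<open>p \<in> set (leaves t)\<close> by (simp add: on_leaves_def emb_comp_assoc)
  qed
next
  case (F t)
  then have "q \<in> set (leaves (graft_leaves \<theta> t))" by (auto simp: leaves_graft_leaves)
  then show ?case using F by (simp add: on_leaves_def emb_comp_assoc)
qed auto

text \<open>A binary generator puts its left branch at negative and its right branch at positive
  real parts, and within a branch the order is kept. Thus the centers of a realization are in the
  order that \<open>omega_plus\<close> assigns to the tree.\<close>

lemma realize_sorted: "distinct (leaves t) \<Longrightarrow> sorted_wrt (\<lambda>p q. Re (snd (realize t p)) < Re (snd (realize t q))) (leaves t)"
proof (induction t)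
  case (MuC s t)
  have 1: "Re (snd (realize (MuC s t) p)) < Re (snd (realize (MuC s t) q))" if "p \<in> set (leaves s)" "q \<in> set (leaves t)" for p q
    using that MuC.prems realize_Re_less[OF that(1)] realize_Re_less[OF that(2)] by (auto simp: on_leaves_def emb_comp_def)
  have "sorted_wrt (\<lambda>p q. Re (snd (realize (MuC s t) p)) < Re (snd (realize (MuC s t) q))) (leaves s)"
    by (rule sorted_wrt_mono_rel[OF _ MuC.IH(1)]) (use MuC.prems in \<open>auto simp: on_leaves_def emb_comp_def\<close>)
  moreover have "sorted_wrt (\<lambda>p q. Re (snd (realize (MuC s t) p)) < Re (snd (realize (MuC s t) q))) (leaves t)"
    by (rule sorted_wrt_mono_rel[OF _ MuC.IH(2)]) (use MuC.prems in \<open>auto simp: on_leaves_def emb_comp_def\<close>)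
  ultimately show ?case using 1 by (simp add: sorted_wrt_append del: realize.simps)
next
  case (MuO s t)
  have 1: "Re (snd (realize (MuO s t) p)) < Re (snd (realize (MuO s t) q))" if "p \<in> set (leaves s)" "q \<in> set (leaves t)" for p q
    using that MuO.prems realize_Re_less[OF that(1)] realize_Re_less[OF that(2)] by (auto simp: on_leaves_def emb_comp_def)
  have "sorted_wrt (\<lambda>p q. Re (snd (realize (MuO s t) p)) < Re (snd (realize (MuO s t) q))) (leaves s)"
    by (rule sorted_wrt_mono_rel[OF _ MuO.IH(1)]) (use MuO.prems in \<open>auto simp: on_leaves_def emb_comp_def\<close>)
  moreover have "sorted_wrt (\<lambda>p q. Re (snd (realize (MuO s t) p)) < Re (snd (realize (MuO s t) q))) (leaves t)"
    by (rule sorted_wrt_mono_rel[OF _ MuO.IH(2)]) (use MuO.prems in \<open>auto simp: on_leaves_def emb_comp_def\<close>)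
  ultimately show ?case using 1 by (simp add: sorted_wrt_append del: realize.simps)
next
  case (F t)
  show ?case unfolding leaves.simps
    by (rule sorted_wrt_mono_rel[OF _ F.IH]) (use F.prems in \<open>auto simp: on_leaves_def emb_comp_def\<close>)
qed auto

section \<open>Insertion and relabeling of trees\<close>

definition labeled_tree :: "color \<Rightarrow> arity \<Rightarrow> tree \<Rightarrow> bool" where
  "labeled_tree d a T \<longleftrightarrow> composable_tree d T \<and> distinct (leaves T) \<and> set (leaves T) = inputs a"

abbreviation relabel_leaves :: "(input \<Rightarrow> input) \<Rightarrow> tree \<Rightarrow> tree" where
  "relabel_leaves \<sigma> \<equiv> graft_leaves (\<lambda>p. Leaf (\<sigma> p))"

text \<open>Insertion as in \<open>Omega_plus\<close> but without the relations: in
  \<open>SC_plus\<close> a nullary input leaves a trace in the size and position of the remaining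
  disks.\<close>

definition insert_tree :: "arity \<Rightarrow> input \<Rightarrow> arity \<Rightarrow> tree \<Rightarrow> tree \<Rightarrow> tree" where
  "insert_tree a p b T S =
     graft_leaves (\<lambda>q. if q = p then relabel_leaves (inner_label a p) S else Leaf (outer_label p b q)) T"

lemma leaves_relabel [simp]: "leaves (relabel_leaves \<sigma> T) = map \<sigma> (leaves T)"
  by (simp add: leaves_graft_leaves concat_map_singleton)

lemma leaves_insert_tree: "leaves (insert_tree a p b T S) = word_ins a p b (leaves T) (leaves S)"
  unfolding insert_tree_def leaves_graft_leaves word_ins_def
  by (rule arg_cong[where f = concat], rule map_cong) auto

lemma distinct_concat_map:
  assumes "distinct w" "\<And>q. q \<in> set w \<Longrightarrow> distinct (f q)"
    and "\<And>q r. \<lbrakk>q \<in> set w; r \<in> set w; q \<noteq> r\<rbrakk> \<Longrightarrow> set (f q) \<inter> set (f r) = {}"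
  shows "distinct (concat (map f w))"
  using assms
proof (induction w)
  case (Cons q w)
  have "set (f q) \<inter> (\<Union>r\<in>set w. set (f r)) = {}"
  proof -
    have "set (f q) \<inter> set (f r) = {}" if "r \<in> set w" for r using Cons.prems(1,3) that by auto
    then show ?thesis by blast
  qed
  then show ?case using Cons by simp
qed simp

lemma word_ins_labels:
  assumes w: "distinct w" "set w = inputs a" and v: "distinct v" "set v = inputs b" and p: "p \<in> inputs a"
  shows "distinct (word_ins a p b w v)" "set (word_ins a p b w v) = inputs (ins_arity a p b)"
proof -
  show "distinct (word_ins a p b w v)"
    unfolding word_ins_def
  proof (rule distinct_concat_map[OF w(1)])
    fix q assume "q \<in> set w"
    show "distinct (if q = p then map (inner_label a p) v else [outer_label p b q])"
      using v inner_label_eq_iff[of _ b _ a p] by (auto simp: distinct_map inj_on_def)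
  next
    fix q r assume "q \<in> set w" "r \<in> set w" "q \<noteq> r"
    have no: "outer_label p b s \<notin> inner_label a p ` inputs b" if "s \<in> inputs a" "s \<noteq> p" for s
      using outer_neq_inner[OF p that] by blast
    show "set (if q = p then map (inner_label a p) v else [outer_label p b q]) \<inter>
        set (if r = p then map (inner_label a p) v else [outer_label p b r]) = {}"
      using no[of q] no[of r] outer_label_eq_iff[OF p, of q r b] w v \<open>q \<in> set w\<close> \<open>r \<in> set w\<close> \<open>q \<noteq> r\<close>
      by (cases "q = p"; cases "r = p") simp_all
  qed
  have "set (word_ins a p b w v) =
      (\<Union>q\<in>inputs a. if q = p then inner_label a p ` inputs b else {outer_label p b q})"
    using w(2) v(2) unfolding word_ins_def by auto
  also have "\<dots> = outer_label p b ` (inputs a - {p}) \<union> inner_label a p ` inputs b"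
    using p by (auto split: if_splits)
  finally show "set (word_ins a p b w v) = inputs (ins_arity a p b)" by (simp add: inputs_ins_arity[OF p])
qed

lemma realize_relabel:
  assumes "distinct (leaves T)" "inj_on \<sigma> (set (leaves T))" "q \<in> set (leaves T)"
  shows "realize (relabel_leaves \<sigma> T) (\<sigma> q) = realize T q"
  using realize_graft_leaves[of "\<lambda>p. Leaf (\<sigma> p)" T q "\<sigma> q"] assms by (simp add: concat_map_singleton leaves_graft_leaves distinct_map)

lemma composable_relabel:
  "\<lbrakk>composable_tree d T; \<And>q. q \<in> set (leaves T) \<Longrightarrow> fst (\<sigma> q) = fst q\<rbrakk> \<Longrightarrow> composable_tree d (relabel_leaves \<sigma> T)"
  by (rule composable_graft_leaves) auto

text \<open>Formal grafting with its renaming of leaves collapses nothing, and neither does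
  insertion of disks, so the two correspond exactly and can be compared entry by entry with
  \<open>graft_eqI\<close>.\<close>

lemma insert_tree_labeled:
  assumes T: "labeled_tree d a T" and p: "p \<in> inputs a" and S: "labeled_tree (fst p) b S"
  shows "labeled_tree d (ins_arity a p b) (insert_tree a p b T S)"
    and "realize (insert_tree a p b T S) = ins SC_plus d a p b (realize T) (realize S)"
proof -
  have Tl: "composable_tree d T" "distinct (leaves T)" "set (leaves T) = inputs a"
    and Sl: "composable_tree (fst p) S" "distinct (leaves S)" "set (leaves S) = inputs b"
    using T S by (auto simp: labeled_tree_def)
  let ?\<theta> = "\<lambda>q. if q = p then relabel_leaves (inner_label a p) S else Leaf (outer_label p b q)"
  have c: "composable_tree d (insert_tree a p b T S)"
    unfolding insert_tree_def
  proof (rule composable_graft_leaves[OF Tl(1)])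
    show "composable_tree (fst q) (?\<theta> q)" for q
      using composable_relabel[OF Sl(1), of "inner_label a p"] by (cases "q = p") simp_all
  qed
  show l: "labeled_tree d (ins_arity a p b) (insert_tree a p b T S)"
    unfolding labeled_tree_def leaves_insert_tree using c word_ins_labels[OF Tl(2,3) Sl(2,3) p] by blast
  then have dist: "distinct (leaves (graft_leaves ?\<theta> T))" by (simp add: labeled_tree_def insert_tree_def)
  have "realize (insert_tree a p b T S) = graft a p b (realize T) (\<lambda>r. emb_comp (realize T p) (realize S r))"
  proof (rule graft_eqI[OF p])
    fix r assume r: "r \<in> inputs a" "r \<noteq> p"
    then show "realize (insert_tree a p b T S) (outer_label p b r) = realize T r"
      using realize_graft_leaves[OF dist, of r "outer_label p b r"] Tl(3) by (simp add: insert_tree_def)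
  next
    fix r assume r: "r \<in> inputs b"
    have "inj_on (inner_label a p) (inputs b)" using inner_label_eq_iff unfolding inj_on_def by blast
    then have "realize (relabel_leaves (inner_label a p) S) (inner_label a p r) = realize S r"
      using realize_relabel[OF Sl(2)] Sl(3) r by simp
    then show "realize (insert_tree a p b T S) (inner_label a p r) = emb_comp (realize T p) (realize S r)"
      using realize_graft_leaves[OF dist, of p "inner_label a p r"] Tl(3) Sl(3) p r by (simp add: insert_tree_def)
  next
    fix q assume "q \<notin> inputs (ins_arity a p b)"
    then show "realize (insert_tree a p b T S) q = 0" using realize_outside l by (simp add: labeled_tree_def)
  qed
  then show "realize (insert_tree a p b T S) = ins SC_plus d a p b (realize T) (realize S)" by simp
qed

lemma relabel_labeled:
  assumes T: "labeled_tree d a T" and \<sigma>: "\<sigma> \<in> input_perms a"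
  shows "labeled_tree d a (relabel_leaves \<sigma> T)"
    and "realize (relabel_leaves \<sigma> T) = act SC_plus d a \<sigma> (realize T)"
proof -
  have Tl: "composable_tree d T" "distinct (leaves T)" "set (leaves T) = inputs a"
    using T by (auto simp: labeled_tree_def)
  note perm = input_perms_permutes[OF \<sigma>]
  have inj: "inj_on \<sigma> (set (leaves T))" using permutes_inj[OF perm] by (rule inj_on_subset) simp
  show l: "labeled_tree d a (relabel_leaves \<sigma> T)"
    using composable_relabel[OF Tl(1)] input_perms_fst[OF \<sigma>] Tl(2,3) inj permutes_image[OF perm]
    by (simp add: labeled_tree_def distinct_map)
  have "realize (relabel_leaves \<sigma> T) = realize T \<circ> inv \<sigma>"
  proof (rule permutes_comp_inv_eqI[OF perm])
    show "realize (relabel_leaves \<sigma> T) (\<sigma> s) = realize T s" if "s \<in> inputs a" for s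
      by (rule realize_relabel[OF Tl(2) inj]) (use that Tl in simp)
    show "realize (relabel_leaves \<sigma> T) q = realize T q" if "q \<notin> inputs a" for q
      using that realize_outside[of q T] realize_outside[of q "relabel_leaves \<sigma> T"] Tl(3) l by (simp add: labeled_tree_def)
  qed
  then show "realize (relabel_leaves \<sigma> T) = act SC_plus d a \<sigma> (realize T)" by simp
qed

section \<open>The generated suboperad consists of the realizations of trees\<close>

lemma inputs_eq: "inputs a = {Closed} \<times> {1..a Closed} \<union> {Open} \<times> {1..a Open}"
proof (rule set_eqI)
  show "p \<in> inputs a \<longleftrightarrow> p \<in> {Closed} \<times> {1..a Closed} \<union> {Open} \<times> {1..a Open}" for p
    by (cases p; cases "fst p") (auto simp: inputs_def)
qed

lemma inputs_ar [simp]: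
  "inputs (ar 0 0) = {}" "inputs (ar 0 (Suc 0)) = {(Closed, 1)}" "inputs (ar 0 2) = {(Closed, 1), (Closed, 2)}"
  "inputs (ar 2 0) = {(Open, 1), (Open, 2)}" "inputs (unit_arity d) = {(d, 1)}"
proof -
  have "{Suc 0..2} = {1, 2}" by auto
  then show "inputs (ar 0 0) = {}" "inputs (ar 0 (Suc 0)) = {(Closed, 1)}" "inputs (ar 0 2) = {(Closed, 1), (Closed, 2)}"
    "inputs (ar 2 0) = {(Open, 1), (Open, 2)}" by (auto simp: inputs_eq ar_def)
  show "inputs (unit_arity d) = {(d, 1)}" by (cases d) (auto simp: inputs_eq unit_arity_def)
qed

lemma realize_generators:
  "realize (MuC (Leaf (Closed, 1)) (Leaf (Closed, 2))) = SC_mu Closed"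
  "realize (MuO (Leaf (Open, 1)) (Leaf (Open, 2))) = SC_mu Open"
  "realize (F (Leaf (Closed, 1))) = SC_f" "realize (Nul d) = SC_nullary"
  "realize (Leaf (d, 1)) = unt SC_plus d"
  by (auto simp: SC_mu_def SC_f_def SC_nullary_def on_leaves_def fun_eq_iff)

text \<open>Induction over the generation: generators and units are realizations of small trees, and
  \<open>insert_tree\<close> and \<open>relabel_leaves\<close> match the two operations.\<close>

lemma Omega'_plus_realize:
  "g \<in> Omega'_plus \<Longrightarrow> \<exists>T. labeled_tree (fst g) (fst (snd g)) T \<and> realize T = snd (snd g)"
  unfolding Omega'_plus_def
proof (induction g rule: generated.induct)
  case (gen g)
  then consider "g = (Closed, ar 0 2, SC_mu Closed)" | "g = (Open, ar 2 0, SC_mu Open)" | "g = (Open, ar 0 1, SC_f)"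
    | "g = (Closed, ar 0 0, SC_nullary)" | "g = (Open, ar 0 0, SC_nullary)" by blast
  then show ?case
  proof cases
    case 1
    then show ?thesis using realize_generators(1)
      by (intro exI[of _ "MuC (Leaf (Closed, 1)) (Leaf (Closed, 2))"]) (simp add: labeled_tree_def del: realize.simps)
  next
    case 2
    then show ?thesis using realize_generators(2)
      by (intro exI[of _ "MuO (Leaf (Open, 1)) (Leaf (Open, 2))"]) (simp add: labeled_tree_def del: realize.simps)
  next
    case 3
    then show ?thesis using realize_generators(3)
      by (intro exI[of _ "F (Leaf (Closed, 1))"]) (simp add: labeled_tree_def del: realize.simps)
  next
    case 4
    then show ?thesis using realize_generators(4)
      by (intro exI[of _ "Nul Closed"]) (simp add: labeled_tree_def del: realize.simps)
  next
    case 5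
    then show ?thesis using realize_generators(4)
      by (intro exI[of _ "Nul Open"]) (simp add: labeled_tree_def del: realize.simps)
  qed
next
  case (unt d)
  show ?case using realize_generators(5)[of d]
    by (intro exI[of _ "Leaf (d, 1)"]) (simp add: labeled_tree_def del: realize.simps SC_plus_simps)
next
  case (ins d a x p b y)
  then show ?case using insert_tree_labeled by (metis fst_conv snd_conv)
next
  case (act d a x \<sigma>)
  then show ?case using relabel_labeled by (metis fst_conv snd_conv)
qed

lemma Omega'_plusE:
  assumes "(d, a, x) \<in> Omega'_plus"
  obtains T where "labeled_tree d a T" "x = realize T"
  using Omega'_plus_realize[OF assms] by auto

lemma Omega'_plus_closed:
  shows Omega'_plus_unt: "(d, unit_arity d, unt SC_plus d) \<in> Omega'_plus"
    and Omega'_plus_ins: "\<lbrakk>(d, a, x) \<in> Omega'_plus; p \<in> inputs a; (fst p, b, y) \<in> Omega'_plus\<rbrakk> \<Longrightarrow>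
      (d, ins_arity a p b, ins SC_plus d a p b x y) \<in> Omega'_plus"
    and Omega'_plus_act: "\<lbrakk>(d, a, x) \<in> Omega'_plus; \<sigma> \<in> input_perms a\<rbrakk> \<Longrightarrow> (d, a, act SC_plus d a \<sigma> x) \<in> Omega'_plus"
  unfolding Omega'_plus_def by (rule generated.unt, rule generated.ins, assumption+, rule generated.act)

lemma Omega'_plus_SC_space: "g \<in> Omega'_plus \<Longrightarrow> snd (snd g) \<in> SC_space (fst g) (fst (snd g))"
  unfolding Omega'_plus_def
proof (induction g rule: generated.induct)
  case (gen g)
  have mu: "SC_mu d \<in> SC_space d a" if "inputs a = {(d, 1), (d, 2)}" "d = Closed \<Longrightarrow> a Open = 0" for d a
    unfolding SC_space_iff using that by (auto simp: SC_mu_def dist_norm norm_divide)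
  have "SC_mu Closed \<in> SC_space Closed (ar 0 2)" by (rule mu, simp, simp add: ar_def)
  moreover have "SC_mu Open \<in> SC_space Open (ar 2 0)" by (rule mu, simp, simp)
  moreover have "SC_f \<in> SC_space Open (ar 0 1)"
    unfolding SC_space_iff by (auto simp: SC_f_def norm_divide)
  moreover have "SC_nullary \<in> SC_space d (ar 0 0)" for d
  proof -
    have "ar 0 0 Open = 0" by (simp add: ar_def)
    then show ?thesis unfolding SC_space_iff by (simp add: SC_nullary_def)
  qed
  ultimately show ?case using gen by auto
next
  case (unt d)
  then show ?case using operad_unt[OF relative_operad_SC_plus, of d] by (simp del: SC_plus_simps(3))
next
  case (ins d a x p b y)
  then show ?case using operad_ins[OF relative_operad_SC_plus, of x d a p y b] by (simp del: SC_plus_simps(4))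
next
  case (act d a x \<sigma>)
  then show ?case using operad_act[OF relative_operad_SC_plus, of x d a \<sigma>] by (simp del: SC_plus_simps(2))
qed

lemma graft_leaves_graft_leaves:
  "graft_leaves \<theta> (graft_leaves \<eta> t) = graft_leaves (\<lambda>p. graft_leaves \<theta> (\<eta> p)) t"
  by (induction t) auto

lemma graft_leaves_cong: "(\<And>p. p \<in> set (leaves t) \<Longrightarrow> \<theta> p = \<eta> p) \<Longrightarrow> graft_leaves \<theta> t = graft_leaves \<eta> t"
  by (induction t) auto

text \<open>The leaves of a subtree are in general not the inputs of any arity. For an induction on
  trees they have to be renamed first, by some \<open>\<tau>\<close> that keeps colors and leads to
  some arity \<open>e\<close>.\<close>

definition generated_up_to_labels :: "color \<Rightarrow> tree \<Rightarrow> bool" where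
  "generated_up_to_labels d T \<longleftrightarrow> (\<exists>\<tau> e. (\<forall>q\<in>set (leaves T). fst (\<tau> q) = fst q) \<and>
     labeled_tree d e (relabel_leaves \<tau> T) \<and> (d, e, realize (relabel_leaves \<tau> T)) \<in> Omega'_plus)"

lemma generated_up_to_labels_insert:
  assumes B: "labeled_tree d a B" "(d, a, realize B) \<in> Omega'_plus" and p: "p \<in> inputs a"
    and T: "generated_up_to_labels (fst p) T"
  obtains \<tau> e where "\<forall>q\<in>set (leaves T). fst (\<tau> q) = fst q"
    "labeled_tree d (ins_arity a p e) (insert_tree a p e B (relabel_leaves \<tau> T))"
    "(d, ins_arity a p e, realize (insert_tree a p e B (relabel_leaves \<tau> T))) \<in> Omega'_plus"
proof -
  obtain \<tau> e where "\<forall>q\<in>set (leaves T). fst (\<tau> q) = fst q" and l: "labeled_tree (fst p) e (relabel_leaves \<tau> T)"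
    and o: "(fst p, e, realize (relabel_leaves \<tau> T)) \<in> Omega'_plus"
    using T unfolding generated_up_to_labels_def by blast
  then show ?thesis using that insert_tree_labeled[OF B(1) p l] Omega'_plus_ins[OF B(2) p o] by metis
qed

text \<open>\<open>M\<close> stands for \<open>MuC\<close> or \<open>MuO\<close>. The right branch
  is inserted at the second input before the left branch is inserted at the first, because insertion
  at the second input does not renumber the first.\<close>

lemma generated_up_to_labels_binary:
  assumes M: "\<And>\<theta> s t. graft_leaves \<theta> (M s t) = M (graft_leaves \<theta> s) (graft_leaves \<theta> t)"
      "\<And>s t. leaves (M s t) = leaves s @ leaves t"
    and B: "labeled_tree d a (M (Leaf (d, 1)) (Leaf (d, 2)))" "(d, a, realize (M (Leaf (d, 1)) (Leaf (d, 2)))) \<in> Omega'_plus"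
    and dist: "set (leaves s) \<inter> set (leaves t) = {}"
    and s: "generated_up_to_labels d s" and t: "generated_up_to_labels d t"
  shows "generated_up_to_labels d (M s t)"
proof -
  have a: "inputs a = {(d, 1), (d, 2)}" using B(1) M(2) by (simp add: labeled_tree_def)
  have p: "(d, 2) \<in> inputs a" using a by simp
  obtain \<tau> e where \<tau>: "\<forall>q\<in>set (leaves t). fst (\<tau> q) = fst q"
    and T: "labeled_tree d (ins_arity a (d, 2) e) (insert_tree a (d, 2) e (M (Leaf (d, 1)) (Leaf (d, 2))) (relabel_leaves \<tau> t))"
      "(d, ins_arity a (d, 2) e, realize (insert_tree a (d, 2) e (M (Leaf (d, 1)) (Leaf (d, 2))) (relabel_leaves \<tau> t))) \<in> Omega'_plus"
    using generated_up_to_labels_insert[OF B p] t by auto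
  let ?a = "ins_arity a (d, 2) e" and ?i = "\<lambda>q. inner_label a (d, 2) (\<tau> q)"
  have o: "outer_label (d, 2) e (d, Suc 0) = (d, Suc 0)" by (simp add: outer_label_def)
  have eqT: "insert_tree a (d, 2) e (M (Leaf (d, 1)) (Leaf (d, 2))) (relabel_leaves \<tau> t) = M (Leaf (d, 1)) (relabel_leaves ?i t)"
    by (simp add: insert_tree_def M(1) o graft_leaves_graft_leaves)
  \<comment> \<open>The leaves of the intermediate tree are distinct, so no renamed leaf of
    \<open>t\<close> collides with the first input, which is still free.\<close>
  have n: "(d, 1) \<notin> ?i ` set (leaves t)" and p': "(d, 1) \<in> inputs ?a"
    using T(1) unfolding eqT labeled_tree_def M(2) by auto
  obtain \<sigma> c where \<sigma>: "\<forall>q\<in>set (leaves s). fst (\<sigma> q) = fst q"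
    and S: "labeled_tree d (ins_arity ?a (d, 1) c) (insert_tree ?a (d, 1) c (M (Leaf (d, 1)) (relabel_leaves ?i t)) (relabel_leaves \<sigma> s))"
      "(d, ins_arity ?a (d, 1) c, realize (insert_tree ?a (d, 1) c (M (Leaf (d, 1)) (relabel_leaves ?i t)) (relabel_leaves \<sigma> s))) \<in> Omega'_plus"
    using generated_up_to_labels_insert[OF T[unfolded eqT] p'] s by auto
  \<comment> \<open>The total renaming: leaves of \<open>s\<close> are inner in the second
    insertion, leaves of \<open>t\<close> are inner in the first and outer in the second.\<close>
  define \<rho> where "\<rho> = (\<lambda>q. if q \<in> set (leaves s) then inner_label ?a (d, 1) (\<sigma> q) else outer_label (d, 1) c (?i q))"
  have "insert_tree ?a (d, 1) c (M (Leaf (d, 1)) (relabel_leaves ?i t)) (relabel_leaves \<sigma> s) = relabel_leaves \<rho> (M s t)"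
  proof -
    have "graft_leaves (\<lambda>q. if q = (d, 1) then relabel_leaves (inner_label ?a (d, 1)) (relabel_leaves \<sigma> s)
        else Leaf (outer_label (d, 1) c q)) (relabel_leaves ?i t) = relabel_leaves \<rho> t"
    proof (rule trans[OF graft_leaves_graft_leaves], rule graft_leaves_cong)
      fix q assume q: "q \<in> set (leaves t)"
      then have "?i q \<noteq> (d, 1)" "q \<notin> set (leaves s)" using n dist by (metis image_eqI, blast)
      then show "graft_leaves (\<lambda>q. if q = (d, 1) then relabel_leaves (inner_label ?a (d, 1)) (relabel_leaves \<sigma> s)
        else Leaf (outer_label (d, 1) c q)) (Leaf (?i q)) = Leaf (\<rho> q)" by (simp add: \<rho>_def)
    qed
    moreover have "relabel_leaves (inner_label ?a (d, 1)) (relabel_leaves \<sigma> s) = relabel_leaves \<rho> s"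
      unfolding graft_leaves_graft_leaves by (rule graft_leaves_cong) (simp add: \<rho>_def)
    ultimately show ?thesis by (simp only: insert_tree_def M(1) graft_leaves.simps if_True simp_thms)
  qed
  moreover have "\<forall>q\<in>set (leaves (M s t)). fst (\<rho> q) = fst q" using \<sigma> \<tau> by (auto simp: \<rho>_def M(2))
  ultimately show ?thesis using S unfolding generated_up_to_labels_def by metis
qed

lemma composable_generated_up_to_labels:
  "\<lbrakk>composable_tree d T; distinct (leaves T)\<rbrakk> \<Longrightarrow> generated_up_to_labels d T"
proof (induction T arbitrary: d)
  case (Leaf p)
  then have "labeled_tree d (unit_arity d) (Leaf (d, 1))" by (simp add: labeled_tree_def)
  then show ?case
    using Omega'_plus_unt[of d] realize_generators(5)[of d] Leaf unfolding generated_up_to_labels_def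
    by (intro exI[of _ "\<lambda>_. (d, 1)"] exI[of _ "unit_arity d"]) (simp del: realize.simps SC_plus_simps)
next
  case (MuC s t)
  have "labeled_tree Closed (ar 0 2) (MuC (Leaf (Closed, 1)) (Leaf (Closed, 2)))" by (simp add: labeled_tree_def)
  moreover have "(Closed, ar 0 2, realize (MuC (Leaf (Closed, 1)) (Leaf (Closed, 2)))) \<in> Omega'_plus"
    unfolding realize_generators Omega'_plus_def by (rule generated.gen) simp
  ultimately show ?case using MuC by (intro generated_up_to_labels_binary[where M = MuC and a = "ar 0 2"]) auto
next
  case (MuO s t)
  have "labeled_tree Open (ar 2 0) (MuO (Leaf (Open, 1)) (Leaf (Open, 2)))" by (simp add: labeled_tree_def)
  moreover have "(Open, ar 2 0, realize (MuO (Leaf (Open, 1)) (Leaf (Open, 2)))) \<in> Omega'_plus"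
    unfolding realize_generators Omega'_plus_def by (rule generated.gen) simp
  ultimately show ?case using MuO by (intro generated_up_to_labels_binary[where M = MuO and a = "ar 2 0"]) auto
next
  case (F t)
  have d: "d = Open" using F.prems by simp
  have B: "labeled_tree Open (ar 0 1) (F (Leaf (Closed, 1)))" by (simp add: labeled_tree_def)
  have O: "(Open, ar 0 1, realize (F (Leaf (Closed, 1)))) \<in> Omega'_plus"
    unfolding realize_generators Omega'_plus_def by (rule generated.gen) simp
  have p: "(Closed, 1) \<in> inputs (ar 0 1)" by simp
  have t: "generated_up_to_labels (fst (Closed, 1 :: nat)) t" using F by simp
  obtain \<tau> e where \<tau>: "\<forall>q\<in>set (leaves t). fst (\<tau> q) = fst q"
    and T: "labeled_tree Open (ins_arity (ar 0 1) (Closed, 1) e) (insert_tree (ar 0 1) (Closed, 1) e (F (Leaf (Closed, 1))) (relabel_leaves \<tau> t))"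
      "(Open, ins_arity (ar 0 1) (Closed, 1) e, realize (insert_tree (ar 0 1) (Closed, 1) e (F (Leaf (Closed, 1))) (relabel_leaves \<tau> t))) \<in> Omega'_plus"
    using generated_up_to_labels_insert[OF B O p t] .
  have e: "insert_tree (ar 0 1) (Closed, 1) e (F (Leaf (Closed, 1))) (relabel_leaves \<tau> t) =
      relabel_leaves (\<lambda>q. inner_label (ar 0 1) (Closed, 1) (\<tau> q)) (F t)"
    by (simp add: insert_tree_def graft_leaves_graft_leaves)
  then show ?case using T \<tau> d unfolding generated_up_to_labels_def e
    by (intro exI[of _ "\<lambda>q. inner_label (ar 0 1) (Closed, 1) (\<tau> q)"] exI[of _ "ins_arity (ar 0 1) (Closed, 1) e"])
      (simp del: realize.simps graft_leaves.simps)
next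
  case (Nul k)
  have "(d, ar 0 0, realize (Nul d)) \<in> Omega'_plus"
    unfolding realize_generators Omega'_plus_def by (rule generated.gen) (cases d, auto)
  then show ?case using Nul unfolding generated_up_to_labels_def
    by (intro exI[of _ id] exI[of _ "ar 0 0"]) (simp add: labeled_tree_def)
qed

lemma card_inputs_color: "card {q \<in> inputs a. fst q = k} = a k"
proof -
  have "{q \<in> inputs a. fst q = k} = {k} \<times> {1..a k}" by (auto simp: inputs_def)
  then show ?thesis by (simp add: card_cartesian_product)
qed

lemma arity_eqI:
  assumes "inj_on \<tau> (inputs a)" "\<tau> ` inputs a = inputs e" "\<And>q. q \<in> inputs a \<Longrightarrow> fst (\<tau> q) = fst q"
  shows "e = a"
proof
  fix k
  have "\<tau> ` {q \<in> inputs a. fst q = k} = {q \<in> inputs e. fst q = k}"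
    unfolding assms(2)[symmetric] using assms(3) by force
  moreover have "inj_on \<tau> {q \<in> inputs a. fst q = k}" by (rule inj_on_subset[OF assms(1)]) auto
  ultimately have "card {q \<in> inputs e. fst q = k} = card {q \<in> inputs a. fst q = k}" using card_image by fastforce
  then show "e k = a k" unfolding card_inputs_color .
qed

text \<open>Up to a renaming \<open>\<tau>\<close> the tree is generated in some arity
  \<open>e\<close>. A bijection of inputs that keeps colors forces \<open>e = a\<close>, so
  \<open>\<tau>\<close> is undone by the action of a permutation, under which
  \<open>Omega'_plus\<close> is closed.\<close>

lemma realize_in_Omega'_plus:
  assumes T: "labeled_tree d a T"
  shows "(d, a, realize T) \<in> Omega'_plus"
proof -
  have Tl: "composable_tree d T" "distinct (leaves T)" "set (leaves T) = inputs a"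
    using T by (auto simp: labeled_tree_def)
  obtain \<tau> e where \<tau>: "\<forall>q\<in>inputs a. fst (\<tau> q) = fst q" and l: "labeled_tree d e (relabel_leaves \<tau> T)"
    and o: "(d, e, realize (relabel_leaves \<tau> T)) \<in> Omega'_plus"
    using composable_generated_up_to_labels[OF Tl(1,2)] Tl(3) unfolding generated_up_to_labels_def by auto
  have inj: "inj_on \<tau> (inputs a)" and im: "\<tau> ` inputs a = inputs e"
    using l Tl by (auto simp: labeled_tree_def distinct_map)
  have e: "e = a" by (rule arity_eqI[OF inj im]) (use \<tau> in blast)
  define \<rho> where "\<rho> = (\<lambda>q. if q \<in> inputs a then inv_into (inputs a) \<tau> q else q)"
  have "bij_betw (inv_into (inputs a) \<tau>) (inputs a) (inputs a)"
    using bij_betw_inv_into[of \<tau> "inputs a" "inputs e"] inj im e by (simp add: bij_betw_def)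
  then have "bij_betw \<rho> (inputs a) (inputs a)" by (rule bij_betw_cong[THEN iffD1, rotated]) (simp add: \<rho>_def)
  then have perm: "\<rho> permutes inputs a" by (rule bij_imp_permutes) (simp add: \<rho>_def)
  have "fst (\<rho> q) = fst q" for q
  proof (cases "q \<in> inputs a")
    case True
    then have "q \<in> \<tau> ` inputs a" using im e by simp
    then show ?thesis using True \<tau> inv_into_into[of q \<tau> "inputs a"] f_inv_into_f[of q \<tau> "inputs a"] by (simp add: \<rho>_def) metis
  qed (simp add: \<rho>_def)
  then have \<rho>: "\<rho> \<in> input_perms a" using perm by (simp add: input_perms_def)
  have "relabel_leaves \<rho> (relabel_leaves \<tau> T) = graft_leaves Leaf T"
    unfolding graft_leaves_graft_leaves
  proof (rule graft_leaves_cong)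
    fix q assume "q \<in> set (leaves T)"
    then have "q \<in> inputs a" "\<tau> q \<in> inputs a" using Tl(3) im e by auto
    then show "relabel_leaves \<rho> (Leaf (\<tau> q)) = Leaf q" using inj by (simp add: \<rho>_def)
  qed
  also have "graft_leaves Leaf T = T" by (induction T) auto
  finally have "realize T = act SC_plus d a \<rho> (realize (relabel_leaves \<tau> T))"
    using relabel_labeled(2)[OF l[unfolded e] \<rho>] by simp
  then show ?thesis using Omega'_plus_act[OF o[unfolded e] \<rho>] by simp
qed

lemma SC_space_realize: "labeled_tree d a T \<Longrightarrow> realize T \<in> SC_space d a"
  using Omega'_plus_SC_space[OF realize_in_Omega'_plus] by simp

lemma labeled_tree_words: "labeled_tree d a T \<Longrightarrow> leaves T \<in> words d a"
proof -
  assume T: "labeled_tree d a T"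
  have "a Open = 0" if "d = Closed"
  proof (rule ccontr)
    assume "a Open \<noteq> 0"
    then have "(Open, 1) \<in> inputs a" by (simp add: inputs_def)
    then show False using T that composable_Closed_leaves[of Closed T "(Open, 1)"] by (simp add: labeled_tree_def)
  qed
  then show ?thesis using T by (simp add: labeled_tree_def words_def)
qed

lemma centers_realize: "labeled_tree d a T \<Longrightarrow> centers (realize T) \<in> Conf_word d a (leaves T)"
  using centers_Conf[OF SC_space_realize] realize_sorted[of T] by (simp add: Conf_word_def labeled_tree_def centers_def)

text \<open>A right comb ending in \<open>Nul d\<close>, which also covers the empty word; in open
  output closed letters enter through \<open>F\<close>. Every word is thus the list of leaves of a
  tree, as surjectivity on objects requires.\<close>

fun word_tree :: "color \<Rightarrow> input list \<Rightarrow> tree" where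
  "word_tree d [] = Nul d"
| "word_tree Closed (p # w) = MuC (Leaf p) (word_tree Closed w)"
| "word_tree Open (p # w) = MuO (if fst p = Open then Leaf p else F (Leaf p)) (word_tree Open w)"

lemma leaves_word_tree [simp]: "leaves (word_tree d w) = w"
  by (induction d w rule: word_tree.induct) auto

lemma composable_word_tree: "(d = Closed \<Longrightarrow> \<forall>p\<in>set w. fst p = Closed) \<Longrightarrow> composable_tree d (word_tree d w)"
  by (induction d w rule: word_tree.induct) (auto intro: color.exhaust)

lemma labeled_word_tree: "w \<in> words d a \<Longrightarrow> labeled_tree d a (word_tree d w)"
proof -
  assume w: "w \<in> words d a"
  have "\<forall>p\<in>set w. fst p = Closed" if "d = Closed"
    using w that Closed_no_open_input unfolding words_def by blast
  then have "composable_tree d (word_tree d w)" by (rule composable_word_tree)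
  then show ?thesis using w by (simp add: labeled_tree_def words_def)
qed

text \<open>The tree of an element of \<open>\<Omega>\<Omega>'\<^sub>+\<close>; it does not depend on the choice of a formal composition.\<close>

definition normal_tree :: "color \<Rightarrow> (input \<Rightarrow> emb) \<Rightarrow> tree" where
  "normal_tree d x = reduce (SOME T. composable_tree d T \<and> distinct (leaves T) \<and> realize T = x)"

lemma normal_tree_realize:
  assumes "labeled_tree d a T"
  shows "normal_tree d (realize T) = reduce T"
proof -
  let ?P = "\<lambda>S. composable_tree d S \<and> distinct (leaves S) \<and> realize S = realize T"
  have "?P T" using assms by (simp add: labeled_tree_def)
  then have "?P (SOME S. ?P S)" by (rule someI)
  then show ?thesis unfolding normal_tree_def
    by (intro realize_inj[of d]) (use assms in \<open>simp_all add: labeled_tree_def\<close>)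
qed

lemma reduce_relabel: "reduce (relabel_leaves \<sigma> T) = tree_relabel \<sigma> (reduce T)"
  unfolding tree_relabel_def tree_subst_reduce reduce_graft_leaves by (simp add: reduce_def)

lemma reduce_insert_tree: "reduce (insert_tree a p b T S) = ins Omega_plus d a p b (reduce T) (reduce S)"
proof -
  have "(\<lambda>q. reduce (if q = p then relabel_leaves (inner_label a p) S else Leaf (outer_label p b q))) =
      (\<lambda>q. if q = p then tree_relabel (inner_label a p) (reduce S) else Leaf (outer_label p b q))"
    by (rule ext) (simp add: reduce_relabel, simp add: reduce_def)
  then show ?thesis by (simp add: insert_tree_def reduce_graft_leaves Omega_plus_def tree_subst_reduce)
qed

lemma reduce_trees: "labeled_tree d a T \<Longrightarrow> reduce T \<in> trees d a"
  using free_tree_reduce[of d T] by (auto simp: labeled_tree_def trees_def)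

lemma trees_labeled: "t \<in> trees d a \<Longrightarrow> labeled_tree d a t \<and> reduce t = t"
  using free_tree_composable[of d t] by (auto simp: labeled_tree_def trees_def reduce_def)

lemma leaves_tree_relabel: "leaves (tree_relabel \<sigma> t) = map \<sigma> (leaves t)"
  by (simp add: tree_relabel_def leaves_tree_subst)

lemma leaves_ins_Omega_plus: "leaves (ins Omega_plus d a p b s t) = word_ins a p b (leaves s) (leaves t)"
  unfolding Omega_plus_def word_ins_def operad.simps leaves_tree_subst
  by (rule arg_cong[where f = concat], rule map_cong) (auto simp: leaves_tree_relabel)

section \<open>The zigzag of equivalences\<close>

abbreviation SC_Omega :: "(input \<Rightarrow> emb, (input \<Rightarrow> emb) \<times> (real \<Rightarrow> input \<Rightarrow> emb) set \<times> (input \<Rightarrow> emb)) goperad" where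
  "SC_Omega \<equiv> full_suboperad (pi_operad SC_plus) Omega'_plus"

lemma relative_goperad_SC_Omega: "relative_goperad SC_Omega"
  by (rule relative_goperad_full_suboperad[OF relative_goperad_pi_SC_plus])
    (simp_all only: pi_operad_simps Omega'_plus_unt Omega'_plus_ins Omega'_plus_act)

lemma SC_Omega_simps [simp]:
  "Src (grpd SC_Omega d a) = Src (fundamental_groupoid (SC_space d a))"
  "Trg (grpd SC_Omega d a) = Trg (fundamental_groupoid (SC_space d a))"
  "Idm (grpd SC_Omega d a) = Idm (fundamental_groupoid (SC_space d a))"
  "Cmp (grpd SC_Omega d a) = Cmp (fundamental_groupoid (SC_space d a))"
  "ob_ins SC_Omega = ins SC_plus" "ob_act SC_Omega = act SC_plus" "gunt SC_Omega = unt SC_plus"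
  "mor_ins SC_Omega = mor_ins (pi_operad SC_plus)" "mor_act SC_Omega = mor_act (pi_operad SC_plus)"
  by (simp_all add: full_suboperad_def)

lemma Omega'_plus_iff: "(d, a, x) \<in> Omega'_plus \<longleftrightarrow> (\<exists>T. labeled_tree d a T \<and> x = realize T)"
  using Omega'_plusE realize_in_Omega'_plus by metis

lemma Ob_SC_Omega: "x \<in> Ob (grpd SC_Omega d a) \<longleftrightarrow> (\<exists>T. labeled_tree d a T \<and> x = realize T)"
proof -
  have "x \<in> Ob (grpd SC_Omega d a) \<longleftrightarrow> (d, a, x) \<in> Omega'_plus"
    using Omega'_plus_SC_space[of "(d, a, x)"] by (auto simp: full_suboperad_def)
  then show ?thesis unfolding Omega'_plus_iff .
qed

definition tree_path :: "color \<Rightarrow> arity \<Rightarrow> tree \<Rightarrow> tree \<Rightarrow> (real \<Rightarrow> input \<Rightarrow> emb) \<Rightarrow> bool" where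
  "tree_path d a T T' g \<longleftrightarrow> labeled_tree d a T \<and> labeled_tree d a T' \<and> path g \<and> path_image g \<subseteq> SC_space d a \<and>
     pathstart g = realize T \<and> pathfinish g = realize T'"

lemma Mor_SC_Omega: "f \<in> Mor (grpd SC_Omega d a) \<longleftrightarrow> (\<exists>T T' g. tree_path d a T T' g \<and> f = path_mor (SC_space d a) g)"
proof -
  have "f \<in> Mor (grpd SC_Omega d a) \<longleftrightarrow> f \<in> Mor (fundamental_groupoid (SC_space d a)) \<and>
    (d, a, Src (fundamental_groupoid (SC_space d a)) f) \<in> Omega'_plus \<and>
    (d, a, Trg (fundamental_groupoid (SC_space d a)) f) \<in> Omega'_plus"
    by (simp add: full_suboperad_def)
  also have "\<dots> \<longleftrightarrow> (\<exists>g. path g \<and> path_image g \<subseteq> SC_space d a \<and> f = path_mor (SC_space d a) g \<and>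
      (d, a, pathstart g) \<in> Omega'_plus \<and> (d, a, pathfinish g) \<in> Omega'_plus)"
    unfolding Mor_fundamental_groupoid by auto
  also have "\<dots> \<longleftrightarrow> (\<exists>T T' g. tree_path d a T T' g \<and> f = path_mor (SC_space d a) g)"
    unfolding tree_path_def Omega'_plus_iff by blast
  finally show ?thesis .
qed

lemma tree_path_word_path:
  assumes "tree_path d a T T' g"
  shows "word_path d a (leaves T) (leaves T') (\<lambda>t. centers (g t))"
  using assms path_centers[of g d a] centers_realize[of d a T] centers_realize[of d a T']
  by (simp add: tree_path_def word_path_def)

definition word_of :: "color \<Rightarrow> (input \<Rightarrow> emb) \<Rightarrow> input list" where
  "word_of d x = leaves (normal_tree d x)"

lemma word_of_realize: "labeled_tree d a T \<Longrightarrow> word_of d (realize T) = leaves T"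
  by (simp add: word_of_def normal_tree_realize)

definition center_mor ::
  "color \<Rightarrow> arity \<Rightarrow> (input \<Rightarrow> emb) \<times> (real \<Rightarrow> input \<Rightarrow> emb) set \<times> (input \<Rightarrow> emb) \<Rightarrow>
   input list \<times> (real \<Rightarrow> input \<Rightarrow> complex) set \<times> input list" where
  "center_mor d a f = (case f of (x, C, y) \<Rightarrow>
     (word_of d x, \<Union>g\<in>C. word_class d a (word_of d x) (word_of d y) (\<lambda>t. centers (g t)), word_of d y))"

text \<open>Homotopic paths of disks have homotopic paths of centers, so all members of the union
  are the same class; the chosen tree enters only through its leaves.\<close>

lemma center_mor_path_mor:
  assumes g: "tree_path d a T T' g"
  shows "center_mor d a (path_mor (SC_space d a) g) = word_mor d a (leaves T) (\<lambda>t. centers (g t)) (leaves T')"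
proof -
  have G: "path g" "path_image g \<subseteq> SC_space d a" using g by (auto simp: tree_path_def)
  have w: "word_of d (pathstart g) = leaves T" "word_of d (pathfinish g) = leaves T'"
    using g word_of_realize by (auto simp: tree_path_def)
  have "(\<Union>h\<in>path_class (SC_space d a) g. word_class d a (leaves T) (leaves T') (\<lambda>t. centers (h t))) =
    word_class d a (leaves T) (leaves T') (\<lambda>t. centers (g t))"
  proof (rule UN_eq_const[OF path_class_self[OF G]], rule word_class_eqI)
    fix h assume "h \<in> path_class (SC_space d a) g"
    then have gh: "homotopic_paths (SC_space d a) h g" unfolding path_class_def using homotopic_paths_sym by blast
    have "homotopic_paths (Conf d a) (\<lambda>t. centers (h t)) (\<lambda>t. centers (g t))"
      by (rule homotopic_paths_compose1[OF gh]) (auto intro: continuous_on_centers continuous_on_id centers_Conf)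
    moreover have "pathstart (\<lambda>t. centers (h t)) = centers (pathstart g)" "pathfinish (\<lambda>t. centers (h t)) = centers (pathfinish g)"
      using homotopic_paths_imp_pathstart[OF gh] homotopic_paths_imp_pathfinish[OF gh] by (auto simp: pathstart_def pathfinish_def)
    ultimately show "word_homotopic d a (leaves T) (leaves T') (\<lambda>t. centers (h t)) (\<lambda>t. centers (g t))"
      using g centers_realize by (intro free_homotopic_paths) (auto simp: tree_path_def)
  qed
  then show ?thesis by (simp add: center_mor_def path_mor_def word_mor_def w)
qed

definition tree_mor ::
  "color \<Rightarrow> arity \<Rightarrow> (input \<Rightarrow> emb) \<times> (real \<Rightarrow> input \<Rightarrow> emb) set \<times> (input \<Rightarrow> emb) \<Rightarrow>
   tree \<times> (input list \<times> (real \<Rightarrow> input \<Rightarrow> complex) set \<times> input list) \<times> tree" where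
  "tree_mor d a f = (normal_tree d (fst f), center_mor d a f, normal_tree d (snd (snd f)))"

lemma tree_mor_path_mor:
  assumes g: "tree_path d a T T' g"
  shows "tree_mor d a (path_mor (SC_space d a) g) =
    (reduce T, word_mor d a (leaves T) (\<lambda>t. centers (g t)) (leaves T'), reduce T')"
proof -
  have "fst (path_mor (SC_space d a) g) = realize T" "snd (snd (path_mor (SC_space d a) g)) = realize T'"
    using g by (simp_all add: path_mor_def tree_path_def)
  then show ?thesis using g normal_tree_realize by (auto simp: tree_mor_def center_mor_path_mor[OF g] tree_path_def)
qed

lemma grpd_CoPB [simp]: "grpd CoPB_plus = word_groupoid"
  by (simp add: CoPB_plus_def)

lemma PaPB_simps [simp]:
  "Ob (grpd PaPB_plus d a) = trees d a"
  "Src (grpd PaPB_plus d a) (u, f, v) = u" "Trg (grpd PaPB_plus d a) (u, f, v) = v"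
  "Idm (grpd PaPB_plus d a) u = (u, Idm (word_groupoid d a) (leaves u), u)"
  "Cmp (grpd PaPB_plus d a) (u, f, v) (u', f', v') = (u, Cmp (word_groupoid d a) f f', v')"
  "ob_ins PaPB_plus = ins Omega_plus" "ob_act PaPB_plus = act Omega_plus" "gunt PaPB_plus = unt Omega_plus"
  "mor_ins PaPB_plus d a p b (u, f, v) (u', f', v') =
    (ins Omega_plus d a p b u u', mor_ins CoPB_plus d a p b f f', ins Omega_plus d a p b v v')"
  "mor_act PaPB_plus d a \<sigma> (u, f, v) = (act Omega_plus d a \<sigma> u, mor_act CoPB_plus d a \<sigma> f, act Omega_plus d a \<sigma> v)"
  by (simp_all add: PaPB_plus_def pullback_operad_def omega_plus_def) (simp add: Omega_plus_def)

lemma Mor_PaPB: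
  "(u, f, v) \<in> Mor (grpd PaPB_plus d a) \<longleftrightarrow> u \<in> trees d a \<and> v \<in> trees d a \<and> f \<in> Mor (word_groupoid d a) \<and>
    Src (word_groupoid d a) f = leaves u \<and> Trg (word_groupoid d a) f = leaves v"
  by (simp add: PaPB_plus_def pullback_operad_def omega_plus_def) (simp add: Omega_plus_def)

lemma Mor_PaPB_word:
  assumes "f \<in> Mor (grpd PaPB_plus d a)"
  obtains u k v where "u \<in> trees d a" "v \<in> trees d a" "word_path d a (leaves u) (leaves v) k"
    "f = (u, word_mor d a (leaves u) k (leaves v), v)"
proof -
  obtain u m v where f: "f = (u, m, v)" by (cases f)
  then have m: "m \<in> Mor (word_groupoid d a)" and uv: "u \<in> trees d a" "v \<in> trees d a"
    "Src (word_groupoid d a) m = leaves u" "Trg (word_groupoid d a) m = leaves v"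
    using assms Mor_PaPB by auto
  obtain k where "word_path d a (leaves u) (leaves v) k" "m = word_mor d a (leaves u) k (leaves v)"
    using m unfolding Mor_word_groupoid using uv(3,4) by auto
  then show ?thesis using that f uv by blast
qed

section \<open>The functor from disks to parenthesized braids\<close>

lemma functor_SC_Omega_PaPB: "is_functor (grpd SC_Omega d a) (grpd PaPB_plus d a) (normal_tree d) (tree_mor d a)"
  unfolding is_functor_def
proof (intro conjI ballI impI)
  fix x assume "x \<in> Ob (grpd SC_Omega d a)"
  then obtain T where T: "labeled_tree d a T" "x = realize T" unfolding Ob_SC_Omega by blast
  show "normal_tree d x \<in> Ob (grpd PaPB_plus d a)" using T by (simp add: normal_tree_realize reduce_trees)
  have "tree_path d a T T (\<lambda>_. x)" using T SC_space_realize by (simp add: tree_path_def path_const)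
  from tree_mor_path_mor[OF this]
  show "tree_mor d a (Idm (grpd SC_Omega d a) x) = Idm (grpd PaPB_plus d a) (normal_tree d x)"
    using T Idm_word_groupoid[OF labeled_tree_words[OF T(1)] centers_realize[OF T(1)]] by (simp add: normal_tree_realize)
next
  fix f assume "f \<in> Mor (grpd SC_Omega d a)"
  then obtain T T' g where g: "tree_path d a T T' g" "f = path_mor (SC_space d a) g" unfolding Mor_SC_Omega by blast
  have T: "labeled_tree d a T" "labeled_tree d a T'" using g by (auto simp: tree_path_def)
  show "tree_mor d a f \<in> Mor (grpd PaPB_plus d a)"
  proof -
    have "word_mor d a (leaves T) (\<lambda>t. centers (g t)) (leaves T') \<in> Mor (word_groupoid d a)"
      unfolding Mor_word_groupoid
      using tree_path_word_path[OF g(1)] labeled_tree_words[OF T(1)] labeled_tree_words[OF T(2)] by blast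
    then show ?thesis using T unfolding g(2) tree_mor_path_mor[OF g(1)] by (simp add: Mor_PaPB reduce_trees)
  qed
  show "Src (grpd PaPB_plus d a) (tree_mor d a f) = normal_tree d (Src (grpd SC_Omega d a) f)"
    "Trg (grpd PaPB_plus d a) (tree_mor d a f) = normal_tree d (Trg (grpd SC_Omega d a) f)"
    using g normal_tree_realize T by (simp_all add: tree_mor_path_mor) (simp_all add: tree_path_def)
next
  fix f f' assume "f \<in> Mor (grpd SC_Omega d a)" "f' \<in> Mor (grpd SC_Omega d a)"
    and e: "Trg (grpd SC_Omega d a) f = Src (grpd SC_Omega d a) f'"
  then obtain T S g S' U g' where g: "tree_path d a T S g" "f = path_mor (SC_space d a) g"
    and g0: "tree_path d a S' U g'" and g': "f' = path_mor (SC_space d a) g'" unfolding Mor_SC_Omega by blast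
  have c: "pathfinish g = pathstart g'" using e g g' by simp
  then have eq: "realize S = realize S'" using g g0 by (simp add: tree_path_def)
  have l: "labeled_tree d a S" "labeled_tree d a S'" using g g0 by (auto simp: tree_path_def)
  \<comment> \<open>The two morphisms meet in one point of \<open>SC_plus\<close>, given by two
    formal compositions \<open>S\<close> and \<open>S'\<close>. These may differ, but they have the
    same reduced tree and hence the same word, so the image morphisms are composable.\<close>
  have r: "reduce S' = reduce S"
    using normal_tree_realize[OF l(1)] normal_tree_realize[OF l(2)] eq by simp
  have ls: "leaves S' = leaves S" using arg_cong[OF r, of leaves] by simp
  have "tree_path d a S U g'" using g0 l eq by (simp add: tree_path_def)
  note g0 = this
  have P: "path g" "path_image g \<subseteq> SC_space d a" "path g'" "path_image g' \<subseteq> SC_space d a"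
    using g(1) g0 by (auto simp: tree_path_def)
  have j: "tree_path d a T U (g +++ g')"
    using g g0 c by (simp add: tree_path_def path_image_join)
  have jc: "(\<lambda>t. centers ((g +++ g') t)) = (\<lambda>t. centers (g t)) +++ (\<lambda>t. centers (g' t))"
    by (auto simp: joinpaths_def)
  have "Cmp (word_groupoid d a) (word_mor d a (leaves T) (\<lambda>t. centers (g t)) (leaves S)) (word_mor d a (leaves S) (\<lambda>t. centers (g' t)) (leaves U)) =
    word_mor d a (leaves T) (\<lambda>t. centers ((g +++ g') t)) (leaves U)"
    unfolding jc
    by (rule Cmp_word_groupoid[OF labeled_tree_words[OF l(1)] tree_path_word_path[OF g(1)] tree_path_word_path[OF g0]])
      (use c in \<open>simp add: pathfinish_def pathstart_def\<close>)
  then show "tree_mor d a (Cmp (grpd SC_Omega d a) f f') = Cmp (grpd PaPB_plus d a) (tree_mor d a f) (tree_mor d a f')"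
    unfolding g(2) g' SC_Omega_simps Cmp_fundamental_groupoid[OF P c] tree_mor_path_mor[OF j] tree_mor_path_mor[OF g(1)]
      tree_mor_path_mor[OF g0] by simp
qed

text \<open>A morphism of \<open>PaPB_plus\<close> is a class with free ends.
  \<open>lift_word_path\<close> lifts a representative to a path between the prescribed points,
  which may be any two points with the given trees.\<close>

lemma full_SC_Omega_PaPB: "full_functor (grpd SC_Omega d a) (grpd PaPB_plus d a) (normal_tree d) (tree_mor d a)"
  unfolding full_functor_def
proof (intro ballI impI; elim conjE)
  fix x y f assume "x \<in> Ob (grpd SC_Omega d a)" "y \<in> Ob (grpd SC_Omega d a)" and f: "f \<in> Mor (grpd PaPB_plus d a)"
    and st: "Src (grpd PaPB_plus d a) f = normal_tree d x" "Trg (grpd PaPB_plus d a) f = normal_tree d y"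
  then obtain T T' where T: "labeled_tree d a T" "x = realize T" and T': "labeled_tree d a T'" "y = realize T'"
    unfolding Ob_SC_Omega by blast
  obtain u k v where k: "word_path d a (leaves u) (leaves v) k" "f = (u, word_mor d a (leaves u) k (leaves v), v)"
    using f by (rule Mor_PaPB_word)
  have uv: "u = reduce T" "v = reduce T'" using st k(2) T T' by (simp_all add: normal_tree_realize)
  obtain g where g: "path g" "path_image g \<subseteq> SC_space d a" "pathstart g = x" "pathfinish g = y"
    and h: "word_homotopic d a (leaves T) (leaves T') (\<lambda>t. centers (g t)) k"
    using lift_word_path[OF SC_space_realize[OF T(1)] SC_space_realize[OF T'(1)] labeled_tree_words[OF T(1)]
        labeled_tree_words[OF T'(1)] centers_realize[OF T(1)] centers_realize[OF T'(1)], of k] k(1) T T'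
    unfolding uv by (auto simp: word_path_def)
  have tp: "tree_path d a T T' g" using g T T' by (simp add: tree_path_def)
  show "\<exists>g\<in>Mor (grpd SC_Omega d a). Src (grpd SC_Omega d a) g = x \<and> Trg (grpd SC_Omega d a) g = y \<and> tree_mor d a g = f"
  proof (intro bexI conjI)
    show "path_mor (SC_space d a) g \<in> Mor (grpd SC_Omega d a)" unfolding Mor_SC_Omega using tp by blast
    show "tree_mor d a (path_mor (SC_space d a) g) = f"
      unfolding tree_mor_path_mor[OF tp] k(2) uv using word_mor_eqI[OF h] by simp
  qed (use g in simp_all)
qed

lemma faithful_SC_Omega_PaPB: "faithful_functor (grpd SC_Omega d a) (tree_mor d a)"
  unfolding faithful_functor_def
proof (intro ballI impI; elim conjE)
  fix f f' assume "f \<in> Mor (grpd SC_Omega d a)" "f' \<in> Mor (grpd SC_Omega d a)"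
    and st: "Src (grpd SC_Omega d a) f = Src (grpd SC_Omega d a) f'" "Trg (grpd SC_Omega d a) f = Trg (grpd SC_Omega d a) f'"
    and eq: "tree_mor d a f = tree_mor d a f'"
  then obtain T S g T' S' g' where g: "tree_path d a T S g" "f = path_mor (SC_space d a) g"
    and g': "tree_path d a T' S' g'" "f' = path_mor (SC_space d a) g'" unfolding Mor_SC_Omega by blast
  have e: "pathstart g = pathstart g'" "pathfinish g = pathfinish g'" using st g g' by simp_all
  \<comment> \<open>Only the realizations of the trees enter \<open>tree_path\<close>, so
    \<open>g'\<close> may be described by the trees of \<open>g\<close>.\<close>
  then have g0: "tree_path d a T S g'" using g g' by (simp add: tree_path_def)
  have "word_mor d a (leaves T) (\<lambda>t. centers (g t)) (leaves S) = word_mor d a (leaves T) (\<lambda>t. centers (g' t)) (leaves S)"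
    using eq unfolding g(2) g'(2) tree_mor_path_mor[OF g(1)] tree_mor_path_mor[OF g0] by simp
  then have h: "word_homotopic d a (leaves T) (leaves S) (\<lambda>t. centers (g t)) (\<lambda>t. centers (g' t))"
    by (rule word_mor_eqD[OF _ tree_path_word_path[OF g0]])
  have l: "leaves T \<in> words d a" "leaves S \<in> words d a" using g labeled_tree_words by (auto simp: tree_path_def)
  have "homotopic_paths (SC_space d a) g g'"
    by (rule homotopic_centers_imp_homotopic[OF l _ _ _ _ e h]) (use g g' in \<open>auto simp: tree_path_def\<close>)
  then show "f = f'" unfolding g(2) g'(2) by (rule path_mor_eqI)
qed

lemma onto_SC_Omega_PaPB: "Ob (grpd PaPB_plus d a) \<subseteq> normal_tree d ` Ob (grpd SC_Omega d a)"
proof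
  fix t assume "t \<in> Ob (grpd PaPB_plus d a)"
  then have t: "labeled_tree d a t" "reduce t = t" using trees_labeled by auto
  then show "t \<in> normal_tree d ` Ob (grpd SC_Omega d a)"
    using normal_tree_realize[OF t(1)] by (intro image_eqI[of _ _ "realize t"]) (auto simp: Ob_SC_Omega)
qed

lemma ob_morphism_SC_Omega_PaPB: "operad_morphism (ob_operad SC_Omega) (ob_operad PaPB_plus) (\<lambda>d a. normal_tree d)"
  unfolding operad_morphism_def
proof (intro conjI allI ballI)
  fix d
  have "labeled_tree d (unit_arity d) (Leaf (d, 1))" by (simp add: labeled_tree_def)
  from normal_tree_realize[OF this]
  show "normal_tree d (unt (ob_operad SC_Omega) d) = unt (ob_operad PaPB_plus) d"
    unfolding realize_generators by (simp add: ob_operad_def Omega_plus_def reduce_def del: SC_plus_simps)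
next
  fix d a x assume x: "x \<in> elts (ob_operad SC_Omega) d a"
  then obtain T where T: "labeled_tree d a T" "x = realize T" by (auto simp: ob_operad_def Ob_SC_Omega)
  show "normal_tree d x \<in> elts (ob_operad PaPB_plus) d a"
    using T by (simp add: ob_operad_def normal_tree_realize reduce_trees)
  show "normal_tree d (act (ob_operad SC_Omega) d a \<sigma> x) = act (ob_operad PaPB_plus) d a \<sigma> (normal_tree d x)"
    if \<sigma>: "\<sigma> \<in> input_perms a" for \<sigma>
    using normal_tree_realize[OF relabel_labeled(1)[OF T(1) \<sigma>]] normal_tree_realize[OF T(1)]
    unfolding relabel_labeled(2)[OF T(1) \<sigma>] reduce_relabel T(2)
    by (simp add: ob_operad_def Omega_plus_def del: SC_plus_simps)
  fix p b y assume p: "p \<in> inputs a" and "y \<in> elts (ob_operad SC_Omega) (fst p) b"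
  then obtain S where S: "labeled_tree (fst p) b S" "y = realize S" by (auto simp: ob_operad_def Ob_SC_Omega)
  show "normal_tree d (ins (ob_operad SC_Omega) d a p b x y) =
      ins (ob_operad PaPB_plus) d a p b (normal_tree d x) (normal_tree (fst p) y)"
    using normal_tree_realize[OF insert_tree_labeled(1)[OF T(1) p S(1)]] normal_tree_realize[OF T(1)] normal_tree_realize[OF S(1)]
    unfolding insert_tree_labeled(2)[OF T(1) p S(1)] T(2) S(2)
    by (simp add: ob_operad_def reduce_insert_tree del: SC_plus_simps)
qed

text \<open>Everything is computed on representing paths. The content lies in
  \<open>CoPB_mor_act\<close> and above all in \<open>CoPB_mor_ins\<close>, which replace the unions
  in \<open>CoPB_plus\<close> by the class of one path of centers.\<close>

lemma mor_morphism_SC_Omega_PaPB: "operad_morphism (mor_operad SC_Omega) (mor_operad PaPB_plus) tree_mor"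
  unfolding operad_morphism_def
proof (intro conjI allI ballI)
  fix d
  have l: "labeled_tree d (unit_arity d) (Leaf (d, 1))" by (simp add: labeled_tree_def)
  then have "unt SC_plus d \<in> Ob (grpd SC_Omega d (unit_arity d))" unfolding Ob_SC_Omega using realize_generators(5) by metis
  from functor_idm[OF functor_SC_Omega_PaPB this]
  have "tree_mor d (unit_arity d) (Idm (grpd SC_Omega d (unit_arity d)) (unt SC_plus d)) =
      Idm (grpd PaPB_plus d (unit_arity d)) (normal_tree d (unt SC_plus d))" .
  moreover have "normal_tree d (unt SC_plus d) = unt Omega_plus d"
    using normal_tree_realize[OF l] unfolding realize_generators by (simp add: Omega_plus_def reduce_def del: SC_plus_simps)
  ultimately show "tree_mor d (unit_arity d) (unt (mor_operad SC_Omega) d) = unt (mor_operad PaPB_plus) d"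
    by (simp add: mor_operad_def del: SC_plus_simps)
next
  note Q = relative_operad_SC_plus continuous_operad_SC_plus
  fix d a f assume f: "f \<in> elts (mor_operad SC_Omega) d a"
  then obtain T T' g where g: "tree_path d a T T' g" "f = path_mor (SC_space d a) g"
    by (auto simp: mor_operad_def Mor_SC_Omega)
  have T: "labeled_tree d a T" "labeled_tree d a T'" and G: "path g" "path_image g \<subseteq> SC_space d a"
    using g by (auto simp: tree_path_def)
  show "tree_mor d a f \<in> elts (mor_operad PaPB_plus) d a"
    using functor_mor[OF functor_SC_Omega_PaPB] f by (simp add: mor_operad_def)
  show "tree_mor d a (act (mor_operad SC_Omega) d a \<sigma> f) = act (mor_operad PaPB_plus) d a \<sigma> (tree_mor d a f)"
    if \<sigma>: "\<sigma> \<in> input_perms a" for \<sigma>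
  proof -
    have tp: "tree_path d a (relabel_leaves \<sigma> T) (relabel_leaves \<sigma> T') (\<lambda>t. act SC_plus d a \<sigma> (g t))"
      unfolding tree_path_def relabel_labeled(2)[OF T(1) \<sigma>] relabel_labeled(2)[OF T(2) \<sigma>]
      using relabel_labeled(1)[OF T(1) \<sigma>] relabel_labeled(1)[OF T(2) \<sigma>] path_act[OF Q \<sigma>, of g d] G g(1)
      by (simp add: tree_path_def pathstart_def pathfinish_def)
    have "act (mor_operad SC_Omega) d a \<sigma> f = path_mor (SC_space d a) (\<lambda>t. act SC_plus d a \<sigma> (g t))"
      using pi_mor_act[OF Q \<sigma>, of g d] G g(2) by (simp add: mor_operad_def)
    moreover have "(\<lambda>t. centers (act SC_plus d a \<sigma> (g t))) = (\<lambda>t. centers (g t) \<circ> inv \<sigma>)"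
      by (auto simp: centers_def fun_eq_iff)
    ultimately show ?thesis
      using CoPB_mor_act[OF \<sigma> tree_path_word_path[OF g(1)]] g(2)
      by (simp add: tree_mor_path_mor[OF tp] tree_mor_path_mor[OF g(1)] mor_operad_def reduce_relabel del: SC_plus_simps)
        (simp add: Omega_plus_def)
  qed
  fix p b f' assume p: "p \<in> inputs a" and "f' \<in> elts (mor_operad SC_Omega) (fst p) b"
  then obtain S S' g' where g': "tree_path (fst p) b S S' g'" "f' = path_mor (SC_space (fst p) b) g'"
    by (auto simp: mor_operad_def Mor_SC_Omega)
  have S: "labeled_tree (fst p) b S" "labeled_tree (fst p) b S'" and G': "path g'" "path_image g' \<subseteq> SC_space (fst p) b"
    using g' by (auto simp: tree_path_def)
  have tp: "tree_path d (ins_arity a p b) (insert_tree a p b T S) (insert_tree a p b T' S') (\<lambda>t. ins SC_plus d a p b (g t) (g' t))"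
    unfolding tree_path_def insert_tree_labeled(2)[OF T(1) p S(1)] insert_tree_labeled(2)[OF T(2) p S(2)]
    using insert_tree_labeled(1)[OF T(1) p S(1)] insert_tree_labeled(1)[OF T(2) p S(2)] path_ins[OF Q p, of g d g' b] G G' g(1) g'(1)
    by (simp add: tree_path_def pathstart_def pathfinish_def del: SC_plus_simps(4))
  have i: "ins (mor_operad SC_Omega) d a p b f f' = path_mor (SC_space d (ins_arity a p b)) (\<lambda>t. ins SC_plus d a p b (g t) (g' t))"
    using pi_mor_ins[OF Q p, of g d g' b] G G' g(2) g'(2) by (simp add: mor_operad_def del: SC_plus_simps(4))
  have wi: "word_ins a p b (leaves T) (leaves S) \<in> words d (ins_arity a p b)"
    "word_ins a p b (leaves T') (leaves S') \<in> words d (ins_arity a p b)"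
    using labeled_tree_words[OF insert_tree_labeled(1)[OF T(1) p S(1)]] labeled_tree_words[OF insert_tree_labeled(1)[OF T(2) p S(2)]]
    by (simp_all add: leaves_insert_tree)
  have m: "mor_ins CoPB_plus d a p b (word_mor d a (leaves T) (\<lambda>t. centers (g t)) (leaves T'))
      (word_mor (fst p) b (leaves S) (\<lambda>t. centers (g' t)) (leaves S')) =
    word_mor d (ins_arity a p b) (word_ins a p b (leaves T) (leaves S))
      (\<lambda>t. centers (ins SC_plus d a p b (g t) (g' t))) (word_ins a p b (leaves T') (leaves S'))"
    by (rule CoPB_mor_ins[OF p labeled_tree_words[OF T(1)] labeled_tree_words[OF T(2)] labeled_tree_words[OF S(1)]
          labeled_tree_words[OF S(2)] G G' tree_path_word_path[OF g(1)] tree_path_word_path[OF g'(1)] wi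
          tree_path_word_path[OF tp, unfolded leaves_insert_tree]])
  show "tree_mor d (ins_arity a p b) (ins (mor_operad SC_Omega) d a p b f f') =
      ins (mor_operad PaPB_plus) d a p b (tree_mor d a f) (tree_mor (fst p) b f')"
    unfolding i unfolding tree_mor_path_mor[OF tp] g(2) g'(2) tree_mor_path_mor[OF g(1)] tree_mor_path_mor[OF g'(1)]
    by (simp add: mor_operad_def reduce_insert_tree leaves_insert_tree m del: SC_plus_simps)
qed

text \<open>The axioms of a relative operad for \<open>PaPB_plus\<close> are obtained here, by
  transport from \<open>SC_Omega\<close>; in turn they are the input for the transport to
  \<open>CoPB_plus\<close>.\<close>

lemma categorical_equivalence_SC_Omega_PaPB:
  "categorical_equivalence SC_Omega PaPB_plus (\<lambda>d a. normal_tree d) tree_mor"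
proof (rule categorical_equivalence_image[OF relative_goperad_SC_Omega functor_SC_Omega_PaPB full_SC_Omega_PaPB
      faithful_SC_Omega_PaPB onto_SC_Omega_PaPB _ ob_morphism_SC_Omega_PaPB mor_morphism_SC_Omega_PaPB])
  show "Src (grpd PaPB_plus d a) f \<in> Ob (grpd PaPB_plus d a) \<and> Trg (grpd PaPB_plus d a) f \<in> Ob (grpd PaPB_plus d a)"
    if "f \<in> Mor (grpd PaPB_plus d a)" for d a f
    using that by (cases f) (simp add: Mor_PaPB)
qed

text \<open>A full suboperad is included fully and faithfully. What remains is a path from each
  point of \<open>SC_space\<close> to the realization of a tree, and \<open>word_tree\<close>
  supplies a tree for every word.\<close>

lemma categorical_equivalence_SC_Omega_pi:
  "categorical_equivalence SC_Omega (pi_operad SC_plus) (\<lambda>d a x. x) (\<lambda>d a f. f)"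
proof -
  let ?P = "pi_operad SC_plus"
  have G: "is_groupoid (grpd SC_Omega d a)" "is_groupoid (grpd ?P d a)" for d a
    using relative_goperad_SC_Omega relative_goperad_pi_SC_plus unfolding relative_goperad_def by blast+
  have func: "is_functor (grpd SC_Omega d a) (grpd ?P d a) (\<lambda>x. x) (\<lambda>f. f)" for d a
    unfolding is_functor_def by (simp add: full_suboperad_def)
  have "equivalence_of_categories (grpd SC_Omega d a) (grpd ?P d a) (\<lambda>x. x) (\<lambda>f. f)" for d a
  proof (rule equivalence_of_categoriesI[OF G func])
    show "full_functor (grpd SC_Omega d a) (grpd ?P d a) (\<lambda>x. x) (\<lambda>f. f)"
      unfolding full_functor_def
    proof (intro ballI impI)
      fix x y f assume "x \<in> Ob (grpd SC_Omega d a)" "y \<in> Ob (grpd SC_Omega d a)" "f \<in> Mor (grpd ?P d a)"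
        "Src (grpd ?P d a) f = x \<and> Trg (grpd ?P d a) f = y"
      then show "\<exists>g\<in>Mor (grpd SC_Omega d a). Src (grpd SC_Omega d a) g = x \<and> Trg (grpd SC_Omega d a) g = y \<and> g = f"
        by (intro bexI[of _ f]) (simp_all add: full_suboperad_def)
    qed
    show "faithful_functor (grpd SC_Omega d a) (\<lambda>f. f)" unfolding faithful_functor_def by simp
    fix y assume "y \<in> Ob (grpd ?P d a)"
    then have y: "y \<in> SC_space d a" by simp
    have "realize (word_tree d w) \<in> SC_space d a \<and> centers (realize (word_tree d w)) \<in> Conf_word d a w"
      if "w \<in> words d a" for w
      using SC_space_realize centers_realize labeled_word_tree[OF that] leaves_word_tree by metis
    from SC_path_to_word[OF y this]
    obtain w g where w: "w \<in> words d a" and g: "path g" "path_image g \<subseteq> SC_space d a" "pathstart g = y"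
      "pathfinish g = realize (word_tree d w)" by blast
    \<comment> \<open>The path was built starting from \<open>y\<close>, whereas the required
      morphism ends there.\<close>
    have "path_mor (SC_space d a) (reversepath g) \<in> Mor (grpd ?P d a)" using g by (simp add: path_mor_in_Mor)
    moreover have "realize (word_tree d w) \<in> Ob (grpd SC_Omega d a)"
      unfolding Ob_SC_Omega using labeled_word_tree[OF w] by blast
    moreover have "Src (grpd ?P d a) (path_mor (SC_space d a) (reversepath g)) = realize (word_tree d w)"
      "Trg (grpd ?P d a) (path_mor (SC_space d a) (reversepath g)) = y" using g by simp_all
    ultimately show "\<exists>x\<in>Ob (grpd SC_Omega d a). \<exists>f\<in>Mor (grpd ?P d a). Src (grpd ?P d a) f = x \<and> Trg (grpd ?P d a) f = y"
      by blast
  qed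
  moreover have "operad_morphism (ob_operad SC_Omega) (ob_operad ?P) (\<lambda>d a x. x)"
    unfolding operad_morphism_def by (simp add: ob_operad_def full_suboperad_def)
  moreover have "operad_morphism (mor_operad SC_Omega) (mor_operad ?P) (\<lambda>d a f. f)"
    unfolding operad_morphism_def by (simp add: mor_operad_def full_suboperad_def)
  ultimately show ?thesis
    unfolding categorical_equivalence_def goperad_morphism_def
    using relative_goperad_SC_Omega relative_goperad_pi_SC_plus func by blast
qed

text \<open>Morphisms of the pullback are those of \<open>CoPB_plus\<close> between the images, so
  the functor is full and faithful; it is onto on objects because each word is the list of leaves of
  a reduced tree. The axioms for \<open>CoPB_plus\<close> come out of the same transport.\<close>

lemma categorical_equivalence_PaPB_CoPB:
  "categorical_equivalence PaPB_plus CoPB_plus omega_plus (\<lambda>d a (u, f, v). f)"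
proof (rule categorical_equivalence_image)
  show "relative_goperad PaPB_plus"
    using categorical_equivalence_SC_Omega_PaPB unfolding categorical_equivalence_def goperad_morphism_def by blast
  have leaves_words: "leaves t \<in> words d a" if "t \<in> trees d a" for t d a
    using labeled_tree_words trees_labeled[OF that] by blast
  show "is_functor (grpd PaPB_plus d a) (grpd CoPB_plus d a) (omega_plus d a) (\<lambda>(u, f, v). f)" for d a
    unfolding is_functor_def by (auto simp: Mor_PaPB omega_plus_def leaves_words)
  show "full_functor (grpd PaPB_plus d a) (grpd CoPB_plus d a) (omega_plus d a) (\<lambda>(u, f, v). f)" for d a
    unfolding full_functor_def
  proof (intro ballI impI)
    fix u v f assume "u \<in> Ob (grpd PaPB_plus d a)" "v \<in> Ob (grpd PaPB_plus d a)" "f \<in> Mor (grpd CoPB_plus d a)"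
      "Src (grpd CoPB_plus d a) f = omega_plus d a u \<and> Trg (grpd CoPB_plus d a) f = omega_plus d a v"
    then show "\<exists>g\<in>Mor (grpd PaPB_plus d a). Src (grpd PaPB_plus d a) g = u \<and> Trg (grpd PaPB_plus d a) g = v \<and> (case g of (u, f, v) \<Rightarrow> f) = f"
      by (intro bexI[of _ "(u, f, v)"]) (simp_all add: Mor_PaPB omega_plus_def)
  qed
  show "faithful_functor (grpd PaPB_plus d a) (\<lambda>(u, f, v). f)" for d a
    unfolding faithful_functor_def by auto
  show "Ob (grpd CoPB_plus d a) \<subseteq> omega_plus d a ` Ob (grpd PaPB_plus d a)" for d a
  proof
    fix w assume "w \<in> Ob (grpd CoPB_plus d a)"
    then have "labeled_tree d a (word_tree d w)" using labeled_word_tree by simp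
    then show "w \<in> omega_plus d a ` Ob (grpd PaPB_plus d a)"
      using reduce_trees by (intro image_eqI[of _ _ "reduce (word_tree d w)"]) (simp_all add: omega_plus_def)
  qed
  show "Src (grpd CoPB_plus d a) f \<in> Ob (grpd CoPB_plus d a) \<and> Trg (grpd CoPB_plus d a) f \<in> Ob (grpd CoPB_plus d a)"
    if "f \<in> Mor (grpd CoPB_plus d a)" for d a f
    using that unfolding grpd_CoPB Mor_word_groupoid by auto
  show "operad_morphism (ob_operad PaPB_plus) (ob_operad CoPB_plus) omega_plus"
    unfolding operad_morphism_def
    by (simp add: ob_operad_def omega_plus_def leaves_words leaves_ins_Omega_plus)
      (simp add: CoPB_plus_def Omega_plus_def leaves_tree_relabel)
  show "operad_morphism (mor_operad PaPB_plus) (mor_operad CoPB_plus) (\<lambda>d a (u, f, v). f)"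
    unfolding operad_morphism_def
    by (auto simp: mor_operad_def Mor_PaPB) (simp add: CoPB_plus_def Omega_plus_def)
qed

theorem proposition4p8:
  shows "categorical_equivalence
           (full_suboperad (pi_operad SC_plus) Omega'_plus) (pi_operad SC_plus)
           (\<lambda>d a x. x) (\<lambda>d a f. f) \<and>
         (\<exists>\<phi> \<psi>. categorical_equivalence
           (full_suboperad (pi_operad SC_plus) Omega'_plus) PaPB_plus \<phi> \<psi>) \<and>
         categorical_equivalence PaPB_plus CoPB_plus omega_plus (\<lambda>d a (u, f, v). f)"
  using categorical_equivalence_SC_Omega_pi categorical_equivalence_SC_Omega_PaPB
    categorical_equivalence_PaPB_CoPB by blast

end
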